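(* Let $0<\gamma<1/2$, $p=1/\gamma$, and let $f$ be a Holland map in $Hol(\gamma,\rho)$ (see context), with $\nu$ its unique invariant probability absolutely continuous with respect to Lebesgue measure. Then for any observable $\varphi:[0,1]\to\mathbb R$ of bounded variation with $\int\varphi\,d\nu=0$, the series $$\sigma^2(\varphi)=\mathrm{Var}(\varphi)+2\sum_{k\ge1}\mathrm{Cov}(\varphi,\varphi\circ f^k)$$ converges absolutely (variance and covariances with respect to $\nu$), and $$W_n(\varphi)\to\sigma(\varphi)W\quad\text{in distribution in }\mathcal H^0_{1/2-1/p}[0,1],$$ where $W$ is a standard Brownian motion and $W_n(\varphi)$ is regarded as a random process on $([0,1],\nu)$.
   Context: **Holland maps.** For $\gamma>0$, $f$ is in $Hol(\gamma,\rho)$ if $f:[0,1]\to[0,1]$ is given by $f(x)=x(1+x^\gamma\rho(x))$ for $0\le x\le1/2$ (with $f(0)=0$) and $f(x)=2x-1$ for $1/2<x\le1$, where: $\rho$ is positive, of class $C^2$ on $(0,1)$ and slowly varying at $0$ (i.e. $\rho(\lambda x)/\rho(x)\to1$ as $x\to0^+$ for every $\lambda>0$); $x\rho'(x)=o(\rho(x))$ and $x^2\rho''(x)=o(\rho(x))$ as $x\to0$; $f(1/2)=1$ and $f'(x)>1$ for all $x\ne0,1/2$; $\rho(x)\to0$ as $x\to0$. For $\gamma<1$ such a map has a unique $f$-invariant probability absolutely continuous with respect to Lebesgue measure. **Birkhoff process.** $S_n(\varphi)=\sum_{k=0}^{n-1}\varphi\circ f^k$ ($S_0=0$), and for $n\ge1$,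 $t\in[0,1]$, $$W_n(\varphi)(t)=n^{-1/2}\big(S_{\lfloor nt\rfloor}(\varphi)+(nt-\lfloor nt\rfloor)\varphi\circ f^{\lfloor nt\rfloor}\big).$$ **Hölder space.** For $\eta\in(0,1)$ and $x:[0,1]\to\mathbb R$, $w_\eta(x,\delta)=\sup_{0<|s-t|<\delta}|x(s)-x(t)|/|s-t|^\eta$ and $w_\eta(x)=\sup_{s\ne t}|x(s)-x(t)|/|s-t|^\eta$. $\mathcal H_\eta[0,1]=\{x:w_\eta(x)<\infty\}$, and $\mathcal H^0_\eta[0,1]=\{x\in\mathcal H_\eta[0,1]:\lim_{\delta\to0}w_\eta(x,\delta)=0\}$ with norm $\|x\|_\eta=w_\eta(x,1)+|x(0)|$ is a separable Banach space. *)

theory Defs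
  imports "HOL-Probability.Probability" "HOL-Library.Landau_Symbols"
begin

section \<open>Holland maps and their invariant measures\<close>

text \<open>Maps of \<open>[0,1]\<close> are total functions on the reals whose values outside \<open>[0,1]\<close> are
  irrelevant. The derivative is taken within \<open>[0,1]\<close>, so that it is one-sided at the end point
  \<open>1\<close>.\<close>

definition Hol :: "real \<Rightarrow> (real \<Rightarrow> real) \<Rightarrow> (real \<Rightarrow> real) set" where
  "Hol \<gamma> \<rho> = {f.
      f \<in> {0..1} \<rightarrow> {0..1} \<and>
      f 0 = 0 \<and>
      (\<forall>x\<in>{0<..1/2}. f x = x * (1 + x powr \<gamma> * \<rho> x)) \<and>
      (\<forall>x\<in>{1/2<..1}. f x = 2 * x - 1) \<and>
      (\<forall>x\<in>{0<..<1}. \<rho> x > 0) \<and>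
      (\<forall>x\<in>{0<..<1}. \<rho> field_differentiable at x \<and> deriv \<rho> field_differentiable at x) \<and>
      continuous_on {0<..<1} (deriv (deriv \<rho>)) \<and>
      (\<forall>c>0. ((\<lambda>x. \<rho> (c * x) / \<rho> x) \<longlongrightarrow> 1) (at_right 0)) \<and>
      (\<lambda>x. x * deriv \<rho> x) \<in> o[at_right 0](\<rho>) \<and>
      (\<lambda>x. x\<^sup>2 * deriv (deriv \<rho>) x) \<in> o[at_right 0](\<rho>) \<and>
      f (1/2) = 1 \<and>
      (\<forall>x\<in>{0..1} - {0, 1/2}. \<exists>D>1. (f has_real_derivative D) (at x within {0..1})) \<and>
      (\<rho> \<longlongrightarrow> 0) (at_right 0)}"

definition acip :: "(real \<Rightarrow> real) \<Rightarrow> real measure \<Rightarrow> bool" where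
  "acip f \<nu> \<longleftrightarrow>
     prob_space \<nu> \<and>
     sets \<nu> = sets (restrict_space borel {0..1}) \<and>
     absolutely_continuous (restrict_space lborel {0..1}) \<nu> \<and>
     f \<in> \<nu> \<rightarrow>\<^sub>M \<nu> \<and> distr \<nu> \<nu> f = \<nu>"

definition bounded_variation_on :: "real \<Rightarrow> real \<Rightarrow> (real \<Rightarrow> real) \<Rightarrow> bool" where
  "bounded_variation_on a b \<phi> \<longleftrightarrow>
     (\<exists>C. \<forall>(n::nat) t. t ` {..n} \<subseteq> {a..b} \<and> mono_on {..n} t \<longrightarrow>
        (\<Sum>i<n. \<bar>\<phi> (t (Suc i)) - \<phi> (t i)\<bar>) \<le> C)"

definition covariance :: "'a measure \<Rightarrow> ('a \<Rightarrow> real) \<Rightarrow> ('a \<Rightarrow> real) \<Rightarrow> real" where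
  "covariance M X Y =
     (\<integral>\<omega>. (X \<omega> - (\<integral>\<omega>'. X \<omega>' \<partial>M)) * (Y \<omega> - (\<integral>\<omega>'. Y \<omega>' \<partial>M)) \<partial>M)"


section \<open>Hoelder spaces\<close>

text \<open>The moduli may be infinite, hence they are valued in the extended nonnegative reals.\<close>

definition holder_mod :: "real \<Rightarrow> (real \<Rightarrow> real) \<Rightarrow> real \<Rightarrow> ennreal" where
  "holder_mod \<eta> x \<delta> =
     (SUP (s, t)\<in>{(s, t). s \<in> {0..1} \<and> t \<in> {0..1} \<and> 0 < \<bar>s - t\<bar> \<and> \<bar>s - t\<bar> < \<delta>}.
        ennreal (\<bar>x s - x t\<bar> / \<bar>s - t\<bar> powr \<eta>))"

definition holder_const :: "real \<Rightarrow> (real \<Rightarrow> real) \<Rightarrow> ennreal" where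
  "holder_const \<eta> x =
     (SUP (s, t)\<in>{(s, t). s \<in> {0..1} \<and> t \<in> {0..1} \<and> s \<noteq> t}.
        ennreal (\<bar>x s - x t\<bar> / \<bar>s - t\<bar> powr \<eta>))"

text \<open>A function on \<open>[0,1]\<close> is represented by its extensional representative.\<close>

definition holder :: "real \<Rightarrow> (real \<Rightarrow> real) set" where
  "holder \<eta> = {x \<in> extensional {0..1}. holder_const \<eta> x < \<infinity>}"

definition holder0 :: "real \<Rightarrow> (real \<Rightarrow> real) set" where
  "holder0 \<eta> = {x \<in> holder \<eta>. (holder_mod \<eta> x \<longlongrightarrow> 0) (at_right 0)}"

definition holder_norm :: "real \<Rightarrow> (real \<Rightarrow> real) \<Rightarrow> real" where
  "holder_norm \<eta> x = enn2real (holder_mod \<eta> x 1) + \<bar>x 0\<bar>"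

definition holder_dist :: "real \<Rightarrow> (real \<Rightarrow> real) \<Rightarrow> (real \<Rightarrow> real) \<Rightarrow> real" where
  "holder_dist \<eta> x y = holder_norm \<eta> (\<lambda>t. x t - y t)"

definition holder0_topology :: "real \<Rightarrow> (real \<Rightarrow> real) topology" where
  "holder0_topology \<eta> = Metric_space.mtopology (holder0 \<eta>) (holder_dist \<eta>)"

lemma holder_mod_mono: "\<delta> \<le> \<delta>' \<Longrightarrow> holder_mod \<eta> x \<delta> \<le> holder_mod \<eta> x \<delta>'"
  unfolding holder_mod_def by (rule SUP_subset_mono) auto

lemma holder_mod_le_const: "holder_mod \<eta> x \<delta> \<le> holder_const \<eta> x"
  unfolding holder_mod_def holder_const_def by (rule SUP_subset_mono) auto

lemma holder_mod_upper:
  assumes "s \<in> {0..1}" "t \<in> {0..1}" "0 < \<bar>s - t\<bar>" "\<bar>s - t\<bar> < \<delta>"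
  shows "ennreal (\<bar>x s - x t\<bar> / \<bar>s - t\<bar> powr \<eta>) \<le> holder_mod \<eta> x \<delta>"
proof -
  have "(case (s, t) of (s, t) \<Rightarrow> ennreal (\<bar>x s - x t\<bar> / \<bar>s - t\<bar> powr \<eta>)) \<le> holder_mod \<eta> x \<delta>"
    unfolding holder_mod_def by (rule SUP_upper) (use assms in auto)
  then show ?thesis by simp
qed

lemma holder_mod_triangle:
  "holder_mod \<eta> (\<lambda>t. x t + y t) \<delta> \<le> holder_mod \<eta> x \<delta> + holder_mod \<eta> y \<delta>"
proof -
  have "ennreal (\<bar>(x s + y s) - (x t + y t)\<bar> / \<bar>s - t\<bar> powr \<eta>)
          \<le> holder_mod \<eta> x \<delta> + holder_mod \<eta> y \<delta>"
    if st: "s \<in> {0..1}" "t \<in> {0..1}" "0 < \<bar>s - t\<bar>" "\<bar>s - t\<bar> < \<delta>" for s t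
  proof -
    have "\<bar>(x s + y s) - (x t + y t)\<bar> / \<bar>s - t\<bar> powr \<eta>
            \<le> (\<bar>x s - x t\<bar> + \<bar>y s - y t\<bar>) / \<bar>s - t\<bar> powr \<eta>"
      by (rule divide_right_mono) auto
    also have "\<dots> = \<bar>x s - x t\<bar> / \<bar>s - t\<bar> powr \<eta> + \<bar>y s - y t\<bar> / \<bar>s - t\<bar> powr \<eta>"
      by (simp add: add_divide_distrib)
    finally have "ennreal (\<bar>(x s + y s) - (x t + y t)\<bar> / \<bar>s - t\<bar> powr \<eta>)
        \<le> ennreal (\<bar>x s - x t\<bar> / \<bar>s - t\<bar> powr \<eta> + \<bar>y s - y t\<bar> / \<bar>s - t\<bar> powr \<eta>)"
      by (rule ennreal_leI)
    also have "\<dots> = ennreal (\<bar>x s - x t\<bar> / \<bar>s - t\<bar> powr \<eta>) + ennreal (\<bar>y s - y t\<bar> / \<bar>s - t\<bar> powr \<eta>)"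
      by (rule ennreal_plus) auto
    also have "\<dots> \<le> holder_mod \<eta> x \<delta> + holder_mod \<eta> y \<delta>"
      by (intro add_mono holder_mod_upper st)
    finally show ?thesis .
  qed
  then show ?thesis
    unfolding holder_mod_def[of _ "\<lambda>t. x t + y t"] by (intro SUP_least) auto
qed

lemma holder_mod_uminus: "holder_mod \<eta> (\<lambda>t. - x t) \<delta> = holder_mod \<eta> x \<delta>"
  unfolding holder_mod_def by (simp add: abs_minus_commute)

lemma holder_mod_minus_commute:
  "holder_mod \<eta> (\<lambda>t. x t - y t) \<delta> = holder_mod \<eta> (\<lambda>t. y t - x t) \<delta>"
  using holder_mod_uminus[of \<eta> "\<lambda>t. x t - y t" \<delta>] by simp

lemma holder_mod_finite: "x \<in> holder0 \<eta> \<Longrightarrow> holder_mod \<eta> x \<delta> < \<infinity>"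
  using holder_mod_le_const[of \<eta> x \<delta>] by (auto simp: holder0_def holder_def intro: le_less_trans)

lemma holder_mod_diff_finite:
  assumes "x \<in> holder0 \<eta>" "y \<in> holder0 \<eta>"
  shows "holder_mod \<eta> (\<lambda>t. x t - y t) \<delta> < \<infinity>"
proof -
  have "holder_mod \<eta> (\<lambda>t. x t - y t) \<delta> \<le> holder_mod \<eta> x \<delta> + holder_mod \<eta> y \<delta>"
    using holder_mod_triangle[of \<eta> x "\<lambda>t. - y t" \<delta>] by (simp add: holder_mod_uminus)
  also have "\<dots> < \<infinity>"
    using holder_mod_finite[OF assms(1)] holder_mod_finite[OF assms(2)] by simp
  finally show ?thesis .
qed

lemma holder_mod_eq_0_const:
  assumes "holder_mod \<eta> z 1 = 0" "s \<in> {0..1}" "t \<in> {0..1}"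
  shows "z s = z t"
proof -
  have close: "z s = z t" if "s \<in> {0..1}" "t \<in> {0..1}" "\<bar>s - t\<bar> < 1" for s t
  proof (cases "s = t")
    case False
    then have "ennreal (\<bar>z s - z t\<bar> / \<bar>s - t\<bar> powr \<eta>) \<le> 0"
      using holder_mod_upper[of s t 1 z \<eta>] that assms(1) by auto
    then have "\<bar>z s - z t\<bar> / \<bar>s - t\<bar> powr \<eta> \<le> 0"
      by (simp add: ennreal_eq_0_iff)
    moreover have "\<bar>s - t\<bar> powr \<eta> > 0"
      using False by simp
    ultimately show ?thesis
      by (simp add: divide_le_0_iff)
  qed simp
  have "z s = z (1/2)" "z t = z (1/2)"
    using assms(2,3) by (auto intro!: close simp: abs_if)
  then show ?thesis by simp
qed

lemma Metric_space_holder0: "Metric_space (holder0 \<eta>) (holder_dist \<eta>)"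
proof
  show "0 \<le> holder_dist \<eta> x y" for x y
    by (simp add: holder_dist_def holder_norm_def)
  show "holder_dist \<eta> x y = holder_dist \<eta> y x" for x y
    using holder_mod_minus_commute[of \<eta> x y 1]
    by (simp add: holder_dist_def holder_norm_def abs_minus_commute)
  show "holder_dist \<eta> x y = 0 \<longleftrightarrow> x = y" if xy: "x \<in> holder0 \<eta>" "y \<in> holder0 \<eta>" for x y
  proof
    assume "holder_dist \<eta> x y = 0"
    then have *: "enn2real (holder_mod \<eta> (\<lambda>t. x t - y t) 1) = 0" "x 0 = y 0"
      using enn2real_nonneg[of "holder_mod \<eta> (\<lambda>t. x t - y t) 1"]
      by (auto simp: holder_dist_def holder_norm_def add_nonneg_eq_0_iff)
    then have "holder_mod \<eta> (\<lambda>t. x t - y t) 1 = 0"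
      using holder_mod_diff_finite[OF xy, of 1] by (auto simp: enn2real_eq_0_iff)
    from holder_mod_eq_0_const[OF this, of _ 0] * have "x t = y t" if "t \<in> {0..1}" for t
      using that by force
    with xy show "x = y"
      by (intro extensionalityI[of _ "{0..1}"]) (auto simp: holder0_def holder_def)
  next
    assume "x = y"
    then have "holder_mod \<eta> (\<lambda>t. x t - y t) 1 = 0"
      by (auto simp: holder_mod_def bot_ennreal intro!: antisym SUP_least)
    with \<open>x = y\<close> show "holder_dist \<eta> x y = 0"
      by (simp add: holder_dist_def holder_norm_def)
  qed
  show "holder_dist \<eta> x z \<le> holder_dist \<eta> x y + holder_dist \<eta> y z"
    if xyz: "x \<in> holder0 \<eta>" "y \<in> holder0 \<eta>" "z \<in> holder0 \<eta>" for x y z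
  proof -
    let ?m = "\<lambda>x y. holder_mod \<eta> (\<lambda>t. x t - y t) 1"
    have "?m x z \<le> ?m x y + ?m y z"
      using holder_mod_triangle[of \<eta> "\<lambda>t. x t - y t" "\<lambda>t. y t - z t" 1] by simp
    then have "enn2real (?m x z) \<le> enn2real (?m x y + ?m y z)"
      using holder_mod_diff_finite[OF xyz(1,2), of 1] holder_mod_diff_finite[OF xyz(2,3), of 1]
      by (intro enn2real_mono) auto
    also have "\<dots> = enn2real (?m x y) + enn2real (?m y z)"
      using holder_mod_diff_finite[OF xyz(1,2), of 1] holder_mod_diff_finite[OF xyz(2,3), of 1]
      by (intro enn2real_plus) auto
    finally show ?thesis
      by (auto simp: holder_dist_def holder_norm_def)
  qed
qed


section \<open>Random elements and convergence in distribution\<close>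

definition borel_of :: "'a topology \<Rightarrow> 'a measure" where
  "borel_of T = sigma (topspace T) {U. openin T U}"

definition conv_in_distribution ::
  "'s topology \<Rightarrow> 'a measure \<Rightarrow> (nat \<Rightarrow> 'a \<Rightarrow> 's) \<Rightarrow> 'b measure \<Rightarrow> ('b \<Rightarrow> 's) \<Rightarrow> bool" where
  "conv_in_distribution T M X N Y \<longleftrightarrow>
     (\<forall>n. X n \<in> M \<rightarrow>\<^sub>M borel_of T) \<and> Y \<in> N \<rightarrow>\<^sub>M borel_of T \<and>
     (\<forall>g::'s \<Rightarrow> real. continuous_map T euclidean g \<and> bounded (g ` topspace T) \<longrightarrow>
        (\<lambda>n. \<integral>\<omega>. g (X n \<omega>) \<partial>M) \<longlonglongrightarrow> (\<integral>\<omega>. g (Y \<omega>) \<partial>N))"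

text \<open>A process \<open>W\<close> is indexed by time first; the path of \<open>\<omega>\<close> is \<open>\<lambda>t. W t \<omega>\<close>.\<close>

definition standard_brownian_motion :: "'b measure \<Rightarrow> (real \<Rightarrow> 'b \<Rightarrow> real) \<Rightarrow> bool" where
  "standard_brownian_motion P W \<longleftrightarrow>
     prob_space P \<and>
     (\<forall>t\<in>{0..1}. W t \<in> borel_measurable P) \<and>
     (AE \<omega> in P. W 0 \<omega> = 0) \<and>
     (\<forall>\<omega>\<in>space P. continuous_on {0..1} (\<lambda>t. W t \<omega>)) \<and>
     (\<forall>s t. 0 \<le> s \<and> s < t \<and> t \<le> 1 \<longrightarrow>
        distributed P lborel (\<lambda>\<omega>. W t \<omega> - W s \<omega>) (normal_density 0 (sqrt (t - s)))) \<and>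
     (\<forall>(n::nat) t. t ` {..n} \<subseteq> {0..1} \<and> mono_on {..n} t \<longrightarrow>
        prob_space.indep_vars P (\<lambda>_. borel) (\<lambda>i \<omega>. W (t (Suc i)) \<omega> - W (t i) \<omega>) {..<n})"

definition birkhoff_sum :: "(real \<Rightarrow> real) \<Rightarrow> (real \<Rightarrow> real) \<Rightarrow> nat \<Rightarrow> real \<Rightarrow> real" where
  "birkhoff_sum f \<phi> n u = (\<Sum>k<n. \<phi> ((f ^^ k) u))"

text \<open>The process \<open>W\<^sub>n(\<phi>)\<close>, evaluated at the starting point \<open>u\<close>, as a path on \<open>[0,1]\<close>.\<close>

definition birkhoff_process ::
  "(real \<Rightarrow> real) \<Rightarrow> (real \<Rightarrow> real) \<Rightarrow> nat \<Rightarrow> real \<Rightarrow> (real \<Rightarrow> real)" where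
  "birkhoff_process f \<phi> n u = (\<lambda>t\<in>{0..1}.
     (birkhoff_sum f \<phi> (nat \<lfloor>real n * t\<rfloor>) u
       + (real n * t - \<lfloor>real n * t\<rfloor>) * \<phi> ((f ^^ nat \<lfloor>real n * t\<rfloor>) u)) / sqrt (real n))"

end

theory Submission imports Defs begin

text \<open>
  Everything rests on one estimate: for \<open>\<phi>\<close> of bounded variation with \<open>\<nu>\<close>-mean zero,
  \<open>\<integral> \<phi> \<cdot> \<psi> \<circ> f ^^ n d\<nu> = O(n powr (-s))\<close> for every \<open>s < 1/\<gamma> - 1\<close>, uniformly over
  measurable \<open>\<psi>\<close> with \<open>|\<psi>| \<le> 1\<close> (\<open>nu_decay\<close>, as \<open>\<phi>\<close> is a difference of monotone functions), together with mixing of \<open>\<nu>\<close>, uniform in the same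
  sense (\<open>nu_mixing\<close>). As \<open>\<gamma> < 1/2\<close>, one can take \<open>p/2 < s\<close> with \<open>p = 1/\<gamma>\<close>. Only these two facts are used
  about \<open>f\<close> afterwards.

  The decay is obtained by coupling densities under the transfer operator \<open>L = L0 + L1\<close>, where \<open>L0\<close>
  belongs to the branch with the neutral fixed point. By bounded distortion (\<open>distortion\<close>), a density whose logarithm is
  Lipschitz is returned to such a density whenever an orbit leaves the left branch, and the Lebesgue measure of the points that stay \<open>k\<close>
  steps in the left branch is at most \<open>v k 1\<close>, of order \<open>k powr (-1/\<gamma>')\<close> for every \<open>\<gamma>' > \<gamma>\<close>
  (\<open>tail_decay\<close>). A strong induction on time compares two log-Lipschitz densities started at different times:
  each common return lets a fixed proportion of the mass be matched, and the weight
  \<open>((l + B)/n) powr s\<close> absorbs the time lag \<open>l\<close> (\<open>coupling\<close>). A monotone observable is, up to an error of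
  order \<open>n powr (-s)\<close>, constant on cylinders of length \<open>n/2\<close>, and multiplying a density by such a function keeps
  it admissible after \<open>n/2\<close> steps (\<open>monotone_decay\<close>).

  From the decay, \<open>moment_bound\<close> derives \<open>\<integral> |S_n| powr q d\<nu> = O(n powr (q/2))\<close> for \<open>2 < q < 2s\<close> by a
  Taylor expansion of \<open>|x| powr q\<close>, in the manner of Rio. Choosing \<open>q > p\<close>, Kolmogorov's chaining
  along dyadic points gives tightness in the Hoelder space of exponent
  \<open>1/2 - 1/p < 1/2 - 1/q\<close> (\<open>W_tight\<close>). The condition \<open>2s > p\<close> is what makes this exponent accessible.

  For the finite-dimensional distributions, let \<open>w_j\<close> be the integral of \<open>exp (i c S_j) \<cdot> \<psi> \<circ> f ^^ j\<close>. One step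
  changes \<open>w_j\<close> by \<open>- c\<^sup>2 \<sigma>\<^sup>2 / 2 \<cdot> w_j\<close> up to a small error (\<open>one_step\<close>), which yields the
  limiting characteristic function even in the presence of an arbitrary future factor \<open>\<psi>\<close>. Taking for \<open>\<psi>\<close> a
  function of the later blocks shows that consecutive block sums become independent and Gaussian
  (\<open>block_clt\<close>, \<open>block_products\<close>). Tightness and finite-dimensional convergence are combined in
  \<open>holder_convergence\<close>: Lipschitz functionals are controlled through piecewise linear interpolation on a
  dyadic grid, and continuous functionals are limits of their Lipschitz envelopes.
\<close>

abbreviation seq_limit :: "(nat => 'a::topological_space) => 'a => bool" (infix "~>" 60) where
 "X ~> x \<equiv> X \<longlonglongrightarrow> x"

section \<open>Bounded measurable functions\<close>

lemmas LINT_cong = Bochner_Integration.integral_cong and LINT_add = Bochner_Integration.integral_add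
 and LINT_diff = Bochner_Integration.integral_diff and LINT_sum = Bochner_Integration.integral_sum

text \<open>All functions whose integrals are computed below are bounded and measurable; the point of the predicate is that
  it is closed under the operations used and implies integrability.\<close>

definition bmeas :: "'a measure => ('a => real) => bool" where
 "bmeas M u \<longleftrightarrow> u \<in> borel_measurable M \<and> (\<exists>B. \<forall>x\<in>space M. abs (u x) <= B)"

lemma bmeas_measurable: "bmeas M u ==> u \<in> borel_measurable M" by (simp add: bmeas_def)

lemma bmeasI: "u \<in> borel_measurable M ==> (!!x. x \<in> space M ==> abs (u x) <= B) ==> bmeas M u"
 by (auto simp: bmeas_def)

lemma bmeasE: assumes "bmeas M u" obtains B where "B >= 0" "!!x. x \<in> space M ==> abs (u x) <= B"
proof -
 obtain B where "!!x. x \<in> space M ==> abs (u x) <= B" using assms by (auto simp: bmeas_def)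
 then show ?thesis by (intro that[of "max B 0"]) force+
qed

lemma bmeas_const[simp, intro]: "bmeas M (%x. c)" by (auto simp: bmeas_def)

lemma bmeas_add[intro]: assumes "bmeas M u" "bmeas M v" shows "bmeas M (%x. u x + v x)"
proof -
 obtain B C where B: "!!x. x \<in> space M ==> abs (u x) <= B" and C: "!!x. x \<in> space M ==> abs (v x) <= C"
  using bmeasE[OF assms(1)] bmeasE[OF assms(2)] by metis
 have "abs (u x + v x) <= B + C" if "x \<in> space M" for x using B[OF that] C[OF that] by linarith
 then show ?thesis using assms[THEN bmeas_measurable] by (intro bmeasI[of _ _ "B + C"]) auto
qed

lemma bmeas_mult[intro]: assumes "bmeas M u" "bmeas M v" shows "bmeas M (%x. u x * v x)"
proof -
 obtain B C where BC: "B >= 0" "!!x. x \<in> space M ==> abs (u x) <= B" "!!x. x \<in> space M ==> abs (v x) <= C"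
  using bmeasE[OF assms(1)] bmeasE[OF assms(2)] by metis
 have "abs (u x * v x) <= B * C" if "x \<in> space M" for x unfolding abs_mult using BC that by (intro mult_mono) auto
 then show ?thesis using assms[THEN bmeas_measurable] by (intro bmeasI[of _ _ "B * C"]) auto
qed

lemma bmeas_cmult[intro]: "bmeas M u ==> bmeas M (%x. c * u x)"
 by (intro bmeas_mult bmeas_const)

lemma bmeas_uminus[intro]: "bmeas M u ==> bmeas M (%x. - u x)"
 using bmeas_cmult[of M u "-1"] by simp

lemma bmeas_diff[intro]: "bmeas M u ==> bmeas M v ==> bmeas M (%x. u x - v x)"
 using bmeas_add[OF _ bmeas_uminus, of M u v] by simp

lemma bmeas_divide[intro]: "bmeas M u ==> bmeas M (%x. u x / c)"
 using bmeas_cmult[of M u "1/c"] by simp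

lemma bmeas_abs[intro]: "bmeas M u ==> bmeas M (%x. abs (u x))"
 by (auto simp: bmeas_def)

lemma bmeas_sum[intro]: "(!!i. i \<in> I ==> bmeas M (u i)) ==> bmeas M (%x. \<Sum>i\<in>I. u i x)"
 by (induction I rule: infinite_finite_induct) auto

lemma bmeas_abs_powr:
 assumes u: "bmeas M u" and r: "r >= 0" shows "bmeas M (%x. abs (u x) powr r)"
proof -
 obtain B where "!!x. x \<in> space M ==> abs (u x) <= B" using bmeasE[OF u] by metis
 then have "abs (abs (u x) powr r) <= B powr r" if "x \<in> space M" for x using that r by (auto intro!: powr_mono2)
 then show ?thesis using bmeas_measurable[OF u] by (intro bmeasI[of _ _ "B powr r"]) auto
qed

lemma bmeas_comp: "bmeas N u ==> f \<in> M \<rightarrow>\<^sub>M N ==> bmeas M (%x. u (f x))"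
 by (auto simp: bmeas_def dest: measurable_space)

lemma bmeas_cong: "(!!x. x \<in> space M ==> u x = v x) ==> bmeas M u \<longleftrightarrow> bmeas M v"
 by (simp add: bmeas_def cong: measurable_cong)

lemma bmeas_le_1: "u \<in> borel_measurable M ==> (!!x. x \<in> space M ==> abs (u x) <= 1) ==> bmeas M u"
 by (rule bmeasI)

lemma (in finite_measure) bmeas_integrable: "bmeas M u ==> integrable M u"
 by (rule integrable_const_bound[of _ "SOME B. \<forall>x\<in>space M. abs (u x) <= B"])
   (auto simp: bmeas_def intro: someI2_ex)

section \<open>Lebesgue measure on the unit interval\<close>

definition Lam :: "real measure" where "Lam = restrict_space lborel {0..1}"

lemma space_Lam[simp]: "space Lam = {0..1}" by (simp add: Lam_def space_restrict_space)
lemma sets_Lam: "sets Lam = sets (restrict_space borel {0..1})"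
 unfolding Lam_def by (rule sets_restrict_space_cong) simp

lemma borel_measurable_Lam: "u \<in> borel_measurable borel ==> u \<in> borel_measurable Lam"
 unfolding Lam_def by (rule measurable_restrict_space1) simp

interpretation Lam: prob_space Lam
 by standard (simp add: Lam_def emeasure_restrict_space space_restrict_space)

lemma integral_Lam: "(LINT x|Lam. u x) = (LINT x|lborel. indicator {0..1} x * u x)" for u :: "real => real"
 unfolding Lam_def by (subst integral_restrict_space) auto

lemma bmeas_Lam_extend: "bmeas Lam u ==> integrable lborel (%x. indicator {0..1} x * u x)"
 using Lam.bmeas_integrable[of u] unfolding Lam_def
 by (subst (asm) integrable_restrict_space) auto

lemma AE_Lam: "AE x in lborel. P x ==> AE x in Lam. P x"
 unfolding Lam_def by (subst AE_restrict_space_iff) auto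

lemma measurable_Lam_Lam:
 "g \<in> borel_measurable Lam ==> (!!x. x \<in> {0..1} ==> g x \<in> {0..1}) ==> g \<in> Lam \<rightarrow>\<^sub>M Lam"
 by (subst measurable_cong_sets[OF refl sets_Lam]) (auto intro!: measurable_restrict_space2)

lemma y1_meas: "(%x. (1 + x) / 2) \<in> Lam \<rightarrow>\<^sub>M Lam"
 by (intro measurable_Lam_Lam borel_measurable_Lam) auto

text \<open>Change of variables along the right branch \<open>x \<mapsto> 2 x - 1\<close>.\<close>

lemma transfer_right:
 assumes "bmeas Lam G"
 shows "(LINT x|Lam. (if x <= 1/2 then 0 else G x)) = (LINT x|Lam. G ((1 + x) / 2) / 2)"
proof -
 let ?G = "%x. indicator {0..1} (1/2 + 1/2 * x) * (if 1/2 + 1/2 * x <= 1/2 then 0 else G (1/2 + 1/2 * x))"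
 have "(LINT x|Lam. (if x <= 1/2 then 0 else G x)) = (LINT x|lborel. indicator {0..1} x * (if x <= 1/2 then 0 else G x))"
  by (rule integral_Lam)
 also have "... = abs (1/2) *\<^sub>R (LINT x|lborel. ?G x)" by (rule lborel_integral_real_affine) simp
 also have "... = (LINT x|lborel. 1/2 * (?G x))" by simp
 also have "... = (LINT x|lborel. indicator {0..1} x * (G ((1 + x) / 2) / 2))"
 proof (rule integral_cong_AE)
  have G': "(%x. indicator {0..1} x * (G ((1 + x) / 2) / 2)) \<in> borel_measurable lborel"
   using bmeas_Lam_extend[OF bmeas_divide[OF bmeas_comp[OF assms y1_meas]]] by auto
  then show "(%x. indicator {0..1} x * (G ((1 + x) / 2) / 2)) \<in> borel_measurable lborel" .
  show *: "AE x in lborel. 1/2 * (?G x) = indicator {0..1} x * (G ((1 + x) / 2) / 2)" using AE_lborel_singleton[of 0]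
   by eventually_elim (auto simp: indicator_def add_divide_distrib)
  have "(%x. indicator {0..1} x * (if x <= 1/2 then 0 else G x)) \<in> borel_measurable borel"
  proof -
   have "(%x. (if x <= 1/2 then 0 else 1) * (indicator {0..1} x * G x)) \<in> borel_measurable borel"
    by (rule borel_measurable_times[OF _ borel_measurable_integrable[OF bmeas_Lam_extend[OF assms], simplified]]) simp
   then show ?thesis by (rule measurable_cong[THEN iffD1, rotated]) auto
  qed
  then have "(%x. ?G x) \<in> borel_measurable borel" by (rule measurable_compose[rotated]) simp
  then show "(%x. 1/2 * (?G x)) \<in> borel_measurable lborel" by simp
 qed
 also have "... = (LINT x|Lam. G ((1 + x) / 2) / 2)" by (rule integral_Lam[symmetric])
 finally show ?thesis .
qed

section \<open>Maps with a slow left branch\<close>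

text \<open>The nonnegative functions whose logarithm is \<open>c\<close>-Lipschitz on \<open>[0,1]\<close>. Bounded distortion is expressed by
  mapping such functions to each other.\<close>

definition cone :: "real => (real => real) set" where
 "cone c = {u. \<forall>x\<in>{0..1}. \<forall>y\<in>{0..1}. 0 <= u x \<and> u x <= exp (c * abs (x - y)) * u y}"

text \<open>The transfer operator is the sum of the contributions of the two branches: \<open>y0\<close> is the inverse of
  the left branch and \<open>d0\<close> its derivative, while the right inverse branch is \<open>x \<mapsto> (1 + x) / 2\<close>.\<close>

definition left_op :: "(real => real) => (real => real) => (real => real) => (real => real)" where
 "left_op y0 d0 u = (%x. d0 x * u (y0 x))"

definition right_op :: "(real => real) => (real => real)" where
 "right_op u = (%x. u ((1 + x) / 2) / 2)"

text \<open>What the coupling needs to know about the map: the excursion to the neutral fixed point has integrable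
  return times with polynomial tail (\<open>tail\<close>), and returning to the right branch after \<open>k\<close> steps on the left regularizes
  (\<open>cone_return\<close>). The gap between the constants \<open>3/2 * D\<close> and \<open>D\<close> is the room needed for subtracting
  a constant from a density.\<close>

locale intermittent =
 fixes f y0 d0 :: "real => real" and D C0 s' :: real
 assumes f_meas: "f \<in> Lam \<rightarrow>\<^sub>M Lam"
  and f_right: "!!x. x \<in> {1/2<..1} ==> f x = 2 * x - 1"
  and y0_range: "!!x. x \<in> {0..1} ==> y0 x \<in> {0..1/2}"
  and y0_mono: "!!x y. 0 <= x ==> x <= y ==> y <= 1 ==> y0 x <= y0 y"
  and f_y0: "!!x. x \<in> {0..1} ==> f (y0 x) = x"
  and y0_f: "!!x. x \<in> {0..1/2} ==> y0 (f x) = x"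
  and y0_meas: "y0 \<in> Lam \<rightarrow>\<^sub>M Lam"
  and d0_meas: "d0 \<in> borel_measurable Lam"
  and d0_bounds: "!!x. x \<in> {0..1} ==> 0 <= d0 x \<and> d0 x <= 1"
  and transfer_left: "!!G. bmeas Lam G ==>
     (LINT x|Lam. (if x <= 1/2 then G x else 0)) = (LINT x|Lam. d0 x * G (y0 x))"
  and D_pos: "D > 0"
  and cone_return: "!!u k. u \<in> cone (3/2 * D) ==> right_op ((left_op y0 d0 ^^ k) u) \<in> cone D"
  and C0_pos: "C0 > 0" and s'_gt: "s' > 1"
  and tail: "!!k. (LINT x|Lam. (left_op y0 d0 ^^ k) (%_. 1) x) <= C0 * (real k + 1) powr (- (s' + 1))"
begin

abbreviation "L0 \<equiv> left_op y0 d0"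
abbreviation "L1 \<equiv> right_op"

text \<open>\<open>G k u\<close> is the part of the density \<open>u\<close> that spends exactly \<open>k\<close> steps in the left branch and then
  uses the right one, transported by these \<open>k + 1\<close> steps.\<close>

definition G :: "nat => (real => real) => (real => real)" where "G k u = L1 ((L0 ^^ k) u)"

definition L :: "(real => real) => (real => real)" where "L u = (%x. L0 u x + L1 u x)"

text \<open>The future of a (signed) density \<open>u\<close>, seen through a test function.\<close>

definition E :: "nat => (real => real) => (real => real) => real" where
 "E n u h = (LINT x|Lam. u x * h ((f ^^ n) x))"

lemma d0_bmeas: "bmeas Lam d0"
 using d0_meas d0_bounds by (intro bmeas_le_1) auto

lemma bmeas_L0: "bmeas Lam u ==> bmeas Lam (L0 u)"
 unfolding left_op_def by (intro bmeas_mult d0_bmeas bmeas_comp[OF _ y0_meas])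
lemma bmeas_L1: "bmeas Lam u ==> bmeas Lam (L1 u)"
 unfolding right_op_def by (intro bmeas_divide bmeas_comp[OF _ y1_meas])
lemma bmeas_L0k: "bmeas Lam u ==> bmeas Lam ((L0 ^^ k) u)"
 by (induction k) (auto intro: bmeas_L0)
lemma bmeas_G: "bmeas Lam u ==> bmeas Lam (G k u)"
 unfolding G_def by (intro bmeas_L1 bmeas_L0k)
lemma bmeas_L: "bmeas Lam u ==> bmeas Lam (L u)"
 unfolding L_def by (intro bmeas_add bmeas_L0 bmeas_L1)
lemma bmeas_Lk: "bmeas Lam u ==> bmeas Lam ((L ^^ k) u)"
 by (induction k) (auto intro: bmeas_L)

lemma fk_meas: "f ^^ k \<in> Lam \<rightarrow>\<^sub>M Lam"
 by (induction k) (auto simp: comp_def intro: measurable_compose[OF _ f_meas])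

lemma bmeas_fk: "bmeas Lam u ==> bmeas Lam (%x. u ((f ^^ k) x))"
 by (rule bmeas_comp[OF _ fk_meas])

lemma split:
 assumes u: "bmeas Lam u" and H: "bmeas Lam H0" "bmeas Lam H1"
 shows "(LINT x|Lam. u x * (if x <= 1/2 then H0 (f x) else H1 (f x))) = (LINT x|Lam. L0 u x * H0 x) + (LINT x|Lam. L1 u x * H1 x)"
proof -
 have b: "bmeas Lam (%x. u x * H0 (f x))" "bmeas Lam (%x. u x * H1 (f x))"
  using u H by (auto intro!: bmeas_mult bmeas_comp[OF _ f_meas])
 have ind: "bmeas Lam (%x. if x <= 1/2 then 1 else 0 :: real)" by (intro bmeas_le_1 borel_measurable_Lam) auto
 have i1: "bmeas Lam (%x. if x <= 1/2 then u x * H0 (f x) else 0)"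
  using bmeas_mult[OF ind b(1)] by (rule bmeas_cong[THEN iffD1, rotated]) auto
 have i2: "bmeas Lam (%x. if x <= 1/2 then 0 else u x * H1 (f x))"
  using bmeas_mult[OF bmeas_diff[OF bmeas_const[of _ 1] ind] b(2)] by (rule bmeas_cong[THEN iffD1, rotated]) auto
 have "(LINT x|Lam. u x * (if x <= 1/2 then H0 (f x) else H1 (f x))) =
  (LINT x|Lam. (if x <= 1/2 then u x * H0 (f x) else 0) + (if x <= 1/2 then 0 else u x * H1 (f x)))"
  by (intro LINT_cong) auto
 also have "... = (LINT x|Lam. (if x <= 1/2 then u x * H0 (f x) else 0)) + (LINT x|Lam. (if x <= 1/2 then 0 else u x * H1 (f x)))"
  by (intro LINT_add Lam.bmeas_integrable i1 i2)
 also have "(LINT x|Lam. (if x <= 1/2 then u x * H0 (f x) else 0)) = (LINT x|Lam. d0 x * (u (y0 x) * H0 (f (y0 x))))"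
  by (rule transfer_left[OF b(1)])
 also have "... = (LINT x|Lam. L0 u x * H0 x)" by (intro LINT_cong) (auto simp: left_op_def f_y0)
 also have "(LINT x|Lam. (if x <= 1/2 then 0 else u x * H1 (f x))) = (LINT x|Lam. (u ((1 + x) / 2) * H1 (f ((1 + x) / 2))) / 2)"
  by (rule transfer_right[OF b(2)])
 also have "... = (LINT x|Lam. L1 u x * H1 x)"
 proof (rule integral_cong_AE)
  show "(%x. u ((1 + x) / 2) * H1 (f ((1 + x) / 2)) / 2) \<in> borel_measurable Lam"
   by (intro bmeas_measurable bmeas_divide bmeas_comp[OF b(2) y1_meas])
  show "(%x. L1 u x * H1 x) \<in> borel_measurable Lam" by (intro bmeas_measurable bmeas_mult bmeas_L1 u H)
  have "AE x in Lam. x ~= 0" by (intro AE_Lam AE_lborel_singleton)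
  moreover have "AE x in Lam. x \<in> {0..1}" using AE_space[of Lam] by simp
  ultimately show "AE x in Lam. u ((1 + x) / 2) * H1 (f ((1 + x) / 2)) / 2 = L1 u x * H1 x"
  proof eventually_elim
   case (elim x)
   then have "f ((1 + x) / 2) = x" using f_right[of "(1 + x) / 2"] by (simp add: field_simps)
   then show ?case by (simp add: right_op_def)
  qed
 qed
 finally show ?thesis .
qed

lemma E_Suc: assumes "bmeas Lam u" "bmeas Lam h" shows "E (Suc n) u h = E n (L0 u) h + E n (L1 u) h"
proof -
 have "E (Suc n) u h = (LINT x|Lam. u x * (if x <= 1/2 then h ((f ^^ n) (f x)) else h ((f ^^ n) (f x))))"
  unfolding E_def by (simp add: funpow_swap1)
 also have "... = E n (L0 u) h + E n (L1 u) h" unfolding E_def by (rule split) (intro assms bmeas_fk)+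
 finally show ?thesis .
qed

lemma E_0: "E 0 u h = (LINT x|Lam. u x * h x)" by (simp add: E_def)

lemma E_add: assumes "bmeas Lam u" "bmeas Lam v" "bmeas Lam h"
 shows "E n (%x. u x + v x) h = E n u h + E n v h"
 unfolding E_def using assms
 by (subst LINT_add[symmetric])
   (auto intro!: Lam.bmeas_integrable bmeas_mult bmeas_fk simp: algebra_simps)

lemma E_cmult: "E n (%x. c * u x) h = c * E n u h"
 unfolding E_def by (simp add: mult.assoc)

lemma E_L: assumes "bmeas Lam u" "bmeas Lam h" shows "E (Suc n) u h = E n (L u) h"
 unfolding L_def by (simp add: E_Suc E_add assms bmeas_L0 bmeas_L1)

lemma E_Lk: assumes "bmeas Lam u" "bmeas Lam h" shows "E (n + k) u h = E n ((L ^^ k) u) h"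
 using assms(1)
proof (induction k arbitrary: u)
 case (Suc k)
 then show ?case by (simp add: E_L assms(2) bmeas_L funpow_swap1)
qed simp

lemma G_L0: "G k (L0 u) = G (Suc k) u" by (simp add: G_def funpow_swap1)

text \<open>Decomposition according to the first use of the right branch.\<close>

lemma E_decomp: assumes "bmeas Lam v" "bmeas Lam h"
 shows "E n v h = (\<Sum>k<n. E (n - 1 - k) (G k v) h) + (LINT x|Lam. (L0 ^^ n) v x * h x)"
 using assms(1)
proof (induction n arbitrary: v)
 case 0 then show ?case by (simp add: E_def)
next
 case (Suc n)
 have "E (Suc n) v h = E n (L1 v) h + E n (L0 v) h" using Suc assms by (simp add: E_Suc)
 also have "E n (L0 v) h = (\<Sum>k<n. E (n - 1 - k) (G (Suc k) v) h) + (LINT x|Lam. (L0 ^^ Suc n) v x * h x)"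
  using Suc.IH[OF bmeas_L0[OF Suc.prems]] by (simp add: G_L0 funpow_swap1)
 also have "E n (L1 v) h + ((\<Sum>k<n. E (n - 1 - k) (G (Suc k) v) h) + (LINT x|Lam. (L0 ^^ Suc n) v x * h x)) =
  (\<Sum>k<Suc n. E (Suc n - 1 - k) (G k v) h) + (LINT x|Lam. (L0 ^^ Suc n) v x * h x)"
  by (subst sum.lessThan_Suc_shift) (simp add: G_def)
 finally show ?case .
qed

definition mass :: "(real => real) => real" where "mass u = (LINT x|Lam. u x)"

definition nonneg :: "(real => real) => bool" where "nonneg u \<longleftrightarrow> (\<forall>x\<in>{0..1}. 0 <= u x)"

lemma E_1: "E n u (%_. 1) = mass u" by (simp add: E_def mass_def)

lemma mass_L: assumes "bmeas Lam u" shows "mass (L u) = mass u" "mass u = mass (L0 u) + mass (L1 u)"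
 using E_L[OF assms bmeas_const, of 0 1] E_Suc[OF assms bmeas_const, of 0 1] by (simp_all add: E_1)

lemma mass_Lk: assumes "bmeas Lam u" shows "mass ((L ^^ k) u) = mass u"
 using assms by (induction k) (auto simp: mass_L bmeas_Lk)

lemma nonneg_L0: "nonneg u ==> nonneg (L0 u)"
 unfolding nonneg_def left_op_def using y0_range d0_bounds by force
lemma nonneg_L1: "nonneg u ==> nonneg (L1 u)"
 unfolding nonneg_def right_op_def by auto
lemma nonneg_L0k: "nonneg u ==> nonneg ((L0 ^^ k) u)" by (induction k) (auto intro: nonneg_L0)
lemma nonneg_G: "nonneg u ==> nonneg (G k u)" unfolding G_def by (intro nonneg_L0k nonneg_L1)
lemma nonneg_L: "nonneg u ==> nonneg (L u)"
 using nonneg_L0[of u] nonneg_L1[of u] unfolding nonneg_def L_def by auto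

lemma mass_nonneg: "nonneg u ==> mass u >= 0"
 unfolding mass_def nonneg_def by (intro integral_nonneg_AE AE_I2) auto

lemma mass_mono: assumes "bmeas Lam u" "bmeas Lam v" "!!x. x \<in> {0..1} ==> u x <= v x" shows "mass u <= mass v"
 unfolding mass_def using assms by (intro integral_mono Lam.bmeas_integrable) auto

lemma mass_cmult: "mass (%x. c * u x) = c * mass u" unfolding mass_def by simp
lemma mass_add: "bmeas Lam u ==> bmeas Lam v ==> mass (%x. u x + v x) = mass u + mass v"
 unfolding mass_def by (intro LINT_add Lam.bmeas_integrable)
lemma mass_const: "mass (%_. c) = c" unfolding mass_def using Lam.prob_space by simp

lemma E_bound:
 assumes "bmeas Lam u" "nonneg u" "bmeas Lam h" and "!!x. x \<in> {0..1} ==> abs (h x) <= 1"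
 shows "abs (E n u h) <= mass u"
proof -
 have fk: "(f ^^ n) x \<in> {0..1}" if "x \<in> {0..1}" for x using measurable_space[OF fk_meas, of x n] that by simp
 have "abs (E n u h) <= (LINT x|Lam. abs (u x * h ((f ^^ n) x)))" unfolding E_def by (rule integral_abs_bound)
 also have "... <= mass u" unfolding mass_def
 proof (intro integral_mono Lam.bmeas_integrable)
  show "bmeas Lam (%x. abs (u x * h ((f ^^ n) x)))" using assms by (intro bmeas_abs bmeas_mult bmeas_fk)
  fix x assume "x \<in> space Lam"
  then show "abs (u x * h ((f ^^ n) x)) <= u x"
   using assms(2) assms(4)[OF fk[of x]] by (auto simp: abs_mult nonneg_def intro!: mult_left_le)
 qed (use assms in auto)
 finally show ?thesis .
qed

text \<open>\<open>a k v\<close> is the mass that leaves the left branch at step \<open>k\<close>, and \<open>t k v\<close> the mass that is still there.\<close>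

definition a :: "nat => (real => real) => real" where "a k v = mass (G k v)"
definition t :: "nat => (real => real) => real" where "t k v = mass ((L0 ^^ k) v)"

lemma t_0: "t 0 v = mass v" by (simp add: t_def)
lemma a_t: "bmeas Lam v ==> a k v = t k v - t (Suc k) v"
 using mass_L(2)[OF bmeas_L0k[of v k]] by (simp add: a_def t_def G_def)
lemma a_nonneg: "nonneg v ==> a k v >= 0" unfolding a_def by (intro mass_nonneg nonneg_G)
lemma t_nonneg: "nonneg v ==> t k v >= 0" unfolding t_def by (intro mass_nonneg nonneg_L0k)

end

section \<open>Log-Lipschitz densities and return times\<close>

lemma exp_sub_convex:
 fixes d p q :: real
 assumes "0 < p" "p <= q" "0 <= d"
 shows "(q - p) / q * (exp (q * d) - 1) <= exp (q * d) - exp (p * d)"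
proof -
 have "convex_on UNIV (exp :: real => real)"
  by (rule convex_on_realI[where f' = exp]) (auto intro!: derivative_eq_intros)
 then have "exp ((1 - p/q) *\<^sub>R 0 + (p/q) *\<^sub>R (q * d)) <= (1 - p/q) * exp 0 + (p/q) * exp (q * d)"
  using assms by (intro convex_onD) auto
 moreover have "(1 - p/q) *\<^sub>R 0 + (p/q) *\<^sub>R (q * d) = p * d" using assms by simp
 ultimately have "exp (p * d) <= (1 - p/q) + (p/q) * exp (q * d)" by simp
 moreover have "(q - p) / q = 1 - p/q" using assms by (simp add: field_simps)
 moreover have "(1 - p/q) * (exp (q * d) - 1) = exp (q * d) - (1 - p/q) - (p/q) * exp (q * d)"
  by (simp only: algebra_simps)
 ultimately show ?thesis by simp
qed

lemma cone_nonneg: "u \<in> cone c ==> x \<in> {0..1} ==> 0 <= u x" by (auto simp: cone_def)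
lemma coneD: "u \<in> cone c ==> x \<in> {0..1} ==> y \<in> {0..1} ==> u x <= exp (c * abs (x - y)) * u y" by (auto simp: cone_def)
lemma cone_mono: assumes "c <= c'" shows "cone c \<subseteq> cone c'"
proof
 fix u assume u: "u \<in> cone c"
 have "u x <= exp (c' * abs (x - y)) * u y" if "x \<in> {0..1}" "y \<in> {0..1}" for x y
 proof -
  have "u x <= exp (c * abs (x - y)) * u y" using coneD[OF u that] .
  also have "... <= exp (c' * abs (x - y)) * u y"
   using assms cone_nonneg[OF u that(2)] by (intro mult_right_mono) (auto intro: mult_right_mono)
  finally show ?thesis .
 qed
 with cone_nonneg[OF u] show "u \<in> cone c'" by (auto simp: cone_def)
qed
lemma cone_add: "u \<in> cone c ==> v \<in> cone c ==> (%x. u x + v x) \<in> cone c"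
 by (auto simp: cone_def distrib_left intro!: add_mono)
lemma cone_const: "c >= 0 ==> m >= 0 ==> (%_. m) \<in> cone c"
 by (auto simp: cone_def intro!: mult_right_mono[of 1 _ m, simplified])

lemma powr_diff_le: fixes x s :: real assumes "s >= 1" "x >= 0" "h >= 0"
 shows "(x + h) powr s - x powr s <= s * h * (x + h) powr (s - 1)"
proof (cases "h = 0 \<or> x = 0")
 case True
 show ?thesis
 proof (cases "h = 0")
  case False
  then have "x = 0" "h > 0" using True assms by auto
  then have "h powr s = h * h powr (s - 1)" by (simp add: powr_mult_base)
  moreover have "1 * (h * h powr (s - 1)) <= s * (h * h powr (s - 1))" using assms by (intro mult_right_mono) auto
  ultimately show ?thesis using \<open>x = 0\<close> by (simp add: mult.assoc)
 qed simp
next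
 case False
 then have "x > 0" "h > 0" using assms by auto
 then have "x < x + h" by simp
 obtain z where z: "x < z" "z < x + h" "(x + h) powr s - x powr s = (x + h - x) * (s * z powr (s - 1))"
  using MVT2[OF \<open>x < x + h\<close>, of "%x. x powr s" "%x. s * x powr (s - 1)"] has_real_derivative_powr \<open>x > 0\<close> by force
 have "z powr (s - 1) <= (x + h) powr (s - 1)" using z \<open>x > 0\<close> assms by (intro powr_mono2) auto
 then have "h * (s * z powr (s - 1)) <= h * (s * (x + h) powr (s - 1))" using \<open>h > 0\<close> assms by (intro mult_left_mono) auto
 then show ?thesis using z by (simp add: mult_ac)
qed

context intermittent begin

text \<open>A log-Lipschitz function is comparable to its mean.\<close>

lemma cone_mass:
 assumes "u \<in> cone c" "bmeas Lam u" "x \<in> {0..1}" "c >= 0"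
 shows "u x <= exp c * mass u" "exp (-c) * mass u <= u x"
proof -
 have xy: "exp (c * abs (x - y)) <= exp c" if "x \<in> {0..1}" "y \<in> {0..1}" for x y :: real
  using that assms by (auto intro!: mult_left_le)
 have 1: "u y <= exp c * u z" if "y \<in> {0..1}" "z \<in> {0..1}" for y z
  using coneD[OF assms(1) that] xy[OF that] cone_nonneg[OF assms(1) that(2)]
  by (meson mult_right_mono order_trans)
 have "mass (%_. u x) <= mass (%y. exp c * u y)" by (rule mass_mono) (use 1 assms in auto)
 then show "u x <= exp c * mass u" by (simp add: mass_const mass_cmult)
 have "mass u <= mass (%_. exp c * u x)" by (rule mass_mono) (use 1 assms in auto)
 then have "mass u <= exp c * u x" by (simp add: mass_const)
 then have "exp (-c) * mass u <= exp (-c) * (exp c * u x)" by (intro mult_left_mono) auto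
 then show "exp (-c) * mass u <= u x" by (simp add: mult.assoc[symmetric] exp_minus_inverse[symmetric] flip: exp_add)
qed

lemma L0_linear: "L0 (%x. \<alpha> * u x + \<beta> * v x) = (%x. \<alpha> * L0 u x + \<beta> * L0 v x)"
 by (auto simp: left_op_def algebra_simps)
lemma L1_linear: "L1 (%x. \<alpha> * u x + \<beta> * v x) = (%x. \<alpha> * L1 u x + \<beta> * L1 v x)"
 by (auto simp: right_op_def algebra_simps)
lemma L0k_linear: "(L0 ^^ k) (%x. \<alpha> * u x + \<beta> * v x) = (%x. \<alpha> * (L0 ^^ k) u x + \<beta> * (L0 ^^ k) v x)"
 by (induction k) (simp_all add: L0_linear)
lemma L0k_add: "(L0 ^^ k) (%x. u x + v x) = (%x. (L0 ^^ k) u x + (L0 ^^ k) v x)"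
 using L0k_linear[of k 1 u 1 v] by simp
lemma L0k_cmult: "(L0 ^^ k) (%x. c * u x) = (%x. c * (L0 ^^ k) u x)"
 using L0k_linear[of k c u 0 u] by simp
lemma G_add: "G k (%x. u x + v x) = (%x. G k u x + G k v x)"
 unfolding G_def using L0k_linear[of k 1 u 1 v] L1_linear[of 1 "(L0 ^^ k) u" 1 "(L0 ^^ k) v"] by simp

lemma L0k_mono:
 assumes "!!x. x \<in> {0..1} ==> u x <= v x" "x \<in> {0..1}"
 shows "(L0 ^^ k) u x <= (L0 ^^ k) v x"
 using assms(2)
proof (induction k arbitrary: x)
 case (Suc k)
 then show ?case using y0_range[of x] d0_bounds[of x] by (force simp: left_op_def intro!: mult_left_mono)
qed (use assms in auto)

lemma t_mono: assumes "bmeas Lam u" "bmeas Lam v" "!!x. x \<in> {0..1} ==> u x <= v x" shows "t k u <= t k v"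
 unfolding t_def using assms by (intro mass_mono bmeas_L0k L0k_mono)

lemma t_add: "bmeas Lam u ==> bmeas Lam v ==> t k (%x. u x + v x) = t k u + t k v"
 unfolding t_def L0k_add by (intro mass_add bmeas_L0k)
lemma t_cmult: "t k (%x. c * u x) = c * t k u"
 unfolding t_def L0k_cmult by (rule mass_cmult)

text \<open>A density after an arbitrary number of steps need not be log-Lipschitz, since part of it may be in the middle of an
  excursion. What survives is that each part becomes log-Lipschitz upon its return.\<close>

definition state :: "(real => real) => bool" where
 "state v \<longleftrightarrow> bmeas Lam v \<and> nonneg v \<and> (\<forall>k. G k v \<in> cone D)"

lemma stateD: "state v ==> bmeas Lam v" "state v ==> nonneg v" "state v ==> G k v \<in> cone D"
 by (auto simp: state_def)

lemma state_cone: assumes "u \<in> cone c" "c <= 3/2 * D" "bmeas Lam u" shows "state u"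
proof -
 have "u \<in> cone (3/2 * D)" using assms cone_mono by blast
 then show ?thesis using assms cone_return cone_nonneg by (auto simp: state_def G_def nonneg_def)
qed

lemma state_cone_D: "u \<in> cone D ==> bmeas Lam u ==> state u" using D_pos by (intro state_cone[of u D]) auto

lemma L1_state: "state v ==> L1 v \<in> cone D" using stateD(3)[of v 0] by (simp add: G_def)
lemma state_L1: "state v ==> state (L1 v)" using state_cone_D[OF L1_state bmeas_L1[OF stateD(1)]] by blast
lemma state_L0: "state v ==> state (L0 v)" by (auto simp: state_def bmeas_L0 nonneg_L0 G_L0)
lemma state_add: "state u ==> state v ==> state (%x. u x + v x)"
 by (auto simp: state_def nonneg_def G_add cone_add)
lemma state_L: "state v ==> state (L v)" unfolding L_def by (intro state_add state_L0 state_L1)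
lemma state_Lk: "state v ==> state ((L ^^ k) v)" by (induction k) (auto intro: state_L)

definition T :: real where "T = exp (3/2 * D) * C0 * 2 powr (s' + 1)"

lemma T_pos: "T > 0" using C0_pos by (simp add: T_def)

text \<open>The exponent is one less than in the assumption \<open>tail\<close>: an evolved density superposes excursions of all ages,
  which costs one power.\<close>

definition tail_le :: "real => (real => real) => bool" where
 "tail_le A v \<longleftrightarrow> (\<forall>k. t k v <= A * (real k + 1) powr (- s'))"

lemma t_cone:
 assumes "u \<in> cone c" "c <= 3/2 * D" "c >= 0" "bmeas Lam u"
 shows "t k u <= exp (3/2 * D) * C0 * mass u * (real k + 1) powr (- (s' + 1))"
proof -
 have m: "mass u >= 0" using cone_nonneg[OF assms(1)] by (intro mass_nonneg) (auto simp: nonneg_def)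
 have "t k u <= t k (%x. exp c * mass u * 1)"
  using cone_mass(1)[OF assms(1,4) _ assms(3)] by (intro t_mono assms bmeas_const) auto
 also have "... = exp c * mass u * t k (%_. 1)" by (rule t_cmult)
 also have "... <= exp c * mass u * (C0 * (real k + 1) powr (- (s' + 1)))"
  using m tail[of k] by (intro mult_left_mono) (auto simp: t_def mass_def)
 also have "... <= exp (3/2 * D) * mass u * (C0 * (real k + 1) powr (- (s' + 1)))"
  using assms m C0_pos by (intro mult_right_mono) auto
 finally show ?thesis by (simp add: mult_ac)
qed

text \<open>The telescoping form of the tail estimate: it makes \<open>tail_le\<close> invariant under \<open>L\<close> with the same constant.\<close>

lemma powr_gap: "2 powr (- (s' + 1)) * (real k + 1) powr (- (s' + 1)) <= (real k + 1) powr (- s') - (real k + 2) powr (- s')"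
proof -
 have d: "((%x. x powr (- s')) has_real_derivative (- s' * x powr (- s' - 1))) (at x)" if "real k + 1 <= x" for x
  using that by (intro has_real_derivative_powr) auto
 obtain z where z: "real k + 1 < z" "z < real k + 2"
  "(real k + 2) powr (- s') - (real k + 1) powr (- s') = (real k + 2 - (real k + 1)) * (- s' * z powr (- s' - 1))"
  using MVT2[of "real k + 1" "real k + 2", OF _ d] by auto
 have "(2 * (real k + 1)) powr (- s' - 1) <= z powr (- s' - 1)" using z s'_gt by (intro powr_mono2') auto
 also have "... <= s' * z powr (- s' - 1)" using s'_gt mult_right_mono[of 1 s' "z powr (- s' - 1)"] by simp
 finally have "(2 * (real k + 1)) powr (- s' - 1) <= (real k + 1) powr (- s') - (real k + 2) powr (- s')" using z by simp
 moreover have "(2 * (real k + 1)) powr (- s' - 1) = 2 powr (- (s' + 1)) * (real k + 1) powr (- (s' + 1))"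
  by (subst powr_mult) auto
 ultimately show ?thesis by simp
qed

lemma tail_cone: assumes "u \<in> cone c" "c <= 3/2 * D" "c >= 0" "bmeas Lam u" shows "tail_le (T * mass u) u"
 unfolding tail_le_def
proof
 fix k
 have m: "mass u >= 0" using cone_nonneg[OF assms(1)] by (intro mass_nonneg) (auto simp: nonneg_def)
 have "t k u <= exp (3/2 * D) * C0 * mass u * (real k + 1) powr (- (s' + 1))" by (rule t_cone[OF assms])
 also have "... <= exp (3/2 * D) * C0 * mass u * (real k + 1) powr (- s')"
  using C0_pos m by (intro mult_left_mono powr_mono) auto
 also have "... <= T * mass u * (real k + 1) powr (- s')"
 proof -
  have "1 <= (2::real) powr (s' + 1)" using s'_gt by (intro ge_one_powr_ge_zero) auto
  then have "exp (3/2 * D) * C0 * mass u * 1 <= exp (3/2 * D) * C0 * mass u * 2 powr (s' + 1)"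
   using C0_pos m by (intro mult_left_mono) auto
  then have "exp (3/2 * D) * C0 * mass u <= T * mass u" unfolding T_def by (simp only: mult_ac mult_1_right)
  then show ?thesis by (rule mult_right_mono) simp
 qed
 finally show "t k u <= T * mass u * (real k + 1) powr (- s')" .
qed

text \<open>The mass that enters a new excursion is paid for by the gap between consecutive tails.\<close>

lemma tail_L: assumes "state v" "tail_le (T * m) v" "mass v <= m" shows "tail_le (T * m) (L v)"
 unfolding tail_le_def
proof
 fix k
 note bm = stateD(1)[OF assms(1)]
 have m: "mass (L1 v) <= m" using mass_L(2)[OF bm] mass_nonneg[OF nonneg_L0[OF stateD(2)[OF assms(1)]]] assms by simp
 have m0: "0 <= m" using mass_nonneg[OF stateD(2)[OF assms(1)]] assms by simp
 have "t k (L v) = t k (L0 v) + t k (L1 v)" unfolding L_def using bm by (intro t_add bmeas_L0 bmeas_L1)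
 also have "t k (L0 v) = t (Suc k) v" by (simp add: t_def funpow_swap1)
 also have "... <= T * m * (real k + 2) powr (- s')"
  using assms(2)[unfolded tail_le_def, rule_format, of "Suc k"] by (simp add: algebra_simps)
 also have "t k (L1 v) <= exp (3/2 * D) * C0 * mass (L1 v) * (real k + 1) powr (- (s' + 1))"
  using D_pos by (intro t_cone[OF L1_state[OF assms(1)]] bmeas_L1 bm) auto
 also have "... <= exp (3/2 * D) * C0 * m * (real k + 1) powr (- (s' + 1))"
  using m C0_pos by (intro mult_right_mono mult_left_mono) auto
 also have "... = T * m * (2 powr (- (s' + 1)) * (real k + 1) powr (- (s' + 1)))"
 proof -
  have "2 powr (s' + 1) * 2 powr (- (s' + 1)) = (1::real)" by (simp flip: powr_add)
  moreover have "T * m * (2 powr (- (s' + 1)) * (real k + 1) powr (- (s' + 1))) =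
   exp (3/2 * D) * C0 * m * (2 powr (s' + 1) * 2 powr (- (s' + 1))) * (real k + 1) powr (- (s' + 1))"
   by (simp only: T_def mult_ac)
  ultimately show ?thesis by (simp only: mult_1_right)
 qed
 also have "... <= T * m * ((real k + 1) powr (- s') - (real k + 2) powr (- s'))"
  using T_pos m0 by (intro mult_left_mono powr_gap) auto
 finally show "t k (L v) <= T * m * (real k + 1) powr (- s')" by (simp add: algebra_simps)
qed

lemma tail_Lk:
 assumes "u \<in> cone c" "c <= 3/2 * D" "c >= 0" "bmeas Lam u"
 shows "tail_le (T * mass u) ((L ^^ k) u)"
proof (induction k)
 case 0 then show ?case using tail_cone[OF assms] by simp
next
 case (Suc k)
 then show ?case
  using tail_L[of "(L ^^ k) u" "mass u"] state_Lk[OF state_cone[OF assms(1,2,4)]] mass_Lk[OF assms(4)] by simp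
qed

lemma a_L: assumes "state v" shows "a k (L v) >= a (Suc k) v"
proof -
 note bm = stateD(1)[OF assms]
 have "a k (L v) = a k (L0 v) + a k (L1 v)"
  unfolding a_def L_def G_add using bm by (intro mass_add bmeas_G bmeas_L0 bmeas_L1)
 moreover have "a k (L0 v) = a (Suc k) v" by (simp add: a_def G_L0)
 moreover have "a k (L1 v) >= 0" by (intro a_nonneg nonneg_L1 stateD assms)
 ultimately show ?thesis by simp
qed

definition \<kappa> :: real where "\<kappa> = exp (- D) / 2"

lemma kappa: "0 < \<kappa>" "\<kappa> <= 1/2" using D_pos by (auto simp: \<kappa>_def)

lemma mass_L1_cone: assumes "u \<in> cone D" "bmeas Lam u" shows "mass (L1 u) >= \<kappa> * mass u"
proof -
 have "mass (%_. exp (-D) * mass u / 2) <= mass (L1 u)" using cone_mass(2)[OF assms(1,2) _ less_imp_le[OF D_pos]]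
  by (intro mass_mono bmeas_L1 assms bmeas_const) (auto simp: right_op_def)
 then show ?thesis by (simp add: mass_const \<kappa>_def)
qed

lemma a_0_L: assumes "state v" shows "a 0 (L v) >= \<kappa> * a 0 v"
proof -
 note bm = stateD(1)[OF assms]
 have "a 0 (L v) = mass (L1 (L v))" by (simp add: a_def G_def)
 also have "... = mass (%x. L1 (L0 v) x + L1 (L1 v) x)" unfolding L_def using L1_linear[of 1 "L0 v" 1 "L1 v"] by simp
 also have "... = mass (L1 (L0 v)) + mass (L1 (L1 v))" using bm by (intro mass_add bmeas_L1 bmeas_L0)
 also have "... >= mass (L1 (L1 v))" using mass_nonneg[OF nonneg_L1[OF nonneg_L0[OF stateD(2)[OF assms]]]] by simp
 finally have "a 0 (L v) >= mass (L1 (L1 v))" .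
 with mass_L1_cone[OF L1_state[OF assms] bmeas_L1[OF bm]] show ?thesis by (simp add: a_def G_def)
qed

lemma a_0_Lk: assumes "state v" shows "a 0 ((L ^^ k) v) >= \<kappa> ^ k * a 0 v" "a 0 ((L ^^ k) v) >= a k v"
proof -
 show "a 0 ((L ^^ k) v) >= \<kappa> ^ k * a 0 v"
 proof (induction k)
  case (Suc k)
  have "\<kappa> ^ Suc k * a 0 v = \<kappa> * (\<kappa> ^ k * a 0 v)" by simp
  also have "... <= \<kappa> * a 0 ((L ^^ k) v)" using Suc kappa by (intro mult_left_mono) auto
  also have "... <= a 0 ((L ^^ Suc k) v)" using a_0_L[OF state_Lk[OF assms]] by simp
  finally show ?case .
 qed simp
 show "a 0 ((L ^^ k) v) >= a k v" using assms
 proof (induction k arbitrary: v)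
  case (Suc k)
  have "a (Suc k) v <= a k (L v)" using a_L[OF Suc.prems] .
  also have "... <= a 0 ((L ^^ k) (L v))" using Suc.IH[OF state_L[OF Suc.prems]] .
  finally show ?case by (simp add: funpow_swap1)
 qed simp
qed

lemma sum_a: "bmeas Lam v ==> (\<Sum>k<n. a k v) = mass v - t n v"
 by (induction n) (auto simp: t_0 a_t)

text \<open>At every time a fixed proportion of the mass uses the right branch. For small times this follows from the lower bound on each
  single step; for large times, the tail bound shows that half of the mass has to leave the left branch within \<open>J\<close> steps, and
  one of these departures carries a definite share.\<close>

lemma release_lower: "\<exists>c>0. c <= 1 \<and> (\<forall>u\<in>cone D. bmeas Lam u --> (\<forall>j. a 0 ((L ^^ j) u) >= c * mass u))"
proof -
 have "(%k. T * (real k + 1) powr (- s')) ~> 0"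
 proof -
  have "filterlim (%k. real k + 1) at_top sequentially"
   using filterlim_compose[OF filterlim_real_sequentially filterlim_Suc] by (simp add: add.commute)
  then show ?thesis using s'_gt by (intro tendsto_mult_right_zero tendsto_neg_powr) auto
 qed
 then have "eventually (%k. T * (real k + 1) powr (- s') < 1/2) sequentially" by (rule order_tendstoD) simp
 then obtain J where J: "T * (real J + 1) powr (- s') < 1/2" by (auto simp: eventually_sequentially)
 define c where "c = \<kappa> ^ (J + 1) / (2 * (real J + 1))"
 have c: "0 < c" "c <= \<kappa> ^ (J + 1)" using kappa by (auto simp: c_def divide_simps)
 have kp: "\<kappa> ^ (J + 1) <= 1" using kappa by (intro power_le_one) auto
 have "a 0 ((L ^^ j) u) >= c * mass u" if u: "u \<in> cone D" "bmeas Lam u" for u j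
 proof -
  have st: "state u" using u by (rule state_cone_D)
  have m: "mass u >= 0" using stateD[OF st] by (intro mass_nonneg)
  show ?thesis
  proof (cases "j <= J")
   case True
   have "c * mass u <= \<kappa> ^ (J + 1) * mass u" using c m by (intro mult_right_mono)
   also have "... <= \<kappa> ^ (j + 1) * mass u" using True kappa m by (intro mult_right_mono power_decreasing) auto
   also have "... <= \<kappa> ^ j * a 0 u"
    using mass_L1_cone[OF u] kappa by (simp add: a_def G_def mult.assoc mult_left_mono)
   also have "... <= a 0 ((L ^^ j) u)" by (rule a_0_Lk[OF st])
   finally show ?thesis .
  next
   case False
   define v where "v = (L ^^ (j - J)) u"
   have sv: "state v" unfolding v_def by (rule state_Lk[OF st])
   have mv: "mass v = mass u" unfolding v_def by (rule mass_Lk[OF u(2)])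
   have "(L ^^ j) u = (L ^^ (J + (j - J))) u" using False by simp
   then have Lv: "(L ^^ J) v = (L ^^ j) u" unfolding v_def by (simp only: funpow_add comp_apply)
   have "tail_le (T * mass u) v" unfolding v_def using D_pos by (intro tail_Lk[OF u(1) _ _ u(2)]) auto
   then have "t J v <= T * mass u * (real J + 1) powr (- s')" by (simp add: tail_le_def)
   also have "... = T * (real J + 1) powr (- s') * mass u" by simp
   also have "... <= 1/2 * mass u" using J m by (intro mult_right_mono) auto
   finally have "(\<Sum>k<J. a k v) >= 1/2 * mass u" using sum_a[OF stateD(1)[OF sv], of J] mv by simp
   moreover have "(\<Sum>k<J. a k v) <= (\<Sum>k<J. a 0 ((L ^^ j) u) / \<kappa> ^ J)"
   proof (intro sum_mono)
    fix k assume k: "k \<in> {..<J}"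
    have "\<kappa> ^ J * a k v <= \<kappa> ^ (J - k) * a k v"
     using kappa a_nonneg[OF stateD(2)[OF sv]] by (intro mult_right_mono power_decreasing) auto
    also have "... <= \<kappa> ^ (J - k) * a 0 ((L ^^ k) v)" using kappa by (intro mult_left_mono a_0_Lk sv) auto
    also have "... <= a 0 ((L ^^ (J - k)) ((L ^^ k) v))" by (intro a_0_Lk state_Lk sv)
    also have "(L ^^ (J - k)) ((L ^^ k) v) = (L ^^ (J - k + k)) v" by (simp only: funpow_add comp_apply)
    also have "... = (L ^^ j) u" using Lv k by simp
    finally show "a k v <= a 0 ((L ^^ j) u) / \<kappa> ^ J" using kappa by (simp add: field_simps)
   qed
   moreover have "(\<Sum>k<J. a 0 ((L ^^ j) u) / \<kappa> ^ J) = real J * (a 0 ((L ^^ j) u) / \<kappa> ^ J)" by simp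
   ultimately have "1/2 * mass u <= real J * (a 0 ((L ^^ j) u) / \<kappa> ^ J)" by linarith
   also have "... <= (real J + 1) * (a 0 ((L ^^ j) u) / \<kappa> ^ J)"
    using kappa a_nonneg[OF stateD(2)[OF state_Lk[OF st]]] by (intro mult_right_mono) auto
   finally have "\<kappa> ^ J / (2 * (real J + 1)) * mass u <= a 0 ((L ^^ j) u)"
    using kappa by (simp add: field_simps)
   moreover have "c * mass u <= \<kappa> ^ J / (2 * (real J + 1)) * mass u"
    unfolding c_def using kappa m by (intro mult_right_mono divide_right_mono power_decreasing) auto
   ultimately show ?thesis by linarith
  qed
 qed
 with c kp show ?thesis by (intro exI[of _ c]) auto
qed

end

section \<open>Coupling of densities\<close>

context intermittent begin

definition test :: "(real => real) => bool" where
 "test h \<longleftrightarrow> h \<in> borel_measurable Lam \<and> (\<forall>x\<in>{0..1}. abs (h x) <= 1)"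

lemma test_bmeas: "test h ==> bmeas Lam h" by (auto simp: test_def intro: bmeas_le_1)

lemma E_le: "bmeas Lam u ==> nonneg u ==> test h ==> abs (E n u h) <= mass u"
 using E_bound[of u h n] test_bmeas[of h] by (auto simp: test_def)

text \<open>Summation by parts turns the tail bound into a moment of order \<open>s\<close> of the departure time. The leading term is
  the mass times \<open>B powr s\<close> and the correction is of lower order in \<open>B\<close>, so that it can be made negligible by the choice of \<open>B\<close>.\<close>

lemma moment:
 assumes "state v" "tail_le A v" "B >= 1" "s >= 1" "A >= 0"
  and Z: "!!n. (\<Sum>k<n. (real k + 2) powr (s - 1 - s')) <= Z"
 shows "(\<Sum>k<n. a k v * (real k + B) powr s) + t n v * (real n + B) powr s
      <= mass v * B powr s + A * s * B powr (s - 1) * Z"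
proof -
 have bm: "bmeas Lam v" using stateD assms by blast
 have "(\<Sum>k<n. a k v * (real k + B) powr s) + t n v * (real n + B) powr s
   <= mass v * B powr s + A * s * B powr (s - 1) * (\<Sum>k<n. (real k + 2) powr (s - 1 - s'))"
 proof (induction n)
  case 0 then show ?case by (simp add: t_0)
 next
  case (Suc n)
  have "(\<Sum>k<Suc n. a k v * (real k + B) powr s) + t (Suc n) v * (real (Suc n) + B) powr s
   = ((\<Sum>k<n. a k v * (real k + B) powr s) + t n v * (real n + B) powr s)
     + t (Suc n) v * ((real (Suc n) + B) powr s - (real n + B) powr s)" by (simp add: a_t[OF bm, of n] algebra_simps)
  also have "t (Suc n) v * ((real (Suc n) + B) powr s - (real n + B) powr s) \<le>
    A * (real n + 2) powr (- s') * (s * (B * (real n + 2)) powr (s - 1))"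
  proof (rule mult_mono)
   show "t (Suc n) v <= A * (real n + 2) powr (- s')"
    using assms(2)[unfolded tail_le_def, rule_format, of "Suc n"] by (simp add: algebra_simps)
   have "(real n + B + 1) powr s - (real n + B) powr s <= s * 1 * (real n + B + 1) powr (s - 1)"
    using assms by (intro powr_diff_le) auto
   also have "... <= s * (B * (real n + 2)) powr (s - 1)"
   proof -
    have "real n <= B * real n" using assms by (simp add: mult_right_mono[of 1 B "real n", simplified])
    then have "real n + B + 1 <= B * (real n + 2)" using assms by (simp add: algebra_simps)
    then show ?thesis using assms by (simp add: powr_mono2)
   qed
   finally show "(real (Suc n) + B) powr s - (real n + B) powr s <= s * (B * (real n + 2)) powr (s - 1)"
    by (simp add: algebra_simps)
   show "0 <= (real (Suc n) + B) powr s - (real n + B) powr s" using assms by (simp add: powr_mono2)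
  qed (use assms in auto)
  also have "... = A * s * B powr (s - 1) * (real n + 2) powr (s - 1 - s')"
  proof -
   have "(real n + 2) powr (s - 1 - s') = (real n + 2) powr (- s') * (real n + 2) powr (s - 1)"
    by (simp flip: powr_add)
   then show ?thesis using assms by (simp add: powr_mult)
  qed
  finally show ?case using Suc by (simp add: algebra_simps)
 qed
 also have "... <= mass v * B powr s + A * s * B powr (s - 1) * Z"
  using Z[of n] assms by (intro add_left_mono mult_left_mono) auto
 finally show ?thesis .
qed

text \<open>The induction hypothesis of the coupling: two log-Lipschitz densities, one of them started \<open>l\<close> steps later, are
  indistinguishable up to \<open>((l + B) / n) powr s\<close>. For \<open>l = 0\<close> there is a gain \<open>1 - e\<close>, which drives the induction.\<close>

definition close :: "real => real => real => real => nat => bool" where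
 "close s K B e n \<longleftrightarrow> (\<forall>l\<le>n. \<forall>u\<in>cone D. \<forall>b\<in>cone D. \<forall>h. bmeas Lam u --> bmeas Lam b --> test h -->
   abs (mass b * E n u h - mass u * E (n - l) b h) \<le>
    mass u * mass b * (if l = 0 then K * (1 - e) * (B / n) powr s else K * ((l + B) / n) powr s))"

lemma closeD:
 assumes "close s K B e n" "l <= n" "u \<in> cone D" "b \<in> cone D" "bmeas Lam u" "bmeas Lam b" "test h" "K >= 0" "0 <= e" "B >= 0"
 shows "abs (mass b * E n u h - mass u * E (n - l) b h) <= mass u * mass b * (K * ((l + B) / n) powr s)"
  and "l = 0 ==> abs (mass b * E n u h - mass u * E (n - l) b h) <= mass u * mass b * (K * (1 - e) * (B / n) powr s)"
proof -
 have m: "0 <= mass u * mass b" using assms cone_nonneg by (intro mult_nonneg_nonneg mass_nonneg) (auto simp: nonneg_def)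
 have *: "abs (mass b * E n u h - mass u * E (n - l) b h) \<le>
    mass u * mass b * (if l = 0 then K * (1 - e) * (B / n) powr s else K * ((l + B) / n) powr s)"
  using assms unfolding close_def by blast
 also have "... <= mass u * mass b * (K * ((l + B) / n) powr s)"
  using m assms by (intro mult_left_mono) (auto intro!: mult_right_mono mult_left_le)
 finally show "abs (mass b * E n u h - mass u * E (n - l) b h) <= mass u * mass b * (K * ((l + B) / n) powr s)" .
 show "l = 0 ==> abs (mass b * E n u h - mass u * E (n - l) b h) <= mass u * mass b * (K * (1 - e) * (B / n) powr s)"
  using * by simp
qed

text \<open>Decompose both densities by the first return and compare the parts pairwise with the hypothesis \<open>close\<close> at smaller times.
  Pairs of which one is released later than \<open>(1 - q) * n\<close> are estimated trivially; the choice of \<open>K\<close> makes the weight exceed \<open>2\<close> there.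
  The elementary inequality \<open>(max k l - min k l + B) powr s \<le> w k + w l - B powr s\<close> decouples the indices, and \<open>moment\<close> sums the weights.\<close>

lemma pair_bound:
 assumes v1: "state v1" "tail_le A1 v1" "A1 >= 0" and v2: "state v2" "tail_le A2 v2" "A2 >= 0"
  and h: "test h" and s: "s >= 1" and B: "B >= 1" and q: "1/2 <= q" "q < 1" and K: "K * (1 - q) powr s >= 2" and e: "e >= 0"
  and n: "n >= 1" and H: "!!n'. 1 <= n' ==> n' < n ==> close s K B e n'"
  and Z: "!!n. (\<Sum>k<n. (real k + 2) powr (s - 1 - s')) <= Z"
 shows "abs (mass v2 * E n v1 h - mass v1 * E n v2 h) \<le>
   K / (q * n) powr s * (mass v1 * mass v2 * (2 * (B + 1) powr s - B powr s)
    + (mass v2 * A1 + mass v1 * A2) * s * (B + 1) powr (s - 1) * Z)"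
proof -
 note b1 = stateD(1)[OF v1(1)] and b2 = stateD(1)[OF v2(1)]
 note p1 = stateD(2)[OF v1(1)] and p2 = stateD(2)[OF v2(1)]
 have K0: "K > 0" using K q by (metis diff_gt_0_iff_gt less_le_trans powr_gt_zero zero_less_mult_pos2 zero_less_numeral less_numeral_extra(3) order_less_imp_not_eq2)
 define Q where "Q = K / (q * n) powr s"
 have Q: "Q > 0" using K0 q n by (simp add: Q_def)
 define X where "X v k = (if k < n then E (n - 1 - k) (G k v) h else (LINT x|Lam. (L0 ^^ n) v x * h x))" for v k
 define A where "A v k = (if k < n then a k v else t n v)" for v k
 have EX: "E n v h = (\<Sum>k<Suc n. X v k)" if "bmeas Lam v" for v
  using E_decomp[OF that test_bmeas[OF h], of n] by (simp add: X_def)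
 have mA: "mass v = (\<Sum>k<Suc n. A v k)" if "bmeas Lam v" for v using sum_a[OF that, of n] by (simp add: A_def)
 have XA: "abs (X v k) <= A v k" if "state v" for v k
 proof (cases "k < n")
  case True
  then show ?thesis using E_le[OF bmeas_G nonneg_G h] stateD(1,2)[OF that] by (simp add: X_def A_def a_def)
 next
  case False
  then show ?thesis using E_le[of "(L0 ^^ n) v" h 0, OF bmeas_L0k nonneg_L0k h] stateD(1,2)[OF that]
   by (simp add: X_def A_def t_def E_0)
 qed
 have A0: "A v k >= 0" if "state v" for v k using XA[OF that, of k] by linarith
 define w where "w k = (real k + 1 + B) powr s" for k :: nat
 have wB: "B powr s <= w k" for k unfolding w_def using B s by (intro powr_mono2) auto
 have triv: "abs (A v2 l * X v1 k - A v1 k * X v2 l) <= A v1 k * A v2 l * 2" for k l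
 proof -
  have "abs (A v2 l * X v1 k - A v1 k * X v2 l) <= abs (A v2 l * X v1 k) + abs (A v1 k * X v2 l)" by (rule abs_triangle_ineq4)
  also have "... <= A v2 l * A v1 k + A v1 k * A v2 l"
   unfolding abs_mult using XA[OF v1(1)] XA[OF v2(1)] A0[OF v1(1)] A0[OF v2(1)]
   by (intro add_mono mult_mono) auto
  finally show ?thesis by simp
 qed
 have large: "2 <= Q * w k" if "real k + 1 > (1 - q) * n" for k
 proof -
  have "2 <= K * (1 - q) powr s" by (rule K)
  also have "... = K / n powr s * ((1 - q) * n) powr s" using n q by (simp add: powr_mult)
  also have "... <= K / n powr s * w k" unfolding w_def using K0 that q B s by (intro mult_left_mono powr_mono2) auto
  also have "... <= Q * w k"
   unfolding Q_def w_def using K0 q n s by (intro mult_right_mono divide_left_mono powr_mono2 mult_pos_pos) (auto intro: mult_left_le_one_le)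
  finally show ?thesis .
 qed
 have each: "abs (A v2 l * X v1 k - A v1 k * X v2 l) <= A v1 k * A v2 l * (Q * (w k + w l - B powr s))"
  if "k < Suc n" "l < Suc n" for k l
 proof (cases "real (max k l) + 1 > (1 - q) * n")
  case True
  have "2 <= Q * (w k + w l - B powr s)"
  proof (cases "k <= l")
   case True
   then have "2 <= Q * w l" using large[of l] \<open>real (max k l) + 1 > (1 - q) * n\<close> by (simp add: max_def)
   also have "... <= Q * (w k + w l - B powr s)" using Q wB[of k] by (intro mult_left_mono) auto
   finally show ?thesis .
  next
   case False
   then have "2 <= Q * w k" using large[of k] \<open>real (max k l) + 1 > (1 - q) * n\<close> by (simp add: max_def)
   also have "... <= Q * (w k + w l - B powr s)" using Q wB[of l] by (intro mult_left_mono) auto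
   finally show ?thesis .
  qed
  then have "A v1 k * A v2 l * 2 <= A v1 k * A v2 l * (Q * (w k + w l - B powr s))"
   using A0[OF v1(1)] A0[OF v2(1)] by (intro mult_left_mono) auto
  with triv[of l k] show ?thesis by linarith
 next
  case False
  then have kl: "real k + 1 <= (1 - q) * n" "real l + 1 <= (1 - q) * n" by auto
  have "(1 - q) * n < 1 * real n" using q n by (intro mult_strict_right_mono) auto
  then have kn: "k < n" "l < n" using kl by linarith+
  have half: "real n / 2 >= (1 - q) * n" using q mult_right_mono[of "1 - q" "1/2" "real n"] by simp
  have main: "abs (a l v' * E (n - 1 - k) (G k v) h - a k v * E (n - 1 - l) (G l v') h) <= a k v * a l v' * (Q * w l)"
   if "k <= l" "state v" "state v'" "real k + 1 <= (1 - q) * n" "real l + 1 <= (1 - q) * n" "l < n" for k l v v'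
  proof -
   have "real (2 * (k + 1)) <= real n" using that(4) half by simp
   then have "2 * (k + 1) <= n" by linarith
   then have n': "1 <= n - 1 - k" "n - 1 - k < n" "n - 1 - k - (l - k) = n - 1 - l" "l - k <= n - 1 - k"
    using that(1,6) by auto
   have "abs (mass (G l v') * E (n - 1 - k) (G k v) h - mass (G k v) * E (n - 1 - k - (l - k)) (G l v') h)
     <= mass (G k v) * mass (G l v') * (K * ((real (l - k) + B) / real (n - 1 - k)) powr s)" using that K0 e B stateD
    by (intro closeD(1)[OF H[OF n'(1,2)] n'(4)] stateD bmeas_G h) auto
   also have "... <= mass (G k v) * mass (G l v') * (Q * w l)"
   proof -
    have "((real (l - k) + B) / real (n - 1 - k)) powr s <= ((real l + 1 + B) / (q * n)) powr s"
    proof (intro powr_mono2 frac_le)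
     have "real (n - 1 - k) = real n - 1 - real k" using n'(1) by auto
     then show "q * n <= real (n - 1 - k)" using that(4) by (simp add: algebra_simps)
     show "0 < q * n" using q n by simp
    qed (use B s that in auto)
    also have "... = w l / (q * n) powr s" using B q n by (simp add: powr_divide w_def)
    finally have "K * ((real (l - k) + B) / real (n - 1 - k)) powr s <= K * (w l / (q * n) powr s)"
     using K0 by (intro mult_left_mono) auto
    then show ?thesis using that by (intro mult_left_mono mult_nonneg_nonneg mass_nonneg nonneg_G stateD) (auto simp: Q_def)
   qed
   finally show ?thesis using n' by (simp add: a_def)
  qed
  have a0: "a k v1 >= 0" "a l v2 >= 0" using a_nonneg p1 p2 by auto
  show ?thesis
  proof (cases "k <= l")
   case True
   have "abs (A v2 l * X v1 k - A v1 k * X v2 l) <= a k v1 * a l v2 * (Q * w l)"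
    using main[OF True v1(1) v2(1) kl kn(2)] kn by (simp add: A_def X_def)
   also have "... <= a k v1 * a l v2 * (Q * (w k + w l - B powr s))"
    using a0 Q wB[of k] by (intro mult_left_mono) auto
   finally show ?thesis using kn by (simp add: A_def)
  next
   case False
   then have "l <= k" by simp
   have "abs (A v1 k * X v2 l - A v2 l * X v1 k) <= a l v2 * a k v1 * (Q * w k)"
    using main[OF \<open>l <= k\<close> v2(1) v1(1) kl(2,1) kn(1)] kn by (simp add: A_def X_def)
   also have "... <= a l v2 * a k v1 * (Q * (w k + w l - B powr s))"
    using a0 Q wB[of l] by (intro mult_left_mono) auto
   finally show ?thesis using kn by (simp add: A_def abs_minus_commute mult.commute)
  qed
 qed
 have sumAw: "(\<Sum>k<Suc n. A v k * w k) <= mass v * (B + 1) powr s + A' * s * (B + 1) powr (s - 1) * Z"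
  if "state v" "tail_le A' v" "A' >= 0" for v A'
  using moment[OF that(1,2) _ s that(3) Z, of "B + 1" n] B by (simp add: A_def w_def add.commute add.left_commute)
 have "mass v2 * E n v1 h - mass v1 * E n v2 h = (\<Sum>k<Suc n. \<Sum>l<Suc n. A v2 l * X v1 k - A v1 k * X v2 l)"
 proof -
  have "mass v2 * E n v1 h = (\<Sum>k<Suc n. \<Sum>l<Suc n. A v2 l * X v1 k)"
   unfolding EX[OF b1] mA[OF b2] by (subst sum_product, subst sum.swap) (rule refl)
  moreover have "mass v1 * E n v2 h = (\<Sum>k<Suc n. \<Sum>l<Suc n. A v1 k * X v2 l)"
   unfolding EX[OF b2] mA[OF b1] by (rule sum_product)
  ultimately show ?thesis by (simp add: sum_subtractf)
 qed
 also have "abs (...) <= (\<Sum>k<Suc n. \<Sum>l<Suc n. A v1 k * A v2 l * (Q * (w k + w l - B powr s)))"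
  by (intro order_trans[OF sum_abs] sum_mono order_trans[OF sum_abs] sum_mono each) auto
 also have "... = Q * ((\<Sum>k<Suc n. A v1 k * w k) * (\<Sum>l<Suc n. A v2 l) + (\<Sum>k<Suc n. A v1 k) * (\<Sum>l<Suc n. A v2 l * w l)
    - B powr s * ((\<Sum>k<Suc n. A v1 k) * (\<Sum>l<Suc n. A v2 l)))" unfolding sum_product
  by (simp only: sum_distrib_left sum_subtractf[symmetric] sum.distrib[symmetric]) (simp only: algebra_simps)
 also have "... = Q * ((\<Sum>k<Suc n. A v1 k * w k) * mass v2 + mass v1 * (\<Sum>l<Suc n. A v2 l * w l) - B powr s * (mass v1 * mass v2))"
  by (simp only: mA[OF b1] mA[OF b2])
 also have "... <= Q * ((mass v1 * (B + 1) powr s + A1 * s * (B + 1) powr (s - 1) * Z) * mass v2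
   + mass v1 * (mass v2 * (B + 1) powr s + A2 * s * (B + 1) powr (s - 1) * Z) - B powr s * (mass v1 * mass v2))"
  using sumAw[OF v1] sumAw[OF v2] mass_nonneg[OF p1] mass_nonneg[OF p2] Q
  by (intro mult_left_mono diff_right_mono add_mono mult_right_mono) auto
 also have "... = Q * (mass v1 * mass v2 * (2 * (B + 1) powr s - B powr s)
    + (mass v2 * A1 + mass v1 * A2) * s * (B + 1) powr (s - 1) * Z)" by (simp add: algebra_simps)
 finally show ?thesis unfolding Q_def by simp
qed

text \<open>A third of the lower bound of a log-Lipschitz density can be removed at the price of a larger Lipschitz constant.\<close>

lemma subtract_cone:
 assumes u: "u \<in> cone D" "bmeas Lam u"
 defines "m \<equiv> exp (- D) / 3 * mass u"
 shows "(%x. u x - m) \<in> cone (3/2 * D)"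
proof -
 have *: "u x - m <= exp (3/2 * D * abs (x - y)) * (u y - m)" "0 <= u x - m"
  if xy: "x \<in> {0..1}" "y \<in> {0..1}" for x y
 proof -
  let ?d = "abs (x - y)"
  have my: "m <= u y / 3" and mx: "m <= u x / 3" using cone_mass(2)[OF u(1,2)] xy D_pos by (auto simp: m_def)
  have pos: "0 <= u y" "0 <= u x" using cone_nonneg[OF u(1)] xy by auto
  have e1: "exp (3/2 * D * ?d) >= 1" using D_pos by auto
  have cv: "1/3 * (exp (3/2 * D * ?d) - 1) <= exp (3/2 * D * ?d) - exp (D * ?d)"
  proof -
   have "(3/2 * D - D) / (3/2 * D) = 1/3" using D_pos by (simp add: field_simps)
   then show ?thesis using exp_sub_convex[of D "3/2 * D" ?d] D_pos by simp
  qed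
  have "m * (exp (3/2 * D * ?d) - 1) <= u y / 3 * (exp (3/2 * D * ?d) - 1)"
   using my e1 by (intro mult_right_mono) auto
  also have "... = u y * (1/3 * (exp (3/2 * D * ?d) - 1))" by simp
  also have "... <= u y * (exp (3/2 * D * ?d) - exp (D * ?d))" using pos cv by (intro mult_left_mono) auto
  finally have "exp (D * ?d) * u y - m <= exp (3/2 * D * ?d) * (u y - m)" by (simp add: algebra_simps)
  moreover have "u x <= exp (D * ?d) * u y" by (rule coneD[OF u(1) xy])
  ultimately show "u x - m <= exp (3/2 * D * ?d) * (u y - m)" by linarith
  show "0 <= u x - m" using mx pos by linarith
 qed
 then show ?thesis unfolding cone_def by blast
qed

text \<open>Strong induction on \<open>n\<close>. For \<open>l = 0\<close>, a constant is subtracted from both densities; it has the same future for both,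
  and the remainders, of mass reduced by \<open>1 - 2 e\<close>, are treated by \<open>pair_bound\<close>. For \<open>l > 0\<close>, the older density
  is decomposed by its next return and each part is compared with the younger one; the parts that return at once, of proportion at least
  \<open>c\<close>, profit from the gain \<open>e\<close>, which beats the loss caused by replacing \<open>n\<close> by \<open>n - l\<close> in the weight.\<close>

lemma coupling:
 assumes s: "1 <= s" "s < s'"
 shows "\<exists>K B q Z. 0 < K \<and> 1 <= B \<and> 1/2 <= q \<and> q < 1 \<and> K * (1 - q) powr s >= 2 \<and>
   (\<forall>n. (\<Sum>k<n. (real k + 2) powr (s - 1 - s')) <= Z) \<and> (\<forall>n\<ge>1. close s K B (exp (- D) / 6) n)"
proof -
 have "summable (%k. real k powr (s - 1 - s'))" using s by (subst summable_real_powr_iff) auto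
 then have "summable (%k. real (Suc (Suc k)) powr (s - 1 - s'))" by (subst summable_Suc_iff)+
 then have sm: "summable (%k. (real k + 2) powr (s - 1 - s'))" by (simp add: add.commute)
 define Z where "Z = (\<Sum>k. (real k + 2) powr (s - 1 - s'))"
 have Z: "(\<Sum>k<n. (real k + 2) powr (s - 1 - s')) <= Z" for n unfolding Z_def by (intro sum_le_suminf sm) auto
 have Z0: "Z >= 0" using Z[of 0] by simp
 obtain c where c: "c > 0" "c <= 1" and rel: "!!u j. u \<in> cone D ==> bmeas Lam u ==> a 0 ((L ^^ j) u) >= c * mass u"
  using release_lower by blast
 define e where "e = exp (- D) / 6"
 have e: "0 < e" "e < 1/6" using D_pos by (auto simp: e_def)
 (* x measures the gain at the return; B makes the lower-order terms smaller than x, and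
   q is so close to 1 that the loss in the weight is below x *)
 define R where "R = (2 * s + 2 * T * s * Z) * 2 powr (s - 1)"
 have TZ: "T * s * Z >= 0" using T_pos Z0 s by simp
 have two: "(1::real) <= 2 powr (s - 1)" using s by (intro ge_one_powr_ge_zero) auto
 have R0: "R >= 0" using TZ s by (simp add: R_def)
 have RT: "T * s * Z <= R"
 proof -
  have "2 * s + 2 * T * s * Z = 2 * s + 2 * (T * s * Z)" by simp
  then have "T * s * Z <= 2 * s + 2 * T * s * Z" "0 <= 2 * s + 2 * T * s * Z" using TZ s by linarith+
  then have "T * s * Z * 1 <= (2 * s + 2 * T * s * Z) * 2 powr (s - 1)" using two TZ by (intro mult_mono) auto
  then show ?thesis by (simp add: R_def)
 qed
 define x where "x = c * e / 2"
 have "c * e <= 1 * e" using c e by (intro mult_right_mono) auto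
 then have "c * e <= e" "0 < c * e" using c e by auto
 then have x: "0 < x" "x < 1/12" "x <= e / 2" using e unfolding x_def by linarith+
 define B where "B = max 1 (R / x)"
 have B: "B >= 1" by (simp add: B_def)
 have RB: "R / B <= x"
 proof -
  have "R / x <= B" by (simp add: B_def)
  then show ?thesis using x B by (simp add: field_simps)
 qed
 define q where "q = max (1/2) ((1 - x) powr (1 / s))"
 have q: "1/2 <= q" "q < 1"
 proof -
  show "1/2 <= q" by (simp add: q_def)
  have "(1 - x) powr (1 / s) < 1 powr (1 / s)" using x s by (intro powr_less_mono2) auto
  then show "q < 1" by (simp add: q_def)
 qed
 have qs: "1 - x <= q powr s"
 proof -
  have "1 - x = ((1 - x) powr (1 / s)) powr s" using x s by (simp add: powr_powr)
  also have "... <= q powr s" using s by (intro powr_mono2) (auto simp: q_def)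
  finally show ?thesis .
 qed
 define K where "K = 2 / (1 - q) powr s"
 have K: "K * (1 - q) powr s >= 2" "K > 0" using q by (auto simp: K_def)
 have K2: "K >= 2"
 proof -
  have "(1 - q) powr s <= 1" using q s by (intro powr_le1) auto
  then show ?thesis using q by (simp add: K_def field_simps)
 qed
 have close: "close s K B e n" if "n >= 1" for n using that
 proof (induction n rule: less_induct)
  case (less n)
  have H: "close s K B e n'" if "1 <= n'" "n' < n" for n' using less that by blast
  show ?case
   unfolding close_def
  proof (intro allI impI ballI)
   fix l u b h
   assume l: "l <= n" and u: "u \<in> cone D" and b: "b \<in> cone D" and bu: "bmeas Lam u" and bb: "bmeas Lam b" and h: "test h"
   have su: "state u" and sb: "state b" using state_cone_D u b bu bb by auto
   note nu = stateD(2)[OF su] and nb = stateD(2)[OF sb]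
   define mu mb where "mu = mass u" and "mb = mass b"
   have m: "0 <= mu" "0 <= mb" unfolding mu_def mb_def using nu nb by (auto intro: mass_nonneg)
   have "abs (mb * E n u h - mu * E (n - l) b h) \<le>
    mu * mb * (if l = 0 then K * (1 - e) * (B / n) powr s else K * ((l + B) / n) powr s)"
   proof (cases "l = 0")
    case True
    define u' b' where "u' = (%x. u x - exp (- D) / 3 * mass u)" and "b' = (%x. b x - exp (- D) / 3 * mass b)"
    have e3: "exp (- D) / 3 = 2 * e" by (simp add: e_def)
    have bm': "bmeas Lam u'" "bmeas Lam b'" unfolding u'_def b'_def using bu bb by auto
    have cu': "u' \<in> cone (3/2 * D)" "b' \<in> cone (3/2 * D)" unfolding u'_def b'_def by (rule subtract_cone u b bu bb)+
    have u_eq: "u = (%x. u' x + 2 * e * mu)" "b = (%x. b' x + 2 * e * mb)" unfolding u'_def b'_def e3 mu_def mb_def by auto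
    have m': "mass u' = (1 - 2 * e) * mu" "mass b' = (1 - 2 * e) * mb"
    proof -
     have "mu = mass u' + 2 * e * mu" using mass_add[OF bm'(1) bmeas_const, of "2 * e * mu"]
      by (simp only: u_eq(1)[symmetric] mass_const mu_def[symmetric])
     then show "mass u' = (1 - 2 * e) * mu" by (simp add: algebra_simps)
     have "mb = mass b' + 2 * e * mb" using mass_add[OF bm'(2) bmeas_const, of "2 * e * mb"]
      by (simp only: u_eq(2)[symmetric] mass_const mb_def[symmetric])
     then show "mass b' = (1 - 2 * e) * mb" by (simp add: algebra_simps)
    qed
    have Ee: "E n u h = E n u' h + 2 * e * mu * E n (%_. 1) h" "E n b h = E n b' h + 2 * e * mb * E n (%_. 1) h"
     using E_add[OF bm'(1) bmeas_const test_bmeas[OF h], of n "2 * e * mu"] E_add[OF bm'(2) bmeas_const test_bmeas[OF h], of n "2 * e * mb"]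
      E_cmult[of n "2 * e * mu" "%_. 1" h] E_cmult[of n "2 * e * mb" "%_. 1" h]
     by (simp_all only: u_eq[symmetric] mult_1_right)
    have st': "state u'" "state b'" by (intro state_cone[OF _ order.refl] cu' bm')+
    have tl': "tail_le (T * mass u') u'" "tail_le (T * mass b') b'" using D_pos by (intro tail_cone[OF _ order.refl] cu' bm'; simp)+
    have mm': "mass u' >= 0" "mass b' >= 0" unfolding m' using m e by auto
    have "abs (mass b' * E n u' h - mass u' * E n b' h) <= K / (q * n) powr s * (mass u' * mass b' * (2 * (B + 1) powr s - B powr s)
      + (mass b' * (T * mass u') + mass u' * (T * mass b')) * s * (B + 1) powr (s - 1) * Z)"
     using mm' T_pos e less.prems by (intro pair_bound[where e = e] st' tl' h s(1) B q K(1) H Z) auto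
    also have "... = K / (q * n) powr s * (mass u' * mass b') * (2 * (B + 1) powr s - B powr s + 2 * T * s * Z * (B + 1) powr (s - 1))"
     by (simp add: algebra_simps)
    also have "... <= K / (q * n) powr s * (mass u' * mass b') * (B powr s * (1 + x))"
    proof -
     have "(B + 1) powr s - B powr s <= s * 1 * (B + 1) powr (s - 1)" using s B by (intro powr_diff_le) auto
     then have "2 * (B + 1) powr s - B powr s + 2 * T * s * Z * (B + 1) powr (s - 1)
       <= B powr s + (2 * s + 2 * T * s * Z) * (B + 1) powr (s - 1)" by (simp add: algebra_simps)
     also have "(B + 1) powr (s - 1) <= (2 * B) powr (s - 1)" using B s by (intro powr_mono2) auto
     also have "(2 * B) powr (s - 1) = 2 powr (s - 1) * (B powr s / B)" using B by (simp add: powr_mult powr_diff)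
     finally have "2 * (B + 1) powr s - B powr s + 2 * T * s * Z * (B + 1) powr (s - 1)
       <= B powr s + (2 * s + 2 * T * s * Z) * (2 powr (s - 1) * (B powr s / B))"
      using TZ s by (simp add: mult_left_mono)
     also have "... = B powr s * (1 + R / B)" by (simp add: R_def algebra_simps add_divide_distrib)
     also have "... <= B powr s * (1 + x)" using RB by (intro mult_left_mono) auto
     finally show ?thesis using K mm' by (intro mult_left_mono) auto
    qed
    finally have 1: "abs (mass b' * E n u' h - mass u' * E n b' h) <= K / (q * n) powr s * (mass u' * mass b') * (B powr s * (1 + x))" .
    have "mass b' * E n u' h - mass u' * E n b' h = (1 - 2 * e) * (mb * E n u h - mu * E n b h)"
     by (simp add: m' Ee algebra_simps)
    then have "(1 - 2 * e) * abs (mb * E n u h - mu * E n b h) <= K / (q * n) powr s * (mass u' * mass b') * (B powr s * (1 + x))"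
     using 1 e by (simp add: abs_mult)
    also have "... = (1 - 2 * e) * (K / (q * n) powr s * (mu * mb) * B powr s * ((1 - 2 * e) * (1 + x)))"
     by (simp add: m')
    finally have "abs (mb * E n u h - mu * E n b h) <= K / (q * n) powr s * (mu * mb) * B powr s * ((1 - 2 * e) * (1 + x))"
     by (rule mult_left_le_imp_le) (use e in auto)
    also have "... <= K / (q * n) powr s * (mu * mb) * B powr s * ((1 - e) * q powr s)"
    proof -
     have "(1 - e) * (1 - x) - (1 - 2 * e) * (1 + x) = e - 2 * x + 3 * (e * x)" by (simp add: algebra_simps)
     moreover have "0 <= e * x" using e x by simp
     ultimately have "(1 - 2 * e) * (1 + x) <= (1 - e) * (1 - x)" using x(3) by linarith
     also have "... <= (1 - e) * q powr s" using qs e by (intro mult_left_mono) auto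
     finally show ?thesis using K m by (intro mult_left_mono) auto
    qed
    also have "... = mu * mb * (K * (1 - e) * (B / n) powr s)"
     using q less.prems B by (simp add: powr_mult powr_divide)
    finally show ?thesis using True by simp
   next
    case False
    show ?thesis
    proof (cases "real l > (1 - q) * n")
     case True
     have "abs (mb * E n u h - mu * E (n - l) b h) <= abs (mb * E n u h) + abs (mu * E (n - l) b h)" by (rule abs_triangle_ineq4)
     also have "... <= mb * mu + mu * mb"
      unfolding abs_mult using m E_le[OF bu nu h, of n] E_le[OF bb nb h, of "n - l"]
      by (intro add_mono mult_mono) (auto simp: mu_def mb_def)
     also have "... = mu * mb * 2" by simp
     also have "2 <= K * ((l + B) / n) powr s"
     proof -
      have "(1 - q) <= (l + B) / n" using True B less.prems by (simp add: field_simps)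
      then have "(1 - q) powr s <= ((l + B) / n) powr s" using q s by (intro powr_mono2) auto
      then show ?thesis using K by (meson less_imp_le mult_left_mono order_trans)
     qed
     finally show ?thesis using False m by (simp add: mult_left_mono)
    next
     case small: False
     define N where "N = n - l"
     have Nq: "real N >= q * n" using small l by (simp add: N_def of_nat_diff algebra_simps)
     have N: "1 <= N" "N < n"
     proof -
      have "q * n > 0" using q less.prems by simp
      then have "real N > 0" using Nq by linarith
      then show "1 <= N" by simp
      show "N < n" using False l less.prems by (simp add: N_def)
     qed
     define v where "v = (L ^^ (l - 1)) u"
     have sv: "state v" unfolding v_def by (rule state_Lk[OF su])
     note bv = stateD(1)[OF sv] and nv = stateD(2)[OF sv]
     have mv: "mass v = mu" unfolding v_def mu_def by (rule mass_Lk[OF bu])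
     have tv: "tail_le (T * mu) v" unfolding v_def mu_def using D_pos by (intro tail_Lk[OF u _ _ bu]) auto
     have av: "a 0 v >= c * mu" unfolding v_def mu_def by (rule rel[OF u bu])
     have Ev: "E n u h = (\<Sum>k<Suc N. E (N - k) (G k v) h) + (LINT x|Lam. (L0 ^^ Suc N) v x * h x)"
     proof -
      have "n = Suc N + (l - 1)" using False l by (simp add: N_def)
      then have "E n u h = E (Suc N) v h" using E_Lk[OF bu test_bmeas[OF h], of "Suc N" "l - 1"] by (simp add: v_def)
      then show ?thesis using E_decomp[OF bv test_bmeas[OF h], of "Suc N"] by simp
     qed
     have mv': "mu = (\<Sum>k<Suc N. a k v) + t (Suc N) v" using sum_a[OF bv, of "Suc N"] mv by simp
     let ?r = "LINT x|Lam. (L0 ^^ Suc N) v x * h x"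
     have r: "abs (?r) <= t (Suc N) v" using E_le[OF bmeas_L0k[OF bv, of "Suc N"] nonneg_L0k[OF nv, of "Suc N"] h, of 0] by (simp only: E_0 t_def)
     have Eb: "abs (E N b h) <= mb" unfolding mb_def by (rule E_le[OF bb nb h])
     have eq: "mb * E n u h - mu * E N b h = (\<Sum>k<Suc N. mb * E (N - k) (G k v) h - a k v * E N b h) + (mb * ?r - t (Suc N) v * E N b h)"
      unfolding Ev sum_subtractf sum_distrib_left[symmetric] sum_distrib_right[symmetric]
      by (subst mv') (simp only: algebra_simps)
     have "abs (mb * E n u h - mu * E N b h) <= (\<Sum>k<Suc N. abs (mb * E (N - k) (G k v) h - a k v * E N b h)) + abs (mb * ?r - t (Suc N) v * E N b h)"
      unfolding eq by (intro order_trans[OF abs_triangle_ineq] add_right_mono sum_abs)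
     also have "... <= (\<Sum>k<Suc N. mb * a k v * (K * ((k + B) / N) powr s) - (if k = 0 then mb * a 0 v * (K * e * (B / N) powr s) else 0))
       + mb * t (Suc N) v * (K * ((Suc N + B) / N) powr s)"
     proof (rule add_mono, rule sum_mono)
      fix k assume "k \<in> {..<Suc N}"
      then have k: "k <= N" by simp
      have sym: "abs (mb * E (N - k) (G k v) h - a k v * E N b h) = abs (a k v * E N b h - mb * E (N - k) (G k v) h)"
       by (rule abs_minus_commute)
      show "abs (mb * E (N - k) (G k v) h - a k v * E N b h) <= mb * a k v * (K * ((k + B) / N) powr s) - (if k = 0 then mb * a 0 v * (K * e * (B / N) powr s) else 0)"
      proof (cases "k = 0")
       case True
       have "abs (a k v * E N b h - mb * E (N - k) (G k v) h) <= mb * a k v * (K * (1 - e) * (B / N) powr s)"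
        unfolding a_def mb_def
        by (rule closeD(2)[OF H[OF N] k b stateD(3)[OF sv] bb bmeas_G[OF bv] h _ _ _ True])
          (use K e B in auto)
       then show ?thesis unfolding sym using True by (simp add: algebra_simps)
      next
       case False
       have "abs (a k v * E N b h - mb * E (N - k) (G k v) h) <= mb * a k v * (K * ((k + B) / N) powr s)"
        unfolding a_def mb_def
        by (rule closeD(1)[OF H[OF N] k b stateD(3)[OF sv] bb bmeas_G[OF bv] h]) (use K e B in auto)
       then show ?thesis unfolding sym using False by simp
      qed
     next
      have "abs (mb * ?r - t (Suc N) v * E N b h) <= abs (mb * ?r) + abs (t (Suc N) v * E N b h)" by (rule abs_triangle_ineq4)
      also have "... <= mb * t (Suc N) v + t (Suc N) v * mb"
       unfolding abs_mult using m r Eb t_nonneg[OF nv, of "Suc N"] by (intro add_mono mult_mono) auto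
      also have "... = mb * t (Suc N) v * 2" by simp
      also have "... <= mb * t (Suc N) v * (K * ((Suc N + B) / N) powr s)"
      proof -
       have "1 <= ((Suc N + B) / N) powr s" using N B s by (intro ge_one_powr_ge_zero) (auto simp: field_simps)
       then have "2 * 1 <= K * ((Suc N + B) / N) powr s" using K2 by (intro mult_mono) auto
       then show ?thesis using m t_nonneg[OF nv] by (intro mult_left_mono) auto
      qed
      finally show "abs (mb * ?r - t (Suc N) v * E N b h) <= mb * t (Suc N) v * (K * ((Suc N + B) / N) powr s)" .
     qed
     also have "... = mb * (K / N powr s) * ((\<Sum>k<Suc N. a k v * (real k + B) powr s) + t (Suc N) v * (real (Suc N) + B) powr s - a 0 v * e * B powr s)"
     proof -
      have 1: "((k + B) / N) powr s = (real k + B) powr s / N powr s" for k using B by (simp add: powr_divide)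
      have 2: "(B / N) powr s = B powr s / N powr s" using B by (simp add: powr_divide)
      have 3: "((Suc N + B) / N) powr s = (real (Suc N) + B) powr s / N powr s" using B by (simp add: powr_divide)
      have 4: "(\<Sum>k<Suc N. if k = 0 then mb * a 0 v * (K * e * (B / N) powr s) else 0) = mb * a 0 v * (K * e * (B / N) powr s)"
       by (subst sum.lessThan_Suc_shift) simp
      have 5: "(\<Sum>k<Suc N. mb * a k v * (K * ((k + B) / N) powr s)) = mb * (K / N powr s) * (\<Sum>k<Suc N. a k v * (real k + B) powr s)"
       unfolding 1 sum_distrib_left by (intro sum.cong) auto
      show ?thesis unfolding sum_subtractf 4 5 2 3 by (simp only: algebra_simps) (simp add: mult_ac)
     qed
     also have "... <= mb * (K / N powr s) * (mu * B powr s + T * mu * s * B powr (s - 1) * Z - (c * mu) * e * B powr s)"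
     proof -
      have "(\<Sum>k<Suc N. a k v * (real k + B) powr s) + t (Suc N) v * (real (Suc N) + B) powr s
        <= mu * B powr s + T * mu * s * B powr (s - 1) * Z"
       using moment[OF sv tv B s(1) _ Z, of "Suc N"] m T_pos mv by simp
      moreover have "(c * mu) * e * B powr s <= a 0 v * e * B powr s" using av e by (intro mult_right_mono) auto
      ultimately show ?thesis using m K by (intro mult_left_mono) auto
     qed
     also have "... = mb * (K / N powr s) * (mu * B powr s * (1 + T * s * Z / B - c * e))"
      using B by (simp add: powr_diff field_simps)
     also have "... <= mb * (K / N powr s) * (mu * B powr s * (1 - x))"
     proof -
      have "T * s * Z / B <= R / B" using RT B by (intro divide_right_mono) auto
      moreover have "c * e = 2 * x" by (simp add: x_def)
      ultimately have "1 + T * s * Z / B - c * e <= 1 - x" using RB by linarith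
      then show ?thesis using m K by (intro mult_left_mono) auto
     qed
     also have "... <= mb * (K / N powr s) * (mu * B powr s * (N / n) powr s)"
     proof -
      have "q <= N / n" using Nq less.prems by (simp add: field_simps)
      then have "q powr s <= (N / n) powr s" using q s by (intro powr_mono2) auto
      then have "1 - x <= (N / n) powr s" using qs by linarith
      then show ?thesis using m K by (intro mult_left_mono) auto
     qed
     also have "... = mu * mb * (K * (B / n) powr s)" using N B by (simp add: powr_divide)
     also have "... <= mu * mb * (K * ((l + B) / n) powr s)"
      using m K B s by (intro mult_left_mono powr_mono2 divide_right_mono) auto
     finally show ?thesis using False by (simp add: N_def)
    qed
   qed
   then show "abs (mass b * E n u h - mass u * E (n - l) b h) \<le>
    mass u * mass b * (if l = 0 then K * (1 - e) * (B / n) powr s else K * ((l + B) / n) powr s)"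
    unfolding mu_def mb_def .
  qed
 qed
 show ?thesis using K B q Z close unfolding e_def by blast
qed

text \<open>One more application of \<open>pair_bound\<close> extends the estimate from log-Lipschitz densities to states.\<close>

theorem pair_decay:
 assumes s: "1 <= s" "s < s'"
 shows "\<exists>C\<ge>0. \<forall>v1 v2 A1 A2 n h. state v1 --> tail_le A1 v1 --> 0 <= A1 --> state v2 --> tail_le A2 v2 --> 0 <= A2 -->
  n >= 1 --> test h -->
  abs (mass v2 * E n v1 h - mass v1 * E n v2 h) <= C * (mass v1 * mass v2 + mass v2 * A1 + mass v1 * A2) * n powr (- s)"
proof -
 obtain K B q Z where K: "0 < K" "1 <= B" "1/2 <= q" "q < 1" "K * (1 - q) powr s >= 2"
  and Z: "!!n. (\<Sum>k<n. (real k + 2) powr (s - 1 - s')) <= Z"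
  and cl: "!!n. n >= 1 ==> close s K B (exp (- D) / 6) n"
  using coupling[OF s] by blast
 have Z0: "Z >= 0" using Z[of 0] by simp
 define c1 c2 where "c1 = 2 * (B + 1) powr s - B powr s" and "c2 = s * (B + 1) powr (s - 1) * Z"
 have c1: "c1 >= 0" unfolding c1_def
 proof -
  have "B powr s <= (B + 1) powr s" using K s by (intro powr_mono2) auto
  moreover have "0 <= (B + 1) powr s" by (rule powr_ge_zero)
  ultimately show "0 <= 2 * (B + 1) powr s - B powr s" by linarith
 qed
 have c2: "c2 >= 0" unfolding c2_def using Z0 s by simp
 define C where "C = K / q powr s * (c1 + c2)"
 have C: "C >= 0" unfolding C_def using K c1 c2 by simp
 have "abs (mass v2 * E n v1 h - mass v1 * E n v2 h) <= C * (mass v1 * mass v2 + mass v2 * A1 + mass v1 * A2) * n powr (- s)"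
  if v1: "state v1" "tail_le A1 v1" "0 <= A1" and v2: "state v2" "tail_le A2 v2" "0 <= A2" and n: "n >= 1" and h: "test h"
  for v1 v2 A1 A2 and n :: nat and h
 proof -
  have m: "mass v1 >= 0" "mass v2 >= 0" using stateD(2) v1 v2 by (auto intro: mass_nonneg)
  have "abs (mass v2 * E n v1 h - mass v1 * E n v2 h) \<le>
   K / (q * n) powr s * (mass v1 * mass v2 * c1 + (mass v2 * A1 + mass v1 * A2) * c2)" unfolding c1_def c2_def
   using pair_bound[OF v1 v2 h s(1) K(2-5) _ n cl Z] by (simp add: mult.assoc)
  also have "... <= K / (q * n) powr s * ((mass v1 * mass v2 + mass v2 * A1 + mass v1 * A2) * (c1 + c2))"
  proof -
   have "0 <= mass v1 * mass v2 * c2" "0 <= (mass v2 * A1 + mass v1 * A2) * c1" using m v1 v2 c1 c2 by auto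
   then have "mass v1 * mass v2 * c1 + (mass v2 * A1 + mass v1 * A2) * c2 <= (mass v1 * mass v2 + mass v2 * A1 + mass v1 * A2) * (c1 + c2)"
    by (simp add: algebra_simps)
   then show ?thesis using K by (intro mult_left_mono) auto
  qed
  also have "... = C * (mass v1 * mass v2 + mass v2 * A1 + mass v1 * A2) * n powr (- s)"
   using K n by (simp add: C_def powr_mult powr_minus field_simps)
  finally show ?thesis .
 qed
 with C show ?thesis by blast
qed

end

section \<open>Decay of correlations for monotone observables\<close>

context intermittent begin

lemma mass_L0_cone: assumes "u \<in> cone D" "bmeas Lam u" shows "mass (L0 u) >= \<kappa> * mass u"
proof -
 have "mass (L0 (%_. 1)) = 1/2"
 proof -
  have "L1 (%_. 1) = (%_. 1/2)" by (simp add: right_op_def)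
  then show ?thesis using mass_L(2)[OF bmeas_const, of 1] by (simp add: mass_const)
 qed
 then have "\<kappa> * mass u = mass (L0 (%x. (exp (-D) * mass u) * 1))"
  using L0k_cmult[of 1 "exp (-D) * mass u" "%_. 1"] by (simp add: mass_cmult \<kappa>_def)
 also have "... <= mass (L0 u)"
  using t_mono[of "%x. (exp (-D) * mass u) * 1" u 1] cone_mass(2)[OF assms _ less_imp_le[OF D_pos]] assms
  by (simp add: t_def)
 finally show ?thesis .
qed

lemma t_le_mass: assumes "bmeas Lam v" "nonneg v" shows "t k v <= mass v"
 using sum_a[OF assms(1), of k] sum_nonneg[of "{..<k}" "%k. a k v"] a_nonneg[OF assms(2)] by simp

lemma a_le_t: "bmeas Lam v ==> nonneg v ==> a k v <= t k v"
 using a_t[of v k] t_nonneg[of v "Suc k"] by simp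

lemma a_le_theta: assumes "u \<in> cone D" "bmeas Lam u" shows "a k u <= (1 - \<kappa>) * mass u"
proof (cases k)
 case 0
 then show ?thesis
  using mass_L(2)[OF assms(2)] mass_L0_cone[OF assms] by (simp add: a_def G_def algebra_simps)
next
 case (Suc k')
 have nn: "nonneg u" using cone_nonneg[OF assms(1)] by (auto simp: nonneg_def)
 have "a k u <= t k u" using a_le_t[OF assms(2) nn] .
 also have "t k u = t k' (L0 u)" by (simp add: Suc t_def funpow_swap1)
 also have "... <= mass (L0 u)" by (intro t_le_mass bmeas_L0 nonneg_L0 assms nn)
 also have "... <= (1 - \<kappa>) * mass u"
  using mass_L(2)[OF assms(2)] mass_L1_cone[OF assms] by (simp add: algebra_simps)
 finally show ?thesis .
qed

text \<open>The part of a density that follows a prescribed itinerary, transported along it; \<open>True\<close> stands for the right branch.\<close>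

primrec word_op :: "bool list => (real => real) => (real => real)" where
 "word_op [] v = v"
| "word_op (b # w) v = word_op w (if b then L1 v else L0 v)"

lemma word_op_append: "word_op (w @ w') v = word_op w' (word_op w v)"
 by (induction w arbitrary: v) auto
lemma word_op_replicate: "word_op (replicate k False) v = (L0 ^^ k) v"
 by (induction k arbitrary: v) (auto simp: funpow_swap1)

lemma word_cases:
 obtains "w = replicate (length w) False"
 | j w' where "w = replicate j False @ True # w'"
proof (cases "True \<in> set w")
 case True
 then obtain ys zs where "w = ys @ True # zs" "True \<notin> set ys" by (meson split_list_first)
 moreover have "ys = replicate (length ys) False" using \<open>True \<notin> set ys\<close> by (intro replicate_eqI) auto
 ultimately show ?thesis using that(2) by metis
next
 case False
 then have "w = replicate (length w) False" by (intro replicate_eqI) auto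
 then show ?thesis by (rule that(1))
qed

lemma mass_word_le: "bmeas Lam v ==> nonneg v ==> mass (word_op w v) <= mass v"
proof (induction w arbitrary: v)
 case (Cons b w)
 have "mass (word_op (b # w) v) <= mass (if b then L1 v else L0 v)" unfolding word_op.simps
  by (rule Cons.IH) (use Cons.prems in \<open>auto intro: bmeas_L0 bmeas_L1 nonneg_L0 nonneg_L1\<close>)
 also have "... <= mass v"
  using mass_L(2)[OF Cons.prems(1)] mass_nonneg[OF nonneg_L0[OF Cons.prems(2)]] mass_nonneg[OF nonneg_L1[OF Cons.prems(2)]] by auto
 finally show ?case .
qed simp

text \<open>Cylinders of length \<open>n\<close> have measure \<open>O(n powr (-s))\<close>. By induction on the word: if its first left run is short,
  the factor \<open>1 - \<kappa>\<close> lost at the return compensates the shortening of the word; if the run is long, its tail bound suffices.\<close>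

lemma word_decay_cone:
 assumes s: "1 <= s" "s < s'"
 shows "\<exists>A\<ge>1. \<forall>w. \<forall>u\<in>cone D. bmeas Lam u --> mass (word_op w u) <= A * mass u * (real (length w) + 1) powr (- s)"
proof -
 define q where "q = (1 - \<kappa>) powr (1 / s)"
 have q: "0 < q" "q < 1"
 proof -
  show "0 < q" using kappa by (simp add: q_def)
  have "(1 - \<kappa>) powr (1 / s) < 1 powr (1 / s)" using kappa s by (intro powr_less_mono2) auto
  then show "q < 1" by (simp add: q_def)
 qed
 have qs: "q powr s = 1 - \<kappa>" using kappa s by (simp add: q_def powr_powr)
 (* A takes care of left runs longer than 1 - q times the word *)
 define A where "A = max 1 (T * (1 - q) powr (- s'))"
 have A: "A >= 1" "A >= T * (1 - q) powr (- s')" by (auto simp: A_def)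
 have AT: "A >= T"
 proof -
  have "(1 - q) powr 0 <= (1 - q) powr (- s')" using q s'_gt by (intro powr_mono') auto
  then have "T * 1 <= T * (1 - q) powr (- s')" using q T_pos by (intro mult_left_mono) auto
  with A show ?thesis by linarith
 qed
 have "mass (word_op w u) <= A * mass u * (real (length w) + 1) powr (- s)" if "u \<in> cone D" "bmeas Lam u" for w u
  using that
 proof (induction "length w" arbitrary: w u rule: less_induct)
  case less
  have st: "state u" using less.prems by (rule state_cone_D)
  have m: "0 <= mass u" using stateD(2)[OF st] by (rule mass_nonneg)
  have tl: "tail_le (T * mass u) u" using less.prems D_pos by (intro tail_cone) auto
  let ?n = "real (length w) + 1"
  have sle: "x powr (- s') <= x powr (- s)" if "x >= 1" for x :: real using that s by (intro powr_mono) auto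
  show ?case
  proof (cases rule: word_cases[of w])
   case 1
   have "mass (word_op w u) = t (length w) u" by (subst 1, subst word_op_replicate) (simp add: t_def)
   also have "... <= T * mass u * ?n powr (- s')" using tl by (simp add: tail_le_def)
   also have "... <= T * mass u * ?n powr (- s)" using T_pos m by (intro mult_left_mono sle) auto
   also have "... <= A * mass u * ?n powr (- s)" using AT m by (intro mult_right_mono) auto
   finally show ?thesis .
  next
   case (2 j w')
   have len: "length w = j + 1 + length w'" using 2 by simp
   have eq: "word_op w u = word_op w' (G j u)" unfolding 2 by (simp add: word_op_append word_op_replicate G_def)
   have a0: "0 <= a j u" by (rule a_nonneg[OF stateD(2)[OF st]])
   show ?thesis
   proof (cases "real j + 1 <= (1 - q) * ?n")
    case True
    have "mass (word_op w u) <= A * a j u * (real (length w') + 1) powr (- s)"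
     unfolding eq a_def by (rule less.hyps) (use len stateD(3)[OF st] bmeas_G less.prems in auto)
    also have "... <= A * ((1 - \<kappa>) * mass u) * (q * ?n) powr (- s)"
    proof (intro mult_mono)
     have "q * ?n <= real (length w') + 1" using True len by (simp add: algebra_simps)
     then show "(real (length w') + 1) powr (- s) <= (q * ?n) powr (- s)" using q s by (intro powr_mono2') auto
    qed (use A a0 a_le_theta[OF less.prems] kappa m in auto)
    also have "... = A * mass u * ?n powr (- s) * ((1 - \<kappa>) * q powr (- s))" using q by (simp add: powr_mult)
    also have "(1 - \<kappa>) * q powr (- s) = 1" using qs kappa q by (simp add: powr_minus)
    finally show ?thesis by simp
   next
    case False
    have "mass (word_op w u) <= a j u" unfolding eq a_def
     by (intro mass_word_le bmeas_G nonneg_G stateD[OF st] less.prems)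
    also have "... <= t j u" by (intro a_le_t stateD[OF st])
    also have "... <= T * mass u * (real j + 1) powr (- s')" using tl by (simp add: tail_le_def)
    also have "... <= T * mass u * ((1 - q) * ?n) powr (- s')"
     using False T_pos m q s'_gt by (intro mult_left_mono powr_mono2') auto
    also have "... = T * (1 - q) powr (- s') * mass u * ?n powr (- s')" using q by (simp add: powr_mult)
    also have "... <= A * mass u * ?n powr (- s)" using A m T_pos by (intro mult_mono mult_right_mono sle) auto
    finally show ?thesis .
   qed
  qed
 qed
 with A show ?thesis by blast
qed

lemma word_decay:
 assumes s: "1 <= s" "s < s'"
 shows "\<exists>A\<ge>0. \<forall>w v A'. state v --> tail_le A' v --> 0 <= A' -->
   mass (word_op w v) <= A * (mass v + A') * (real (length w) + 1) powr (- s)"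
proof -
 obtain A1 where A1: "A1 >= 1" and H: "!!w u. u \<in> cone D ==> bmeas Lam u ==> mass (word_op w u) <= A1 * mass u * (real (length w) + 1) powr (- s)"
  using word_decay_cone[OF s] by blast
 define A where "A = A1 * 2 powr s'"
 have t1: "(1::real) <= 2 powr s'" using s'_gt by (intro ge_one_powr_ge_zero) auto
 have A: "A >= 1" "A >= 2 powr s'"
  using A1 t1 mult_mono[of 1 A1 1 "2 powr s'"] mult_right_mono[of 1 A1 "2 powr s'"] by (auto simp: A_def)
 have "mass (word_op w v) <= A * (mass v + A') * (real (length w) + 1) powr (- s)"
  if st: "state v" and tl: "tail_le A' v" and A': "0 <= A'" for w v A'
 proof -
  have m: "0 <= mass v" using stateD(2)[OF st] by (rule mass_nonneg)
  let ?n = "real (length w) + 1"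
  have sle: "x powr (- s') <= x powr (- s)" if "x >= 1" for x :: real using that s by (intro powr_mono) auto
  show ?thesis
  proof (cases rule: word_cases[of w])
   case 1
   have "mass (word_op w v) = t (length w) v" by (subst 1, subst word_op_replicate) (simp add: t_def)
   also have "... <= A' * ?n powr (- s')" using tl by (simp add: tail_le_def)
   also have "... <= (A * (mass v + A')) * ?n powr (- s)"
    using A' m A mult_mono[of 1 A A' "mass v + A'"] by (intro mult_mono sle) auto
   finally show ?thesis by simp
  next
   case (2 j w')
   have len: "length w = j + 1 + length w'" using 2 by simp
   have eq: "word_op w v = word_op w' (G j v)" unfolding 2 by (simp add: word_op_append word_op_replicate G_def)
   have a0: "0 <= a j v" by (rule a_nonneg[OF stateD(2)[OF st]])
   have at: "a j v <= t j v" by (intro a_le_t stateD[OF st])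
   show ?thesis
   proof (cases "real j + 1 <= ?n / 2")
    case True
    have "mass (word_op w v) <= A1 * a j v * (real (length w') + 1) powr (- s)"
     unfolding eq a_def by (intro H stateD[OF st] bmeas_G)
    also have "... <= A1 * mass v * (?n / 2) powr (- s)"
    proof (intro mult_mono)
     show "a j v <= mass v" using at t_le_mass[OF stateD(1,2)[OF st]] by (rule order_trans)
     have "?n / 2 <= real (length w') + 1" using True len by simp
     then show "(real (length w') + 1) powr (- s) <= (?n / 2) powr (- s)" using s by (intro powr_mono2') auto
    qed (use A1 a0 m in auto)
    also have "... = A1 * mass v * (2 powr s * ?n powr (- s))" by (simp add: powr_divide powr_minus field_simps)
    also have "... <= A1 * (mass v + A') * (2 powr s' * ?n powr (- s))"
     using A1 m A' s by (intro mult_mono mult_right_mono powr_mono) auto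
    finally show ?thesis by (simp add: A_def mult_ac)
   next
    case False
    have "mass (word_op w v) <= a j v" unfolding eq a_def
     by (intro mass_word_le bmeas_G nonneg_G stateD[OF st])
    also have "... <= A' * (real j + 1) powr (- s')" using at tl unfolding tail_le_def by (meson order_trans)
    also have "... <= A' * (?n / 2) powr (- s')" using False A' s'_gt by (intro mult_left_mono powr_mono2') auto
    also have "... = 2 powr s' * A' * ?n powr (- s')" by (simp add: powr_divide powr_minus field_simps)
    also have "... <= A * (mass v + A') * ?n powr (- s)" using A A' m by (intro mult_mono sle) auto
    finally show ?thesis .
   qed
  qed
 qed
 with A show ?thesis by (intro exI[of _ A]) auto
qed

text \<open>\<open>approx N \<phi>\<close> is constant on the cylinders of length \<open>N\<close>, with the value of \<open>\<phi>\<close> at the right end of the cylinder.\<close>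

primrec approx :: "nat => (real => real) => (real => real)" where
 "approx 0 \<phi> = (%x. \<phi> 1)"
| "approx (Suc N) \<phi> = (%x. if x <= 1/2 then approx N (%x. \<phi> (y0 x)) (f x) else approx N (%x. \<phi> ((1 + x) / 2)) (f x))"

text \<open>The image of the density \<open>approx N \<phi> * v\<close> under \<open>N\<close> steps of the transfer operator. As \<open>approx N \<phi>\<close> is constant
  on cylinders, this is a positive combination of images of \<open>v\<close> along itineraries, hence a state if \<open>v\<close> is one and \<open>\<phi> \<ge> 0\<close>.\<close>

primrec evolved :: "nat => (real => real) => (real => real) => (real => real)" where
 "evolved 0 \<phi> v = (%x. \<phi> 1 * v x)"
| "evolved (Suc N) \<phi> v = (%x. evolved N (%x. \<phi> (y0 x)) (L0 v) x + evolved N (%x. \<phi> ((1 + x) / 2)) (L1 v) x)"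

lemma y0_01: "x \<in> {0..1} ==> y0 x \<in> {0..1}" using y0_range[of x] by auto
lemma f_01: "x \<in> {0..1} ==> f x \<in> {0..1}" using measurable_space[OF f_meas, of x] by simp

lemma if_half_bmeas: assumes "bmeas Lam u" "bmeas Lam v" shows "bmeas Lam (%x. if x <= 1/2 then u x else v x)"
proof -
 have ind: "bmeas Lam (%x. if x <= 1/2 then 1 else 0 :: real)" by (intro bmeas_le_1 borel_measurable_Lam) auto
 have "bmeas Lam (%x. (if x <= 1/2 then 1 else 0) * u x + (1 - (if x <= 1/2 then 1 else 0)) * v x)"
  by (intro bmeas_add bmeas_mult bmeas_diff bmeas_const ind assms)
 then show ?thesis by (rule bmeas_cong[THEN iffD1, rotated]) auto
qed

lemma approx_bmeas: "bmeas Lam (approx N \<phi>)"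
proof (induction N arbitrary: \<phi>)
 case (Suc N)
 show ?case unfolding approx.simps by (intro if_half_bmeas bmeas_comp[OF Suc f_meas])
qed simp

lemma evolved_bmeas: "bmeas Lam v ==> bmeas Lam (evolved N \<phi> v)"
proof (induction N arbitrary: \<phi> v)
 case (Suc N)
 show ?case unfolding evolved.simps by (intro bmeas_add Suc.IH bmeas_L0 bmeas_L1 Suc.prems)
qed (auto intro: bmeas_cmult)

lemma state_cmult: assumes "state v" "c >= 0" shows "state (%x. c * v x)"
proof -
 have "G k (%x. c * v x) = (%x. c * G k v x)" for k
  unfolding G_def L0k_cmult using L1_linear[of c "(L0 ^^ k) v" 0 "(L0 ^^ k) v"] by simp
 moreover have "(%x. c * u x) \<in> cone D" if "u \<in> cone D" for u
  using that assms(2) by (auto simp: cone_def mult.left_commute intro: mult_left_mono)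
 ultimately show ?thesis using assms by (auto simp: state_def nonneg_def)
qed

lemma evolved_state: "(!!x. x \<in> {0..1} ==> 0 <= \<phi> x) ==> state v ==> state (evolved N \<phi> v)"
proof (induction N arbitrary: \<phi> v)
 case (Suc N)
 show ?case unfolding evolved.simps
  by (intro state_add Suc.IH state_L0 state_L1 Suc.prems(2)) (use Suc.prems y0_01 in auto)
qed (auto intro: state_cmult)

lemma Lk_add: "(L ^^ k) (%x. u x + v x) = (%x. (L ^^ k) u x + (L ^^ k) v x)"
proof (induction k arbitrary: u v)
 case (Suc k)
 have "L (%x. u x + v x) = (%x. L u x + L v x)" for u v
  using L0_linear[of 1 u 1 v] L1_linear[of 1 u 1 v] by (auto simp: L_def)
 with Suc show ?case by simp
qed simp

lemma evolved_le:
 assumes "!!x. x \<in> {0..1} ==> \<phi> x <= hi" "nonneg v" "x \<in> {0..1}"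
 shows "evolved N \<phi> v x <= hi * (L ^^ N) v x"
 using assms(1,2)
proof (induction N arbitrary: \<phi> v)
 case 0 then show ?case using assms(3) by (auto simp: nonneg_def intro: mult_right_mono)
next
 case (Suc N)
 have "(L ^^ Suc N) v = (%x. (L ^^ N) (L0 v) x + (L ^^ N) (L1 v) x)" by (simp add: funpow_swap1 L_def Lk_add)
 moreover have "evolved N (%x. \<phi> (y0 x)) (L0 v) x <= hi * (L ^^ N) (L0 v) x"
  using Suc.prems y0_01 by (intro Suc.IH nonneg_L0) auto
 moreover have "evolved N (%x. \<phi> ((1 + x) / 2)) (L1 v) x <= hi * (L ^^ N) (L1 v) x"
  using Suc.prems by (intro Suc.IH nonneg_L1) auto
 ultimately show ?case by (simp add: algebra_simps)
qed

lemma E_evolved: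
 assumes "bmeas Lam v" "bmeas Lam h"
 shows "E (N + n) (%x. approx N \<phi> x * v x) h = E n (evolved N \<phi> v) h"
 using assms(1)
proof (induction N arbitrary: \<phi> v)
 case (Suc N)
 let ?H0 = "%x. approx N (%x. \<phi> (y0 x)) x * h ((f ^^ (N + n)) x)" and ?H1 = "%x. approx N (%x. \<phi> ((1 + x) / 2)) x * h ((f ^^ (N + n)) x)"
 have b: "bmeas Lam ?H0" "bmeas Lam ?H1" by (intro bmeas_mult approx_bmeas bmeas_fk assms)+
 have "E (Suc N + n) (%x. approx (Suc N) \<phi> x * v x) h = (LINT x|Lam. v x * (if x <= 1/2 then ?H0 (f x) else ?H1 (f x)))"
  unfolding E_def by (intro LINT_cong) (auto simp: funpow_swap1)
 also have "... = (LINT x|Lam. L0 v x * ?H0 x) + (LINT x|Lam. L1 v x * ?H1 x)" by (rule split[OF Suc.prems b])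
 also have "... = E (N + n) (%x. approx N (%x. \<phi> (y0 x)) x * L0 v x) h + E (N + n) (%x. approx N (%x. \<phi> ((1 + x) / 2)) x * L1 v x) h"
  unfolding E_def by (simp add: mult_ac)
 also have "... = E n (evolved N (%x. \<phi> (y0 x)) (L0 v)) h + E n (evolved N (%x. \<phi> ((1 + x) / 2)) (L1 v)) h"
  using Suc.IH bmeas_L0 bmeas_L1 Suc.prems by simp
 also have "... = E n (evolved (Suc N) \<phi> v) h"
  unfolding evolved.simps by (intro E_add[symmetric] evolved_bmeas bmeas_L0 bmeas_L1 Suc.prems assms(2))
 finally show ?case .
qed simp

lemma mono_bmeas: assumes "mono_on {0..1} \<phi>" shows "bmeas Lam \<phi>"
proof (rule bmeasI)
 have "\<phi> \<in> borel_measurable (restrict_space borel {0..1})" using assms by (intro borel_measurable_mono_on_fnc) auto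
 then show "\<phi> \<in> borel_measurable Lam" by (subst measurable_cong_sets[OF sets_Lam refl])
 show "abs (\<phi> x) <= abs (\<phi> 0) + abs (\<phi> 1)" if "x \<in> space Lam" for x
  using monotone_onD[OF assms, of 0 x] monotone_onD[OF assms, of x 1] that by auto
qed

text \<open>On each cylinder the error is at most the oscillation of \<open>\<phi>\<close>, and for a monotone function the oscillations
  add up to the total increase.\<close>

lemma approx_error:
 assumes "mono_on {0..1} \<phi>" "bmeas Lam v" "nonneg v" "!!w. length w = N ==> mass (word_op w v) <= e"
 shows "(LINT x|Lam. abs (\<phi> x - approx N \<phi> x) * v x) <= (\<phi> 1 - \<phi> 0) * e"
 using assms
proof (induction N arbitrary: \<phi> v)
 case 0
 have m: "mass v <= e" using 0(4)[of "[]"] by simp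
 have "(LINT x|Lam. abs (\<phi> x - approx 0 \<phi> x) * v x) <= mass (%x. (\<phi> 1 - \<phi> 0) * v x)"
  unfolding mass_def
 proof (intro integral_mono Lam.bmeas_integrable)
  show "bmeas Lam (%x. abs (\<phi> x - approx 0 \<phi> x) * v x)"
   by (intro bmeas_mult bmeas_abs bmeas_diff approx_bmeas mono_bmeas 0)
  show "bmeas Lam (%x. (\<phi> 1 - \<phi> 0) * v x)" using 0 by auto
  fix x assume "x \<in> space Lam"
  then show "abs (\<phi> x - approx 0 \<phi> x) * v x <= (\<phi> 1 - \<phi> 0) * v x"
   using 0 monotone_onD[OF 0(1), of 0 x] monotone_onD[OF 0(1), of x 1] by (intro mult_right_mono) (auto simp: nonneg_def)
 qed
 also have "... <= (\<phi> 1 - \<phi> 0) * e"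
  unfolding mass_cmult using m monotone_onD[OF 0(1), of 0 1] by (intro mult_left_mono) auto
 finally show ?case .
next
 case (Suc N)
 have m0: "mono_on {0..1} (%x. \<phi> (y0 x))"
  using Suc.prems(1) y0_mono y0_01 by (intro mono_onI monotone_onD[OF Suc.prems(1)]) auto
 have m1: "mono_on {0..1} (%x. \<phi> ((1 + x) / 2))" by (intro mono_onI monotone_onD[OF Suc.prems(1)]) auto
 let ?H0 = "%x. abs (\<phi> (y0 x) - approx N (%x. \<phi> (y0 x)) x)" and ?H1 = "%x. abs (\<phi> ((1 + x) / 2) - approx N (%x. \<phi> ((1 + x) / 2)) x)"
 have b: "bmeas Lam ?H0" "bmeas Lam ?H1" by (intro bmeas_abs bmeas_diff approx_bmeas mono_bmeas m0 m1)+
 have "(LINT x|Lam. abs (\<phi> x - approx (Suc N) \<phi> x) * v x) = (LINT x|Lam. v x * (if x <= 1/2 then ?H0 (f x) else ?H1 (f x)))"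
 proof (intro LINT_cong refl)
  fix x assume "x \<in> space Lam"
  then show "abs (\<phi> x - approx (Suc N) \<phi> x) * v x = v x * (if x <= 1/2 then ?H0 (f x) else ?H1 (f x))"
   using y0_f[of x] f_right[of x] by (auto simp: mult.commute)
 qed
 also have "... = (LINT x|Lam. L0 v x * ?H0 x) + (LINT x|Lam. L1 v x * ?H1 x)" by (rule split[OF Suc.prems(2) b])
 also have "(LINT x|Lam. L0 v x * ?H0 x) <= (\<phi> (y0 1) - \<phi> (y0 0)) * e"
  using Suc.IH[OF m0 bmeas_L0[OF Suc.prems(2)] nonneg_L0[OF Suc.prems(3)]] Suc.prems(4)[of "False # w" for w]
  by (simp add: mult.commute)
 also have "(LINT x|Lam. L1 v x * ?H1 x) <= (\<phi> 1 - \<phi> (1/2)) * e"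
  using Suc.IH[OF m1 bmeas_L1[OF Suc.prems(2)] nonneg_L1[OF Suc.prems(3)]] Suc.prems(4)[of "True # w" for w]
  by (simp add: mult.commute)
 also have "(\<phi> (y0 1) - \<phi> (y0 0)) * e + (\<phi> 1 - \<phi> (1/2)) * e <= (\<phi> 1 - \<phi> 0) * e"
 proof -
  have "0 <= e"
  proof -
   have "nonneg v ==> nonneg (word_op w v)" for w v by (induction w arbitrary: v) (auto intro: nonneg_L0 nonneg_L1)
   then have "0 <= mass (word_op (replicate (Suc N) True) v)" using Suc.prems(3) by (intro mass_nonneg) blast
   also have "... <= e" by (rule Suc.prems(4)) simp
   finally show ?thesis .
  qed
  moreover have "\<phi> (y0 1) <= \<phi> (1/2)" "\<phi> 0 <= \<phi> (y0 0)"
   using y0_range[of 1] y0_range[of 0] by (auto intro!: monotone_onD[OF Suc.prems(1)])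
  ultimately have "(\<phi> (y0 1) - \<phi> (y0 0) + (\<phi> 1 - \<phi> (1/2))) * e <= (\<phi> 1 - \<phi> 0) * e"
   by (intro mult_right_mono) auto
  then show ?thesis by (simp only: distrib_right)
 qed
 finally show ?case by simp
qed

text \<open>Replace \<open>\<phi>\<close> by its approximation on cylinders of length \<open>n div 2\<close>, which is then absorbed in the density, and let
  \<open>pair_decay\<close> act during the remaining half of the time. The reference measure is pushed forward by \<open>m\<close> steps because
  \<open>m \<rightarrow> \<infinity>\<close> will lead to the invariant probability.\<close>

theorem monotone_decay:
 assumes s: "1 <= s" "s < s'" and \<phi>: "mono_on {0..1} \<phi>"
 shows "\<exists>C\<ge>0. \<forall>m n h. n >= 1 --> test h -->
  abs ((LINT x|Lam. \<phi> ((f ^^ m) x) * h ((f ^^ (n + m)) x)) - (LINT x|Lam. \<phi> ((f ^^ m) x)) * (LINT x|Lam. h ((f ^^ (n + m)) x)))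
   <= C * n powr (- s)"
proof -
 obtain C1 where C1: "C1 >= 0" and pd: "!!v1 v2 A1 A2 n h. state v1 ==> tail_le A1 v1 ==> 0 <= A1 ==> state v2 ==> tail_le A2 v2 ==> 0 <= A2 ==>
  n >= 1 ==> test h ==>
  abs (mass v2 * E n v1 h - mass v1 * E n v2 h) <= C1 * (mass v1 * mass v2 + mass v2 * A1 + mass v1 * A2) * n powr (- s)"
  using pair_decay[OF s] by blast
 obtain A where A: "A >= 0" and wd: "!!w v A'. state v ==> tail_le A' v ==> 0 <= A' ==>
   mass (word_op w v) <= A * (mass v + A') * (real (length w) + 1) powr (- s)" using word_decay[OF s] by blast
 define Phi where "Phi = \<phi> 1 - \<phi> 0"
 define Z where "Z x = \<phi> x - \<phi> 0" for x
 have Zm: "mono_on {0..1} Z" using \<phi> by (auto simp: Z_def mono_on_def)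
 have Zr: "0 <= Z x \<and> Z x <= Phi" if "x \<in> {0..1}" for x
  using monotone_onD[OF \<phi>, of 0 x] monotone_onD[OF \<phi>, of x 1] that by (auto simp: Z_def Phi_def)
 have Phi0: "Phi >= 0" using Zr[of 0] by simp
 define C where "C = 2 powr s * (2 * Phi * A * (1 + T) + C1 * (Phi + 2 * Phi * T))"
 have C: "C >= 0" using Phi0 A C1 T_pos by (simp add: C_def)
 have "abs ((LINT x|Lam. \<phi> ((f ^^ m) x) * h ((f ^^ (n + m)) x)) - (LINT x|Lam. \<phi> ((f ^^ m) x)) * (LINT x|Lam. h ((f ^^ (n + m)) x)))
   <= C * n powr (- s)" if n: "n >= 1" and h: "test h" for m n h
 proof -
  define v where "v = (L ^^ m) (%_. 1)"
  have one: "(%_. 1) \<in> cone D" "bmeas Lam (%_. 1)" "state (%_. 1)"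
   using cone_const[of D 1] D_pos state_cone_D[of "%_. 1"] by auto
  have sv: "state v" unfolding v_def by (rule state_Lk[OF one(3)])
  note bv = stateD(1)[OF sv] and nv = stateD(2)[OF sv]
  have mv: "mass v = 1" unfolding v_def by (simp add: mass_Lk mass_const)
  have tv: "tail_le T v" unfolding v_def using tail_Lk[OF one(1) _ _ one(2), of m] D_pos by (simp add: mass_const)
  have push: "(LINT x|Lam. g ((f ^^ m) x)) = (LINT x|Lam. v x * g x)" if "bmeas Lam g" for g
   using E_Lk[OF one(2) that, of 0 m] by (simp add: E_def v_def)
  define N where "N = n div 2"
  have N: "n - N >= 1" "real n / 2 <= real (n - N)" "real n / 2 <= real N + 1" "N + (n - N) = n"
   using n by (auto simp: N_def)
  have decn: "x powr (- s) <= 2 powr s * n powr (- s)" if "real n / 2 <= x" for x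
  proof -
   have "x powr (- s) <= (real n / 2) powr (- s)" using that n s by (intro powr_mono2') auto
   also have "... = 2 powr s * n powr (- s)" by (simp add: powr_divide powr_minus field_simps)
   finally show ?thesis .
  qed
  define e where "e = A * (1 + T) * (2 powr s * n powr (- s))"
  have weps: "mass (word_op w v) <= e" if "length w = N" for w
  proof -
   have "mass (word_op w v) <= A * (1 + T) * (real N + 1) powr (- s)" using wd[OF sv tv] T_pos mv that by force
   also have "... <= e" unfolding e_def using A T_pos N by (intro mult_left_mono decn) auto
   finally show ?thesis .
  qed
  have err: "(LINT x|Lam. abs (Z x - approx N Z x) * v x) <= Phi * e"
   using approx_error[OF Zm bv nv weps] by (simp add: Z_def Phi_def)
  have bZ: "bmeas Lam Z" by (rule mono_bmeas[OF Zm])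
  have bh: "bmeas Lam h" by (rule test_bmeas[OF h])
  have fr: "abs (h ((f ^^ k) x)) <= 1" if "x \<in> {0..1}" for x k
   using measurable_space[OF fk_meas, of x k] that h by (simp add: test_def)
  have err_test: "abs ((LINT x|Lam. Z x * v x * g x) - (LINT x|Lam. approx N Z x * v x * g x)) <= Phi * e"
   if g: "bmeas Lam g" "!!x. x \<in> {0..1} ==> abs (g x) <= 1" for g
  proof -
   have "(LINT x|Lam. Z x * v x * g x) - (LINT x|Lam. approx N Z x * v x * g x) = (LINT x|Lam. (Z x - approx N Z x) * v x * g x)"
    by (subst LINT_diff[symmetric])
      (auto intro!: Lam.bmeas_integrable bmeas_mult bZ approx_bmeas bv g simp: algebra_simps)
   also have "abs (...) <= (LINT x|Lam. abs ((Z x - approx N Z x) * v x * g x))" by (rule integral_abs_bound)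
   also have "... <= (LINT x|Lam. abs (Z x - approx N Z x) * v x)"
   proof (intro integral_mono Lam.bmeas_integrable)
    show "bmeas Lam (%x. abs ((Z x - approx N Z x) * v x * g x))" "bmeas Lam (%x. abs (Z x - approx N Z x) * v x)"
     by (intro bmeas_mult bmeas_abs bmeas_diff bZ approx_bmeas bv g)+
    fix x assume "x \<in> space Lam"
    then show "abs ((Z x - approx N Z x) * v x * g x) <= abs (Z x - approx N Z x) * v x"
     using g(2)[of x] nv by (auto simp: abs_mult nonneg_def intro!: mult_left_le)
   qed
   finally show ?thesis using err by linarith
  qed
  define u where "u = evolved N Z v"
  have su: "state u" unfolding u_def using Zr by (intro evolved_state sv) auto
  have tu: "tail_le (Phi * T) u" unfolding tail_le_def
  proof
   fix k
   have "t k u <= t k (%x. Phi * (L ^^ N) v x)"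
    unfolding u_def using Zr by (intro t_mono evolved_bmeas bmeas_cmult bmeas_Lk bv evolved_le nv) auto
   also have "... = Phi * t k ((L ^^ N) v)" by (rule t_cmult)
   also have "(L ^^ N) v = (L ^^ (N + m)) (%_. 1)" unfolding v_def by (simp add: funpow_add)
   also have "Phi * t k ... <= Phi * (T * (real k + 1) powr (- s'))"
    using tail_Lk[OF one(1) _ _ one(2), of "N + m"] D_pos Phi0 by (intro mult_left_mono) (auto simp: tail_le_def mass_const)
   finally show "t k u <= Phi * T * (real k + 1) powr (- s')" by simp
  qed
  have mu: "mass u = (LINT x|Lam. approx N Z x * v x)"
   using E_evolved[OF bv bmeas_const, of N 0 Z 1] unfolding u_def by (simp add: E_1) (simp add: mass_def)
  have mu1: "mass u <= Phi"
  proof -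
   have "mass u <= mass (%x. Phi * (L ^^ N) v x)"
    unfolding u_def using Zr by (intro mass_mono evolved_bmeas bmeas_cmult bmeas_Lk bv evolved_le nv) auto
   then show ?thesis by (simp add: mass_cmult mass_Lk[OF bv] mv)
  qed
  have mu0: "mass u >= 0" by (rule mass_nonneg[OF stateD(2)[OF su]])
  define v2 where "v2 = (L ^^ N) v"
  have s2: "state v2" unfolding v2_def by (rule state_Lk[OF sv])
  have t2: "tail_le T v2"
  proof -
   have "v2 = (L ^^ (N + m)) (%_. 1)" unfolding v2_def v_def by (simp add: funpow_add)
   then show ?thesis using tail_Lk[OF one(1) _ _ one(2), of "N + m"] D_pos by (simp add: mass_const)
  qed
  have m2: "mass v2 = 1" unfolding v2_def by (simp add: mass_Lk[OF bv] mv)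
  have "abs (mass v2 * E (n - N) u h - mass u * E (n - N) v2 h) <= C1 * (mass u * mass v2 + mass v2 * (Phi * T) + mass u * T) * real (n - N) powr (- s)"
   using Phi0 T_pos N by (intro pd su tu s2 t2 h) auto
  also have "... <= C1 * (Phi + 2 * Phi * T) * (2 powr s * n powr (- s))"
  proof (intro mult_mono decn N)
   have "mass u * T <= Phi * T" using mu1 T_pos by (intro mult_right_mono) auto
   then show "mass u * mass v2 + mass v2 * (Phi * T) + mass u * T <= Phi + 2 * Phi * T" using mu1 m2 by simp
  qed (use C1 Phi0 T_pos mu0 m2 in auto)
  finally have main: "abs (E (n - N) u h - mass u * E (n - N) v2 h) <= C1 * (Phi + 2 * Phi * T) * (2 powr s * n powr (- s))" by (simp add: m2)
  have Eu: "E (n - N) u h = (LINT x|Lam. approx N Z x * v x * h ((f ^^ n) x))"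
   using E_evolved[OF bv bh, of N "n - N" Z] N(4) unfolding u_def by (simp add: E_def)
  have E2: "E (n - N) v2 h = E n v h"
   using E_Lk[OF bv bh, of "n - N" N] N(4) unfolding v2_def by (simp add: add.commute)
  have Ev: "abs (E n v h) <= 1" using E_le[OF bv nv h, of n] mv by simp
  have i1: "(LINT x|Lam. Z ((f ^^ m) x) * h ((f ^^ (n + m)) x)) = (LINT x|Lam. Z x * v x * h ((f ^^ n) x))"
   using push[of "%x. Z x * h ((f ^^ n) x)"] bZ bh by (simp add: funpow_add bmeas_mult bmeas_fk mult_ac)
  have i2: "(LINT x|Lam. Z ((f ^^ m) x)) = (LINT x|Lam. Z x * v x * 1)" using push[OF bZ] by (simp add: mult.commute)
  have i3: "(LINT x|Lam. h ((f ^^ (n + m)) x)) = E n v h" using push[of "%x. h ((f ^^ n) x)"] bmeas_fk[OF bh, of n] by (simp add: funpow_add E_def)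
  have e1: "abs ((LINT x|Lam. Z x * v x * h ((f ^^ n) x)) - E (n - N) u h) <= Phi * e"
   unfolding Eu using fr by (intro err_test bmeas_fk bh) auto
  have e2: "abs ((LINT x|Lam. Z x * v x * 1) - mass u) <= Phi * e" using err_test[of "%_. 1"] by (simp add: mu)
  have e3: "abs ((LINT x|Lam. Z x * v x * 1) * E n v h - mass u * E n v h) <= Phi * e"
  proof -
   have "abs ((LINT x|Lam. Z x * v x * 1) * E n v h - mass u * E n v h) = abs ((LINT x|Lam. Z x * v x * 1) - mass u) * abs (E n v h)"
    by (simp add: left_diff_distrib[symmetric] abs_mult)
   also have "... <= (Phi * e) * 1" using e2 Ev by (intro mult_mono) auto
   finally show ?thesis by simp
  qed
  have "abs ((LINT x|Lam. Z ((f ^^ m) x) * h ((f ^^ (n + m)) x)) - (LINT x|Lam. Z ((f ^^ m) x)) * (LINT x|Lam. h ((f ^^ (n + m)) x)))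
   <= Phi * e + Phi * e + C1 * (Phi + 2 * Phi * T) * (2 powr s * n powr (- s))"
   unfolding i1 i2 i3 using e1 e3 main unfolding E2 by linarith
  also have "... = C * n powr (- s)" by (simp add: C_def e_def algebra_simps)
  finally have fin: "abs ((LINT x|Lam. Z ((f ^^ m) x) * h ((f ^^ (n + m)) x)) - (LINT x|Lam. Z ((f ^^ m) x)) * (LINT x|Lam. h ((f ^^ (n + m)) x)))
   <= C * n powr (- s)" .
  have b\<phi>: "bmeas Lam \<phi>" by (rule mono_bmeas[OF \<phi>])
  have j1: "(LINT x|Lam. Z ((f ^^ m) x) * h ((f ^^ (n + m)) x)) = (LINT x|Lam. \<phi> ((f ^^ m) x) * h ((f ^^ (n + m)) x)) - \<phi> 0 * (LINT x|Lam. h ((f ^^ (n + m)) x))"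
   unfolding Z_def left_diff_distrib
   by (subst LINT_diff) (auto intro!: Lam.bmeas_integrable bmeas_mult bmeas_fk b\<phi> bh)
  have j2: "(LINT x|Lam. Z ((f ^^ m) x)) = (LINT x|Lam. \<phi> ((f ^^ m) x)) - \<phi> 0" unfolding Z_def
   by (subst LINT_diff) (use Lam.prob_space in \<open>auto intro!: Lam.bmeas_integrable bmeas_mult bmeas_fk b\<phi> bh\<close>)
  show ?thesis using fin unfolding j1 j2 by (simp add: algebra_simps)
 qed
 with C show ?thesis by blast
qed

end

section \<open>Exactness and the invariant probability\<close>

context intermittent begin

text \<open>Exactness in the form of a uniform loss of memory of the density \<open>h\<close>.\<close>

definition exact :: "(real => real) => bool" where
 "exact h \<longleftrightarrow> integrable Lam h \<and> (\<forall>e>0. \<exists>N. \<forall>n\<ge>N. \<forall>g. test g -->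
   abs ((LINT x|Lam. h x * g ((f ^^ n) x)) - (LINT x|Lam. h x) * (LINT x|Lam. g ((f ^^ n) x))) <= e)"

lemma test_fk: "test h ==> test (%x. h ((f ^^ n) x))"
 using measurable_compose[OF fk_meas, of h borel n] measurable_space[OF fk_meas, of _ n] unfolding test_def by auto

lemma integrable_test: assumes "integrable Lam h" "test g" shows "integrable Lam (%x. h x * g x)"
 using assms by (intro Bochner_Integration.integrable_bound[OF assms(1)])
  (auto simp: test_def abs_mult intro!: mult_left_le)

lemma integral_test_le: assumes "integrable Lam h" "test g" shows "abs (LINT x|Lam. h x * g x) <= (LINT x|Lam. abs (h x))"
proof -
 have "abs (LINT x|Lam. h x * g x) <= (LINT x|Lam. abs (h x * g x))" by (rule integral_abs_bound)
 also have "... <= (LINT x|Lam. abs (h x))"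
 proof (intro integral_mono integrable_abs integrable_test assms)
  fix x assume "x \<in> space Lam"
  then show "abs (h x * g x) <= abs (h x)" using assms(2) by (auto simp: abs_mult test_def intro!: mult_left_le)
 qed
 finally show ?thesis .
qed

lemma one_test: "test (%_. 1)" by (simp add: test_def)

text \<open>Exactness is stable under approximation in \<open>L\<^sup>1\<close>, because test functions are bounded by \<open>1\<close>.\<close>

lemma exact_closed:
 assumes h: "integrable Lam h" and appr: "!!e. e > 0 ==> \<exists>g. exact g \<and> (LINT x|Lam. abs (h x - g x)) <= e"
 shows "exact h"
 unfolding exact_def
proof (intro conjI h allI impI)
 fix e :: real assume "e > 0"
 then obtain g where g: "exact g" "(LINT x|Lam. abs (h x - g x)) <= e / 3" using appr[of "e/3"] by auto
 have gi: "integrable Lam g" using g by (simp add: exact_def)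
 obtain N where N: "!!n u. n >= N ==> test u ==>
   abs ((LINT x|Lam. g x * u ((f ^^ n) x)) - (LINT x|Lam. g x) * (LINT x|Lam. u ((f ^^ n) x))) <= e/3"
  using g(1) \<open>e > 0\<close> unfolding exact_def by (meson divide_pos_pos zero_less_numeral)
 have "abs ((LINT x|Lam. h x * u ((f ^^ n) x)) - (LINT x|Lam. h x) * (LINT x|Lam. u ((f ^^ n) x))) <= e"
  if n: "n >= N" and u: "test u" for n u
 proof -
  let ?p = "%x. u ((f ^^ n) x)"
  note tp = test_fk[OF u, of n]
  have d: "integrable Lam (%x. h x - g x)" using h gi by simp
  have 1: "abs ((LINT x|Lam. h x * ?p x) - (LINT x|Lam. g x * ?p x)) <= e/3"
  proof -
   have "(LINT x|Lam. h x * ?p x) - (LINT x|Lam. g x * ?p x) = (LINT x|Lam. (h x - g x) * ?p x)"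
    using integrable_test[OF h tp] integrable_test[OF gi tp] by (simp add: left_diff_distrib)
   then show ?thesis using integral_test_le[OF d tp] g(2) by linarith
  qed
  have 2: "abs ((LINT x|Lam. h x) - (LINT x|Lam. g x)) <= e/3"
  proof -
   have "(LINT x|Lam. h x) - (LINT x|Lam. g x) = (LINT x|Lam. (h x - g x) * 1)" using h gi by simp
   then show ?thesis using integral_test_le[OF d one_test] g(2) by linarith
  qed
  have 3: "abs (LINT x|Lam. ?p x) <= 1"
   using integral_test_le[OF Lam.bmeas_integrable[OF bmeas_const[of _ 1]] tp] Lam.prob_space by simp
  have "abs ((LINT x|Lam. h x) * (LINT x|Lam. ?p x) - (LINT x|Lam. g x) * (LINT x|Lam. ?p x)) = abs ((LINT x|Lam. h x) - (LINT x|Lam. g x)) * abs (LINT x|Lam. ?p x)"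
   by (simp only: left_diff_distrib[symmetric] abs_mult)
  also have "... <= e/3 * 1" using 2 3 by (intro mult_mono) (use \<open>e > 0\<close> in auto)
  finally show ?thesis using 1 N[OF n u] by linarith
 qed
 then show "\<exists>N. \<forall>n\<ge>N. \<forall>u. test u --> abs ((LINT x|Lam. h x * u ((f ^^ n) x)) - (LINT x|Lam. h x) * (LINT x|Lam. u ((f ^^ n) x))) <= e"
  by blast
qed

lemma exact_linear:
 assumes "exact g" "exact h" shows "exact (%x. \<alpha> * g x + \<beta> * h x)"
 unfolding exact_def
proof (intro conjI allI impI)
 have gi: "integrable Lam g" and hi: "integrable Lam h" using assms by (auto simp: exact_def)
 show "integrable Lam (%x. \<alpha> * g x + \<beta> * h x)" using gi hi by simp
 fix r :: real assume e: "r > 0"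
 define d where "d = r / (abs \<alpha> + abs \<beta> + 1)"
 have d: "d > 0" using e by (auto simp: d_def intro!: divide_pos_pos)
 have de: "(abs \<alpha> + abs \<beta>) * d <= r" using e by (simp add: d_def field_simps)
 obtain N1 where N1: "!!n u. n >= N1 ==> test u ==>
   abs ((LINT x|Lam. g x * u ((f ^^ n) x)) - (LINT x|Lam. g x) * (LINT x|Lam. u ((f ^^ n) x))) <= d"
  using assms(1) d unfolding exact_def by meson
 obtain N2 where N2: "!!n u. n >= N2 ==> test u ==>
   abs ((LINT x|Lam. h x * u ((f ^^ n) x)) - (LINT x|Lam. h x) * (LINT x|Lam. u ((f ^^ n) x))) <= d"
  using assms(2) d unfolding exact_def by meson
 have "abs ((LINT x|Lam. (\<alpha> * g x + \<beta> * h x) * u ((f ^^ n) x)) - (LINT x|Lam. \<alpha> * g x + \<beta> * h x) * (LINT x|Lam. u ((f ^^ n) x))) <= r"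
  if n: "n >= max N1 N2" and u: "test u" for n u
 proof -
  let ?p = "%x. u ((f ^^ n) x)"
  note tp = test_fk[OF u, of n]
  have "(LINT x|Lam. (\<alpha> * g x + \<beta> * h x) * ?p x) = \<alpha> * (LINT x|Lam. g x * ?p x) + \<beta> * (LINT x|Lam. h x * ?p x)"
   using integrable_test[OF gi tp] integrable_test[OF hi tp] by (simp add: distrib_right mult.assoc)
  moreover have "(LINT x|Lam. \<alpha> * g x + \<beta> * h x) = \<alpha> * (LINT x|Lam. g x) + \<beta> * (LINT x|Lam. h x)" using gi hi by simp
  ultimately have "(LINT x|Lam. (\<alpha> * g x + \<beta> * h x) * ?p x) - (LINT x|Lam. \<alpha> * g x + \<beta> * h x) * (LINT x|Lam. ?p x) =
   \<alpha> * ((LINT x|Lam. g x * ?p x) - (LINT x|Lam. g x) * (LINT x|Lam. ?p x)) + \<beta> * ((LINT x|Lam. h x * ?p x) - (LINT x|Lam. h x) * (LINT x|Lam. ?p x))"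
   by (simp add: algebra_simps)
  also have "abs (...) <= abs \<alpha> * d + abs \<beta> * d"
   by (intro order_trans[OF abs_triangle_ineq] add_mono) (use N1[OF _ u, of n] N2[OF _ u, of n] n in \<open>auto simp: abs_mult intro!: mult_left_mono\<close>)
  also have "... <= r" using de by (simp add: distrib_right)
  finally show ?thesis .
 qed
 then show "\<exists>N. \<forall>n\<ge>N. \<forall>u. test u --> abs ((LINT x|Lam. (\<alpha> * g x + \<beta> * h x) * u ((f ^^ n) x)) - (LINT x|Lam. \<alpha> * g x + \<beta> * h x) * (LINT x|Lam. u ((f ^^ n) x))) <= r"
  by blast
qed

lemma exact_mono: assumes "mono_on {0..1} \<phi>" shows "exact \<phi>"
 unfolding exact_def
proof (intro conjI allI impI Lam.bmeas_integrable mono_bmeas assms)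
 fix r :: real assume e: "r > 0"
 obtain C where C: "!!m n h. n >= 1 ==> test h ==>
  abs ((LINT x|Lam. \<phi> ((f ^^ m) x) * h ((f ^^ (n + m)) x)) - (LINT x|Lam. \<phi> ((f ^^ m) x)) * (LINT x|Lam. h ((f ^^ (n + m)) x)))
   <= C * n powr (- 1)" using monotone_decay[OF order.refl s'_gt assms] by blast
 have "(%n. C * real n powr (- 1)) ~> 0"
  by (intro tendsto_mult_right_zero tendsto_neg_powr filterlim_real_sequentially) auto
 then have "eventually (%n. C * real n powr (- 1) < r) sequentially" using e by (rule order_tendstoD)
 then obtain N where N: "!!n. n >= N ==> C * real n powr (- 1) < r" by (auto simp: eventually_sequentially)
 have "abs ((LINT x|Lam. \<phi> x * h ((f ^^ n) x)) - (LINT x|Lam. \<phi> x) * (LINT x|Lam. h ((f ^^ n) x))) <= r"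
  if "n >= max 1 N" "test h" for n h using C[of n h 0] N[of n] that by simp
 then show "\<exists>N. \<forall>n\<ge>N. \<forall>h. test h --> abs ((LINT x|Lam. \<phi> x * h ((f ^^ n) x)) - (LINT x|Lam. \<phi> x) * (LINT x|Lam. h ((f ^^ n) x))) <= r"
  by blast
qed

lemma exact_cong: assumes "!!x. x \<in> {0..1} ==> g x = h x" shows "exact g \<longleftrightarrow> exact h"
proof -
 have "(LINT x|Lam. g x * u x) = (LINT x|Lam. h x * u x)" for u :: "real => real"
  using assms by (intro LINT_cong) auto
 moreover have "(LINT x|Lam. g x) = (LINT x|Lam. h x)" "integrable Lam g \<longleftrightarrow> integrable Lam h"
  using assms by (intro LINT_cong Bochner_Integration.integrable_cong; auto)+
 ultimately show ?thesis unfolding exact_def by simp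
qed

lemma exact_lim:
 assumes "!!i. exact (s i)" "integrable Lam h" "(%i. (LINT x|Lam. abs (h x - s i x))) ~> 0"
 shows "exact h"
proof (rule exact_closed[OF assms(2)])
 fix e :: real assume "e > 0"
 then have "eventually (%i. (LINT x|Lam. abs (h x - s i x)) < e) sequentially" using order_tendstoD(2)[OF assms(3)] by blast
 then show "\<exists>g. exact g \<and> (LINT x|Lam. abs (h x - g x)) <= e"
  using assms(1) by (auto simp: eventually_sequentially intro: less_imp_le)
qed

text \<open>Half-lines generate the Borel sets, and their indicators are monotone up to a constant.\<close>

lemma exact_borel: assumes "B \<in> sets borel" shows "exact (indicator B)"
proof -
 have one: "exact (%_. 1)" by (rule exact_mono) (auto intro: mono_onI)
 have "Int_stable (range (%a::real. {..a}))" by (auto simp: Int_stable_def)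
 moreover have "range (%a::real. {..a}) \<subseteq> Pow UNIV" by auto
 moreover have "B \<in> sigma_sets UNIV (range (%a::real. {..a}))" using assms by (simp add: borel_eq_atMost)
 ultimately show ?thesis
 proof (induction rule: sigma_sets_induct_disjoint)
  case (basic A)
  then obtain a where A: "A = {..a}" by auto
  have "exact (indicator {a<..})" by (rule exact_mono) (auto intro!: mono_onI simp: indicator_def)
  from exact_linear[OF one this, of 1 "-1"]
  have "exact (%x. 1 * 1 + (-1) * indicator {a<..} x)" .
  then show ?case by (rule exact_cong[THEN iffD1, rotated]) (auto simp: A indicator_def)
 next
  case empty
  from exact_linear[OF one one, of 0 0] show ?case by (rule exact_cong[THEN iffD1, rotated]) auto
 next
  case (compl A)
  from exact_linear[OF one compl.IH, of 1 "-1"] show ?case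
   by (rule exact_cong[THEN iffD1, rotated]) (auto simp: indicator_def)
 next
  case (union A)
  have meas: "A i \<in> sets borel" for i
   using union.hyps(2)[THEN subsetD, of "A i"] unfolding borel_eq_atMost by simp
  have part: "exact (%x. \<Sum>i<n. indicator (A i) x)" for n
  proof (induction n)
   case 0
   from exact_linear[OF one one, of 0 0] show ?case by (rule exact_cong[THEN iffD1, rotated]) auto
  next
   case (Suc n)
   from exact_linear[OF Suc union.IH, of 1 1 n] show ?case by (rule exact_cong[THEN iffD1, rotated]) auto
  qed
  have sums: "(%n. \<Sum>i<n. indicator (A i) x :: real) ~> indicator (\<Union>i. A i) x" for x
   using indicator_sums[of A x] union.hyps by (auto simp: sums_def disjoint_family_on_def)
  have bound: "abs (\<Sum>i<n. indicator (A i) x :: real) <= 1" for n x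
  proof -
   have "(\<Sum>i<n. indicator (A i) x :: real) = indicator (\<Union>i<n. A i) x"
    using union.hyps by (intro indicator_UN_disjoint[symmetric]) (auto simp: disjoint_family_on_def)
   then show ?thesis by (simp add: indicator_def)
  qed
  have mU: "(indicator (\<Union>i. A i) :: real => real) \<in> borel_measurable Lam" "(%x. \<Sum>i<n. indicator (A i) x :: real) \<in> borel_measurable Lam" for n
   using meas by (auto intro!: borel_measurable_Lam)
  show ?case
  proof (rule exact_lim[of "%n x. \<Sum>i<n. indicator (A i) x"])
   show "exact (%x. \<Sum>i<n. indicator (A i) x)" for n by (rule part)
   show "integrable Lam (indicator (\<Union>i. A i) :: real => real)"
    by (intro Lam.bmeas_integrable bmeas_le_1 mU) (auto simp: indicator_def)
   have "(%n. (LINT x|Lam. abs (indicator (\<Union>i. A i) x - (\<Sum>i<n. indicator (A i) x) :: real))) ~> (LINT x|Lam. 0)"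
   proof (rule integral_dominated_convergence[where w = "%_. 2"])
    show "AE x in Lam. (%n. abs (indicator (\<Union>i. A i) x - (\<Sum>i<n. indicator (A i) x))) ~> (0::real)"
    proof (rule AE_I2)
     fix x
     have "(%n. indicator (\<Union>i. A i) x - (\<Sum>i<n. indicator (A i) x :: real)) ~> indicator (\<Union>i. A i) x - indicator (\<Union>i. A i) x"
      by (intro tendsto_diff tendsto_const sums)
     then show "(%n. abs (indicator (\<Union>i. A i) x - (\<Sum>i<n. indicator (A i) x))) ~> (0::real)"
      by (intro tendsto_rabs_zero) simp
    qed
    show "AE x in Lam. norm (abs (indicator (\<Union>i. A i) x - (\<Sum>i<n. indicator (A i) x) :: real)) <= 2" for n
    proof (rule AE_I2)
     fix x
     have "abs (indicator (\<Union>i. A i) x :: real) <= 1" by (simp add: indicator_def)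
     then show "norm (abs (indicator (\<Union>i. A i) x - (\<Sum>i<n. indicator (A i) x) :: real)) <= 2" using bound[where n=n and x=x] unfolding real_norm_def abs_idempotent by linarith
    qed
   qed (use mU in auto)
   then show "(%n. (LINT x|Lam. abs (indicator (\<Union>i. A i) x - (\<Sum>i<n. indicator (A i) x) :: real))) ~> 0" by simp
  qed
 qed
qed

theorem exact_integrable: assumes "integrable Lam h" shows "exact h"
 using assms
proof (induction rule: integrable_induct)
 case (base A c)
 then obtain B where B: "B \<in> sets borel" "A = B \<inter> {0..1}" by (auto simp: sets_Lam sets_restrict_space)
 from exact_linear[OF exact_borel[OF B(1)] exact_borel[OF B(1)], of c 0] show ?case
  by (rule exact_cong[THEN iffD1, rotated]) (auto simp: B indicator_def)
next
 case (add g h)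
 from exact_linear[OF add(3,4), of 1 1] show ?case by (rule exact_cong[THEN iffD1, rotated]) auto
next
 case (lim h s)
 show ?case
 proof (rule exact_lim[of s h])
  show "exact (s i)" for i by (rule lim)
  show "integrable Lam h" by (rule lim)
  have "(%i. (LINT x|Lam. abs (h x - s i x))) ~> (LINT x|Lam. 0)"
  proof (rule integral_dominated_convergence[where w = "%x. 3 * abs (h x)"])
   show "integrable Lam (%x. 3 * abs (h x))" using lim by auto
   show "AE x in Lam. (%i. abs (h x - s i x)) ~> 0"
   proof (rule AE_I2)
    fix x assume "x \<in> space Lam"
    then have "(%i. h x - s i x) ~> h x - h x" by (intro tendsto_diff tendsto_const lim)
    then show "(%i. abs (h x - s i x)) ~> 0" by (intro tendsto_rabs_zero) simp
   qed
   show "AE x in Lam. norm (abs (h x - s i x)) <= 3 * abs (h x)" for i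
   proof (rule AE_I2)
    fix x assume "x \<in> space Lam"
    then have "norm (s i x) <= 2 * norm (h x)" by (rule lim)
    then show "norm (abs (h x - s i x)) <= 3 * abs (h x)" by simp
   qed
  qed (use lim in auto)
  then show "(%i. (LINT x|Lam. abs (h x - s i x))) ~> 0" by simp
 qed
qed

end

locale intermittent_acip = intermittent +
 fixes \<nu> :: "real measure"
 assumes acip: "acip f \<nu>"
begin

sublocale nu: prob_space \<nu> using acip by (simp add: acip_def)

lemma sets_nu: "sets \<nu> = sets Lam" using acip by (simp add: acip_def sets_Lam)
lemma space_nu: "space \<nu> = {0..1}" using sets_eq_imp_space_eq[OF sets_nu] by simp
lemma f_meas_nu: "f \<in> \<nu> \<rightarrow>\<^sub>M \<nu>" and distr_nu: "distr \<nu> \<nu> f = \<nu>" using acip by (auto simp: acip_def)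
lemma meas_nu: "borel_measurable \<nu> = borel_measurable Lam" by (intro measurable_cong_sets sets_nu refl)
lemma bmeas_nu: "bmeas \<nu> u \<longleftrightarrow> bmeas Lam u" by (simp add: bmeas_def meas_nu space_nu)

text \<open>The invariant probability enters only through its density, which is merely integrable; this is where exactness for all
  integrable functions is needed.\<close>

lemma density_exists:
 obtains d where "integrable Lam d" "!!u. bmeas Lam u ==> (LINT x|\<nu>. u x) = (LINT x|Lam. d x * u x)"
  "!!u. bmeas Lam u ==> integrable Lam (%x. d x * u x)"
proof -
 have ac: "absolutely_continuous Lam \<nu>" using acip by (simp add: acip_def Lam_def)
 obtain d where d: "d \<in> borel_measurable Lam" "AE x in Lam. RN_deriv Lam \<nu> x = ennreal (d x)" "!!x. 0 <= d x"
  using Lam.real_RN_deriv[OF nu.finite_measure_axioms ac sets_nu] by metis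
 have "density Lam (%x. ennreal (d x)) = density Lam (RN_deriv Lam \<nu>)" using d by (intro density_cong) auto
 also have "... = \<nu>" by (rule Lam.density_RN_deriv[OF ac sets_nu])
 finally have dens: "density Lam (%x. ennreal (d x)) = \<nu>" .
 have int: "integrable Lam (%x. d x * u x)" if "bmeas Lam u" for u
 proof -
  have "integrable \<nu> u" using that by (intro nu.bmeas_integrable) (simp add: bmeas_nu)
  then show ?thesis using d bmeas_measurable[OF that] unfolding dens[symmetric]
   by (subst (asm) integrable_real_density) auto
 qed
 show ?thesis
 proof (rule that)
  show "integrable Lam d" using int[of "%_. 1"] by simp
  show "(LINT x|\<nu>. u x) = (LINT x|Lam. d x * u x)" if "bmeas Lam u" for u
   unfolding dens[symmetric] using d bmeas_measurable[OF that] by (subst integral_real_density) auto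
 qed (rule int)
qed

lemma nu_invariant: "bmeas Lam u ==> (LINT x|\<nu>. u ((f ^^ n) x)) = (LINT x|\<nu>. u x)"
proof (induction n)
 case (Suc n)
 have b: "bmeas Lam (%x. u ((f ^^ n) x))" using Suc by (intro bmeas_fk)
 have "(LINT x|(distr \<nu> \<nu> f). u ((f ^^ n) x)) = (LINT x|\<nu>. u ((f ^^ n) (f x)))"
  using b by (intro integral_distr f_meas_nu) (auto simp: meas_nu bmeas_def)
 then show ?case using Suc by (simp add: distr_nu funpow_swap1)
qed simp

text \<open>Hence Lebesgue measure converges to \<open>\<nu>\<close> under iteration, uniformly over test functions.\<close>

lemma to_nu:
 assumes "e > 0"
 shows "\<exists>N. \<forall>n\<ge>N. \<forall>h. test h --> abs ((LINT x|\<nu>. h x) - (LINT x|Lam. h ((f ^^ n) x))) <= e"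
proof -
 obtain d where d: "integrable Lam d" "!!u. bmeas Lam u ==> (LINT x|\<nu>. u x) = (LINT x|Lam. d x * u x)" using density_exists by metis
 have d1: "(LINT x|Lam. d x) = 1" using d(2)[of "%_. 1"] nu.prob_space by simp
 obtain N where N: "!!n h. n >= N ==> test h ==> abs ((LINT x|Lam. d x * h ((f ^^ n) x)) - (LINT x|Lam. d x) * (LINT x|Lam. h ((f ^^ n) x))) <= e"
  using exact_integrable[OF d(1)] assms unfolding exact_def by meson
 have "abs ((LINT x|\<nu>. h x) - (LINT x|Lam. h ((f ^^ n) x))) <= e" if "n >= N" "test h" for n h
  using N[OF that] nu_invariant[OF test_bmeas[OF that(2)], of n] d(2)[OF bmeas_fk[OF test_bmeas[OF that(2)], of n]] by (simp add: d1)
 then show ?thesis by blast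
qed

theorem nu_mixing:
 assumes "bmeas \<nu> g" "e > 0"
 shows "\<exists>N. \<forall>n\<ge>N. \<forall>h. test h --> abs ((LINT x|\<nu>. g x * h ((f ^^ n) x)) - (LINT x|\<nu>. g x) * (LINT x|\<nu>. h x)) <= e"
proof -
 have bg: "bmeas Lam g" using assms by (simp add: bmeas_nu)
 obtain d where d: "integrable Lam d" "!!u. bmeas Lam u ==> (LINT x|\<nu>. u x) = (LINT x|Lam. d x * u x)"
  "!!u. bmeas Lam u ==> integrable Lam (%x. d x * u x)" using density_exists by metis
 have e2: "e / 2 > 0" using assms by simp
 obtain N1 where N1: "!!n h. n >= N1 ==> test h ==> abs ((LINT x|Lam. d x * g x * h ((f ^^ n) x)) - (LINT x|Lam. d x * g x) * (LINT x|Lam. h ((f ^^ n) x))) <= e / 2"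
  using exact_integrable[OF d(3)[OF bg]] e2 unfolding exact_def by meson
 define c where "c = (LINT x|\<nu>. g x)"
 have c: "abs c + 1 > 0" by simp
 obtain N2 where N2: "!!n h. n >= N2 ==> test h ==> abs ((LINT x|\<nu>. h x) - (LINT x|Lam. h ((f ^^ n) x))) <= e / 2 / (abs c + 1)"
  using to_nu[of "e / 2 / (abs c + 1)"] e2 c by (meson divide_pos_pos)
 have "abs ((LINT x|\<nu>. g x * h ((f ^^ n) x)) - c * (LINT x|\<nu>. h x)) <= e" if n: "n >= max N1 N2" and h: "test h" for n h
 proof -
  have "(LINT x|\<nu>. g x * h ((f ^^ n) x)) = (LINT x|Lam. d x * g x * h ((f ^^ n) x))"
   using d(2)[OF bmeas_mult[OF bg bmeas_fk[OF test_bmeas[OF h], of n]]] by (simp add: mult.assoc)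
  moreover have "c = (LINT x|Lam. d x * g x)" unfolding c_def by (rule d(2)[OF bg])
  ultimately have 1: "abs ((LINT x|\<nu>. g x * h ((f ^^ n) x)) - c * (LINT x|Lam. h ((f ^^ n) x))) <= e / 2"
   using N1[of n h] n h by simp
  have "abs (c * (LINT x|\<nu>. h x) - c * (LINT x|Lam. h ((f ^^ n) x))) = abs c * abs ((LINT x|\<nu>. h x) - (LINT x|Lam. h ((f ^^ n) x)))"
   by (simp only: right_diff_distrib[symmetric] abs_mult)
  also have "... <= (abs c + 1) * (e / 2 / (abs c + 1))" using N2[of n h] n h by (intro mult_mono) auto
  also have "... = e / 2" using c by (subst times_divide_eq_right, subst nonzero_mult_div_cancel_left) auto
  finally show ?thesis using 1 by linarith
 qed
 then show ?thesis unfolding c_def by blast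
qed

text \<open>Let \<open>m \<rightarrow> \<infinity>\<close> in \<open>monotone_decay\<close>, whose bound does not depend on \<open>m\<close>.\<close>

theorem nu_decay:
 assumes s: "1 <= s" "s < s'" and \<phi>: "mono_on {0..1} \<phi>"
 shows "\<exists>C\<ge>0. \<forall>n h. n >= 1 --> test h -->
  abs ((LINT x|\<nu>. \<phi> x * h ((f ^^ n) x)) - (LINT x|\<nu>. \<phi> x) * (LINT x|\<nu>. h x)) <= C * n powr (- s)"
proof -
 obtain C where C: "C >= 0" "!!m n h. n >= 1 ==> test h ==>
  abs ((LINT x|Lam. \<phi> ((f ^^ m) x) * h ((f ^^ (n + m)) x)) - (LINT x|Lam. \<phi> ((f ^^ m) x)) * (LINT x|Lam. h ((f ^^ (n + m)) x)))
   <= C * n powr (- s)" using monotone_decay[OF s \<phi>] by blast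
 have b\<phi>: "bmeas Lam \<phi>" by (rule mono_bmeas[OF \<phi>])
 have lim: "(%m. (LINT x|Lam. u ((f ^^ m) x))) ~> (LINT x|\<nu>. u x)" if bu: "bmeas Lam u" for u
 proof -
  obtain B where B: "B >= 0" "!!x. x \<in> space Lam ==> abs (u x) <= B" using bmeasE[OF bu] by metis
  define h where "h x = u x / (B + 1)" for x
  have "abs (h x) <= 1" if "x \<in> {0..1}" for x using B(1) B(2)[of x] that by (simp add: h_def)
  moreover have "h \<in> borel_measurable Lam" using bmeas_measurable[OF bu] unfolding h_def by simp
  ultimately have "test h" by (simp add: test_def)
  have "(%m. (LINT x|Lam. h ((f ^^ m) x))) ~> (LINT x|\<nu>. h x)"
  proof (rule LIMSEQ_I)
   fix r :: real assume "r > 0"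
   then obtain N where "!!n. n >= N ==> abs ((LINT x|\<nu>. h x) - (LINT x|Lam. h ((f ^^ n) x))) <= r / 2"
    using to_nu[of "r/2"] \<open>test h\<close> by auto
   then show "\<exists>no. \<forall>n\<ge>no. norm ((LINT x|Lam. h ((f ^^ n) x)) - (LINT x|\<nu>. h x)) < r"
    using \<open>r > 0\<close> by (intro exI[of _ N]) (force simp: abs_minus_commute)
  qed
  then have "(%m. (LINT x|Lam. h ((f ^^ m) x)) * (B + 1)) ~> (LINT x|\<nu>. h x) * (B + 1)" by (rule tendsto_mult_right)
  then show ?thesis using B(1) by (simp add: h_def)
 qed
 have "abs ((LINT x|\<nu>. \<phi> x * h ((f ^^ n) x)) - (LINT x|\<nu>. \<phi> x) * (LINT x|\<nu>. h x)) <= C * n powr (- s)" if n: "n >= 1" and h: "test h" for n h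
 proof -
  have b: "bmeas Lam (%x. h ((f ^^ n) x))" using test_bmeas[OF h] by (rule bmeas_fk)
  have "(%m. abs ((LINT x|Lam. \<phi> ((f ^^ m) x) * h ((f ^^ n) ((f ^^ m) x))) - (LINT x|Lam. \<phi> ((f ^^ m) x)) * (LINT x|Lam. h ((f ^^ n) ((f ^^ m) x)))))
   ~> (abs ((LINT x|\<nu>. \<phi> x * h ((f ^^ n) x)) - (LINT x|\<nu>. \<phi> x) * (LINT x|\<nu>. h ((f ^^ n) x))))"
   by (intro tendsto_intros lim[OF bmeas_mult[OF b\<phi> b]] lim[OF b\<phi>] lim[OF b])
  moreover have "abs ((LINT x|Lam. \<phi> ((f ^^ m) x) * h ((f ^^ n) ((f ^^ m) x))) - (LINT x|Lam. \<phi> ((f ^^ m) x)) * (LINT x|Lam. h ((f ^^ n) ((f ^^ m) x)))) <= C * n powr (- s)" for m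
   using C(2)[OF n h, of m] by (simp add: funpow_add)
  ultimately have "abs ((LINT x|\<nu>. \<phi> x * h ((f ^^ n) x)) - (LINT x|\<nu>. \<phi> x) * (LINT x|\<nu>. h ((f ^^ n) x))) <= C * n powr (- s)"
   by (intro LIMSEQ_le_const2) auto
  then show ?thesis by (simp add: nu_invariant[OF test_bmeas[OF h]])
 qed
 with C(1) show ?thesis by blast
qed

end

section \<open>Holland maps near the neutral fixed point\<close>

locale holland =
 fixes \<gamma> :: real and \<rho> f :: "real => real"
 assumes gamma_pos: "0 < \<gamma>" and gamma_lt: "\<gamma> < 1" and f_Hol: "f \<in> Hol \<gamma> \<rho>"
begin

text \<open>The left branch, continued by the identity to negative arguments so that two-sided derivatives exist at \<open>0\<close>; \<open>F'\<close> and \<open>F''\<close>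
  are its derivatives.\<close>

definition F :: "real => real" where
 "F x = (if x <= 0 then x else x * (1 + x powr \<gamma> * \<rho> x))"

definition F' :: "real => real" where
 "F' x = (if x <= 0 then 1 else 1 + x powr \<gamma> * ((1 + \<gamma>) * \<rho> x + x * deriv \<rho> x))"

definition F'' :: "real => real" where
 "F'' x = x powr (\<gamma> - 1) *
   (\<gamma> * (1 + \<gamma>) * \<rho> x + 2 * (1 + \<gamma>) * (x * deriv \<rho> x) + x^2 * deriv (deriv \<rho>) x)"

lemma f_maps: "x \<in> {0..1} ==> f x \<in> {0..1}"
 and f_0: "f 0 = 0"
 and f_left: "x \<in> {0<..1/2} ==> f x = x * (1 + x powr \<gamma> * \<rho> x)"
 and f_right: "x \<in> {1/2<..1} ==> f x = 2 * x - 1"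
 and rho_pos: "x \<in> {0<..<1} ==> \<rho> x > 0"
 and rho_diff: "x \<in> {0<..<1} ==> \<rho> field_differentiable at x"
 and rho_diff2: "x \<in> {0<..<1} ==> deriv \<rho> field_differentiable at x"
 and rho_C2: "continuous_on {0<..<1} (deriv (deriv \<rho>))"
 and rho_1: "(%x. x * deriv \<rho> x) \<in> o[at_right 0](\<rho>)"
 and rho_2: "(%x. x^2 * deriv (deriv \<rho>) x) \<in> o[at_right 0](\<rho>)"
 and f_half: "f (1/2) = 1"
 and f_exp: "x \<in> {0..1} - {0, 1/2} ==> \<exists>D>1. (f has_real_derivative D) (at x within {0..1})"
 and rho_0: "(\<rho> \<longlongrightarrow> 0) (at_right 0)"
 using f_Hol unfolding Hol_def by (auto simp del: greaterThanLessThan_iff atLeastAtMost_iff)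

lemma f_eq_F: "x \<in> {0..1/2} ==> f x = F x"
 using f_left[of x] f_0 by (cases "x = 0") (auto simp: F_def)

lemma F_0[simp]: "F 0 = 0" by (simp add: F_def)
lemma F_half[simp]: "F (1/2) = 1" using f_eq_F[of "1/2"] f_half by simp

lemma rho_deriv: "x \<in> {0<..<1} ==> (\<rho> has_real_derivative deriv \<rho> x) (at x)"
 using rho_diff DERIV_deriv_iff_field_differentiable by blast
lemma rho_deriv2: "x \<in> {0<..<1} ==> (deriv \<rho> has_real_derivative deriv (deriv \<rho>) x) (at x)"
 using rho_diff2 DERIV_deriv_iff_field_differentiable by blast

lemma F_deriv_pos: assumes "x \<in> {0<..<1}" shows "(F has_real_derivative F' x) (at x)"
proof -
 have x: "x > 0" using assms by simp
 have "((%x. x * (1 + x powr \<gamma> * \<rho> x)) has_real_derivative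
     (1 * (1 + x powr \<gamma> * \<rho> x) + (0 + (\<gamma> * x powr (\<gamma> - 1) * 1 * \<rho> x + deriv \<rho> x * x powr \<gamma>)) * x)) (at x)"
  using x by (intro derivative_intros DERIV_powr rho_deriv assms refl DERIV_mult) (auto intro!: derivative_eq_intros)
 also have "(1 * (1 + x powr \<gamma> * \<rho> x) + (0 + (\<gamma> * x powr (\<gamma> - 1) * 1 * \<rho> x + deriv \<rho> x * x powr \<gamma>)) * x) = F' x"
 proof -
  have "x powr \<gamma> = x powr (\<gamma> - 1) * x" using x by (simp add: powr_diff)
  then show ?thesis using x by (simp add: F'_def algebra_simps)
 qed
 finally have *: "((%x. x * (1 + x powr \<gamma> * \<rho> x)) has_real_derivative F' x) (at x)" .
 show ?thesis
  by (rule has_field_derivative_transform_within_open[OF *, of "{0<..}"]) (use x in \<open>auto simp: F_def\<close>)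
qed

lemma F'_deriv: assumes "x \<in> {0<..<1}" shows "(F' has_real_derivative F'' x) (at x)"
proof -
 have x: "x > 0" using assms by simp
 have "((%x. 1 + x powr \<gamma> * ((1 + \<gamma>) * \<rho> x + x * deriv \<rho> x)) has_real_derivative
   (0 + (\<gamma> * x powr (\<gamma> - 1) * ((1 + \<gamma>) * \<rho> x + x * deriv \<rho> x) +
    ((1+\<gamma>) * deriv \<rho> x + (1 * deriv \<rho> x + deriv (deriv \<rho>) x * x)) * x powr \<gamma>))) (at x)"
  by (rule rho_deriv[OF assms] rho_deriv2[OF assms] has_real_derivative_powr[OF x] derivative_eq_intros refl)+
    simp
 also have "(0 + (\<gamma> * x powr (\<gamma> - 1) * ((1 + \<gamma>) * \<rho> x + x * deriv \<rho> x) +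
    ((1+\<gamma>) * deriv \<rho> x + (1 * deriv \<rho> x + deriv (deriv \<rho>) x * x)) * x powr \<gamma>)) = F'' x"
 proof -
  have "x powr \<gamma> = x powr (\<gamma> - 1) * x" using x by (simp add: powr_diff)
  then show ?thesis using x by (simp add: F''_def algebra_simps power2_eq_square)
 qed
 finally have *: "((%x. 1 + x powr \<gamma> * ((1 + \<gamma>) * \<rho> x + x * deriv \<rho> x)) has_real_derivative F'' x) (at x)" .
 show ?thesis
  by (rule has_field_derivative_transform_within_open[OF *, of "{0<..}"]) (use x in \<open>auto simp: F'_def\<close>)
qed

text \<open>In all estimates near \<open>0\<close>, the derivatives of \<open>\<rho>\<close> may be neglected against \<open>\<rho>\<close> itself.\<close>

lemma near_0:
 assumes "e > 0"
 shows "eventually (%x. 0 < x \<and> x < 1 \<and> \<rho> x > 0 \<and> \<rho> x <= e \<and> abs (x * deriv \<rho> x) <= e * \<rho> x \<and>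
      abs (x^2 * deriv (deriv \<rho>) x) <= e * \<rho> x) (at_right 0)"
proof -
 have 1: "eventually (%x. 0 < x \<and> x < (1::real)) (at_right 0)"
  by (simp add: eventually_at_right_less eventually_conj eventually_at_right_real[of 0 1, simplified])
 have 2: "eventually (%x. dist (\<rho> x) 0 < e) (at_right 0)" using rho_0 assms by (rule tendstoD)
 have 3: "eventually (%x. norm (x * deriv \<rho> x) <= e * norm (\<rho> x)) (at_right 0)"
  using landau_o.smallD[OF rho_1 assms] .
 have 4: "eventually (%x. norm (x^2 * deriv (deriv \<rho>) x) <= e * norm (\<rho> x)) (at_right 0)"
  using landau_o.smallD[OF rho_2 assms] .
 show ?thesis using 1 2 3 4
 proof eventually_elim
  case (elim x)
  then show ?case using rho_pos[of x] by auto
 qed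
qed

lemma F'_tendsto_0: "(F' \<longlongrightarrow> 1) (at_right 0)"
proof -
 have a: "((%x::real. x powr \<gamma>) \<longlongrightarrow> 0) (at_right 0)"
  using gamma_pos by (intro tendsto_eq_intros tendsto_powr' | auto simp: eventually_at_filter)+
 have "(%x. x * deriv \<rho> x) \<in> o[at_right 0](%x. 1)"
 proof (rule landau_o.small_big_trans[OF rho_1])
  show "\<rho> \<in> O[at_right 0](%x. 1)" using rho_0 by (intro bigoI_tendsto[where c=0]) (auto)
 qed
 then have b: "((%x. x * deriv \<rho> x) \<longlongrightarrow> 0) (at_right 0)" by (auto dest: smalloD_tendsto)
 have "((%x. 1 + x powr \<gamma> * ((1 + \<gamma>) * \<rho> x + x * deriv \<rho> x)) \<longlongrightarrow> 1 + 0 * ((1 + \<gamma>) * 0 + 0)) (at_right 0)"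
  by (intro tendsto_intros a b rho_0)
 moreover have "eventually (%x. 1 + x powr \<gamma> * ((1 + \<gamma>) * \<rho> x + x * deriv \<rho> x) = F' x) (at_right 0)"
  by (rule eventually_at_rightI[of 0 1]) (auto simp: F'_def)
 ultimately show ?thesis using Lim_transform_eventually by fastforce
qed

lemma F_deriv_0: "(F has_real_derivative 1) (at 0)"
proof -
 have a: "((%x::real. x powr \<gamma>) \<longlongrightarrow> 0) (at_right 0)"
  using gamma_pos by (intro tendsto_eq_intros tendsto_powr' | auto simp: eventually_at_filter)+
 have "((%x. 1 + x powr \<gamma> * \<rho> x) \<longlongrightarrow> 1 + 0 * 0) (at_right 0)"
  by (intro tendsto_intros a rho_0)
 moreover have "eventually (%x. 1 + x powr \<gamma> * \<rho> x = (F x - F 0) / (x - 0)) (at_right 0)"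
  by (rule eventually_at_rightI[of 0 1]) (auto simp: F_def)
 ultimately have r: "((%x. (F x - F 0) / (x - 0)) \<longlongrightarrow> 1) (at_right 0)"
  using Lim_transform_eventually by fastforce
 have l: "((%x. (F x - F 0) / (x - 0)) \<longlongrightarrow> 1) (at_left 0)"
  by (rule tendsto_eventually) (auto simp: F_def eventually_at_filter)
 have "((%x. (F x - F 0) / (x - 0)) \<longlongrightarrow> 1) (at 0)" using l r filterlim_split_at by blast
 then show ?thesis by (simp add: has_field_derivative_iff)
qed

lemma F_deriv: assumes "x \<in> {0..<1}" shows "(F has_real_derivative F' x) (at x)"
 using F_deriv_pos[of x] F_deriv_0 assms by (cases "x = 0") (auto simp: F'_def)

lemma F'_cont: "continuous_on {0..1/2} F'"
proof -
 have "continuous (at x within {0..1/2}) F'" if "x \<in> {0..1/2}" for x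
 proof (cases "x = 0")
  case True
  have "(F' \<longlongrightarrow> F' 0) (at_right 0)" using F'_tendsto_0 by (simp add: F'_def)
  then show ?thesis using True
   by (simp add: continuous_within at_within_Icc_at_right)
 next
  case False
  then have "isCont F' x" using F'_deriv[of x] that by (intro DERIV_isCont) auto
  then show ?thesis by (rule continuous_at_imp_continuous_at_within)
 qed
 then show ?thesis by (simp add: continuous_on_eq_continuous_within)
qed

lemma F'_gt_1: assumes "x \<in> {0<..<1/2}" shows "F' x > 1"
proof -
 obtain D where D: "D > 1" "(f has_real_derivative D) (at x within {0..1})" using f_exp[of x] assms by auto
 have "at x within {0..1} = at x" using assms by (intro at_within_interior) auto
 with D have "(f has_real_derivative D) (at x)" by simp
 then have "(F has_real_derivative D) (at x)"
  by (rule has_field_derivative_transform_within_open[of _ _ _ "{0<..<1/2}"])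
    (use assms f_eq_F in auto)
 with F_deriv[of x] assms have "F' x = D" by (auto intro: DERIV_unique)
 with D show ?thesis by simp
qed

lemma F'_ge_1: assumes "x \<in> {0..1/2}" shows "F' x >= 1"
proof -
 have "closure {0<..<1/2::real} = {0..1/2}" by simp
 then show ?thesis
  using continuous_ge_on_closure[of "{0<..<1/2}" F' x 1] F'_cont F'_gt_1 assms
  by (auto intro: less_imp_le)
qed

lemma F_expand: assumes "0 <= a" "a <= b" "b <= 1/2" shows "b - a <= F b - F a"
proof (cases "a = b")
 case False
 then obtain z where z: "a < z" "z < b" "F b - F a = (b - a) * F' z" using MVT2[of a b F F'] F_deriv assms by auto
 then have "F' z >= 1" using F'_ge_1[of z] assms by auto
 then have "(b - a) * 1 <= (b - a) * F' z" using assms by (intro mult_left_mono) auto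
 with z show ?thesis by simp
qed simp

lemma F_strict: assumes "0 <= a" "a < b" "b <= 1/2" shows "F a < F b"
 using F_expand[of a b] assms by simp

lemma F_cont: "continuous_on {0..1/2} F"
 by (rule DERIV_continuous_on[where D=F']) (auto intro!: F_deriv DERIV_subset[OF F_deriv])

definition y0 :: "real => real" where "y0 = the_inv_into {0..1/2} F"

lemma F_inj: "inj_on F {0..1/2}"
 by (rule linorder_inj_onI') (use F_strict in force)

lemma F_image: "F ` {0..1/2} = {0..1}"
proof
 show "F ` {0..1/2} \<subseteq> {0..1}" using F_expand[of 0] F_expand[of _ "1/2"] by force
 show "{0..1} \<subseteq> F ` {0..1/2}"
 proof
  fix y :: real assume "y \<in> {0..1}"
  then obtain x where "0 <= x" "x <= 1/2" "F x = y" using IVT'[of F 0 y "1/2"] F_cont by auto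
  then show "y \<in> F ` {0..1/2}" by force
 qed
qed

lemma y0_range: "x \<in> {0..1} ==> y0 x \<in> {0..1/2}"
 unfolding y0_def by (rule the_inv_into_into[OF F_inj _ order.refl]) (simp add: F_image)
lemma F_y0: "x \<in> {0..1} ==> F (y0 x) = x"
 unfolding y0_def by (rule f_the_inv_into_f[OF F_inj]) (simp add: F_image)
lemma y0_F: "x \<in> {0..1/2} ==> y0 (F x) = x"
 unfolding y0_def by (rule the_inv_into_f_f[OF F_inj])
lemma y0_mono: "0 <= a ==> a <= b ==> b <= 1 ==> y0 a <= y0 b"
 using F_strict[of "y0 b" "y0 a"] F_y0[of a] F_y0[of b] y0_range[of a] y0_range[of b] by force
lemma y0_0[simp]: "y0 0 = 0" using y0_F[of 0] by simp
lemma y0_1[simp]: "y0 1 = 1/2" using y0_F[of "1/2"] by simp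
lemma y0_contract: assumes "a \<in> {0..1}" "b \<in> {0..1}" shows "abs (y0 a - y0 b) <= abs (a - b)"
proof -
 have "y0 b - y0 a <= b - a \<and> y0 a <= y0 b" if "a <= b" "a \<in> {0..1}" "b \<in> {0..1}" for a b
  using F_expand[of "y0 a" "y0 b"] y0_mono[of a b] F_y0 y0_range that by auto
 from this[of a b] this[of b a] assms show ?thesis by linarith
qed
lemma y0_pos: "0 < x ==> x <= 1 ==> 0 < y0 x"
 using F_y0[of x] y0_range[of x] by (cases "y0 x = 0") auto

text \<open>The inverse iterates of the left branch: \<open>v k\<close> maps \<open>[0,1]\<close> to the points that spend \<open>k\<close> steps on the left.\<close>

definition v :: "nat => real => real" where "v i = y0 ^^ i"

lemma v_0[simp]: "v 0 w = w" and v_Suc: "v (Suc i) w = y0 (v i w)" by (simp_all add: v_def)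
lemma v_range: "w \<in> {0..1} ==> v i w \<in> {0..1}"
 by (induction i) (use y0_range in \<open>force simp: v_Suc\<close>)+
lemma v_range_half: "w \<in> {0..1} ==> v (Suc i) w \<in> {0..1/2}"
 using v_range y0_range by (simp add: v_Suc)
lemma v_mono: "0 <= a ==> a <= b ==> b <= 1 ==> v i a <= v i b"
 using v_range[of a] v_range[of b] by (induction i) (auto simp: v_Suc intro!: y0_mono)
lemma v_contract: "a \<in> {0..1} ==> b \<in> {0..1} ==> abs (v i a - v i b) <= abs (a - b)"
 by (induction i) (auto simp: v_Suc intro: order_trans[OF y0_contract[OF v_range v_range]])
lemma v_pos: "0 < x ==> x <= 1 ==> 0 < v i x"
 using v_range[of x] by (induction i) (auto simp: v_Suc intro!: y0_pos)
lemma F_v: "w \<in> {0..1} ==> F (v (Suc i) w) = v i w"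
 using F_y0 v_range by (simp add: v_Suc)
lemma v_Suc_le: "w \<in> {0..1} ==> v (Suc i) w <= v i w"
 using F_expand[of 0 "v (Suc i) w"] v_range_half[of w i] F_v[of w i] by auto
lemma v_half: "v i (1/2) = v (Suc i) 1"
 by (simp add: v_def funpow_swap1)

text \<open>A slowly varying function dominates every positive power: \<open>x powr (-r) * \<rho> x\<close> is decreasing near \<open>0\<close>.\<close>

lemma rho_lower:
 assumes "r > 0"
 shows "\<exists>c>0. \<forall>x\<in>{0<..1/2}. \<rho> x >= c * x powr r"
proof -
 obtain d where d: "d > 0" "!!x. 0 < x ==> x < d ==> x < 1 \<and> \<rho> x > 0 \<and> abs (x * deriv \<rho> x) <= r * \<rho> x"
  using near_0[OF assms] unfolding eventually_at_right_field by fastforce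
 define e where "e = min (d/2) (1/2)"
 have e: "0 < e" "e < d" "e <= 1/2" using d by (auto simp: e_def)
 define h where "h x = x powr (-r) * \<rho> x" for x
 have hpos: "h x > 0" if "x \<in> {0<..<1}" for x using rho_pos[OF that] that by (simp add: h_def)
 have "continuous_on {e..1/2} \<rho>"
  by (rule DERIV_continuous_on[where D="deriv \<rho>"]) (use e in \<open>auto intro!: DERIV_subset[OF rho_deriv]\<close>)
 then have "continuous_on {e..1/2} h" unfolding h_def using e by (intro continuous_intros) auto
 then obtain z where z: "z \<in> {e..1/2}" "!!x. x \<in> {e..1/2} ==> h z <= h x"
  using continuous_attains_inf[of "{e..1/2}" h] e by auto
 have dec: "h e <= h x" if "0 < x" "x <= e" for x
 proof (rule DERIV_nonpos_imp_nonincreasing[OF that(2)])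
  fix t assume t: "x <= t" "t <= e"
  have t0: "t > 0" "t < 1" using t that e by auto
  have "(h has_real_derivative (- r * t powr (-r - 1) * 1 * \<rho> t + deriv \<rho> t * t powr (-r))) (at t)"
   unfolding h_def using t0 by (intro DERIV_mult DERIV_powr rho_deriv) (auto intro!: derivative_eq_intros)
  also have "(- r * t powr (-r - 1) * 1 * \<rho> t + deriv \<rho> t * t powr (-r)) = t powr (-r-1) * (t * deriv \<rho> t - r * \<rho> t)"
  proof -
   have "t powr (-r) = t powr (-r-1) * t" using t0 by (simp add: powr_diff)
   then show ?thesis by (simp add: algebra_simps)
  qed
  finally have "(h has_real_derivative t powr (-r-1) * (t * deriv \<rho> t - r * \<rho> t)) (at t)" .
  moreover have "t * deriv \<rho> t - r * \<rho> t <= 0" using d(2)[of t] t t0 e by auto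
  then have "t powr (-r-1) * (t * deriv \<rho> t - r * \<rho> t) <= 0" by (intro mult_nonneg_nonpos) auto
  ultimately show "\<exists>y. (h has_real_derivative y) (at t) \<and> y <= 0" by blast
 qed
 have "h z <= h x" if "x \<in> {0<..1/2}" for x using z(2)[of x] z(2)[of e] dec[of x] that e by (cases "x <= e") auto
 then have "h z * x powr r <= \<rho> x" if "x \<in> {0<..1/2}" for x
 proof -
  have "h z * x powr r <= h x * x powr r" using \<open>!!x. x \<in> {0<..1/2} ==> h z <= h x\<close>[OF that] by (intro mult_right_mono) auto
  also have "... = \<rho> x" using that by (simp add: h_def powr_minus)
  finally show ?thesis .
 qed
 moreover have "h z > 0" using hpos[of z] z e by auto
 ultimately show ?thesis by blast
qed

lemma F_lower:
 assumes "\<gamma>' > \<gamma>"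
 shows "\<exists>c>0. \<forall>x\<in>{0..1/2}. F x >= x * (1 + c * x powr \<gamma>')"
proof -
 obtain c where c: "c > 0" "\<forall>x\<in>{0<..1/2}. \<rho> x >= c * x powr (\<gamma>' - \<gamma>)"
  using rho_lower[of "\<gamma>' - \<gamma>"] assms by auto
 have "F x >= x * (1 + c * x powr \<gamma>')" if x: "x \<in> {0..1/2}" for x
 proof (cases "x = 0")
  case False
  then have x0: "x > 0" using x by simp
  have "c * x powr \<gamma>' = x powr \<gamma> * (c * x powr (\<gamma>' - \<gamma>))"
   using x0 by (simp flip: powr_add)
  also have "... <= x powr \<gamma> * \<rho> x" using c x x0 by (intro mult_left_mono) auto
  finally show ?thesis using x0 by (simp add: F_def)
 qed simp
 with c show ?thesis by blast
qed

text \<open>The recursion \<open>F (v (k + 1) 1) = v k 1\<close> is compared with the explicit sequence \<open>A * (k + 1) powr (-1/\<gamma>')\<close>.\<close>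

lemma tail_decay:
 assumes "\<gamma>' > \<gamma>"
 shows "\<exists>A>0. \<forall>k. v k 1 <= A * (real k + 1) powr (- (1 / \<gamma>'))"
proof -
 obtain c where c: "c > 0" "\<forall>x\<in>{0..1/2}. F x >= x * (1 + c * x powr \<gamma>')" using F_lower[OF assms] by blast
 have g': "\<gamma>' > 0" using assms gamma_pos by simp
 define b where "b = 1 / \<gamma>'"
 have b: "b > 0" "b * \<gamma>' = 1" using g' by (auto simp: b_def)
 define A where "A = max 1 ((2 * b * exp b / c) powr b)"
 have A: "A >= 1" "A > 0" by (auto simp: A_def)
 have cA: "c * A powr \<gamma>' >= 2 * b * exp b"
 proof -
  have "2 * b * exp b / c = ((2 * b * exp b / c) powr b) powr \<gamma>'" using b c by (simp add: powr_powr)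
  also have "... <= A powr \<gamma>'" unfolding A_def using g' by (intro powr_mono2) auto
  finally show ?thesis using c by (simp add: field_simps)
 qed
 have "v k 1 <= A * (real k + 1) powr (- b)" for k
 proof (induction k)
  case 0 then show ?case using A by simp
 next
  case (Suc k)
  define t where "t = A * (real k + 2) powr (- b)"
  have t0: "t > 0" using A by (simp add: t_def)
  show ?case
  proof (rule ccontr)
   assume "\<not> ?case"
   then have lt: "t < v (Suc k) 1" by (simp add: t_def algebra_simps)
   have th: "t <= 1/2" "v (Suc k) 1 <= 1/2" using lt v_range_half[of 1 k] by auto
   have "F t < F (v (Suc k) 1)" using F_strict[OF _ lt] t0 th by simp
   also have "... = v k 1" by (rule F_v) simp
   also have "... <= A * (real k + 1) powr (- b)" by (rule Suc)
   finally have 1: "F t < A * (real k + 1) powr (- b)" .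
   have "t powr \<gamma>' = A powr \<gamma>' * (real k + 2) powr (- 1)"
    using A b by (simp add: t_def powr_mult powr_powr)
   then have "c * t powr \<gamma>' = c * A powr \<gamma>' / (real k + 2)" by (simp add: powr_minus field_simps)
   also have "... >= 2 * b * exp b / (real k + 2)" using cA by (intro divide_right_mono) auto
   finally have 2: "c * t powr \<gamma>' >= 2 * b * exp b / (real k + 2)" .
   have "t * (1 + 2 * b * exp b / (real k + 2)) <= t * (1 + c * t powr \<gamma>')"
    using 2 t0 by (intro mult_left_mono) auto
   also have "... <= F t" using c th t0 by auto
   finally have 3: "t * (1 + 2 * b * exp b / (real k + 2)) < A * (real k + 1) powr (- b)" using 1 by simp
   have "((real k + 2) / (real k + 1)) powr b = (1 + 1 / (real k + 1)) powr b" by (simp add: field_simps)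
   also have "... = exp (b * ln (1 + 1 / (real k + 1)))" by (simp add: powr_def add_nonneg_eq_0_iff)
   also have "... <= exp (b * (1 / (real k + 1)))"
    using b ln_add_one_self_le_self[of "1 / (real k + 1)"] by (intro exp_le_cancel_iff[THEN iffD2] mult_left_mono) auto
   also have "... <= 1 + b * (1 / (real k + 1)) * exp b"
   proof -
    define z where "z = b * (1 / (real k + 1))"
    have z: "0 <= z" "z <= b" using b by (auto simp: z_def divide_simps)
    have "1 - z <= exp (-z)" using exp_ge_add_one_self[of "-z"] by simp
    then have "(1 - z) * exp z <= exp (-z) * exp z" by (intro mult_right_mono) auto
    then have "exp z <= 1 + z * exp z" by (simp add: algebra_simps flip: exp_add)
    also have "z * exp z <= z * exp b" using z by (intro mult_left_mono) auto
    finally show ?thesis by (simp add: z_def)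
   qed
   also have "... <= 1 + 2 * b * exp b / (real k + 2)"
   proof -
    have "1 / (real k + 1) <= 2 / (real k + 2)" by (simp add: divide_simps)
    then have "(b * exp b) * (1 / (real k + 1)) <= (b * exp b) * (2 / (real k + 2))"
     using b by (intro mult_left_mono) auto
    then show ?thesis by (simp add: algebra_simps)
   qed
   finally have "((real k + 2) / (real k + 1)) powr b <= 1 + 2 * b * exp b / (real k + 2)" .
   then have "t * ((real k + 2) / (real k + 1)) powr b <= t * (1 + 2 * b * exp b / (real k + 2))"
    using t0 by (intro mult_left_mono) auto
   moreover have "t * ((real k + 2) / (real k + 1)) powr b = A * (real k + 1) powr (- b)"
    by (simp add: t_def powr_divide powr_minus field_simps)
   ultimately show False using 3 by simp
  qed
 qed
 then show ?thesis using A unfolding b_def by blast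
qed

end

section \<open>Bounded distortion\<close>

context holland begin

definition g :: "real => real" where "g x = F x - x"

lemma g_mono: "0 <= a ==> a <= b ==> b <= 1/2 ==> g a <= g b"
 using F_expand[of a b] by (simp add: g_def)

lemma g_v: "w \<in> {0..1} ==> g (v (Suc i) w) = v i w - v (Suc i) w"
 by (simp add: g_def F_v)

text \<open>The second derivative behaves like \<open>\<gamma> * (1 + \<gamma>) * x powr (\<gamma> - 1) * \<rho> x\<close>, so that \<open>F\<close> is convex near \<open>0\<close>.\<close>

lemma near_convex:
 "\<exists>d>0. d < 1/2 \<and> (\<forall>x\<in>{0<..d}. 0 <= F'' x \<and> F'' x <= 4 * x powr (\<gamma> - 1) \<and> F x <= 2 * x)"
proof -
 define \<epsilon> where "\<epsilon> = min 1 (\<gamma> * (1 + \<gamma>) / (2 * (1 + \<gamma>) + 1))"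
 have e: "\<epsilon> > 0" "\<epsilon> <= 1" "(2 * (1 + \<gamma>) + 1) * \<epsilon> <= \<gamma> * (1 + \<gamma>)"
 proof -
  have q: "2 * (1 + \<gamma>) + 1 > 0" "\<gamma> * (1 + \<gamma>) > 0" using gamma_pos by auto
  then show "\<epsilon> > 0" "\<epsilon> <= 1" by (auto simp: \<epsilon>_def)
  have "(2 * (1 + \<gamma>) + 1) * \<epsilon> <= (2 * (1 + \<gamma>) + 1) * (\<gamma> * (1 + \<gamma>) / (2 * (1 + \<gamma>) + 1))"
   using q by (intro mult_left_mono) (auto simp: \<epsilon>_def)
  then show "(2 * (1 + \<gamma>) + 1) * \<epsilon> <= \<gamma> * (1 + \<gamma>)" using q by simp
 qed
 obtain d where d: "d > 0" "!!x. 0 < x ==> x < d ==> x < 1 \<and> \<rho> x > 0 \<and> \<rho> x <= \<epsilon> \<and>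
    abs (x * deriv \<rho> x) <= \<epsilon> * \<rho> x \<and> abs (x^2 * deriv (deriv \<rho>) x) <= \<epsilon> * \<rho> x"
  using near_0[OF e(1)] unfolding eventually_at_right_field by fastforce
 have "0 <= F'' x \<and> F'' x <= 4 * x powr (\<gamma> - 1) \<and> F x <= 2 * x" if x: "x \<in> {0<..min (d/2) (1/4)}" for x
 proof -
  have dx: "\<rho> x > 0" "\<rho> x <= \<epsilon>" "abs (x * deriv \<rho> x) <= \<epsilon> * \<rho> x" "abs (x^2 * deriv (deriv \<rho>) x) <= \<epsilon> * \<rho> x"
   using d(2)[of x] x d(1) by (auto simp: min_def split: if_splits)
  let ?r = "2 * (1 + \<gamma>) * (x * deriv \<rho> x) + x^2 * deriv (deriv \<rho>) x"
  have "abs (?r) <= abs (2 * (1 + \<gamma>) * (x * deriv \<rho> x)) + abs (x^2 * deriv (deriv \<rho>) x)" by (rule abs_triangle_ineq)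
  also have "abs (2 * (1 + \<gamma>) * (x * deriv \<rho> x)) = 2 * (1 + \<gamma>) * abs (x * deriv \<rho> x)" using gamma_pos by (simp add: abs_mult)
  also have "... <= 2 * (1 + \<gamma>) * (\<epsilon> * \<rho> x)" using dx gamma_pos by (intro mult_left_mono) auto
  finally have "abs (?r) <= ((2 * (1 + \<gamma>) + 1) * \<epsilon>) * \<rho> x" using dx by (simp add: algebra_simps)
  also have "... <= (\<gamma> * (1 + \<gamma>)) * \<rho> x" using e dx by (intro mult_right_mono) auto
  finally have r: "abs (?r) <= \<gamma> * (1 + \<gamma>) * \<rho> x" .
  have lo: "0 <= \<gamma> * (1 + \<gamma>) * \<rho> x + ?r" using r by linarith
  have g2: "\<gamma> * (1 + \<gamma>) <= 1 * 2" using gamma_pos gamma_lt by (intro mult_mono) auto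
  have "\<gamma> * (1 + \<gamma>) * \<rho> x <= 2 * 1" using g2 dx e gamma_pos by (intro mult_mono) auto
  then have hi: "\<gamma> * (1 + \<gamma>) * \<rho> x + ?r <= 4" using r by linarith
  have "F'' x = x powr (\<gamma> - 1) * (\<gamma> * (1 + \<gamma>) * \<rho> x + ?r)" by (simp add: F''_def algebra_simps)
  moreover have "0 <= x powr (\<gamma> - 1) * (\<gamma> * (1 + \<gamma>) * \<rho> x + ?r)" using lo by simp
  moreover have "x powr (\<gamma> - 1) * (\<gamma> * (1 + \<gamma>) * \<rho> x + ?r) <= x powr (\<gamma> - 1) * 4" using hi by (intro mult_left_mono) auto
  moreover have "F x <= 2 * x"
  proof -
   have "x powr \<gamma> * \<rho> x <= 1 * 1" using x dx e gamma_pos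
    by (intro mult_mono powr_le1) auto
   then have "x * (1 + x powr \<gamma> * \<rho> x) <= x * 2" using x by (intro mult_left_mono) auto
   then show ?thesis using x by (simp add: F_def)
  qed
  ultimately show ?thesis by auto
 qed
 moreover have "min (d/2) (1/4) > 0" "min (d/2) (1/4) < (1/2::real)" using d by auto
 ultimately show ?thesis by blast
qed

lemma F''_bounded: assumes "a > 0" shows "\<exists>K\<ge>0. \<forall>x\<in>{a..1/2}. abs (F'' x) <= K"
proof (cases "a <= 1/2")
 case True
 have sub: "{a..1/2} \<subseteq> {0<..<1}" using assms by auto
 have "continuous_on {0<..<1} \<rho>"
  by (rule DERIV_continuous_on[where D="deriv \<rho>"]) (auto intro!: DERIV_subset[OF rho_deriv])
 moreover have "continuous_on {0<..<1} (deriv \<rho>)"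
  by (rule DERIV_continuous_on[where D="deriv (deriv \<rho>)"]) (auto intro!: DERIV_subset[OF rho_deriv2])
 ultimately have "continuous_on {a..1/2} F''"
  unfolding F''_def by (intro continuous_intros continuous_on_subset[OF _ sub] rho_C2) (use assms in auto)
 then have "bounded (F'' ` {a..1/2})" by (intro compact_imp_bounded compact_continuous_image) auto
 then obtain K where "\<forall>x\<in>{a..1/2}. abs (F'' x) <= K" by (auto simp: bounded_iff)
 then show ?thesis by (intro exI[of _ "max K 0"]) force
qed (auto intro!: exI[of _ 0])

lemma F'_ratio:
 assumes ab: "a \<in> {lo..hi}" "b \<in> {lo..hi}" "lo > 0" "hi <= 1/2" and K: "!!x. x \<in> {lo..hi} ==> abs (F'' x) <= K"
 shows "1 / F' a <= exp (K * abs (a - b)) * (1 / F' b)"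
proof -
 have "abs (F' b - F' a) <= K * abs (b - a)"
 proof -
  have "norm (F' b - F' a) <= K * norm (b - a)" by (rule field_differentiable_bound[of "{lo..hi}" F' F''])
     (use ab K in \<open>auto intro!: DERIV_subset[OF F'_deriv]\<close>)
  then show ?thesis by simp
 qed
 then have "F' b <= F' a + K * abs (a - b)" by (simp add: abs_minus_commute)
 also have "... <= F' a * (1 + K * abs (a - b))"
 proof -
  have "K >= 0" using K[OF ab(1)] by simp
  then have "1 * (K * abs (a - b)) <= F' a * (K * abs (a - b))" using F'_ge_1[of a] ab by (intro mult_right_mono) auto
  then show ?thesis by (simp add: algebra_simps)
 qed
 also have "... <= F' a * exp (K * abs (a - b))" using F'_ge_1[of a] ab by (intro mult_left_mono) auto
 finally have "F' b <= F' a * exp (K * abs (a - b))" .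
 then show ?thesis using F'_ge_1[of a] F'_ge_1[of b] ab by (simp add: field_simps)
qed

definition P :: "nat => real => real" where "P k w = (\<Prod>j<k. 1 / F' (v (Suc j) w))"

lemma inv_F'_v: assumes "w \<in> {0..1}" shows "0 < 1 / F' (v (Suc j) w)" "1 / F' (v (Suc j) w) <= 1"
 using F'_ge_1[OF v_range_half[OF assms, of j]] by (auto simp: divide_simps)
lemma P_pos: "w \<in> {0..1} ==> P k w > 0"
 unfolding P_def by (intro prod_pos ballI inv_F'_v)
lemma P_le_1: "w \<in> {0..1} ==> P k w <= 1"
 unfolding P_def by (intro prod_le_1 conjI inv_F'_v less_imp_le[OF inv_F'_v(1)])
lemma P_Suc: "P (Suc k) w = P k w / F' (v (Suc k) w)" by (simp add: P_def)

lemma y0_deriv: assumes "x \<in> {0<..<1}" shows "(y0 has_real_derivative 1 / F' (y0 x)) (at x)"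
proof -
 have y: "y0 x \<in> {0..<1}" using y0_range[of x] assms by auto
 have cont: "isCont y0 x"
 proof -
  have "continuous_on {0..1} y0" unfolding continuous_on_iff
  proof (intro ballI allI impI)
   fix a e :: real assume "a \<in> {0..1}" "e > 0"
   then show "\<exists>d>0. \<forall>x'\<in>{0..1}. dist x' a < d --> dist (y0 x') (y0 a) < e"
    using y0_contract by (intro exI[of _ e]) (force simp: dist_real_def)
  qed
  then show ?thesis using assms by (intro continuous_on_interior[of "{0..1}"]) auto
 qed
 have "(y0 has_real_derivative inverse (F' (y0 x))) (at x)" by (rule DERIV_inverse_function[of F _ _ _ 0 1])
    (use F_deriv[OF y] F'_ge_1[OF y0_range[of x]] assms cont F_y0 in auto)
 then show ?thesis by (simp add: divide_inverse)
qed

lemma v_deriv: assumes "w \<in> {0<..<1}" shows "(v k w \<in> {0<..<1}) \<and> (v k has_real_derivative P k w) (at w)"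
proof (induction k)
 case 0 then show ?case using assms by (simp add: v_def P_def)
next
 case (Suc k)
 have r: "v (Suc k) w \<in> {0<..<1}" using v_pos[of w "Suc k"] v_range_half[of w k] assms by auto
 have "((%w. y0 (v k w)) has_real_derivative 1 / F' (y0 (v k w)) * P k w) (at w)"
  using Suc by (intro DERIV_chain2[OF y0_deriv]) auto
 then show ?case using r by (simp add: P_Suc v_Suc[abs_def])
qed

text \<open>A mean value estimate for the inverse iterates, whose derivative is \<open>P k\<close>.\<close>

lemma v_diff:
 assumes "a \<in> {1/2..1}" "b \<in> {1/2..1}" and B: "!!w. w \<in> {1/2..1} ==> P k w <= B"
 shows "abs (v k a - v k b) <= B * abs (a - b)"
proof -
 have *: "v k b - v k a <= B * (b - a)" if ab: "a < b" "a \<in> {1/2..1}" "b \<in> {1/2..1}" for a b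
 proof -
  have cont: "continuous_on {a..b} (v k)" unfolding continuous_on_iff
  proof (intro ballI allI impI)
   fix x e :: real assume x: "x \<in> {a..b}" and e: "e > 0"
   have "dist (v k x') (v k x) <= dist x' x" if "x' \<in> {a..b}" for x'
    using v_contract[of x' x k] that x \<open>a \<in> _\<close> \<open>b \<in> _\<close> by (auto simp: dist_real_def)
   then show "\<exists>d>0. \<forall>x'\<in>{a..b}. dist x' x < d --> dist (v k x') (v k x) < e"
    using e by (intro exI[of _ e]) (meson le_less_trans)
  qed
  obtain l z where z: "a < z" "z < b" "(v k has_real_derivative l) (at z)" "v k b - v k a = (b - a) * l"
  proof -
   have "v k differentiable (at x)" if "a < x" "x < b" for x
    using v_deriv[of x k] that ab real_differentiable_def by auto
   from MVT[OF ab(1) cont this] show ?thesis using that by blast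
  qed
  have "l = P k z" using v_deriv[of z k] z that by (auto intro: DERIV_unique)
  then have "l <= B" using B[of z] z that by auto
  then show ?thesis using z that by (simp add: mult.commute mult_left_mono)
 qed
 show ?thesis
  using *[of a b] *[of b a] v_mono[of a b k] v_mono[of b a k] assms(1,2)
  by (cases a b rule: linorder_cases) (auto simp: abs_if not_less)
qed

lemma v_1_LIMSEQ: "(%k. v k 1) ~> 0"
proof -
 obtain A where A: "A > 0" "\<forall>k. v k 1 <= A * (real k + 1) powr (- (1 / (2 * \<gamma>)))"
  using tail_decay[of "2 * \<gamma>"] gamma_pos by auto
 have "filterlim (%k. real k + 1) at_top sequentially"
  using filterlim_compose[OF filterlim_real_sequentially filterlim_Suc] by (simp add: add.commute)
 then have "(%k. (real k + 1) powr (- (1 / (2 * \<gamma>)))) ~> 0" using gamma_pos by (intro tendsto_neg_powr) auto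
 then have "(%k. A * (real k + 1) powr (- (1 / (2 * \<gamma>)))) ~> 0" by (rule tendsto_mult_right_zero)
 then show ?thesis
  by (rule tendsto_sandwich[OF _ _ tendsto_const, rotated -1])
    (use A v_range[of 1] in \<open>auto intro!: always_eventually\<close>)
qed

text \<open>With \<open>g x = F x - x\<close>, convexity gives \<open>g (F y) \<le> F' (F y) * g y\<close>, and this telescopes along the orbit to
  \<open>P j w \<le> R * g (v j w)\<close>: derivatives of inverse iterates are comparable to the lengths \<open>g\<close> of the fundamental domains.
  These lengths are summable together with the weight \<open>F''\<close>, which bounds the distortion.\<close>

lemma distortion:
 "\<exists>\<Delta>\<ge>0. \<forall>k. \<forall>a\<in>{1/2..1}. \<forall>b\<in>{1/2..1}. P k a <= exp (\<Delta> * abs (a - b)) * P k b"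
proof -
 obtain d where d: "d > 0" "d < 1/2"
  and dd: "!!x. x \<in> {0<..d} ==> 0 <= F'' x \<and> F'' x <= 4 * x powr (\<gamma> - 1) \<and> F x <= 2 * x"
  using near_convex by blast
 let ?x = "%k. v k 1"
 obtain i0 where "\<forall>j\<ge>i0. ?x j < d"
  using order_tendstoD(2)[OF v_1_LIMSEQ d(1)] by (auto simp: eventually_sequentially)
 then have xd: "?x j <= d" if "j >= i0" for j using that by force
 have xpos: "?x j > 0" for j by (rule v_pos) auto
 have vle: "v j w <= ?x j" "?x (Suc j) <= v j w" if "w \<in> {1/2..1}" for j w
  using v_mono[of w 1 j] v_mono[of "1/2" w j] that by (auto simp: v_half)
 have vpos: "v j w > 0" if "w \<in> {1/2..1}" for j w using v_pos[of w j] that by auto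
 have F'_mono: "F' a <= F' b" if "0 < a" "a <= b" "b <= d" for a b
  by (rule DERIV_nonneg_imp_nondecreasing[OF that(2)]) (use that d dd F'_deriv in force)
 have upper: "F b - F a <= F' b * (b - a)" if ab: "0 < a" "a <= b" "b <= d" for a b
 proof (cases "a = b")
  case False
  then obtain z where z: "a < z" "z < b" "F b - F a = (b - a) * F' z" using MVT2[of a b F F'] F_deriv ab d by auto
  then have "F' z <= F' b" using F'_mono[of z b] ab by auto
  then show ?thesis using z ab by (simp add: mult.commute mult_left_mono)
 qed simp
 have "bounded (F' ` {0..1/2})" using F'_cont by (intro compact_imp_bounded compact_continuous_image) auto
 then obtain M where "\<forall>y\<in>F' ` {0..1/2}. norm y <= M" unfolding bounded_iff by blast
 then have M: "abs (F' x) <= M" if "x \<in> {0..1/2}" for x using that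
  using \<open>\<forall>y\<in>F' ` {0..1/2}. norm y <= M\<close> by (metis imageI real_norm_def)
 have M1: "M >= 1" using M[of 0] F'_ge_1[of 0] by auto
 have gpos: "g (?x (Suc i0)) > 0"
 proof -
  have "?x (Suc i0) < ?x i0"
  proof -
   have "F (?x (Suc i0)) > ?x (Suc i0)"
   proof -
    obtain c where c: "c > 0" "\<forall>x\<in>{0..1/2}. F x >= x * (1 + c * x powr (2 * \<gamma>))"
     using F_lower[of "2 * \<gamma>"] gamma_pos by auto
    have "?x (Suc i0) * 1 < ?x (Suc i0) * (1 + c * ?x (Suc i0) powr (2 * \<gamma>))"
     using c xpos[of "Suc i0"] by (intro mult_strict_left_mono) auto
    also have "... <= F (?x (Suc i0))" using c v_range_half[of 1 i0] by simp
    finally show ?thesis by simp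
   qed
   then show ?thesis by (simp add: F_v)
  qed
  then show ?thesis by (simp add: g_v)
 qed
 define R where "R = M / g (?x (Suc i0))"
 have R: "R >= 0" using gpos M1 by (simp add: R_def)
 (* the induction starts at i0 because the branch is convex below d only *)
 have PR: "P j w * F' (v j w) <= R * g (v j w)" if "j >= i0" and w: "w \<in> {1/2..1}" for j w
  using \<open>j >= i0\<close>
 proof (induction j rule: dec_induct)
  case base
  have r: "v i0 w \<in> {0..1/2}" using vle(1)[OF w, of i0] vpos[OF w, of i0] xd[of i0] d by auto
  have "P i0 w * F' (v i0 w) <= 1 * M" using P_le_1[of w i0] M[OF r] F'_ge_1[OF r] w by (intro mult_mono) auto
  also have "... = R * g (?x (Suc i0))" using gpos by (simp add: R_def)
  also have "... <= R * g (v i0 w)"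
   using R vle(2)[OF w, of i0] xpos[of "Suc i0"] r by (intro mult_left_mono g_mono) auto
  finally show ?case .
 next
  case (step j)
  have r: "v j w \<in> {0..1/2}" "v (Suc j) w \<in> {0..1/2}"
   using vle(1)[OF w, of j] vpos[OF w, of j] xd[of j] step(1) d v_range_half[of w j] w by auto
  have F1: "F' (v j w) >= 1" "F' (v (Suc j) w) >= 1" using F'_ge_1 r by auto
  have w1: "w \<in> {0..1}" using w by auto
  have "P (Suc j) w * F' (v (Suc j) w) = P j w" using F1 by (simp add: P_Suc)
  moreover have "P j w * F' (v j w) <= R * (g (v (Suc j) w) * F' (v j w))"
  proof -
   have "g (v j w) = F (v j w) - F (v (Suc j) w)" using F_v[OF w1] by (simp add: g_def)
   also have "... <= F' (v j w) * (v j w - v (Suc j) w)"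
    using upper[of "v (Suc j) w" "v j w"] vpos[OF w, of "Suc j"] v_Suc_le[OF w1, of j] vle(1)[OF w, of j] xd[of j] step(1) by auto
   also have "... = g (v (Suc j) w) * F' (v j w)" using g_v[OF w1] by simp
   finally show ?thesis using step(3) R by (meson mult_left_mono order_trans)
  qed
  ultimately show ?case using F1 by (simp flip: mult.assoc)
 qed
 have Pb: "P j w <= R * g (?x j)" if "j >= i0" and w: "w \<in> {1/2..1}" for j w
 proof -
  have r: "v j w \<in> {0..1/2}" using vle(1)[OF w, of j] vpos[OF w, of j] xd[of j] d that by auto
  have "P j w * 1 <= P j w * F' (v j w)" using P_pos[of w j] w F'_ge_1[OF r] by (intro mult_left_mono) auto
  also have "... <= R * g (v j w)" using PR that by blast
  also have "... <= R * g (?x j)" using R r vle(1)[OF w, of j] xd[of j] d that by (intro mult_left_mono g_mono) auto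
  finally show ?thesis by simp
 qed
 obtain K0 where K0: "K0 >= 0" "!!x. x \<in> {?x (Suc i0)..1/2} ==> abs (F'' x) <= K0"
  using F''_bounded[OF xpos] by blast
 define c where "c = 16 * R / \<gamma>"
 have c: "c >= 0" using R gamma_pos by (simp add: c_def)
 define \<kappa> where "\<kappa> j = (if j < i0 then K0 else 0) + c * (?x j powr \<gamma> - ?x (Suc j) powr \<gamma>)" for j
 have dec: "?x (Suc j) <= ?x j" for j by (rule v_Suc_le) simp
 have decp: "?x (Suc j) powr \<gamma> <= ?x j powr \<gamma>" for j using dec xpos gamma_pos by (intro powr_mono2) (auto intro: less_imp_le)
 have one: "1 / F' (v (Suc j) a) <= exp (\<kappa> j * abs (a - b)) * (1 / F' (v (Suc j) b))"
  if a: "a \<in> {1/2..1}" and b: "b \<in> {1/2..1}" for a b j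
 proof (cases "j < i0")
  case True
  have mono: "?x (Suc i0) <= ?x (Suc (Suc j))"
   using lift_Suc_antimono_le[of ?x "Suc (Suc j)" "Suc i0", OF dec] True by auto
  have hi: "v (Suc j) w <= 1/2" if "w \<in> {1/2..1}" for w using v_range_half[of w j] that by auto
  have "1 / F' (v (Suc j) a) <= exp (K0 * abs (v (Suc j) a - v (Suc j) b)) * (1 / F' (v (Suc j) b))"
   by (rule F'_ratio[of _ "?x (Suc i0)" "1/2"])
     (use vle(2)[OF a, of "Suc j"] vle(2)[OF b, of "Suc j"] mono hi a b xpos K0 in auto)
  also have "... <= exp (\<kappa> j * abs (a - b)) * (1 / F' (v (Suc j) b))"
  proof -
   have "K0 * abs (v (Suc j) a - v (Suc j) b) <= K0 * abs (a - b)"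
    using v_contract[of a b "Suc j"] a b K0 by (intro mult_left_mono) auto
   also have "... <= \<kappa> j * abs (a - b)" using True decp[of j] c by (intro mult_right_mono) (auto simp: \<kappa>_def)
   finally show ?thesis using F'_ge_1[OF v_range_half[of b j]] b by (intro mult_right_mono) auto
  qed
  finally show ?thesis .
 next
  case False
  then have j: "j >= i0" by simp
  let ?lo = "?x (Suc (Suc j))" and ?hi = "?x (Suc j)"
  have hid: "?hi <= d" using xd[of "Suc j"] j by simp
  have "1 / F' (v (Suc j) a) <= exp (4 * ?lo powr (\<gamma> - 1) * abs (v (Suc j) a - v (Suc j) b)) * (1 / F' (v (Suc j) b))"
  proof (rule F'_ratio[of _ ?lo ?hi])
   fix x assume x: "x \<in> {?lo..?hi}"
   then have x0: "x \<in> {0<..d}" using hid xpos[of "Suc (Suc j)"] by auto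
   have "x powr (\<gamma> - 1) <= ?lo powr (\<gamma> - 1)" using x xpos gamma_lt by (intro powr_mono2') auto
   then show "abs (F'' x) <= 4 * ?lo powr (\<gamma> - 1)" using dd[OF x0] by auto
  qed (use vle[OF a, of "Suc j"] vle[OF b, of "Suc j"] xpos hid d in auto)
  also have "... <= exp (\<kappa> j * abs (a - b)) * (1 / F' (v (Suc j) b))"
  proof -
   have 1: "abs (v (Suc j) a - v (Suc j) b) <= R * g ?hi * abs (a - b)" by (rule v_diff[OF a b]) (use Pb j in auto)
   have 2: "?x j <= 4 * ?lo"
    using dd[of ?hi] dd[of ?lo] F_v[of 1 j] F_v[of 1 "Suc j"] hid xpos dec[of "Suc j"] by auto
   have 3: "?lo powr (\<gamma> - 1) <= 4 * ?x j powr (\<gamma> - 1)"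
   proof -
    have "?lo powr (\<gamma> - 1) <= (?x j / 4) powr (\<gamma> - 1)"
     using 2 xpos[of j] gamma_lt by (intro powr_mono2') auto
    also have "... = ?x j powr (\<gamma> - 1) * 4 powr (1 - \<gamma>)"
     using xpos[of j] by (simp add: powr_divide powr_diff field_simps)
    also have "... <= ?x j powr (\<gamma> - 1) * 4 powr 1" using gamma_pos by (intro mult_left_mono powr_mono) auto
    finally show ?thesis by simp
   qed
   have 4: "\<gamma> * ?x j powr (\<gamma> - 1) * (?x j - ?hi) <= ?x j powr \<gamma> - ?hi powr \<gamma>"
   proof (cases "?hi = ?x j")
    case False
    then have lt: "?hi < ?x j" using dec[of j] by simp
    obtain z where z: "?hi < z" "z < ?x j" "?x j powr \<gamma> - ?hi powr \<gamma> = (?x j - ?hi) * (\<gamma> * z powr (\<gamma> - 1))"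
     using MVT2[OF lt, of "%x. x powr \<gamma>" "%x. \<gamma> * x powr (\<gamma> - 1)"] has_real_derivative_powr xpos[of "Suc j"] by force
    have "?x j powr (\<gamma> - 1) <= z powr (\<gamma> - 1)" using z xpos[of "Suc j"] gamma_lt by (intro powr_mono2') auto
    then have "(?x j - ?hi) * (\<gamma> * ?x j powr (\<gamma> - 1)) <= (?x j - ?hi) * (\<gamma> * z powr (\<gamma> - 1))"
     using gamma_pos lt by (intro mult_left_mono) auto
    then show ?thesis using z by (simp add: mult_ac)
   qed simp
   have ghi: "g ?hi = ?x j - ?hi" by (rule g_v) simp
   have "4 * ?lo powr (\<gamma> - 1) * abs (v (Suc j) a - v (Suc j) b) <= 4 * (4 * ?x j powr (\<gamma> - 1)) * (R * g ?hi * abs (a - b))"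
    using 1 3 by (intro mult_mono) auto
   also have "... = c * (\<gamma> * ?x j powr (\<gamma> - 1) * (?x j - ?hi)) * abs (a - b)"
    using gamma_pos by (simp add: c_def ghi)
   also have "... <= c * (?x j powr \<gamma> - ?hi powr \<gamma>) * abs (a - b)"
    using 4 c by (intro mult_right_mono mult_left_mono) auto
   also have "... = \<kappa> j * abs (a - b)" using j by (simp add: \<kappa>_def)
   finally show ?thesis using F'_ge_1[OF v_range_half[of b j]] b by (intro mult_right_mono) auto
  qed
  finally show ?thesis .
 qed
 define \<Delta> where "\<Delta> = real i0 * K0 + c"
 have sum: "(\<Sum>j<k. \<kappa> j) <= \<Delta>" for k
 proof -
  have "(\<Sum>j<k. if j < i0 then K0 else 0) <= (\<Sum>j<i0. K0)"
  proof -
   have "(\<Sum>j<k. if j < i0 then K0 else 0) = (\<Sum>j\<in>{..<k} \<inter> {j. j < i0}. K0)" by (subst sum.If_cases) auto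
   also have "... <= (\<Sum>j<i0. K0)" using K0 by (intro sum_mono2) auto
   finally show ?thesis .
  qed
  moreover have "(\<Sum>j<k. c * (?x j powr \<gamma> - ?x (Suc j) powr \<gamma>)) <= c"
  proof -
   have "(\<Sum>j<k. ?x j powr \<gamma> - ?x (Suc j) powr \<gamma>) = 1 - ?x k powr \<gamma>"
    using sum_lessThan_telescope'[of "%j. ?x j powr \<gamma>" k] by simp
   then have "(\<Sum>j<k. ?x j powr \<gamma> - ?x (Suc j) powr \<gamma>) <= 1" by simp
   then have "c * (\<Sum>j<k. ?x j powr \<gamma> - ?x (Suc j) powr \<gamma>) <= c * 1" using c by (rule mult_left_mono)
   then show ?thesis by (simp add: sum_distrib_left)
  qed
  ultimately show ?thesis by (simp add: \<kappa>_def sum.distrib \<Delta>_def)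
 qed
 have "P k a <= exp (\<Delta> * abs (a - b)) * P k b" if a: "a \<in> {1/2..1}" and b: "b \<in> {1/2..1}" for k a b
 proof -
  have "P k a <= (\<Prod>j<k. exp (\<kappa> j * abs (a - b)) * (1 / F' (v (Suc j) b)))" unfolding P_def
  proof (intro prod_mono conjI)
   fix j show "0 <= 1 / F' (v (Suc j) a)" using inv_F'_v(1)[of a j] a by simp
  qed (rule one[OF a b])
  also have "... = exp ((\<Sum>j<k. \<kappa> j) * abs (a - b)) * P k b"
   by (simp only: prod.distrib P_def exp_sum[OF finite_lessThan] sum_distrib_right)
  also have "... <= exp (\<Delta> * abs (a - b)) * P k b"
   using sum[of k] P_pos[of b k] b by (intro mult_right_mono exp_le_cancel_iff[THEN iffD2]) auto
  finally show ?thesis .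
 qed
 moreover have "\<Delta> >= 0" using K0 c by (simp add: \<Delta>_def)
 ultimately show ?thesis by blast
qed

end

section \<open>The transfer operator of a Holland map\<close>

context holland begin

definition d0 :: "real => real" where "d0 x = 1 / F' (y0 x)"

lemma left_op_power: "(left_op y0 d0 ^^ k) u = (%x. P k x * u (v k x))"
proof (induction k arbitrary: u)
 case 0 then show ?case by (simp add: P_def)
next
 case (Suc k)
 have "(left_op y0 d0 ^^ Suc k) u = (left_op y0 d0 ^^ k) (left_op y0 d0 u)" by (simp add: funpow_swap1)
 also have "... = (%x. P k x * left_op y0 d0 u (v k x))" by (rule Suc)
 also have "... = (%x. P (Suc k) x * u (v (Suc k) x))" by (simp add: left_op_def d0_def P_Suc v_Suc)
 finally show ?case .
qed

text \<open>The right branch halves the logarithmic Lipschitz constant of a density, and the excursion adds only the distortion \<open>\<Delta>\<close>.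
  Therefore \<open>3/2 * D\<close> returns to \<open>D\<close> as soon as \<open>D \<ge> 2 * \<Delta>\<close>.\<close>

lemma cone_return_exists:
 "\<exists>D>0. \<forall>u k. u \<in> cone (3/2 * D) --> right_op ((left_op y0 d0 ^^ k) u) \<in> cone D"
proof -
 obtain \<Delta> where \<Delta>: "\<Delta> >= 0" "!!k a b. a \<in> {1/2..1} ==> b \<in> {1/2..1} ==> P k a <= exp (\<Delta> * abs (a - b)) * P k b"
  using distortion by blast
 define D where "D = max 1 (2 * \<Delta>)"
 have D: "D > 0" "\<Delta> <= D / 2" by (auto simp: D_def)
 have "right_op ((left_op y0 d0 ^^ k) u) \<in> cone D" if u: "u \<in> cone (3/2 * D)" for u k unfolding cone_def
 proof (intro CollectI ballI conjI)
  fix x y :: real assume x: "x \<in> {0..1}" and y: "y \<in> {0..1}"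
  define a b where "a = (1 + x) / 2" and "b = (1 + y) / 2"
  have d: "a - b = (x - y) / 2" unfolding a_def b_def by (simp add: diff_divide_distrib add_divide_distrib)
  have "a \<in> {1/2..1}" "b \<in> {1/2..1}" using x y by (auto simp: a_def b_def)
  moreover have "abs (a - b) = abs (x - y) / 2" unfolding d by simp
  ultimately have ab: "a \<in> {1/2..1}" "b \<in> {1/2..1}" "abs (a - b) = abs (x - y) / 2" by auto
  have ab1: "a \<in> {0..1}" "b \<in> {0..1}" using ab by auto
  have va: "v k a \<in> {0..1}" "v k b \<in> {0..1}" using v_range ab1 by auto
  have P0: "P k a > 0" "P k b > 0" using P_pos ab1 by auto
  have u0: "0 <= u (v k a)" "0 <= u (v k b)" using u va by (auto simp: cone_def)
  have val: "right_op ((left_op y0 d0 ^^ k) u) x = P k a * u (v k a) / 2" "right_op ((left_op y0 d0 ^^ k) u) y = P k b * u (v k b) / 2"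
   by (simp_all add: right_op_def left_op_power a_def b_def)
  show "0 <= right_op ((left_op y0 d0 ^^ k) u) x" unfolding val using P0 u0 by simp
  have "u (v k a) <= exp (3/2 * D * abs (v k a - v k b)) * u (v k b)" using u va by (auto simp: cone_def)
  also have "... <= exp (3/2 * D * (abs (x - y) / 2)) * u (v k b)"
   using v_contract[OF ab1, of k] ab(3) D u0 by (intro mult_right_mono) auto
  finally have 1: "u (v k a) <= exp (3/2 * D * (abs (x - y) / 2)) * u (v k b)" .
  have 2: "P k a <= exp (D / 2 * (abs (x - y) / 2)) * P k b"
  proof -
   have "P k a <= exp (\<Delta> * abs (a - b)) * P k b" by (rule \<Delta>(2)[OF ab(1,2)])
   also have "... <= exp (D / 2 * (abs (x - y) / 2)) * P k b"
    unfolding ab(3) using D P0 by (intro mult_right_mono exp_le_cancel_iff[THEN iffD2]) auto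
   finally show ?thesis .
  qed
  have "P k a * u (v k a) <= (exp (D / 2 * (abs (x - y) / 2)) * P k b) * (exp (3/2 * D * (abs (x - y) / 2)) * u (v k b))"
   using 1 2 P0 u0 by (intro mult_mono) auto
  also have "... = exp (D / 2 * (abs (x - y) / 2) + 3/2 * D * (abs (x - y) / 2)) * (P k b * u (v k b))"
   by (simp only: exp_add mult_ac)
  also have "D / 2 * (abs (x - y) / 2) + 3/2 * D * (abs (x - y) / 2) = D * abs (x - y)" by (simp add: field_simps)
  finally show "right_op ((left_op y0 d0 ^^ k) u) x <= exp (D * abs (x - y)) * right_op ((left_op y0 d0 ^^ k) u) y"
   unfolding val by simp
 qed
 with D show ?thesis by blast
qed

lemma y0_measurable: "y0 \<in> Lam \<rightarrow>\<^sub>M Lam"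
proof (rule measurable_Lam_Lam)
 have "mono_on {0..1} y0" using y0_mono by (auto intro: mono_onI)
 then have "y0 \<in> borel_measurable (restrict_space borel {0..1})" by (intro borel_measurable_mono_on_fnc) auto
 then show "y0 \<in> borel_measurable Lam" by (subst measurable_cong_sets[OF sets_Lam refl])
qed (use y0_range in force)

lemma f_measurable: "f \<in> Lam \<rightarrow>\<^sub>M Lam"
proof (rule measurable_Lam_Lam)
 have "mono_on {0..1} (%x. F (min x (1/2)))"
 proof (rule mono_onI)
  fix r s :: real assume "r \<in> {0..1}" "s \<in> {0..1}" "r <= s"
  then have "min s (1/2) - min r (1/2) <= F (min s (1/2)) - F (min r (1/2))" "min r (1/2) <= min s (1/2)"
   by (intro F_expand, auto)
  then show "F (min r (1/2)) <= F (min s (1/2))" by linarith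
 qed
 then have "(%x. F (min x (1/2))) \<in> borel_measurable (restrict_space borel {0..1})" by (intro borel_measurable_mono_on_fnc) auto
 then have m: "(%x. F (min x (1/2))) \<in> borel_measurable Lam" by (subst measurable_cong_sets[OF sets_Lam refl])
 have i: "(%x. if x <= 1/2 then 1 else 0 :: real) \<in> borel_measurable Lam" "(%x. 2 * x - 1 :: real) \<in> borel_measurable Lam"
  by (auto intro: borel_measurable_Lam)
 have "(%x. (if x <= 1/2 then 1 else 0) * F (min x (1/2)) + (1 - (if x <= 1/2 then 1 else 0)) * (2 * x - 1)) \<in> borel_measurable Lam"
  by (intro borel_measurable_add borel_measurable_times borel_measurable_diff borel_measurable_const m i)
 then show "f \<in> borel_measurable Lam"
  by (rule measurable_cong[THEN iffD1, rotated]) (use f_eq_F f_right in \<open>auto simp: min_def\<close>)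
qed (use f_maps in auto)

lemma d0_range: "x \<in> {0..1} ==> 0 <= d0 x \<and> d0 x <= 1"
 using F'_ge_1[OF y0_range[of x]] by (auto simp: d0_def divide_simps)

lemma d0_measurable: "d0 \<in> borel_measurable Lam"
proof -
 have "continuous_on UNIV (%x. F' (max 0 (min x (1/2))))"
  by (rule continuous_on_compose2[OF F'_cont]) (auto intro!: continuous_intros)
 then have "(%x. F' (max 0 (min x (1/2)))) \<in> borel_measurable borel" by (rule borel_measurable_continuous_onI)
 then have "(%x. F' (max 0 (min x (1/2)))) \<in> borel_measurable Lam" by (rule borel_measurable_Lam)
 from measurable_compose[OF y0_measurable this]
 have "(%x. 1 / F' (max 0 (min (y0 x) (1/2)))) \<in> borel_measurable Lam" by (intro borel_measurable_divide) auto
 then show ?thesis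
  by (rule measurable_cong[THEN iffD1, rotated]) (use y0_range in \<open>auto simp: d0_def max_def min_def\<close>)
qed

lemma d0_bm: "bmeas Lam d0" using d0_measurable d0_range by (intro bmeas_le_1) auto

lemma left_substitution:
 assumes G: "bmeas Lam G"
 shows "(LINT x|Lam. (if x <= 1/2 then G x else 0)) = (LINT x|Lam. d0 x * G (y0 x))"
proof -
 have b: "bmeas Lam (%x. d0 x * G (y0 x))" by (intro bmeas_mult d0_bm bmeas_comp[OF G y0_measurable])
 have "(LBINT x. (d0 x * G (y0 x)) * indicator {F 0..F (1/2)} x) = (LBINT x. (d0 (F x) * G (y0 (F x))) * F' x * indicator {0..1/2} x)"
  by (rule integral_substitution)
    (use bmeas_Lam_extend[OF b] F_deriv F'_cont F'_ge_1 in \<open>auto simp: set_integrable_def intro: order_trans[OF zero_le_one]\<close>)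
 also have "(LBINT x. (d0 x * G (y0 x)) * indicator {F 0..F (1/2)} x) = (LINT x|Lam. d0 x * G (y0 x))"
  unfolding integral_Lam by (simp add: mult.commute)
 also have "(LBINT x. (d0 (F x) * G (y0 (F x))) * F' x * indicator {0..1/2} x) = (LBINT x. indicator {0..1} x * (if x <= 1/2 then G x else 0))"
 proof (intro LINT_cong refl)
  fix x :: real
  show "(d0 (F x) * G (y0 (F x))) * F' x * indicator {0..1/2} x = indicator {0..1} x * (if x <= 1/2 then G x else 0)"
   using y0_F[of x] F'_ge_1[of x] by (auto simp: indicator_def d0_def)
 qed
 also have "... = (LINT x|Lam. (if x <= 1/2 then G x else 0))" by (rule integral_Lam[symmetric])
 finally show ?thesis by simp
qed

lemma initial_bmeas: "bmeas Lam u ==> bmeas Lam (%x. if x <= c then u x else 0)"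
proof -
 assume u: "bmeas Lam u"
 have "bmeas Lam (%x. if x <= c then 1 else 0 :: real)" by (intro bmeas_le_1 borel_measurable_Lam) auto
 from bmeas_mult[OF this u] show ?thesis by (rule bmeas_cong[THEN iffD1, rotated]) auto
qed

lemma integral_left_op:
 "bmeas Lam u ==> (LINT x|Lam. (left_op y0 d0 ^^ k) u x) = (LINT x|Lam. (if x <= v k 1 then u x else 0))"
proof (induction k arbitrary: u)
 case 0
 then show ?case by (intro LINT_cong) auto
next
 case (Suc k)
 have bL: "bmeas Lam (left_op y0 d0 u)"
  unfolding left_op_def by (intro bmeas_mult d0_bm bmeas_comp[OF Suc.prems y0_measurable])
 let ?G = "%x. if x <= v (Suc k) 1 then u x else 0"
 have "(LINT x|Lam. (left_op y0 d0 ^^ Suc k) u x) = (LINT x|Lam. (if x <= v k 1 then left_op y0 d0 u x else 0))"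
  using Suc.IH[OF bL] by (simp add: funpow_swap1)
 also have "... = (LINT x|Lam. d0 x * ?G (y0 x))"
 proof (intro LINT_cong refl)
  fix x assume "x \<in> space Lam"
  then have x: "x \<in> {0..1}" by simp
  have vk: "v k 1 \<in> {0..1}" by (rule v_range) simp
  have "y0 x <= y0 (v k 1) \<longleftrightarrow> x <= v k 1"
  proof
   assume "x <= v k 1" then show "y0 x <= y0 (v k 1)" using y0_mono x vk by simp
  next
   assume "y0 x <= y0 (v k 1)"
   then have "y0 (v k 1) - y0 x <= F (y0 (v k 1)) - F (y0 x)"
    using y0_range[OF x] y0_range[OF vk] by (intro F_expand) auto
   then show "x <= v k 1" using F_y0[OF x] F_y0[OF vk] \<open>y0 x <= y0 (v k 1)\<close> by linarith
  qed
  then show "(if x <= v k 1 then left_op y0 d0 u x else 0) = d0 x * ?G (y0 x)" by (simp add: left_op_def v_Suc)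
 qed
 also have "... = (LINT x|Lam. (if x <= 1/2 then ?G x else 0))" by (rule left_substitution[symmetric, OF initial_bmeas[OF Suc.prems]])
 also have "... = (LINT x|Lam. ?G x)" using v_range_half[of 1 k] by (intro LINT_cong) auto
 finally show ?case .
qed

lemma tail_measure: "(LINT x|Lam. (left_op y0 d0 ^^ k) (%_. 1) x) = v k 1"
proof -
 have vk: "v k 1 \<in> {0..1}" by (rule v_range) simp
 have "(LINT x|Lam. (left_op y0 d0 ^^ k) (%_. 1) x) = (LINT x|Lam. (if x <= v k 1 then 1 else 0))" by (rule integral_left_op) simp
 also have "... = (LINT x|lborel. indicator {0..v k 1} x)"
  unfolding integral_Lam using vk by (intro LINT_cong) (auto simp: indicator_def)
 also have "... = v k 1" using vk by simp
 finally show ?thesis .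
qed

theorem intermittent_exists:
 assumes "1 < s'" "s' < 1 / \<gamma> - 1"
 shows "\<exists>D C0. intermittent f y0 d0 D C0 s'"
proof -
 obtain D where D: "D > 0" "!!u k. u \<in> cone (3/2 * D) ==> right_op ((left_op y0 d0 ^^ k) u) \<in> cone D"
  using cone_return_exists by blast
 have "\<gamma> < 1 / (s' + 1)" using assms gamma_pos by (simp add: field_simps)
 from tail_decay[OF this] obtain A where A: "A > 0" "!!k. v k 1 <= A * (real k + 1) powr (- (s' + 1))" by auto
 have "intermittent f y0 d0 D A s'" by unfold_locales
    (use f_measurable f_right y0_range y0_mono f_eq_F F_y0 y0_F y0_measurable d0_measurable d0_range
     left_substitution D A assms tail_measure in auto)
 then show ?thesis by blast
qed

end

section \<open>Jordan decomposition\<close>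

text \<open>Both the variation up to \<open>x\<close> and its difference with the function are increasing.\<close>

lemma bounded_variation_decomposition:
 assumes "bounded_variation_on 0 1 \<phi>"
 shows "\<exists>g h. mono_on {0..1} g \<and> mono_on {0..1} h \<and> (\<forall>x\<in>{0..1}. \<phi> x = g x - h x)"
proof -
 define S where "S t = {\<Sum>i<n. abs (\<phi> (\<tau> (Suc i)) - \<phi> (\<tau> i)) | (n::nat) \<tau>. \<tau> ` {..n} \<subseteq> {0..t} \<and> mono_on {..n} \<tau>}" for t :: real
 obtain C where C: "!!(n::nat) \<tau>. \<tau> ` {..n} \<subseteq> {0..1} ==> mono_on {..n} \<tau> ==> (\<Sum>i<n. abs (\<phi> (\<tau> (Suc i)) - \<phi> (\<tau> i))) <= C"
  using assms unfolding bounded_variation_on_def by blast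
 have bdd: "bdd_above (S t)" if "t <= 1" for t
 proof (rule bdd_aboveI[of _ C])
  fix x assume "x \<in> S t"
  then obtain n :: nat and \<tau> where "x = (\<Sum>i<n. abs (\<phi> (\<tau> (Suc i)) - \<phi> (\<tau> i)))" "\<tau> ` {..n} \<subseteq> {0..t}" "mono_on {..n} \<tau>"
   by (auto simp: S_def)
  moreover have "{0..t} \<subseteq> {0..1}" using that by auto
  ultimately show "x <= C" using C by blast
 qed
 have ne: "S t ~= {}" if "0 <= t" for t
 proof -
  have "(\<Sum>i<(0::nat). abs (\<phi> ((%_. 0) (Suc i)) - \<phi> ((%_. 0) i))) \<in> S t"
   unfolding S_def using that by (intro CollectI exI[of _ 0] exI[of _ "%_. 0"]) (auto intro: mono_onI)
  then show ?thesis by auto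
 qed
 define V where "V t = Sup (S t)" for t
 have step: "V s + abs (\<phi> t - \<phi> s) <= V t" if st: "0 <= s" "s <= t" "t <= 1" for s t
 proof -
  have "x <= V t - abs (\<phi> t - \<phi> s)" if "x \<in> S s" for x
  proof -
   obtain n :: nat and \<tau> where x: "x = (\<Sum>i<n. abs (\<phi> (\<tau> (Suc i)) - \<phi> (\<tau> i)))" and \<tau>: "\<tau> ` {..n} \<subseteq> {0..s}" "mono_on {..n} \<tau>"
    using \<open>x \<in> S s\<close> by (auto simp: S_def)
   define \<tau>' where "\<tau>' i = (if i <= n then \<tau> i else if i = Suc n then s else t)" for i
   have le: "\<tau> i <= s" "0 <= \<tau> i" if "i <= n" for i using \<tau>(1) that by (auto simp: image_subset_iff)
   have "\<tau>' ` {..Suc (Suc n)} \<subseteq> {0..t}" using le st by (force simp: \<tau>'_def)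
   moreover have "mono_on {..Suc (Suc n)} \<tau>'"
   proof (rule mono_onI)
    fix i j assume "i \<in> {..Suc (Suc n)}" "j \<in> {..Suc (Suc n)}" "i <= j"
    then show "\<tau>' i <= \<tau>' j"
     using monotone_onD[OF \<tau>(2), of i j] le[of i] st by (auto simp: \<tau>'_def)
   qed
   ultimately have "(\<Sum>i<Suc (Suc n). abs (\<phi> (\<tau>' (Suc i)) - \<phi> (\<tau>' i))) \<in> S t" unfolding S_def by blast
   then have "(\<Sum>i<Suc (Suc n). abs (\<phi> (\<tau>' (Suc i)) - \<phi> (\<tau>' i))) <= V t"
    unfolding V_def using bdd[OF st(3)] by (rule cSup_upper)
   moreover have "(\<Sum>i<n. abs (\<phi> (\<tau>' (Suc i)) - \<phi> (\<tau>' i))) = x" unfolding x by (intro sum.cong) (auto simp: \<tau>'_def)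
   moreover have "abs (\<phi> (\<tau>' (Suc (Suc n))) - \<phi> (\<tau>' (Suc n))) = abs (\<phi> t - \<phi> s)" by (simp add: \<tau>'_def)
   moreover have "0 <= abs (\<phi> (\<tau>' (Suc n)) - \<phi> (\<tau>' n))" by simp
   ultimately show ?thesis unfolding sum.lessThan_Suc by linarith
  qed
  then have "V s <= V t - abs (\<phi> t - \<phi> s)" unfolding V_def[of s] by (intro cSup_least ne st)
  then show ?thesis by simp
 qed
 have "mono_on {0..1} V" using step by (intro mono_onI) force
 moreover have "mono_on {0..1} (%t. V t - \<phi> t)" using step by (intro mono_onI) force
 moreover have "\<forall>x\<in>{0..1}. \<phi> x = V x - (V x - \<phi> x)" by simp
 ultimately show ?thesis by blast
qed

section \<open>Birkhoff sums of a mixing observable\<close>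

text \<open>From here on the dynamics is only known through decay against the single observable \<open>\<phi>\<close> and mixing, both uniform over test functions of the future.\<close>

locale mixing_observable = prob_space M for M :: "real measure" +
 fixes f \<phi> :: "real => real" and C s :: real
 assumes f_meas: "f \<in> M \<rightarrow>\<^sub>M M" and f_inv: "distr M M f = M"
  and phi_bmeas: "bmeas M \<phi>" and phi_mean: "(LINT x|M. \<phi> x) = 0"
  and s_gt: "s > 1" and C_nonneg: "C >= 0"
  and decay: "!!n \<psi>. n >= 1 ==> \<psi> \<in> borel_measurable M ==> (!!x. x \<in> space M ==> abs (\<psi> x) <= 1) ==>
    abs (LINT x|M. \<phi> x * \<psi> ((f ^^ n) x)) <= C * n powr (- s)"
  and mixing: "!!g e. bmeas M g ==> e > 0 ==> \<exists>N. \<forall>n\<ge>N. \<forall>\<psi>\<in>borel_measurable M. (\<forall>x\<in>space M. abs (\<psi> x) <= 1) -->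
    abs ((LINT x|M. g x * \<psi> ((f ^^ n) x)) - (LINT x|M. g x) * (LINT x|M. \<psi> x)) <= e"
begin

abbreviation "S \<equiv> birkhoff_sum f \<phi>"

lemma fk_meas: "f ^^ k \<in> M \<rightarrow>\<^sub>M M"
 by (induction k) (auto simp: comp_def intro: measurable_compose[OF _ f_meas])

lemma fk_space: "x \<in> space M ==> (f ^^ k) x \<in> space M"
 using measurable_space[OF fk_meas] .

lemma bmeas_fk: "bmeas M u ==> bmeas M (%x. u ((f ^^ k) x))"
 by (rule bmeas_comp[OF _ fk_meas])

lemma invariant_1:
 fixes u :: "real => 'b::{banach, second_countable_topology}"
 assumes "u \<in> borel_measurable M" shows "(LINT x|M. u (f x)) = (LINT x|M. u x)"
 using integral_distr[OF f_meas assms] by (simp add: f_inv)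

lemma invariant:
 fixes u :: "real => 'b::{banach, second_countable_topology}"
 assumes "u \<in> borel_measurable M" shows "(LINT x|M. u ((f ^^ k) x)) = (LINT x|M. u x)"
proof (induction k)
 case (Suc k)
 have "(LINT x|M. u ((f ^^ k) (f x))) = (LINT x|M. u ((f ^^ k) x))"
  using measurable_compose[OF fk_meas assms] by (rule invariant_1)
 then show ?case using Suc by (simp add: funpow_swap1)
qed simp

definition Phi :: real where "Phi = (SOME B. B >= 1 \<and> (\<forall>x\<in>space M. abs (\<phi> x) <= B))"

lemma Phi: "Phi >= 1" "x \<in> space M ==> abs (\<phi> x) <= Phi"
proof -
 obtain B where "B >= 0" "!!x. x \<in> space M ==> abs (\<phi> x) <= B" using bmeasE[OF phi_bmeas] by metis
 then have "\<exists>B. B >= 1 \<and> (\<forall>x\<in>space M. abs (\<phi> x) <= B)" by (intro exI[of _ "max B 1"]) force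
 from someI_ex[OF this] show "Phi >= 1" "x \<in> space M ==> abs (\<phi> x) <= Phi" unfolding Phi_def by auto
qed

lemma S_0: "S 0 x = 0" by (simp add: birkhoff_sum_def)
lemma S_Suc: "S (Suc n) x = \<phi> x + S n (f x)"
 unfolding birkhoff_sum_def by (subst sum.lessThan_Suc_shift) (simp add: funpow_swap1)
lemma S_bmeas: "bmeas M (S n)"
 unfolding birkhoff_sum_def[abs_def] by (intro bmeas_sum bmeas_fk phi_bmeas)
lemma S_le: "x \<in> space M ==> abs (S n x) <= real n * Phi"
 unfolding birkhoff_sum_def by (rule order_trans[OF sum_abs]) (use sum_bounded_above[of "{..<n}" "%k. abs (\<phi> ((f ^^ k) x))" Phi] Phi(2) fk_space in auto)

end

section \<open>Moments of Birkhoff sums\<close>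

text \<open>Up to the factor \<open>r + 1\<close>, the derivative of \<open>|x| powr (r + 1)\<close>.\<close>

definition spw :: "real => real => real" where "spw r x = sgn x * abs x powr r"

lemma abs_powr_tendsto_0: assumes "r > 0" shows "((%h::real. abs h powr r) \<longlongrightarrow> 0) (at 0)"
proof -
 have "((%h::real. abs h) \<longlongrightarrow> 0) (at 0)" by (intro tendsto_eq_intros) auto
 from tendsto_powr'[OF this tendsto_const, of r] assms show ?thesis by (simp add: eventually_at_filter)
qed

lemma DERIV_abs_powr: assumes "q > 1" shows "((%x. abs x powr q) has_real_derivative q * spw (q - 1) x) (at x)"
proof (cases x "0::real" rule: linorder_cases)
 case equal
 have "((%h. (abs h powr q - abs 0 powr q) / (h - 0)) \<longlongrightarrow> 0) (at 0)"
 proof (rule Lim_null_comparison)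
  show "((%h::real. abs h powr (q - 1)) \<longlongrightarrow> 0) (at 0)" using assms by (intro abs_powr_tendsto_0) auto
  show "\<forall>\<^sub>F h in at 0. norm ((abs h powr q - abs 0 powr q) / (h - 0)) <= abs h powr (q - 1)"
   by (auto simp: eventually_at_filter powr_diff abs_mult)
 qed
 then show ?thesis by (simp add: equal has_field_derivative_iff spw_def)
next
 case less
 have "((%x. (- x) powr q) has_real_derivative q * spw (q - 1) x) (at x)"
  using less by (auto intro!: derivative_eq_intros simp: spw_def)
 then show ?thesis
  by (rule has_field_derivative_transform_within_open[where S = "{..<0}"]) (use less in auto)
next
 case greater
 have "((%x. x powr q) has_real_derivative q * spw (q - 1) x) (at x)"
  using greater by (auto intro!: derivative_eq_intros simp: spw_def)
 then show ?thesis
  by (rule has_field_derivative_transform_within_open[where S = "{0<..}"]) (use greater in auto)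
qed

lemma DERIV_spw: assumes "r > 1" shows "(spw r has_real_derivative r * abs x powr (r - 1)) (at x)"
proof (cases x "0::real" rule: linorder_cases)
 case equal
 have "((%h. (spw r h - spw r 0) / (h - 0)) \<longlongrightarrow> 0) (at 0)"
 proof (rule Lim_null_comparison)
  show "((%h::real. abs h powr (r - 1)) \<longlongrightarrow> 0) (at 0)" using assms by (intro abs_powr_tendsto_0) auto
  show "\<forall>\<^sub>F h in at 0. norm ((spw r h - spw r 0) / (h - 0)) <= abs h powr (r - 1)"
   by (auto simp: eventually_at_filter powr_diff abs_mult spw_def abs_sgn_eq)
 qed
 then show ?thesis using assms by (simp add: equal has_field_derivative_iff)
next
 case less
 have "((%x. - ((- x) powr r)) has_real_derivative r * abs x powr (r - 1)) (at x)"
  using less by (auto intro!: derivative_eq_intros)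
 then show ?thesis
  by (rule has_field_derivative_transform_within_open[where S = "{..<0}"]) (use less in \<open>auto simp: spw_def\<close>)
next
 case greater
 have "((%x. x powr r) has_real_derivative r * abs x powr (r - 1)) (at x)"
  using greater by (auto intro!: derivative_eq_intros)
 then show ?thesis
  by (rule has_field_derivative_transform_within_open[where S = "{0<..}"]) (use greater in \<open>auto simp: spw_def\<close>)
qed

lemma powr_add_le:
 assumes "0 <= a" "0 <= b" "q > 0" shows "((a::real) + b) powr q <= 2 powr q * (a powr q + b powr q)"
proof -
 have "(a + b) powr q <= (2 * max a b) powr q" using assms by (intro powr_mono2) auto
 also have "... = 2 powr q * max a b powr q" using assms by (simp add: powr_mult)
 also have "... <= 2 powr q * (a powr q + b powr q)" by (intro mult_left_mono) (auto simp: max_def)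
 finally show ?thesis .
qed

lemma spw_increment:
 assumes "q > 2" shows "abs (q * spw (q - 1) (a + x) - q * spw (q - 1) a) <= q * (q - 1) * abs x * (abs a + abs x) powr (q - 2)"
proof -
 let ?R = "abs a + abs x"
 have "norm (q * spw (q - 1) (a + x) - q * spw (q - 1) a) <= (q * (q - 1) * ?R powr (q - 2)) * norm (a + x - a)"
 proof (rule field_differentiable_bound[of "{-?R..?R}" "%z. q * spw (q - 1) z" "%z. q * ((q - 1) * abs z powr (q - 2))"])
  fix z assume "z \<in> {-?R..?R}"
  have d: "(spw (q - 1) has_real_derivative (q - 1) * abs z powr (q - 2)) (at z)"
   using DERIV_spw[of "q - 1" z] assms by simp
  show "((%z. q * spw (q - 1) z) has_field_derivative q * ((q - 1) * abs z powr (q - 2))) (at z within {-?R..?R})"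
   by (rule DERIV_subset[OF DERIV_cmult[OF d] subset_UNIV])
  have "abs z <= ?R" using \<open>z \<in> {-?R..?R}\<close> by auto
  then have "abs z powr (q - 2) <= ?R powr (q - 2)" using assms by (intro powr_mono2) auto
  then have "q * (q - 1) * abs z powr (q - 2) <= q * (q - 1) * ?R powr (q - 2)" using assms by (intro mult_left_mono) auto
  moreover have "norm (q * ((q - 1) * abs z powr (q - 2))) = q * (q - 1) * abs z powr (q - 2)" using assms by (simp add: abs_mult)
  ultimately show "norm (q * ((q - 1) * abs z powr (q - 2))) <= q * (q - 1) * ?R powr (q - 2)" by simp
 next
  show "a + x \<in> {-?R..?R}" "a \<in> {-?R..?R}" by (simp_all; arith)+
 qed simp
 then show ?thesis by (simp add: mult_ac)
qed

text \<open>Taylor expansion to second order. For \<open>2 < q < 3\<close> the second derivative is not differentiable, hence the crude remainder.\<close>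

lemma abs_powr_taylor:
 assumes "q > 2"
 shows "abs (a + x) powr q - abs a powr q <= x * (q * spw (q - 1) a) + q * (q - 1) * x^2 * (abs a + abs x) powr (q - 2)"
proof -
 have *: "\<exists>y. abs y <= abs x \<and> abs (a + x) powr q - abs a powr q = x * (q * spw (q - 1) (a + y))"
 proof (cases x "0::real" rule: linorder_cases)
  case less
  then have "a + x < a" by simp
  then obtain z where "a + x < z" "z < a" "abs a powr q - abs (a + x) powr q = (a - (a + x)) * (q * spw (q - 1) z)"
   using MVT2[of "a + x" a "%x. abs x powr q" "%x. q * spw (q - 1) x"] DERIV_abs_powr assms by auto
  then show ?thesis by (intro exI[of _ "z - a"]) auto
 next
  case greater
  then have "a < a + x" by simp
  then obtain z where "a < z" "z < a + x" "abs (a + x) powr q - abs a powr q = (a + x - a) * (q * spw (q - 1) z)"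
   using MVT2[of a "a + x" "%x. abs x powr q" "%x. q * spw (q - 1) x"] DERIV_abs_powr assms by auto
  then show ?thesis by (intro exI[of _ "z - a"]) auto
 qed auto
 then obtain y where y: "abs y <= abs x" "abs (a + x) powr q - abs a powr q = x * (q * spw (q - 1) (a + y))" by blast
 have "x * (q * spw (q - 1) (a + y)) - x * (q * spw (q - 1) a) <= abs (x * (q * spw (q - 1) (a + y) - q * spw (q - 1) a))"
  by (simp add: right_diff_distrib)
 also have "... = abs x * abs (q * spw (q - 1) (a + y) - q * spw (q - 1) a)" by (rule abs_mult)
 also have "... <= abs x * (q * (q - 1) * abs y * (abs a + abs y) powr (q - 2))"
  using spw_increment[OF assms] by (intro mult_left_mono) auto
 also have "... <= abs x * (q * (q - 1) * abs x * (abs a + abs x) powr (q - 2))"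
  using y assms by (intro mult_left_mono mult_mono powr_mono2) auto
 also have "... = q * (q - 1) * (abs x * abs x) * (abs a + abs x) powr (q - 2)" by (simp only: mult_ac)
 also have "abs x * abs x = x^2" by (simp add: power2_eq_square)
 finally show ?thesis using y(2) by simp
qed

context mixing_observable begin

text \<open>Decay is only available against bounded functions. Truncating \<open>\<Gamma>\<close> where \<open>Y > b\<close> and choosing \<open>b\<close> optimally turns
  it into decay against functions with a moment; the rate \<open>2 * s / q\<close> exceeds \<open>1\<close> exactly for \<open>q < 2 * s\<close>.\<close>

lemma truncated_decay:
 assumes q: "q > 2" and Y: "bmeas M Y" "!!x. x \<in> space M ==> Y x > 0" and m: "(LINT x|M. Y x powr q) <= m" "m > 0"
  and Gam: "bmeas M \<Gamma>" "!!x. x \<in> space M ==> abs (\<Gamma> x) <= Y x powr (q - 2)" and l: "l >= 1"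
 shows "abs (LINT x|M. \<phi> x * \<Gamma> ((f ^^ l) x)) <= (C + Phi) * m powr (1 - 2 / q) * l powr (- (2 * s / q))"
proof -
 have Yq: "bmeas M (%x. Y x powr r)" if "r >= 0" for r
 proof -
  obtain B where B: "B >= 0" "!!x. x \<in> space M ==> abs (Y x) <= B" using bmeasE[OF Y(1)] by metis
  have "abs (Y x powr r) <= B powr r" if x: "x \<in> space M" for x
   using B(2)[OF x] Y(2)[OF x] \<open>r >= 0\<close> by (auto intro!: powr_mono2)
  then show ?thesis using bmeas_measurable[OF Y(1)] by (intro bmeasI[of _ _ "B powr r"]) auto
 qed
 define b where "b = (m * l powr s) powr (1 / q)"
 have b: "b > 0" using m l by (simp add: b_def)
 have b1: "b powr (q - 2) * l powr (- s) = m powr (1 - 2 / q) * l powr (- (2 * s / q))"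
 proof -
  have "1 / q * (q - 2) = 1 - 2 / q" using q by (simp add: field_simps)
  then have "b powr (q - 2) = (m * l powr s) powr (1 - 2 / q)" by (simp add: b_def powr_powr)
  also have "... = m powr (1 - 2 / q) * l powr (s * (1 - 2 / q))" using m by (simp add: powr_mult powr_powr)
  finally have "b powr (q - 2) * l powr (- s) = m powr (1 - 2 / q) * (l powr (s * (1 - 2 / q)) * l powr (- s))" by simp
  also have "l powr (s * (1 - 2 / q)) * l powr (- s) = l powr (- (2 * s / q))" using l by (simp flip: powr_add) (simp add: algebra_simps)
  finally show ?thesis .
 qed
 have b2: "b powr (- 2) * m = m powr (1 - 2 / q) * l powr (- (2 * s / q))"
 proof -
  have "b powr (- 2) = (m * l powr s) powr (- (2 / q))" by (simp add: b_def powr_powr)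
  also have "... = m powr (- (2 / q)) * l powr (- (2 * s / q))" using m by (simp add: powr_mult powr_powr mult.commute)
  finally have "b powr (- 2) * m = (m powr (- (2 / q)) * m powr 1) * l powr (- (2 * s / q))" using m by simp
  also have "m powr (- (2 / q)) * m powr 1 = m powr (1 - 2 / q)" by (subst powr_add[symmetric]) simp
  finally show ?thesis .
 qed
 define ind where "ind x = (if Y x <= b then 1 else 0 :: real)" for x
 have indm: "bmeas M ind" unfolding ind_def using bmeas_measurable[OF Y(1)] by (intro bmeas_le_1) auto
 define G1 G2 where "G1 x = \<Gamma> x * ind x" and "G2 x = \<Gamma> x * (1 - ind x)" for x
 have Gb: "bmeas M G1" "bmeas M G2" unfolding G1_def[abs_def] G2_def[abs_def] by (intro bmeas_mult bmeas_diff Gam indm bmeas_const)+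
 have "(LINT x|M. \<phi> x * \<Gamma> ((f ^^ l) x)) = (LINT x|M. \<phi> x * G1 ((f ^^ l) x) + \<phi> x * G2 ((f ^^ l) x))"
  by (simp add: G1_def G2_def algebra_simps)
 also have "... = (LINT x|M. \<phi> x * G1 ((f ^^ l) x)) + (LINT x|M. \<phi> x * G2 ((f ^^ l) x))"
  by (intro LINT_add bmeas_integrable bmeas_mult phi_bmeas bmeas_fk Gb)
 finally have split: "(LINT x|M. \<phi> x * \<Gamma> ((f ^^ l) x)) = (LINT x|M. \<phi> x * G1 ((f ^^ l) x)) + (LINT x|M. \<phi> x * G2 ((f ^^ l) x))" .
 have p1: "abs (LINT x|M. \<phi> x * G1 ((f ^^ l) x)) <= C * (b powr (q - 2) * l powr (- s))"
 proof -
  have "abs (G1 x / b powr (q - 2)) <= 1" if x: "x \<in> space M" for x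
  proof -
   have "abs (G1 x) <= b powr (q - 2)"
   proof (cases "Y x <= b")
    case True
    then have "abs (G1 x) <= Y x powr (q - 2)" using Gam(2)[OF x] by (simp add: G1_def ind_def)
    also have "... <= b powr (q - 2)" using True Y(2)[OF x] q by (intro powr_mono2) auto
    finally show ?thesis .
   qed (simp add: G1_def ind_def)
   then show ?thesis using b by (simp add: field_simps)
  qed
  then have "abs (LINT x|M. \<phi> x * (G1 ((f ^^ l) x) / b powr (q - 2))) <= C * l powr (- s)"
   using bmeas_measurable[OF Gb(1)] by (intro decay[where \<psi> = "%x. G1 x / b powr (q - 2)"] l) auto
  then show ?thesis using b by (simp add: field_simps)
 qed
 have p2: "abs (LINT x|M. \<phi> x * G2 ((f ^^ l) x)) <= Phi * (b powr (- 2) * m)"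
 proof -
  have "abs (LINT x|M. \<phi> x * G2 ((f ^^ l) x)) <= (LINT x|M. abs (\<phi> x * G2 ((f ^^ l) x)))" by (rule integral_abs_bound)
  also have "... <= (LINT x|M. Phi * (b powr (- 2) * Y ((f ^^ l) x) powr q))"
  proof (intro integral_mono bmeas_integrable)
   show "bmeas M (%x. abs (\<phi> x * G2 ((f ^^ l) x)))" by (intro bmeas_abs bmeas_mult phi_bmeas bmeas_fk Gb)
   show "bmeas M (%x. Phi * (b powr (- 2) * Y ((f ^^ l) x) powr q))" using q by (intro bmeas_cmult bmeas_fk[of "%x. Y x powr q"] Yq) auto
   fix x assume x: "x \<in> space M"
   let ?y = "(f ^^ l) x"
   have y: "?y \<in> space M" by (rule fk_space[OF x])
   have "abs (G2 ?y) <= b powr (- 2) * Y ?y powr q"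
   proof (cases "Y ?y <= b")
    case True then show ?thesis by (simp add: G2_def ind_def)
   next
    case False
    have "abs (G2 ?y) <= Y ?y powr (q - 2)" using Gam(2)[OF y] False by (simp add: G2_def ind_def)
    also have "... = Y ?y powr (- 2) * Y ?y powr q" by (simp flip: powr_add)
    also have "... <= b powr (- 2) * Y ?y powr q" using False b by (intro mult_right_mono powr_mono2') auto
    finally show ?thesis .
   qed
   then show "abs (\<phi> x * G2 ?y) <= Phi * (b powr (- 2) * Y ?y powr q)"
    unfolding abs_mult using Phi(1) Phi(2)[OF x] by (intro mult_mono) auto
  qed
  also have "... = Phi * (b powr (- 2) * (LINT x|M. Y x powr q))"
   using invariant[of "%x. Y x powr q" l] bmeas_measurable[OF Yq[of q]] q by simp
  also have "... <= Phi * (b powr (- 2) * m)" using m Phi(1) by (intro mult_left_mono) auto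
  finally show ?thesis .
 qed
 show ?thesis unfolding split using p1 p2 unfolding b1 b2 by (simp add: algebra_simps)
qed

text \<open>Rio's inductive argument. By the Taylor expansion, the \<open>q\<close>-th moment of \<open>S (j + 1) = \<phi> + S j \<circ> f\<close> exceeds that of \<open>S j\<close> by a term
  linear in \<open>\<phi>\<close> and a quadratic one. In the linear term, \<open>|S j \<circ> f| powr (q - 1)\<close> (with sign) is written as a telescoping sum of functions of later and later
  times, to which \<open>truncated_decay\<close> applies. All errors are of order \<open>m powr (1 - 2/q)\<close>, where \<open>m\<close> is the inductive bound for time \<open>n\<close>, and
  summing \<open>n\<close> of them reproduces the bound \<open>n powr (q/2)\<close>.\<close>

theorem moment_bound:
 assumes q: "2 < q" "q < 2 * s"
 shows "\<exists>K\<ge>0. \<forall>n. (LINT x|M. abs (S n x) powr q) <= K * real n powr (q / 2)"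
proof -
 have "summable (%l. real l powr (- (2 * s / q)))" using q by (subst summable_real_powr_iff) (simp add: field_simps)
 then have sm: "summable (%l. real (Suc l) powr (- (2 * s / q)))" by (subst summable_Suc_iff)
 define Z where "Z = (\<Sum>l. real (Suc l) powr (- (2 * s / q)))"
 have Z: "(\<Sum>l<n. real (Suc l) powr (- (2 * s / q))) <= Z" for n unfolding Z_def by (intro sum_le_suminf sm) auto
 have Z0: "Z >= 0" using Z[of 0] by simp
 define c0 where "c0 = q * (q - 1) * Phi"
 have c0: "c0 > 0" using q Phi(1) by (simp add: c0_def)
 define K1 where "K1 = c0 * (C + Phi) * Z + 2 * c0 * Phi"
 have K1: "K1 > 0" using c0 C_nonneg Z0 Phi(1) by (auto simp: K1_def intro!: add_nonneg_pos mult_nonneg_nonneg)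
 define K where "K = max (Phi powr q) ((K1 * 2 powr ((q + 1) * (1 - 2 / q))) powr (q / 2))"
 have K: "K >= Phi powr q" "K > 0"
 proof -
  show "K >= Phi powr q" by (simp add: K_def)
  moreover have "Phi powr q > 0" using Phi(1) by simp
  ultimately show "K > 0" by linarith
 qed
 have KK: "K1 * 2 powr ((q + 1) * (1 - 2 / q)) <= K powr (2 / q)"
 proof -
  let ?B = "K1 * 2 powr ((q + 1) * (1 - 2 / q))"
  have "?B = (?B powr (q / 2)) powr (2 / q)" using K1 q by (simp add: powr_powr)
  also have "... <= K powr (2 / q)" using q by (intro powr_mono2) (auto simp: K_def)
  finally show ?thesis .
 qed
 have Sq: "bmeas M (%x. abs (S n x) powr q)" for n using q by (intro bmeas_abs_powr S_bmeas) auto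
 have spw_b: "bmeas M (%x. spw (q - 1) (u x))" if u: "bmeas M u" for u
 proof -
  obtain B where B: "B >= 0" "!!x. x \<in> space M ==> abs (u x) <= B" using bmeasE[OF u] by metis
  have "abs (spw (q - 1) (u x)) <= B powr (q - 1)" if "x \<in> space M" for x
  proof -
   have "abs (spw (q - 1) (u x)) <= abs (u x) powr (q - 1)" by (simp add: spw_def abs_mult abs_sgn_eq)
   also have "... <= B powr (q - 1)" using B(2)[OF that] q by (intro powr_mono2) auto
   finally show ?thesis .
  qed
  moreover have "(%x. spw (q - 1) (u x)) \<in> borel_measurable M"
   unfolding spw_def using bmeas_measurable[OF u] by measurable
  ultimately show ?thesis by (intro bmeasI[of _ _ "B powr (q - 1)"]) auto
 qed
 have "(LINT x|M. abs (S n x) powr q) <= K * real n powr (q / 2)" for n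
 proof (induction n rule: less_induct)
  case (less n)
  show ?case
  proof (cases "n = 0")
   case True then show ?thesis by (simp add: S_0)
  next
   case False
   (* m bounds the q-th moments of |S i| + Phi for all i < n *)
   define m where "m = 2 powr (q + 1) * K * real n powr (q / 2)"
   have n1: "real n powr (q / 2) >= 1" using False q by (intro ge_one_powr_ge_zero) auto
   have m: "m > 0" using K False by (simp add: m_def)
   have Ym: "(LINT x|M. (abs (S i (f x)) + Phi) powr q) <= m" if "i < n" for i
   proof -
    have "(LINT x|M. (abs (S i (f x)) + Phi) powr q) <= (LINT x|M. 2 powr q * (abs (S i (f x)) powr q + Phi powr q))"
    proof (intro integral_mono bmeas_integrable)
     have b1: "bmeas M (%x. abs (S i (f x)) powr q)" using bmeas_comp[OF Sq f_meas] .
     then show "bmeas M (%x. 2 powr q * (abs (S i (f x)) powr q + Phi powr q))" by (intro bmeas_cmult bmeas_add bmeas_const)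
     show "(abs (S i (f x)) + Phi) powr q <= 2 powr q * (abs (S i (f x)) powr q + Phi powr q)" for x
      using Phi(1) q by (intro powr_add_le) auto
     show "bmeas M (%x. (abs (S i (f x)) + Phi) powr q)"
     proof (rule bmeasI)
      show "(%x. (abs (S i (f x)) + Phi) powr q) \<in> borel_measurable M"
       using bmeas_measurable[OF bmeas_comp[OF S_bmeas f_meas]] by measurable
      fix x assume "x \<in> space M"
      then have "f x \<in> space M" using measurable_space[OF f_meas] by blast
      then show "abs ((abs (S i (f x)) + Phi) powr q) <= (real i * Phi + Phi) powr q"
       using S_le[of "f x" i] Phi(1) q by (auto intro!: powr_mono2)
     qed
    qed
    also have "... = 2 powr q * ((LINT x|M. abs (S i (f x)) powr q) + Phi powr q)"
     using bmeas_integrable[OF bmeas_comp[OF Sq f_meas]] prob_space by simp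
    also have "(LINT x|M. abs (S i (f x)) powr q) = (LINT x|M. abs (S i x) powr q)" using bmeas_measurable[OF Sq] by (rule invariant_1)
    also have "... <= K * real i powr (q / 2)" by (rule less.IH[OF that])
    also have "... <= K * real n powr (q / 2)" using K q that by (intro mult_left_mono powr_mono2) auto
    also have "Phi powr q <= K * real n powr (q / 2)" using K n1 mult_mono[of "Phi powr q" K 1 "real n powr (q / 2)"] by simp
    finally show ?thesis by (simp add: m_def powr_add algebra_simps)
   qed
   have incr: "(LINT x|M. abs (S (Suc j) x) powr q) - (LINT x|M. abs (S j x) powr q) <= K1 * m powr (1 - 2 / q)" if j: "j < n" for j
   proof -
    define Y where "Y i x = abs (S i (f x)) + Phi" for i x
    have Yb: "bmeas M (Y i)" for i unfolding Y_def[abs_def] by (intro bmeas_add bmeas_abs bmeas_const bmeas_comp[OF S_bmeas f_meas])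
    have Ypos: "Y i x > 0" for i x using Phi(1) by (simp add: Y_def add_nonneg_pos)
    have Yq: "bmeas M (%x. Y i x powr r)" if "r >= 0" for i r
    proof -
     obtain B where B: "B >= 0" "!!x. x \<in> space M ==> abs (Y i x) <= B" using bmeasE[OF Yb] by metis
     have "abs (Y i x powr r) <= B powr r" if "x \<in> space M" for x
      using B(2)[OF that] Ypos[of i x] \<open>r >= 0\<close> by (auto intro!: powr_mono2)
     then show ?thesis using bmeas_measurable[OF Yb] by (intro bmeasI[of _ _ "B powr r"]) auto
    qed
    let ?p' = "%z. q * spw (q - 1) z"
    have pb: "bmeas M (%x. ?p' (u x))" if "bmeas M u" for u using spw_b[OF that] by (rule bmeas_cmult)
    have Sfb: "bmeas M (%x. S i (f x))" for i by (rule bmeas_comp[OF S_bmeas f_meas])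
    define \<Gamma> where "\<Gamma> i x = (?p' (\<phi> x + S i (f x)) - ?p' (S i (f x))) / c0" for i x
    have \<Gamma>b: "bmeas M (\<Gamma> i)" for i unfolding \<Gamma>_def[abs_def] by (intro bmeas_divide bmeas_diff pb bmeas_add phi_bmeas Sfb)
    have \<Gamma>le: "abs (\<Gamma> i x) <= Y i x powr (q - 2)" if x: "x \<in> space M" for i x
    proof -
     have "abs (?p' (S i (f x) + \<phi> x) - ?p' (S i (f x))) <= q * (q - 1) * abs (\<phi> x) * (abs (S i (f x)) + abs (\<phi> x)) powr (q - 2)"
      by (rule spw_increment[OF q(1)])
     also have "... <= c0 * Y i x powr (q - 2)"
      unfolding Y_def c0_def using q Phi(2)[OF x] by (intro mult_mono powr_mono2) auto
     finally have "abs (?p' (\<phi> x + S i (f x)) - ?p' (S i (f x))) <= c0 * Y i x powr (q - 2)" by (simp only: add.commute)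
     then show ?thesis using c0 unfolding \<Gamma>_def by (simp only: abs_divide abs_of_pos divide_le_eq mult.commute if_True)
    qed
    have tele: "?p' (S j (f x)) = (\<Sum>l<j. c0 * \<Gamma> (j - Suc l) ((f ^^ Suc l) x))" for x
    proof (induction j arbitrary: x)
     case 0 then show ?case by (simp add: S_0 spw_def)
    next
     case (Suc j)
     have "?p' (S (Suc j) (f x)) = c0 * \<Gamma> j (f x) + ?p' (S j (f (f x)))" using c0 by (simp add: \<Gamma>_def S_Suc)
     also have "?p' (S j (f (f x))) = (\<Sum>l<j. c0 * \<Gamma> (j - Suc l) ((f ^^ Suc l) (f x)))" by (rule Suc)
     finally show ?case by (subst sum.lessThan_Suc_shift) (simp add: funpow_swap1)
    qed
    have lin: "abs (LINT x|M. \<phi> x * ?p' (S j (f x))) <= c0 * (C + Phi) * Z * m powr (1 - 2 / q)"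
    proof -
     have "(LINT x|M. \<phi> x * ?p' (S j (f x))) = (LINT x|M. (\<Sum>l<j. c0 * (\<phi> x * \<Gamma> (j - Suc l) ((f ^^ Suc l) x))))"
      unfolding tele by (simp add: sum_distrib_left mult_ac)
     also have "... = (\<Sum>l<j. c0 * (LINT x|M. \<phi> x * \<Gamma> (j - Suc l) ((f ^^ Suc l) x)))"
      by (subst LINT_sum) (auto intro!: bmeas_integrable bmeas_cmult bmeas_mult phi_bmeas bmeas_fk[OF \<Gamma>b, of _ "Suc l" for l, simplified])
     also have "abs (...) <= (\<Sum>l<j. c0 * ((C + Phi) * m powr (1 - 2 / q) * real (Suc l) powr (- (2 * s / q))))"
     proof (rule order_trans[OF sum_abs], rule sum_mono)
      fix l assume "l \<in> {..<j}"
      then have "abs (LINT x|M. \<phi> x * \<Gamma> (j - Suc l) ((f ^^ Suc l) x)) <= (C + Phi) * m powr (1 - 2 / q) * real (Suc l) powr (- (2 * s / q))"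
       using j by (intro truncated_decay[OF q(1) Yb Ypos _ m \<Gamma>b \<Gamma>le]) (auto simp: Y_def intro!: Ym)
      then show "abs (c0 * (LINT x|M. \<phi> x * \<Gamma> (j - Suc l) ((f ^^ Suc l) x))) <= c0 * ((C + Phi) * m powr (1 - 2 / q) * real (Suc l) powr (- (2 * s / q)))"
       unfolding abs_mult using c0 by (simp add: mult_left_mono)
     qed
     also have "... = c0 * (C + Phi) * m powr (1 - 2 / q) * (\<Sum>l<j. real (Suc l) powr (- (2 * s / q)))"
      by (simp add: sum_distrib_left mult_ac)
     also have "... <= c0 * (C + Phi) * m powr (1 - 2 / q) * Z"
      using c0 C_nonneg Phi(1) by (intro mult_left_mono Z) auto
     finally show ?thesis by (simp add: mult_ac)
    qed
    have quad: "(LINT x|M. c0 * Phi * Y j x powr (q - 2)) <= 2 * c0 * Phi * m powr (1 - 2 / q)"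
    proof -
     define b where "b = m powr (1 / q)"
     have b: "b > 0" using m by (simp add: b_def)
     have pw: "Y j x powr (q - 2) <= b powr (q - 2) + b powr (- 2) * Y j x powr q" for x
     proof (cases "Y j x <= b")
      case True
      then have "Y j x powr (q - 2) <= b powr (q - 2)" using Ypos[of j x] q by (intro powr_mono2) auto
      then show ?thesis by (simp add: add_increasing2)
     next
      case False
      have "Y j x powr (q - 2) = Y j x powr (- 2) * Y j x powr q" by (simp flip: powr_add)
      also have "... <= b powr (- 2) * Y j x powr q" using False b by (intro mult_right_mono powr_mono2') auto
      finally show ?thesis by (simp add: add_increasing)
     qed
     have "(LINT x|M. Y j x powr (q - 2)) <= (LINT x|M. b powr (q - 2) + b powr (- 2) * Y j x powr q)"
      using q by (intro integral_mono bmeas_integrable bmeas_add bmeas_const bmeas_cmult Yq pw) auto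
     also have "... = b powr (q - 2) + b powr (- 2) * (LINT x|M. Y j x powr q)"
      using bmeas_integrable[OF Yq[of q j]] q prob_space by simp
     also have "... <= b powr (q - 2) + b powr (- 2) * m" using Ym[OF j] by (intro add_left_mono mult_left_mono) (auto simp: Y_def)
     also have "b powr (q - 2) = m powr (1 - 2 / q)" using q by (simp add: b_def powr_powr diff_divide_distrib)
     also have "b powr (- 2) * m = m powr (1 - 2 / q)"
     proof -
      have "b powr (- 2) = m powr (- (2 / q))" by (simp add: b_def powr_powr)
      then have "b powr (- 2) * m = m powr (- (2 / q)) * m powr 1" using m by simp
      also have "... = m powr (1 - 2 / q)" by (subst powr_add[symmetric]) simp
      finally show ?thesis .
     qed
     finally have "(LINT x|M. Y j x powr (q - 2)) <= 2 * m powr (1 - 2 / q)" by simp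
     then have "c0 * Phi * (LINT x|M. Y j x powr (q - 2)) <= c0 * Phi * (2 * m powr (1 - 2 / q))"
      using c0 Phi(1) by (intro mult_left_mono) auto
     then show ?thesis by simp
    qed
    have "(LINT x|M. abs (S (Suc j) x) powr q) - (LINT x|M. abs (S j x) powr q) = (LINT x|M. abs (S (Suc j) x) powr q - abs (S j (f x)) powr q)"
     using invariant_1[OF bmeas_measurable[OF Sq[of j]]] bmeas_integrable[OF Sq] bmeas_integrable[OF bmeas_comp[OF Sq f_meas]] by simp
    also have "... <= (LINT x|M. \<phi> x * ?p' (S j (f x)) + c0 * Phi * Y j x powr (q - 2))"
    proof (intro integral_mono bmeas_integrable)
     show "bmeas M (%x. abs (S (Suc j) x) powr q - abs (S j (f x)) powr q)" by (intro bmeas_diff Sq bmeas_comp[OF Sq f_meas])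
     show "bmeas M (%x. \<phi> x * ?p' (S j (f x)) + c0 * Phi * Y j x powr (q - 2))"
      using q by (intro bmeas_add bmeas_mult[OF phi_bmeas] pb Sfb bmeas_cmult Yq) auto
     fix x assume x: "x \<in> space M"
     have "abs (S j (f x) + \<phi> x) powr q - abs (S j (f x)) powr q <= \<phi> x * ?p' (S j (f x)) + q * (q - 1) * (\<phi> x)^2 * (abs (S j (f x)) + abs (\<phi> x)) powr (q - 2)"
      by (rule abs_powr_taylor[OF q(1)])
     also have "q * (q - 1) * (\<phi> x)^2 * (abs (S j (f x)) + abs (\<phi> x)) powr (q - 2) <= q * (q - 1) * Phi^2 * Y j x powr (q - 2)"
      unfolding Y_def using q Phi(2)[OF x] power_mono[of "abs (\<phi> x)" Phi 2] by (intro mult_mono powr_mono2) auto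
     finally show "abs (S (Suc j) x) powr q - abs (S j (f x)) powr q <= \<phi> x * ?p' (S j (f x)) + c0 * Phi * Y j x powr (q - 2)"
      by (simp add: S_Suc add.commute c0_def power2_eq_square mult_ac)
    qed
    also have "... = (LINT x|M. \<phi> x * ?p' (S j (f x))) + (LINT x|M. c0 * Phi * Y j x powr (q - 2))"
     using q by (intro LINT_add bmeas_integrable bmeas_mult[OF phi_bmeas] pb Sfb bmeas_cmult Yq) auto
    also have "... <= K1 * m powr (1 - 2 / q)" using lin quad by (simp add: K1_def algebra_simps)
    finally show ?thesis .
   qed
   have "(LINT x|M. abs (S n x) powr q) = (\<Sum>j<n. (LINT x|M. abs (S (Suc j) x) powr q) - (LINT x|M. abs (S j x) powr q))"
    using sum_lessThan_telescope[of "%j. (LINT x|M. abs (S j x) powr q)" n] by (simp add: S_0)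
   also have "... <= (\<Sum>j<n. K1 * m powr (1 - 2 / q))" by (intro sum_mono incr) auto
   also have "... = real n * (K1 * m powr (1 - 2 / q))" by simp
   also have "m powr (1 - 2 / q) = 2 powr ((q + 1) * (1 - 2 / q)) * K powr (1 - 2 / q) * real n powr (q / 2 - 1)"
   proof -
    have "q / 2 * (1 - 2 / q) = q / 2 - 1" using q by (simp add: field_simps)
    then show ?thesis using K by (simp add: m_def powr_mult powr_powr diff_divide_distrib)
   qed
   also have "real n * (K1 * (2 powr ((q + 1) * (1 - 2 / q)) * K powr (1 - 2 / q) * real n powr (q / 2 - 1)))
    = (K1 * 2 powr ((q + 1) * (1 - 2 / q))) * K powr (1 - 2 / q) * real n powr (q / 2)"
    using False by (simp add: powr_diff)
   also have "... <= K powr (2 / q) * K powr (1 - 2 / q) * real n powr (q / 2)" by (intro mult_right_mono KK) auto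
   also have "K powr (2 / q) * K powr (1 - 2 / q) = K" using K by (simp flip: powr_add)
   finally show ?thesis .
  qed
 qed
 with K show ?thesis by (intro exI[of _ K]) auto
qed

end

section \<open>Characteristic functions of Birkhoff sums\<close>

context mixing_observable begin

lemma integrable_bounded:
 fixes u :: "real => complex"
 assumes "u \<in> borel_measurable M" "!!x. x \<in> space M ==> cmod (u x) <= B" shows "integrable M u"
 using assms by (intro integrable_const_bound[of _ B]) auto

lemma cmod_integral_le:
 fixes u :: "real => complex"
 assumes "u \<in> borel_measurable M" "!!x. x \<in> space M ==> cmod (u x) <= B" shows "cmod (LINT x|M. u x) <= B"
proof -
 have "cmod (LINT x|M. u x) <= (LINT x|M. cmod (u x))" by (rule integral_norm_bound)
 also have "... <= (LINT x|M. B)" using integrable_bounded[OF assms] assms by (intro integral_mono) auto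
 finally show ?thesis using prob_space by simp
qed

lemma cmod_integral_diff_le:
 fixes u v :: "real => complex"
 assumes "u \<in> borel_measurable M" "v \<in> borel_measurable M" "!!x. x \<in> space M ==> cmod (u x) <= B1" "!!x. x \<in> space M ==> cmod (v x) <= B2"
  "!!x. x \<in> space M ==> cmod (u x - v x) <= B"
 shows "cmod ((LINT x|M. u x) - (LINT x|M. v x)) <= B"
proof -
 have "(LINT x|M. u x) - (LINT x|M. v x) = (LINT x|M. u x - v x)"
  using integrable_bounded[OF assms(1,3)] integrable_bounded[OF assms(2,4)] by simp
 then show ?thesis using cmod_integral_le[of "%x. u x - v x" B] assms by simp
qed

lemma decay_scaled:
 assumes "n >= 1" "\<psi> \<in> borel_measurable M" "!!x. x \<in> space M ==> abs (\<psi> x) <= B" "B > 0"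
 shows "abs (LINT x|M. \<phi> x * \<psi> ((f ^^ n) x)) <= C * B * n powr (- s)"
proof -
 have "abs (LINT x|M. \<phi> x * (\<psi> ((f ^^ n) x) / B)) <= C * n powr (- s)"
  by (rule decay[where \<psi> = "%x. \<psi> x / B"]) (use assms in auto)
 then show ?thesis using assms(4) by (simp add: field_simps)
qed

lemma Re_Im_integral:
 fixes u :: "real => complex"
 assumes g: "bmeas M g" and u: "u \<in> borel_measurable M" "!!x. x \<in> space M ==> cmod (u x) <= B"
 shows "Re (LINT x|M. of_real (g x) * u x) = (LINT x|M. g x * Re (u x))" "Im (LINT x|M. of_real (g x) * u x) = (LINT x|M. g x * Im (u x))"
  and "integrable M (%x. of_real (g x) * u x)"
proof -
 obtain A where A: "A >= 0" "!!x. x \<in> space M ==> abs (g x) <= A" using bmeasE[OF g] by metis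
 show i: "integrable M (%x. of_real (g x) * u x)"
 proof (rule integrable_bounded[where B = "A * B"])
  show "(%x. of_real (g x) * u x) \<in> borel_measurable M" using bmeas_measurable[OF g] u(1) by measurable
  show "cmod (of_real (g x) * u x) <= A * B" if "x \<in> space M" for x
   unfolding norm_mult norm_of_real using A u(2)[OF that] that by (intro mult_mono) auto
 qed
 show "Re (LINT x|M. of_real (g x) * u x) = (LINT x|M. g x * Re (u x))" "Im (LINT x|M. of_real (g x) * u x) = (LINT x|M. g x * Im (u x))"
  using i by (simp_all flip: integral_Re integral_Im)
qed

lemma decay_complex:
 fixes u :: "real => complex"
 assumes n: "n >= 1" and u: "u \<in> borel_measurable M" "!!x. x \<in> space M ==> cmod (u x) <= B" and B: "B >= 0"
 shows "cmod (LINT x|M. of_real (\<phi> x) * u ((f ^^ n) x)) <= 2 * C * B * n powr (- s)"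
proof (cases "B = 0")
 case True
 then have "u ((f ^^ n) x) = 0" if "x \<in> space M" for x using u(2)[OF fk_space[OF that, of n]] by simp
 then have "(LINT x|M. of_real (\<phi> x) * u ((f ^^ n) x)) = (LINT x|M. 0)" by (intro LINT_cong) auto
 then show ?thesis using True by simp
next
 case False
 then have B: "B > 0" using B by simp
 have un: "(%x. u ((f ^^ n) x)) \<in> borel_measurable M" "!!x. x \<in> space M ==> cmod (u ((f ^^ n) x)) <= B"
  using measurable_compose[OF fk_meas u(1)] u(2)[OF fk_space] by auto
 have r: "abs (LINT x|M. \<phi> x * Re (u ((f ^^ n) x))) <= C * B * n powr (- s)"
  by (rule decay_scaled[where \<psi> = "%x. Re (u x)"]) (use n u B in \<open>auto intro: order_trans[OF abs_Re_le_cmod]\<close>)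
 have i: "abs (LINT x|M. \<phi> x * Im (u ((f ^^ n) x))) <= C * B * n powr (- s)"
  by (rule decay_scaled[where \<psi> = "%x. Im (u x)"]) (use n u B in \<open>auto intro: order_trans[OF abs_Im_le_cmod]\<close>)
 show ?thesis
  using cmod_le[of "LINT x|M. of_real (\<phi> x) * u ((f ^^ n) x)"] r i Re_Im_integral(1,2)[OF phi_bmeas un] by simp
qed

lemma mixing_complex:
 assumes g: "bmeas M g" and e: "r > 0"
 shows "\<exists>N. \<forall>n\<ge>N. \<forall>u::real => complex. u \<in> borel_measurable M --> (\<forall>x\<in>space M. cmod (u x) <= 1) -->
   cmod ((LINT x|M. of_real (g x) * u ((f ^^ n) x)) - of_real (LINT x|M. g x) * (LINT x|M. u x)) <= r"
proof -
 obtain N where N: "!!n h. n >= N ==> h \<in> borel_measurable M ==> (!!x. x \<in> space M ==> abs (h x) <= 1) ==>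
    abs ((LINT x|M. g x * h ((f ^^ n) x)) - (LINT x|M. g x) * (LINT x|M. h x)) <= r / 2"
  using mixing[OF g, of "r / 2"] e by (meson half_gt_zero)
 have "cmod ((LINT x|M. of_real (g x) * u ((f ^^ n) x)) - of_real (LINT x|M. g x) * (LINT x|M. u x)) <= r"
  if n: "n >= N" and u: "u \<in> borel_measurable M" "!!x. x \<in> space M ==> cmod (u x) <= 1" for n and u :: "real => complex"
 proof -
  have un: "(%x. u ((f ^^ n) x)) \<in> borel_measurable M" "!!x. x \<in> space M ==> cmod (u ((f ^^ n) x)) <= 1"
   using measurable_compose[OF fk_meas u(1)] u(2)[OF fk_space] by auto
  let ?z = "(LINT x|M. of_real (g x) * u ((f ^^ n) x)) - of_real (LINT x|M. g x) * (LINT x|M. u x)"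
  have ui: "Re (LINT x|M. u x) = (LINT x|M. Re (u x))" "Im (LINT x|M. u x) = (LINT x|M. Im (u x))"
   using integrable_bounded[OF u] by (simp_all flip: integral_Re integral_Im)
  have "abs (Re ?z) <= r / 2"
   using N[OF n, of "%x. Re (u x)"] u order_trans[OF abs_Re_le_cmod u(2)] by (simp add: Re_Im_integral(1)[OF g un] ui)
  moreover have "abs (Im ?z) <= r / 2"
   using N[OF n, of "%x. Im (u x)"] u order_trans[OF abs_Im_le_cmod u(2)] by (simp add: Re_Im_integral(2)[OF g un] ui)
  ultimately show ?thesis using cmod_le[of ?z] by linarith
 qed
 then show ?thesis by blast
qed

definition cov :: "nat => real" where "cov k = (LINT x|M. \<phi> x * \<phi> ((f ^^ k) x))"

lemma cov_le: "abs (cov (Suc k)) <= C * Phi * real (Suc k) powr (- s)"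
 unfolding cov_def using decay_scaled[of "Suc k" \<phi> Phi] bmeas_measurable[OF phi_bmeas] Phi by auto

lemma summable_rate: "summable (%k. real (Suc k) powr (- s))"
proof -
 have "summable (%k. real k powr (- s))" using s_gt by (subst summable_real_powr_iff) auto
 then show ?thesis by (subst summable_Suc_iff)
qed

lemma summable_cov: "summable (%k. abs (cov (Suc k)))"
 by (rule summable_comparison_test[OF _ summable_mult[OF summable_rate, of "C * Phi"]])
   (use cov_le in \<open>auto simp: mult.assoc\<close>)

text \<open>The asymptotic variance of the Birkhoff sums (Green--Kubo formula).\<close>

definition \<sigma>2 :: real where "\<sigma>2 = cov 0 + 2 * (\<Sum>k. cov (Suc k))"

text \<open>\<open>xi c h j = exp (i * c * S j) * h \<circ> f ^^ j\<close>, in recursive form. The factor \<open>h\<close> carries everything that happens after time \<open>j\<close>.\<close>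

primrec xi :: "real => (real => real) => nat => real => complex" where
 "xi c h 0 = (%x. of_real (h x))"
| "xi c h (Suc j) = (%x. iexp (c * \<phi> x) * xi c h j (f x))"

definition unit_test :: "(real => real) => bool" where
 "unit_test h \<longleftrightarrow> h \<in> borel_measurable M \<and> (\<forall>x\<in>space M. abs (h x) <= 1)"

lemma f_space: "x \<in> space M ==> f x \<in> space M" using measurable_space[OF f_meas] .

lemma xi_meas: "unit_test h ==> xi c h j \<in> borel_measurable M"
proof (induction j)
 case 0
 then have "h \<in> borel_measurable M" by (simp add: unit_test_def)
 then show ?case unfolding xi.simps by measurable
next
 case (Suc j)
 have "(%x. xi c h j (f x)) \<in> borel_measurable M" by (rule measurable_compose[OF f_meas Suc.IH[OF Suc.prems]])
 then show ?case using bmeas_measurable[OF phi_bmeas] unfolding xi.simps by measurable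
qed

lemma xi_norm: "unit_test h ==> x \<in> space M ==> cmod (xi c h j x) <= 1"
 by (induction j arbitrary: x) (auto simp: unit_test_def norm_mult f_space)

lemma xi_eq: "xi c h j x = iexp (c * S j x) * of_real (h ((f ^^ j) x))"
 by (induction j arbitrary: x) (simp_all add: S_0 S_Suc funpow_swap1 distrib_left exp_add)

lemma iexp_1: "cmod (iexp x - 1) <= abs x" using iexp_approx1[of x 0] by simp
lemma iexp_2: "cmod (iexp x - 1 - \<i> * of_real x) <= x^2"
proof -
 have "(\<Sum>k\<le>Suc 0. (\<i> * of_real x) ^ k / fact k) = 1 + \<i> * of_real x" by simp
 then have "cmod (iexp x - (1 + \<i> * of_real x)) <= abs x ^ Suc (Suc 0) / fact (Suc (Suc 0))"
  using iexp_approx1[of x "Suc 0"] by simp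
 also have "... <= x^2" by (simp add: power2_eq_square)
 finally show ?thesis by (simp add: diff_diff_eq)
qed
lemma iexp_3: "cmod (iexp x - 1 - \<i> * of_real x + of_real (x^2) / 2) <= abs x ^ 3"
proof -
 have "(\<Sum>k\<le>Suc (Suc 0). (\<i> * of_real x) ^ k / fact k) = 1 + \<i> * of_real x - of_real (x^2) / 2"
  by (simp add: power2_eq_square algebra_simps)
 then have "cmod (iexp x - (1 + \<i> * of_real x - of_real (x^2) / 2)) <= abs x ^ Suc (Suc (Suc 0)) / fact (Suc (Suc (Suc 0)))"
  using iexp_approx1[of x "Suc (Suc 0)"] by simp
 also have "... = abs x ^ 3 / fact 3" by (simp add: numeral_3_eq_3)
 also have "... <= abs x ^ 3" by (simp add: fact_numeral)
 finally show ?thesis by (simp add: algebra_simps)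
qed

lemma xi_step: "unit_test h ==> x \<in> space M ==> cmod (xi c h (Suc j) x - xi c h j (f x)) <= abs c * Phi"
proof -
 assume t: "unit_test h" and x: "x \<in> space M"
 have "xi c h (Suc j) x - xi c h j (f x) = (iexp (c * \<phi> x) - 1) * xi c h j (f x)" by (simp add: left_diff_distrib)
 then have "cmod (xi c h (Suc j) x - xi c h j (f x)) <= abs (c * \<phi> x) * 1"
  unfolding \<open>_ = _\<close> norm_mult using iexp_1[of "c * \<phi> x"] xi_norm[OF t f_space[OF x], of c j] by (intro mult_mono) auto
 also have "... <= abs c * Phi" using Phi(2)[OF x] by (simp add: abs_mult mult_left_mono)
 finally show ?thesis .
qed

lemma xi_steps: "unit_test h ==> x \<in> space M ==> cmod (xi c h (j + r) x - xi c h j ((f ^^ r) x)) <= real r * abs c * Phi"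
proof (induction r arbitrary: x)
 case (Suc r)
 have "cmod (xi c h (Suc (j + r)) x - xi c h j ((f ^^ r) (f x))) \<le>
  cmod (xi c h (Suc (j + r)) x - xi c h (j + r) (f x)) + cmod (xi c h (j + r) (f x) - xi c h j ((f ^^ r) (f x)))"
  using norm_triangle_ineq[of "xi c h (Suc (j + r)) x - xi c h (j + r) (f x)" "xi c h (j + r) (f x) - xi c h j ((f ^^ r) (f x))"] by simp
 also have "... <= abs c * Phi + real r * abs c * Phi" by (intro add_mono xi_step Suc.IH Suc.prems f_space)
 finally show ?case by (simp add: funpow_swap1 algebra_simps)
qed simp

definition w :: "real => (real => real) => nat => complex" where "w c h j = (LINT x|M. xi c h j x)"

lemma w_steps: assumes "unit_test h" shows "cmod (w c h (j + r) - w c h j) <= real r * abs c * Phi"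
proof -
 have "w c h j = (LINT x|M. xi c h j ((f ^^ r) x))" unfolding w_def by (rule invariant[OF xi_meas[OF assms], symmetric])
 then show ?thesis unfolding w_def
  using xi_meas[OF assms] xi_norm[OF assms] xi_steps[OF assms] measurable_compose[OF fk_meas xi_meas[OF assms]] fk_space
  by (simp only:) (intro cmod_integral_diff_le[where ?B1.0 = 1 and ?B2.0 = 1], auto)
qed

text \<open>A fixed function decouples from \<open>xi\<close>: skip \<open>R\<close> steps, which changes \<open>xi\<close> by \<open>O(|c|)\<close>, and use mixing.\<close>

lemma almost_independent:
 assumes g: "bmeas M g" and G: "!!x. x \<in> space M ==> abs (g x) <= A" and d: "e > 0"
 shows "\<exists>N. \<forall>R\<ge>N. \<forall>r j c h. unit_test h --> j >= R -->
  cmod ((LINT x|M. of_real (g x) * xi c h j ((f ^^ r) x)) - of_real (LINT x|M. g x) * w c h j) <= e + 2 * A * real R * abs c * Phi"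
proof -
 obtain N where N: "!!n u. n >= N ==> (u::real => complex) \<in> borel_measurable M ==> (!!x. x \<in> space M ==> cmod (u x) <= 1) ==>
   cmod ((LINT x|M. of_real (g x) * u ((f ^^ n) x)) - of_real (LINT x|M. g x) * (LINT x|M. u x)) <= e"
  using mixing_complex[OF g d] by blast
 have A: "A >= 0" using G not_empty by (metis abs_ge_zero all_not_in_conv order_trans)
 have "cmod ((LINT x|M. of_real (g x) * xi c h j ((f ^^ r) x)) - of_real (LINT x|M. g x) * w c h j) <= e + 2 * A * real R * abs c * Phi"
  if R: "R >= N" and h: "unit_test h" and j: "j >= R" for R r j c h
 proof -
  (* xi is shortened by R steps, which provides the gap for mixing *)
  define i where "i = j - R"
  have ji: "j = i + R" using j by (simp add: i_def)
  have m: "(%x. of_real (g x) * xi c h k ((f ^^ l) x)) \<in> borel_measurable M" for k l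
   using bmeas_measurable[OF g] measurable_compose[OF fk_meas xi_meas[OF h]] by measurable
  have b: "cmod (of_real (g x) * xi c h k ((f ^^ l) x)) <= A" if "x \<in> space M" for x k l
   unfolding norm_mult norm_of_real using G[OF that] xi_norm[OF h fk_space[OF that], of c k l] mult_mono[of "abs (g x)" A "cmod (xi c h k ((f ^^ l) x))" 1] A by simp
  have 1: "cmod ((LINT x|M. of_real (g x) * xi c h j ((f ^^ r) x)) - (LINT x|M. of_real (g x) * xi c h i ((f ^^ (R + r)) x))) <= A * (real R * abs c * Phi)"
  proof (rule cmod_integral_diff_le[OF m m b b])
   fix x assume x: "x \<in> space M"
   have "cmod (of_real (g x) * xi c h j ((f ^^ r) x) - of_real (g x) * xi c h i ((f ^^ (R + r)) x))
    = abs (g x) * cmod (xi c h (i + R) ((f ^^ r) x) - xi c h i ((f ^^ R) ((f ^^ r) x)))"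
    by (simp add: right_diff_distrib[symmetric] norm_mult ji funpow_add)
   also have "... <= A * (real R * abs c * Phi)"
    using G[OF x] xi_steps[OF h fk_space[OF x, of r], of c i R] A by (intro mult_mono) auto
   finally show "cmod (of_real (g x) * xi c h j ((f ^^ r) x) - of_real (g x) * xi c h i ((f ^^ (R + r)) x)) <= A * (real R * abs c * Phi)" .
  qed
  have 2: "cmod ((LINT x|M. of_real (g x) * xi c h i ((f ^^ (R + r)) x)) - of_real (LINT x|M. g x) * w c h i) <= e"
   unfolding w_def using R by (intro N xi_meas xi_norm h) auto
  have 3: "cmod (of_real (LINT x|M. g x) * w c h i - of_real (LINT x|M. g x) * w c h j) <= A * (real R * abs c * Phi)"
  proof -
   have gi: "abs (LINT x|M. g x) <= A"
    using cmod_integral_le[of "%x. of_real (g x)" A] bmeas_measurable[OF g] G by simp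
   have "cmod (of_real (LINT x|M. g x) * w c h i - of_real (LINT x|M. g x) * w c h j) = abs (LINT x|M. g x) * cmod (w c h (i + R) - w c h i)"
    by (simp add: right_diff_distrib[symmetric] norm_mult ji norm_minus_commute)
   also have "... <= A * (real R * abs c * Phi)" using gi w_steps[OF h, of c i R] A by (intro mult_mono) auto
   finally show ?thesis .
  qed
  let ?a = "LINT x|M. of_real (g x) * xi c h j ((f ^^ r) x)" and ?b = "LINT x|M. of_real (g x) * xi c h i ((f ^^ (R + r)) x)"
   and ?c = "of_real (LINT x|M. g x) * w c h i" and ?d = "of_real (LINT x|M. g x) * w c h j"
  have "cmod (?a - ?d) <= cmod (?a - ?b) + cmod (?b - ?c) + cmod (?c - ?d)"
   using norm_triangle_ineq[of "?a - ?b" "?b - ?c"] norm_triangle_ineq[of "?a - ?c" "?c - ?d"] by simp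
  then show ?thesis using 1 2 3 by (simp add: algebra_simps)
 qed
 then show ?thesis by blast
qed

text \<open>Expand \<open>exp (i * c * \<phi>)\<close> to second order in \<open>w c h (j + 1) - w c h j\<close>. The quadratic term yields the variance of \<open>\<phi>\<close>. The linear
  term \<open>\<integral> \<phi> * xi c h j \<circ> f\<close> is again telescoped into contributions of the times \<open>l\<close>; each is itself of order \<open>c\<close> and yields the covariance with
  \<open>\<phi> \<circ> f ^^ (l + 1)\<close> for \<open>l < Q\<close>, while decay makes the later ones negligible.\<close>

lemma one_step:
 assumes eta: "\<eta> > 0"
 shows "\<exists>K j0. K >= 0 \<and> (\<forall>j\<ge>j0. \<forall>c h. unit_test h -->
   cmod (w c h (Suc j) - w c h j + of_real (c^2 * \<sigma>2 / 2) * w c h j) <= c^2 * \<eta> + abs c ^ 3 * K + abs c * (2 * C * real (Suc j) powr (- s)))"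
proof -
 have sc: "summable (%k. cov (Suc k))" using summable_cov by (rule summable_rabs_cancel)
 let ?rate = "%k. real (Suc k) powr (- s)"
 have "(%Q. (\<Sum>k<Q. cov (Suc k))) ~> (\<Sum>k. cov (Suc k))" using sc by (rule summable_LIMSEQ)
 then have "eventually (%Q. dist (\<Sum>k<Q. cov (Suc k)) (\<Sum>k. cov (Suc k)) < \<eta> / 4) sequentially" using eta by (intro tendstoD) auto
 moreover have "eventually (%Q. dist (\<Sum>k<Q. ?rate k) (\<Sum>k. ?rate k) < \<eta> / (4 * (2 * C * Phi + 1))) sequentially"
  using eta C_nonneg Phi(1) summable_LIMSEQ[OF summable_rate] by (intro tendstoD) (auto intro!: divide_pos_pos add_nonneg_pos)
 ultimately obtain Q where Q1: "dist (\<Sum>k<Q. cov (Suc k)) (\<Sum>k. cov (Suc k)) < \<eta> / 4"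
  and Q2: "dist (\<Sum>k<Q. ?rate k) (\<Sum>k. ?rate k) < \<eta> / (4 * (2 * C * Phi + 1))"
  using eventually_happens'[OF sequentially_bot eventually_conj] by blast
 (* Q separates the covariances that matter from a negligible tail *)
 define tl where "tl = (\<Sum>k. ?rate k) - (\<Sum>k<Q. ?rate k)"
 have tl: "(\<Sum>k\<in>{Q..<j}. ?rate k) <= tl" for j
 proof (cases "Q <= j")
  case True
  have "(\<Sum>k<j. ?rate k) = (\<Sum>k<Q. ?rate k) + (\<Sum>k\<in>{Q..<j}. ?rate k)"
   using True by (metis lessThan_atLeast0 sum.atLeastLessThan_concat zero_le)
  moreover have "(\<Sum>k<j. ?rate k) <= (\<Sum>k. ?rate k)" by (intro sum_le_suminf summable_rate) auto
  ultimately show ?thesis by (simp add: tl_def)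
 next
  case False
  have "(\<Sum>k<Q. ?rate k) <= (\<Sum>k. ?rate k)" by (intro sum_le_suminf summable_rate) auto
  then show ?thesis using False by (simp add: tl_def)
 qed
 have tlb: "2 * C * Phi * tl <= \<eta> / 4"
 proof -
  have p: "2 * C * Phi + 1 > 0" using C_nonneg Phi(1) by (intro add_nonneg_pos) auto
  have "tl <= \<eta> / (4 * (2 * C * Phi + 1))" using Q2 by (simp add: tl_def dist_real_def)
  then have "(2 * C * Phi + 1) * tl <= \<eta> / 4" using p by (simp add: field_simps)
  moreover have "tl >= 0" using tl[of 0] by simp
  ultimately show ?thesis by (simp add: algebra_simps)
 qed
 define e where "e = \<eta> / (4 * (real Q + 1))"
 have e: "e > 0" "(real Q + 1) * e = \<eta> / 4" using eta by (auto simp: e_def field_simps)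
 define gl where "gl l = (%x. \<phi> x * \<phi> ((f ^^ l) x))" for l
 have glb: "bmeas M (gl l)" for l unfolding gl_def by (intro bmeas_mult phi_bmeas bmeas_fk)
 have glA: "abs (gl l x) <= Phi^2" if "x \<in> space M" for l x
  unfolding gl_def abs_mult power2_eq_square using Phi(1) Phi(2)[OF that] Phi(2)[OF fk_space[OF that]] by (intro mult_mono) auto
 have "\<exists>N. \<forall>l. \<forall>R\<ge>N l. \<forall>r j c h. unit_test h --> j >= R -->
  cmod ((LINT x|M. of_real (gl l x) * xi c h j ((f ^^ r) x)) - of_real (LINT x|M. gl l x) * w c h j) <= e + 2 * Phi^2 * real R * abs c * Phi"
  by (rule choice, rule allI, rule almost_independent[OF glb glA e(1)])
 then obtain N where N': "\<forall>l. \<forall>R\<ge>N l. \<forall>r j c h. unit_test h --> j >= R -->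
  cmod ((LINT x|M. of_real (gl l x) * xi c h j ((f ^^ r) x)) - of_real (LINT x|M. gl l x) * w c h j) <= e + 2 * Phi^2 * real R * abs c * Phi"
  by (rule exE)
 note N = N'[rule_format]
 define R where "R = (\<Sum>l\<le>Q. N l)"
 have NR: "N l <= R" if "l <= Q" for l unfolding R_def using that by (intro member_le_sum) auto
 define K0 where "K0 = Phi ^ 3 * (1 + 2 * real R + real Q)"
 have Ph3: "Phi ^ 3 >= 0" using Phi(1) by simp
 have K0: "K0 >= 0" unfolding K0_def using Ph3 by simp
 define K where "K = real Q * K0 + Phi^2 * real R * Phi + Phi ^ 3"
 have K: "K >= 0" using K0 Ph3 Phi(1) by (simp add: K_def)
 have main: "cmod (w c h (Suc j) - w c h j + of_real (c^2 * \<sigma>2 / 2) * w c h j) <= c^2 * \<eta> + abs c ^ 3 * K + abs c * (2 * C * real (Suc j) powr (- s))"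
  if j: "j >= Q + R" and h: "unit_test h" for j c h
 proof -
  note xm = xi_meas[OF h] and xn = xi_norm[OF h]
  have xfm: "(%x. xi c h k ((f ^^ l) x)) \<in> borel_measurable M" for k l by (rule measurable_compose[OF fk_meas xm])
  have xfn: "cmod (xi c h k ((f ^^ l) x)) <= 1" if "x \<in> space M" for k l x using xn fk_space[OF that] by blast
  have pm: "\<phi> \<in> borel_measurable M" by (rule bmeas_measurable[OF phi_bmeas])
  have wn: "cmod (w c h k) <= 1" for k unfolding w_def by (rule cmod_integral_le[OF xm xn])
  define Dk where "Dk k x = (iexp (c * \<phi> x) - 1) * xi c h k (f x)" for k x
  have Dm: "Dk k \<in> borel_measurable M" for k unfolding Dk_def using pm xfm[of k 1] by simp
  have Dn: "cmod (Dk k x) <= abs c * Phi" if "x \<in> space M" for k x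
   using xi_step[OF h that, of c k] by (simp add: Dk_def left_diff_distrib)
  have Dfm: "(%x. Dk k ((f ^^ l) x)) \<in> borel_measurable M" for k l by (rule measurable_compose[OF fk_meas Dm])
  have Dfn: "cmod (Dk k ((f ^^ l) x)) <= abs c * Phi" if "x \<in> space M" for k l x using Dn fk_space[OF that] by blast
  have tele: "xi c h i (f x) = (\<Sum>l<i. Dk (i - Suc l) ((f ^^ Suc l) x)) + of_real (h ((f ^^ Suc i) x))" for i x
  proof (induction i arbitrary: x)
   case (Suc i)
   have "xi c h (Suc i) (f x) = Dk i (f x) + xi c h i (f (f x))" by (simp add: Dk_def left_diff_distrib)
   also have "xi c h i (f (f x)) = (\<Sum>l<i. Dk (i - Suc l) ((f ^^ Suc l) (f x))) + of_real (h ((f ^^ Suc i) (f x)))" by (rule Suc)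
   finally show ?case by (subst sum.lessThan_Suc_shift) (simp add: funpow_swap1)
  qed simp
  define I1 where "I1 = (LINT x|M. of_real (\<phi> x) * xi c h j (f x))"
  define J where "J l = (LINT x|M. of_real (\<phi> x) * Dk (j - Suc l) ((f ^^ Suc l) x))" for l
  have Ji: "integrable M (%x. of_real (\<phi> x) * Dk (j - Suc l) ((f ^^ Suc l) x))" for l
   by (rule Re_Im_integral(3)[OF phi_bmeas Dfm Dfn])
  have psif: "(%x. complex_of_real (h ((f ^^ Suc j) x))) \<in> borel_measurable M" using xfm[of 0 "Suc j"] by simp
  have psin: "cmod (complex_of_real (h ((f ^^ Suc j) x))) <= 1" if "x \<in> space M" for x using xfn[OF that, of 0 "Suc j"] by simp
  have I1: "I1 = (\<Sum>l<j. J l) + (LINT x|M. of_real (\<phi> x) * of_real (h ((f ^^ Suc j) x)))"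
   unfolding I1_def J_def tele distrib_left sum_distrib_left
   by (subst LINT_add)
     (auto intro!: Bochner_Integration.integrable_sum Ji Re_Im_integral(3)[OF phi_bmeas psif psin] simp del: funpow.simps
      simp: LINT_sum[OF Ji])
  have last: "cmod (LINT x|M. of_real (\<phi> x) * of_real (h ((f ^^ Suc j) x))) <= 2 * C * 1 * real (Suc j) powr (- s)"
   using decay_complex[of "Suc j" "%x. of_real (h x)" 1] xm[of c 0] xn[of _ c 0] by simp
  have Jlarge: "cmod (J l) <= 2 * C * (abs c * Phi) * ?rate l" for l
   unfolding J_def using Phi(1) by (intro decay_complex Dm Dn) auto
  have Jsmall: "cmod (J l - \<i> * of_real c * (of_real (cov (Suc l)) * w c h j)) <= abs c * e + c^2 * K0" if l: "l < Q" for l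
  proof -
   define i where "i = j - Suc l"
   have i: "i >= R" "j = i + Suc l" using j l by (auto simp: i_def)
   let ?I = "LINT x|M. of_real (gl (Suc l) x) * xi c h i ((f ^^ Suc (Suc l)) x)"
   have gi: "integrable M (%x. of_real (gl (Suc l) x) * xi c h i ((f ^^ Suc (Suc l)) x))"
    by (rule Re_Im_integral(3)[OF glb xfm xfn])
   have 1: "cmod (J l - \<i> * of_real c * ?I) <= c^2 * Phi ^ 3"
   proof -
    have "J l - \<i> * of_real c * ?I = (LINT x|M. of_real (\<phi> x) * Dk i ((f ^^ Suc l) x)) - (LINT x|M. \<i> * of_real c * (of_real (gl (Suc l) x) * xi c h i ((f ^^ Suc (Suc l)) x)))"
     unfolding J_def i_def by simp
    also have "... = (LINT x|M. of_real (\<phi> x) * Dk i ((f ^^ Suc l) x) - \<i> * of_real c * (of_real (gl (Suc l) x) * xi c h i ((f ^^ Suc (Suc l)) x)))"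
     by (rule LINT_diff[symmetric]) (use Ji[of l] gi in \<open>auto simp: i_def simp del: funpow.simps\<close>)
    also have "cmod ... <= c^2 * Phi ^ 3"
    proof (rule cmod_integral_le)
     show "(%x. of_real (\<phi> x) * Dk i ((f ^^ Suc l) x) - \<i> * of_real c * (of_real (gl (Suc l) x) * xi c h i ((f ^^ Suc (Suc l)) x))) \<in> borel_measurable M"
      using Ji[of l] gi by (intro borel_measurable_diff) (auto simp: i_def simp del: funpow.simps intro: borel_measurable_integrable)
     fix x assume x: "x \<in> space M"
     let ?y = "(f ^^ Suc l) x"
     have y: "?y \<in> space M" by (rule fk_space[OF x])
     have eq: "of_real (\<phi> x) * Dk i ?y - \<i> * of_real c * (of_real (gl (Suc l) x) * xi c h i ((f ^^ Suc (Suc l)) x))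
       = of_real (\<phi> x) * ((iexp (c * \<phi> ?y) - 1 - \<i> * of_real (c * \<phi> ?y)) * xi c h i (f ?y))"
      by (simp add: Dk_def gl_def algebra_simps)
     have "cmod (of_real (\<phi> x) * ((iexp (c * \<phi> ?y) - 1 - \<i> * of_real (c * \<phi> ?y)) * xi c h i (f ?y))) <= Phi * ((c * \<phi> ?y)^2 * 1)"
      unfolding norm_mult norm_of_real using Phi(1) Phi(2)[OF x] iexp_2[of "c * \<phi> ?y"] xn[OF f_space[OF y], of c i]
      by (intro mult_mono) auto
     also have "... <= Phi * (c^2 * Phi^2)"
      using Phi(1) power_mono[OF Phi(2)[OF y] abs_ge_zero, of 2] by (simp add: power_mult_distrib mult_left_mono)
     finally show "cmod (of_real (\<phi> x) * Dk i ?y - \<i> * of_real c * (of_real (gl (Suc l) x) * xi c h i ((f ^^ Suc (Suc l)) x))) <= c^2 * Phi ^ 3"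
      unfolding eq by (simp add: power3_eq_cube power2_eq_square mult_ac)
    qed
    finally show ?thesis .
   qed
   have 2: "cmod (?I - of_real (cov (Suc l)) * w c h i) <= e + 2 * Phi^2 * real R * abs c * Phi"
    using N[OF NR h i(1), where l = "Suc l" and r = "Suc (Suc l)" and c = c] l by (simp add: cov_def gl_def)
   have cv: "abs (cov (Suc l)) <= Phi^2"
   proof -
    have "abs (cov (Suc l)) = cmod (LINT x|M. of_real (gl (Suc l) x))"
     by (simp only: cov_def gl_def integral_complex_of_real norm_of_real)
    also have "... <= Phi^2" using bmeas_measurable[OF glb] glA by (intro cmod_integral_le) auto
    finally show ?thesis .
   qed
   have 3: "cmod (of_real (cov (Suc l)) * w c h i - of_real (cov (Suc l)) * w c h j) <= Phi^2 * (real Q * abs c * Phi)"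
   proof -
    have "cmod (of_real (cov (Suc l)) * w c h i - of_real (cov (Suc l)) * w c h j) = abs (cov (Suc l)) * cmod (w c h (i + Suc l) - w c h i)"
     by (simp add: right_diff_distrib[symmetric] norm_mult i(2) norm_minus_commute)
    also have "... <= Phi^2 * (real (Suc l) * abs c * Phi)" using cv w_steps[OF h, of c i "Suc l"] by (intro mult_mono) auto
    also have "... <= Phi^2 * (real Q * abs c * Phi)" using l Phi(1) by (intro mult_left_mono mult_right_mono) auto
    finally show ?thesis .
   qed
   have 4: "cmod (\<i> * of_real c * ?I - \<i> * of_real c * (of_real (cov (Suc l)) * w c h j)) <= abs c * (e + 2 * Phi^2 * real R * abs c * Phi + Phi^2 * (real Q * abs c * Phi))"
   proof -
    have "cmod (?I - of_real (cov (Suc l)) * w c h j) <= e + 2 * Phi^2 * real R * abs c * Phi + Phi^2 * (real Q * abs c * Phi)"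
     using norm_triangle_ineq[of "?I - of_real (cov (Suc l)) * w c h i" "of_real (cov (Suc l)) * w c h i - of_real (cov (Suc l)) * w c h j"] 2 3 by simp
    then show ?thesis by (simp only: right_diff_distrib[symmetric] norm_mult norm_ii norm_of_real mult_1_left mult_left_mono[OF _ abs_ge_zero])
   qed
   have "cmod (J l - \<i> * of_real c * (of_real (cov (Suc l)) * w c h j)) <= c^2 * Phi ^ 3 + abs c * (e + 2 * Phi^2 * real R * abs c * Phi + Phi^2 * (real Q * abs c * Phi))"
    using norm_triangle_ineq[of "J l - \<i> * of_real c * ?I" "\<i> * of_real c * ?I - \<i> * of_real c * (of_real (cov (Suc l)) * w c h j)"] 1 4 by simp
   also have "... = abs c * e + c^2 * K0"
   proof -
    have cc: "c^2 = abs c * abs c" by (simp add: power2_eq_square)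
    show ?thesis unfolding cc K0_def by (simp add: algebra_simps power2_eq_square power3_eq_cube)
   qed
   finally show ?thesis .
  qed
  have I1b: "cmod (I1 - \<i> * of_real c * (of_real (\<Sum>l<Q. cov (Suc l)) * w c h j)) \<le>
    real Q * (abs c * e + c^2 * K0) + 2 * C * (abs c * Phi) * tl + 2 * C * real (Suc j) powr (- s)"
  proof -
   have Qj: "Q <= j" using j by simp
   have "(\<Sum>l<j. J l) = (\<Sum>l<Q. J l) + (\<Sum>l\<in>{Q..<j}. J l)"
    using Qj by (metis lessThan_atLeast0 sum.atLeastLessThan_concat zero_le)
   then have eq: "I1 - \<i> * of_real c * (of_real (\<Sum>l<Q. cov (Suc l)) * w c h j) =
     (\<Sum>l<Q. J l - \<i> * of_real c * (of_real (cov (Suc l)) * w c h j)) + (\<Sum>l\<in>{Q..<j}. J l) + (LINT x|M. of_real (\<phi> x) * of_real (h ((f ^^ Suc j) x)))"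
    (is "_ = ?A + ?B + ?C") unfolding I1 by (simp add: sum_subtractf sum_distrib_left sum_distrib_right)
   have "cmod ?A <= (\<Sum>l<Q. abs c * e + c^2 * K0)" by (intro order_trans[OF norm_sum] sum_mono Jsmall) auto
   then have A: "cmod ?A <= real Q * (abs c * e + c^2 * K0)" by simp
   have "cmod ?B <= (\<Sum>l\<in>{Q..<j}. 2 * C * (abs c * Phi) * ?rate l)"
    by (intro order_trans[OF norm_sum] sum_mono Jlarge)
   also have "... = 2 * C * (abs c * Phi) * (\<Sum>l\<in>{Q..<j}. ?rate l)" by (simp only: sum_distrib_left)
   also have "... <= 2 * C * (abs c * Phi) * tl" using C_nonneg Phi(1) by (intro mult_left_mono tl) auto
   finally have B: "cmod ?B <= 2 * C * (abs c * Phi) * tl" .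
   have "cmod (?A + ?B + ?C) <= cmod ?A + cmod ?B + cmod ?C"
    using norm_triangle_ineq[of "?A + ?B" ?C] norm_triangle_ineq[of ?A ?B] by linarith
   then show ?thesis unfolding eq using A B last by linarith
  qed
  define I2 where "I2 = (LINT x|M. of_real (gl 0 x) * xi c h j (f x))"
  have I2b: "cmod (I2 - of_real (cov 0) * w c h j) <= e + 2 * Phi^2 * real R * abs c * Phi"
   using N[OF NR h, where l = 0 and j = j and r = 1 and c = c] j by (simp add: I2_def cov_def gl_def)
  have i1: "integrable M (%x. of_real (\<phi> x) * xi c h j (f x))" using Re_Im_integral(3)[OF phi_bmeas xfm[of j 1] xfn[of _ j 1]] by simp
  have i2: "integrable M (%x. of_real (gl 0 x) * xi c h j (f x))" using Re_Im_integral(3)[OF glb xfm[of j 1] xfn[of _ j 1], of 0] by simp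
  have i3: "integrable M (xi c h (Suc j))" "integrable M (%x. xi c h j (f x))"
   using integrable_bounded[OF xm xn] integrable_bounded[OF xfm[of j 1] xfn[of _ j 1]] by (simp_all del: xi.simps)
  have step: "cmod (w c h (Suc j) - w c h j - \<i> * of_real c * I1 + of_real (c^2 / 2) * I2) <= abs c ^ 3 * Phi ^ 3"
  proof -
   have "w c h j = (LINT x|M. xi c h j (f x))" unfolding w_def by (rule invariant_1[OF xm, symmetric])
   then have E0: "w c h (Suc j) - w c h j - \<i> * of_real c * I1 + of_real (c^2 / 2) * I2 =
    (LINT x|M. xi c h (Suc j) x - xi c h j (f x) - \<i> * of_real c * (of_real (\<phi> x) * xi c h j (f x)) + of_real (c^2 / 2) * (of_real (gl 0 x) * xi c h j (f x)))"
    unfolding w_def I1_def I2_def using i1 i2 i3 by (simp del: xi.simps)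
   show ?thesis unfolding E0
   proof (rule cmod_integral_le)
    show "(%x. xi c h (Suc j) x - xi c h j (f x) - \<i> * of_real c * (of_real (\<phi> x) * xi c h j (f x)) + of_real (c^2 / 2) * (of_real (gl 0 x) * xi c h j (f x))) \<in> borel_measurable M"
     using i1 i2 i3 by (intro borel_measurable_add borel_measurable_diff borel_measurable_times borel_measurable_const borel_measurable_integrable)
    fix x assume x: "x \<in> space M"
    have eq: "xi c h (Suc j) x - xi c h j (f x) - \<i> * of_real c * (of_real (\<phi> x) * xi c h j (f x)) + of_real (c^2 / 2) * (of_real (gl 0 x) * xi c h j (f x))
     = (iexp (c * \<phi> x) - 1 - \<i> * of_real (c * \<phi> x) + of_real ((c * \<phi> x)^2) / 2) * xi c h j (f x)"
     by (simp add: gl_def algebra_simps power2_eq_square)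
    have "cmod ((iexp (c * \<phi> x) - 1 - \<i> * of_real (c * \<phi> x) + of_real ((c * \<phi> x)^2) / 2) * xi c h j (f x)) <= abs (c * \<phi> x) ^ 3 * 1"
     unfolding norm_mult using iexp_3[of "c * \<phi> x"] xn[OF f_space[OF x], of c j] by (intro mult_mono) auto
    also have "... <= abs c ^ 3 * Phi ^ 3"
     using power_mono[OF Phi(2)[OF x] abs_ge_zero, of 3] by (simp add: abs_mult power_mult_distrib mult_left_mono)
    finally show "cmod (xi c h (Suc j) x - xi c h j (f x) - \<i> * of_real c * (of_real (\<phi> x) * xi c h j (f x)) + of_real (c^2 / 2) * (of_real (gl 0 x) * xi c h j (f x))) <= abs c ^ 3 * Phi ^ 3"
     unfolding eq .
   qed
  qed
  define sQ where "sQ = (\<Sum>l<Q. cov (Suc l))"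
  have sQ: "abs ((\<Sum>k. cov (Suc k)) - sQ) <= \<eta> / 4" using Q1 by (simp add: sQ_def dist_real_def abs_minus_commute)
  let ?w = "w c h j"
  have decomp: "w c h (Suc j) - ?w + of_real (c^2 * \<sigma>2 / 2) * ?w =
    (w c h (Suc j) - ?w - \<i> * of_real c * I1 + of_real (c^2 / 2) * I2)
    + \<i> * of_real c * (I1 - \<i> * of_real c * (of_real sQ * ?w)) - of_real (c^2 / 2) * (I2 - of_real (cov 0) * ?w)
    + of_real (c^2 * ((\<Sum>k. cov (Suc k)) - sQ)) * ?w"
   unfolding \<sigma>2_def by (simp add: algebra_simps power2_eq_square add_divide_distrib)
  have A1: "cmod (\<i> * of_real c * (I1 - \<i> * of_real c * (of_real sQ * ?w))) <= abs c * (real Q * (abs c * e + c^2 * K0) + 2 * C * (abs c * Phi) * tl + 2 * C * real (Suc j) powr (- s))"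
   unfolding norm_mult norm_ii norm_of_real mult_1_left using I1b unfolding sQ_def by (intro mult_left_mono) auto
  have A2: "cmod (of_real (c^2 / 2) * (I2 - of_real (cov 0) * ?w)) <= c^2 / 2 * (e + 2 * Phi^2 * real R * abs c * Phi)"
  proof -
   have "cmod (of_real (c^2 / 2) * (I2 - of_real (cov 0) * ?w)) = c^2 / 2 * cmod (I2 - of_real (cov 0) * ?w)" by (simp only: norm_mult norm_of_real) simp
   then show ?thesis using I2b by (simp only:) (intro mult_left_mono, auto)
  qed
  have A3: "cmod (of_real (c^2 * ((\<Sum>k. cov (Suc k)) - sQ)) * ?w) <= c^2 * (\<eta> / 4)"
  proof -
   have "cmod (of_real (c^2 * ((\<Sum>k. cov (Suc k)) - sQ)) * ?w) = c^2 * abs ((\<Sum>k. cov (Suc k)) - sQ) * cmod ?w"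
    by (simp only: norm_mult norm_of_real abs_mult) simp
   also have "... <= c^2 * (\<eta> / 4) * 1" using sQ wn[of j] eta by (intro mult_mono mult_left_mono) auto
   finally show ?thesis by simp
  qed
  have "cmod (w c h (Suc j) - ?w + of_real (c^2 * \<sigma>2 / 2) * ?w) \<le>
   abs c ^ 3 * Phi ^ 3 + abs c * (real Q * (abs c * e + c^2 * K0) + 2 * C * (abs c * Phi) * tl + 2 * C * real (Suc j) powr (- s))
    + c^2 / 2 * (e + 2 * Phi^2 * real R * abs c * Phi) + c^2 * (\<eta> / 4)" unfolding decomp
   by (intro order_trans[OF norm_triangle_ineq] order_trans[OF norm_triangle_ineq4] add_mono step A1 A2 A3)
  also have "... = c^2 * (real Q * e + e / 2 + 2 * C * Phi * tl + \<eta> / 4) + abs c ^ 3 * K + abs c * (2 * C * real (Suc j) powr (- s))"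
  proof -
   define d where "d = abs c"
   have cc: "c^2 = d * d" by (simp add: power2_eq_square d_def)
   show ?thesis unfolding cc K_def power3_eq_cube d_def[symmetric] by (simp add: algebra_simps)
  qed
  also have "... <= c^2 * \<eta> + abs c ^ 3 * K + abs c * (2 * C * real (Suc j) powr (- s))"
  proof -
   have "real Q * e + e / 2 <= (real Q + 1) * e" using e by (simp add: algebra_simps)
   then have "real Q * e + e / 2 + 2 * C * Phi * tl + \<eta> / 4 <= \<eta>" using e(2) tlb eta by linarith
   then show ?thesis by (intro add_right_mono mult_left_mono) auto
  qed
  finally show ?thesis .
 qed
 show ?thesis using K main by blast
qed

end

section \<open>The central limit theorem for blocks\<close>

lemma exp_quadratic: fixes x :: real assumes "abs x <= 1" shows "abs (exp x - 1 - x) <= x^2"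
proof -
 have lo: "1 + x <= exp x" by (rule exp_ge_add_one_self)
 have "exp x <= 1 + x + x^2"
 proof (cases "x >= 0")
  case True then show ?thesis using exp_bound[of x] assms by auto
 next
  case False
  have "1 - x <= exp (- x)" using exp_ge_add_one_self[of "-x"] by simp
  then have "exp x <= 1 / (1 - x)" using False by (simp add: exp_minus field_simps)
  also have "... <= 1 + x + x^2"
  proof -
   have "(1 + x + x^2) * (1 - x) = 1 - x ^ 3" by (simp add: algebra_simps power2_eq_square power3_eq_cube)
   moreover have "x ^ 3 <= 0" using False by simp
   ultimately have "1 <= (1 + x + x^2) * (1 - x)" by linarith
   then show ?thesis using False by (simp add: field_simps)
  qed
  finally show ?thesis .
 qed
 then have "exp x - 1 - x <= x^2" by linarith
 moreover have "0 <= exp x - 1 - x" using lo by linarith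
 ultimately show ?thesis by linarith
qed

context mixing_observable begin

text \<open>The recursion of \<open>one_step\<close>, solved.\<close>

lemma w_recursion:
 assumes e: "e > 0"
 shows "\<exists>K j0. K >= 0 \<and> j0 >= 0 \<and> (\<forall>c h b. unit_test h --> abs (c^2 * \<sigma>2 / 2) <= 1 -->
   cmod (w c h b - of_real (exp (- (real b * (c^2 * \<sigma>2 / 2)))) * w c h 0) \<le>
   exp (real b * abs (c^2 * \<sigma>2 / 2)) * (real b * (c^2 * e + abs c ^ 3 * K + (c^2 * \<sigma>2 / 2)^2) + abs c * K + j0 * (abs c * Phi + abs (c^2 * \<sigma>2 / 2))))"
proof -
 obtain K j0 where K: "K >= 0" and st: "!!j c h. j >= j0 ==> unit_test h ==>
   cmod (w c h (Suc j) - w c h j + of_real (c^2 * \<sigma>2 / 2) * w c h j) <= c^2 * e + abs c ^ 3 * K + abs c * (2 * C * real (Suc j) powr (- s))"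
  using one_step[OF e] by blast
 define Z where "Z = (\<Sum>k. real (Suc k) powr (- s))"
 have Z: "(\<Sum>k<b. real (Suc k) powr (- s)) <= Z" for b unfolding Z_def by (intro sum_le_suminf summable_rate) auto
 have Z0: "Z >= 0" using Z[of 0] by simp
 define K' where "K' = max K (2 * C * Z)"
 have K': "K' >= K" "K' >= 2 * C * Z" "K' >= 0" using K by (auto simp: K'_def)
 have "cmod (w c h b - of_real (exp (- (real b * (c^2 * \<sigma>2 / 2)))) * w c h 0) \<le>
   exp (real b * abs (c^2 * \<sigma>2 / 2)) * (real b * (c^2 * e + abs c ^ 3 * K' + (c^2 * \<sigma>2 / 2)^2) + abs c * K' + real j0 * (abs c * Phi + abs (c^2 * \<sigma>2 / 2)))"
  if h: "unit_test h" and v1: "abs (c^2 * \<sigma>2 / 2) <= 1" for c h b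
 proof -
  define v where "v = c^2 * \<sigma>2 / 2"
  have v1: "abs v <= 1" using v1 by (simp add: v_def)
  have wn: "cmod (w c h k) <= 1" for k unfolding w_def by (rule cmod_integral_le[OF xi_meas[OF h] xi_norm[OF h]])
  define d where "d j = (c^2 * e + abs c ^ 3 * K + v^2) + abs c * (2 * C) * real (Suc j) powr (- s) + (if j < j0 then abs c * Phi + abs v else 0)" for j
  have base: "0 <= c^2 * e + abs c ^ 3 * K" "0 <= abs c * (2 * C) * real (Suc j) powr (- s)" for j using e K C_nonneg by auto
  have d0: "d j >= 0" for j using base(1) base(2)[of j] Phi(1) by (simp add: d_def)
  have dj: "cmod (w c h (Suc j) - of_real (exp (- v)) * w c h j) <= d j" for j
  proof -
   have 1: "cmod (w c h (Suc j) - w c h j + of_real v * w c h j) <= (c^2 * e + abs c ^ 3 * K) + abs c * (2 * C) * real (Suc j) powr (- s) + (if j < j0 then abs c * Phi + abs v else 0)"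
   proof (cases "j < j0")
    case True
    have "cmod (w c h (Suc j) - w c h j + of_real v * w c h j) <= cmod (w c h (Suc j) - w c h j) + cmod (of_real v * w c h j)" by (rule norm_triangle_ineq)
    also have "... <= abs c * Phi + abs v * 1"
     using w_steps[OF h, of c j 1] wn[of j] unfolding norm_mult norm_of_real by (intro add_mono mult_left_mono) auto
    finally have "cmod (w c h (Suc j) - w c h j + of_real v * w c h j) <= abs c * Phi + abs v" by simp
    then show ?thesis using base(1) base(2)[of j] unfolding if_P[OF True] by linarith
   next
    case False
    then show ?thesis using st[OF _ h, of j c] by (simp add: v_def mult.assoc)
   qed
   have 2: "cmod (of_real (1 - v - exp (- v)) * w c h j) <= v^2"
   proof -
    have abs_flip: "abs (1 - v - exp (- v)) = abs (exp (- v) - 1 - (- v))" by linarith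
    have "cmod (of_real (1 - v - exp (- v)) * w c h j) = abs (exp (- v) - 1 - (- v)) * cmod (w c h j)"
     unfolding norm_mult norm_of_real abs_flip ..
    also have "... <= (- v)^2 * 1" using exp_quadratic[of "-v"] v1 wn[of j] by (intro mult_mono) auto
    finally show ?thesis by simp
   qed
   have split: "w c h (Suc j) - of_real (exp (- v)) * w c h j = (w c h (Suc j) - w c h j + of_real v * w c h j) + of_real (1 - v - exp (- v)) * w c h j"
    by (simp add: algebra_simps)
   show ?thesis
    using norm_triangle_ineq[of "w c h (Suc j) - w c h j + of_real v * w c h j" "of_real (1 - v - exp (- v)) * w c h j"] 1 2
    unfolding d_def split by linarith
  qed
  have "cmod (w c h b - of_real (exp (- (real b * v))) * w c h 0) <= exp (real b * abs v) * (\<Sum>j<b. d j)"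
  proof (induction b)
   case (Suc b)
   have split: "w c h (Suc b) - of_real (exp (- (real (Suc b) * v))) * w c h 0 =
     (w c h (Suc b) - of_real (exp (- v)) * w c h b) + of_real (exp (- v)) * (w c h b - of_real (exp (- (real b * v))) * w c h 0)"
    by (simp add: algebra_simps exp_add[symmetric] flip: of_real_mult)
   have scale: "cmod (of_real (exp (- v)) * z) = exp (- v) * cmod z" for z by (simp add: norm_mult del: of_real_exp)
   have "cmod (w c h (Suc b) - of_real (exp (- (real (Suc b) * v))) * w c h 0) \<le>
     cmod (w c h (Suc b) - of_real (exp (- v)) * w c h b) + exp (- v) * cmod (w c h b - of_real (exp (- (real b * v))) * w c h 0)"
    unfolding split scale[symmetric] by (rule norm_triangle_ineq)
   also have "... <= exp (real (Suc b) * abs v) * d b + exp (abs v) * (exp (real b * abs v) * (\<Sum>j<b. d j))"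
   proof (intro add_mono mult_mono Suc)
    have "1 * d b <= exp (real (Suc b) * abs v) * d b" using d0 by (intro mult_right_mono) auto
    then show "cmod (w c h (Suc b) - of_real (exp (- v)) * w c h b) <= exp (real (Suc b) * abs v) * d b" using dj[of b] by simp
   qed auto
   also have "... = exp (real (Suc b) * abs v) * (\<Sum>j<Suc b. d j)" by (simp add: algebra_simps exp_add)
   finally show ?case .
  qed simp
  also have "... <= exp (real b * abs v) * (real b * (c^2 * e + abs c ^ 3 * K' + v^2) + abs c * K' + real j0 * (abs c * Phi + abs v))"
  proof (intro mult_left_mono)
   have s1: "(\<Sum>j<b. d j) = real b * (c^2 * e + abs c ^ 3 * K + v^2) + abs c * (2 * C) * (\<Sum>j<b. real (Suc j) powr (- s)) + (\<Sum>j<b. if j < j0 then abs c * Phi + abs v else 0)"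
    unfolding d_def sum.distrib sum_distrib_left by (simp add: distrib_left)
   have s2: "(\<Sum>j<b. if j < j0 then abs c * Phi + abs v else 0) <= real j0 * (abs c * Phi + abs v)"
   proof -
    have "(\<Sum>j<b. if j < j0 then abs c * Phi + abs v else 0) = (\<Sum>j\<in>{..<b} \<inter> {j. j < j0}. abs c * Phi + abs v)" by (subst sum.If_cases) auto
    also have "... <= (\<Sum>j<j0. abs c * Phi + abs v)" using Phi(1) by (intro sum_mono2) auto
    finally show ?thesis by simp
   qed
   have s3: "abs c * (2 * C) * (\<Sum>j<b. real (Suc j) powr (- s)) <= abs c * K'"
   proof -
    have "2 * C * (\<Sum>j<b. real (Suc j) powr (- s)) <= 2 * C * Z" using C_nonneg by (intro mult_left_mono Z) auto
    then have "2 * C * (\<Sum>j<b. real (Suc j) powr (- s)) <= K'" using K'(2) by linarith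
    then have "abs c * (2 * C * (\<Sum>j<b. real (Suc j) powr (- s))) <= abs c * K'" by (intro mult_left_mono) auto
    then show ?thesis by (simp only: mult.assoc)
   qed
   have s4: "real b * (c^2 * e + abs c ^ 3 * K + v^2) <= real b * (c^2 * e + abs c ^ 3 * K' + v^2)"
    using K' by (intro mult_left_mono add_mono order.refl) auto
   show "(\<Sum>j<b. d j) <= real b * (c^2 * e + abs c ^ 3 * K' + v^2) + abs c * K' + real j0 * (abs c * Phi + abs v)"
    unfolding s1 using s2 s3 s4 by linarith
  qed simp
  finally show ?thesis unfolding v_def .
 qed
 then show ?thesis using K' by (intro exI[of _ K'] exI[of _ "real j0"]) auto
qed

text \<open>At scale \<open>c = t / sqrt n\<close> the errors of \<open>n\<close> steps still vanish. The test functions may vary with \<open>n\<close>.\<close>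

theorem charfun_limit:
 assumes b: "!!n. b n <= n" "(%n. real (b n) / real n) ~> \<beta>" and h: "!!n. unit_test (h n)"
 shows "(%n. w (t / sqrt n) (h n) (b n) - of_real (exp (- (\<beta> * t^2 * \<sigma>2 / 2))) * w (t / sqrt n) (h n) 0) ~> 0"
proof -
 let ?c = "%n. t / sqrt (real n)"
 let ?v = "%n. (?c n)^2 * \<sigma>2 / 2"
 define L where "L = t^2 * abs (\<sigma>2) / 2"
 have c2: "(?c n)^2 = t^2 / n" for n by (simp add: power_divide)
 have inv: "(%n. 1 / sqrt (real n)) ~> 0"
  by (intro tendsto_divide_0[OF tendsto_const] filterlim_at_top_imp_at_infinity filterlim_compose[OF sqrt_at_top filterlim_real_sequentially])
 have inv1: "(%n. 1 / real n) ~> 0" by (rule lim_1_over_n)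
 have ctend: "(%n. abs (?c n)) ~> 0" using tendsto_rabs_zero[OF tendsto_mult_right_zero[OF inv, of t]] by simp
 have vt: "(%n. abs (?v n)) ~> 0"
  using tendsto_rabs_zero[OF tendsto_mult_right_zero[OF inv1, of "t^2 * \<sigma>2 / 2"]] by (simp add: c2 mult.commute)
 have part1: "(%n. w (?c n) (h n) (b n) - of_real (exp (- (real (b n) * ?v n))) * w (?c n) (h n) 0) ~> 0"
 proof (rule LIMSEQ_I)
  fix r :: real assume r: "r > 0"
  define e where "e = r / (2 * (exp L * (t^2 + 1)))"
  have e: "e > 0" using r by (auto simp: e_def intro!: divide_pos_pos mult_pos_pos add_nonneg_pos)
  obtain K j0 where K: "K >= 0" "j0 >= 0" and rec: "!!c h b. unit_test h ==> abs (c^2 * \<sigma>2 / 2) <= 1 ==>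
   cmod (w c h b - of_real (exp (- (real b * (c^2 * \<sigma>2 / 2)))) * w c h 0) \<le>
   exp (real b * abs (c^2 * \<sigma>2 / 2)) * (real b * (c^2 * e + abs c ^ 3 * K + (c^2 * \<sigma>2 / 2)^2) + abs c * K + j0 * (abs c * Phi + abs (c^2 * \<sigma>2 / 2)))"
   using w_recursion[OF e] by blast
  define rest where "rest n = exp L * (t^2 * abs (?c n) * K + L * abs (?v n) + abs (?c n) * K + j0 * (abs (?c n) * Phi + abs (?v n)))" for n
  have "rest ~> exp L * (t^2 * 0 * K + L * 0 + 0 * K + j0 * (0 * Phi + 0))"
   unfolding rest_def by (intro tendsto_intros ctend vt)
  then have "rest ~> 0" by simp
  then have "eventually (%n. rest n < r / 2) sequentially" using r by (intro order_tendstoD(2)) auto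
  moreover have "eventually (%n. abs (?v n) < 1) sequentially" using order_tendstoD(2)[OF vt, of 1] by simp
  moreover have "eventually (%n. n >= 1) sequentially" by (rule eventually_ge_at_top)
  ultimately have "eventually (%n. norm (w (?c n) (h n) (b n) - of_real (exp (- (real (b n) * ?v n))) * w (?c n) (h n) 0 - 0) < r) sequentially"
  proof eventually_elim
   case (elim n)
   have n: "real n > 0" using elim by simp
   have bn: "real (b n) <= real n" using b(1)[of n] by simp
   have bv: "real (b n) * abs (?v n) <= L"
   proof -
    have "real (b n) * abs (?v n) <= real n * abs (?v n)" using bn by (intro mult_right_mono) auto
    also have "... = L" using n by (simp add: c2 L_def abs_mult)
    finally show ?thesis .
   qed
   have bc: "real (b n) * (?c n)^2 <= t^2"
   proof -
    have "real (b n) * (?c n)^2 <= real n * (?c n)^2" using bn by (intro mult_right_mono) auto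
    also have "... = t^2" using n by (simp add: c2)
    finally show ?thesis .
   qed
   have "cmod (w (?c n) (h n) (b n) - of_real (exp (- (real (b n) * ?v n))) * w (?c n) (h n) 0) \<le>
    exp (real (b n) * abs (?v n)) * (real (b n) * ((?c n)^2 * e + abs (?c n) ^ 3 * K + (?v n)^2) + abs (?c n) * K + j0 * (abs (?c n) * Phi + abs (?v n)))"
    by (rule rec[OF h]) (use elim in simp)
   also have "... <= exp L * ((t^2 * e + t^2 * abs (?c n) * K + L * abs (?v n)) + abs (?c n) * K + j0 * (abs (?c n) * Phi + abs (?v n)))"
   proof (intro mult_mono add_mono order.refl)
    show "exp (real (b n) * abs (?v n)) <= exp L" using bv by simp
    have "real (b n) * ((?c n)^2 * e + abs (?c n) ^ 3 * K + (?v n)^2) = (real (b n) * (?c n)^2) * e + (real (b n) * (?c n)^2) * (abs (?c n) * K) + (real (b n) * abs (?v n)) * abs (?v n)"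
    proof -
     have "abs (?c n) ^ 3 = (?c n)^2 * abs (?c n)" by (simp add: power3_eq_cube power2_eq_square)
     moreover have "(?v n)^2 = abs (?v n) * abs (?v n)" by (simp add: power2_eq_square)
     ultimately show ?thesis by (simp only: algebra_simps)
    qed
    also have "... <= t^2 * e + t^2 * (abs (?c n) * K) + L * abs (?v n)"
     using bc bv e K by (intro add_mono mult_right_mono) auto
    finally show "real (b n) * ((?c n)^2 * e + abs (?c n) ^ 3 * K + (?v n)^2) <= t^2 * e + t^2 * abs (?c n) * K + L * abs (?v n)" by (simp add: mult.assoc)
   qed (use K e Phi(1) in auto)
   also have "... = exp L * t^2 * e + rest n" by (simp add: rest_def algebra_simps)
   also have "exp L * t^2 * e <= exp L * (t^2 + 1) * e" using e by (intro mult_right_mono mult_left_mono) auto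
   also have "exp L * (t^2 + 1) * e = r / 2"
   proof -
    have "exp L * (t^2 + 1) > 0" by (intro mult_pos_pos add_nonneg_pos) auto
    then have "exp L * (t^2 + 1) ~= 0" by linarith
    moreover have "E * (r / (2 * E)) = r / 2" if "E ~= 0" for E :: real using that by simp
    ultimately show ?thesis unfolding e_def by blast
   qed
   finally show ?case using elim by simp
  qed
  then show "\<exists>no. \<forall>n\<ge>no. norm (w (?c n) (h n) (b n) - of_real (exp (- (real (b n) * ?v n))) * w (?c n) (h n) 0 - 0) < r"
   by (simp only: eventually_sequentially)
 qed
 have part2: "(%n. of_real (exp (- (real (b n) * ?v n))) * w (?c n) (h n) 0 - of_real (exp (- (\<beta> * t^2 * \<sigma>2 / 2))) * w (?c n) (h n) 0) ~> 0"
 proof (rule Lim_null_comparison)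
  have "(%n. exp (- (real (b n) / real n * t^2 * \<sigma>2 / 2)) - exp (- (\<beta> * t^2 * \<sigma>2 / 2))) ~> exp (- (\<beta> * t^2 * \<sigma>2 / 2)) - exp (- (\<beta> * t^2 * \<sigma>2 / 2))"
   by (intro tendsto_intros b(2)) auto
  then show "(%n. abs (exp (- (real (b n) * ?v n)) - exp (- (\<beta> * t^2 * \<sigma>2 / 2)))) ~> 0"
   by (intro tendsto_rabs_zero) (simp add: c2 mult.assoc)
  show "\<forall>\<^sub>F n in sequentially. norm (of_real (exp (- (real (b n) * ?v n))) * w (?c n) (h n) 0 - of_real (exp (- (\<beta> * t^2 * \<sigma>2 / 2))) * w (?c n) (h n) 0)
   <= abs (exp (- (real (b n) * ?v n)) - exp (- (\<beta> * t^2 * \<sigma>2 / 2)))"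
  proof (intro always_eventually allI)
   fix n
   have wn: "cmod (w (?c n) (h n) 0) <= 1" unfolding w_def by (rule cmod_integral_le[OF xi_meas[OF h] xi_norm[OF h]])
   have "norm (of_real (exp (- (real (b n) * ?v n))) * w (?c n) (h n) 0 - of_real (exp (- (\<beta> * t^2 * \<sigma>2 / 2))) * w (?c n) (h n) 0)
    = abs (exp (- (real (b n) * ?v n)) - exp (- (\<beta> * t^2 * \<sigma>2 / 2))) * cmod (w (?c n) (h n) 0)"
    by (simp only: left_diff_distrib[symmetric] of_real_diff[symmetric] norm_mult norm_of_real)
   then show "norm (of_real (exp (- (real (b n) * ?v n))) * w (?c n) (h n) 0 - of_real (exp (- (\<beta> * t^2 * \<sigma>2 / 2))) * w (?c n) (h n) 0)
   <= abs (exp (- (real (b n) * ?v n)) - exp (- (\<beta> * t^2 * \<sigma>2 / 2)))" using wn by (simp only:) (intro mult_left_le, auto)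
  qed
 qed
 show ?thesis using tendsto_add[OF part1 part2] by simp
qed

lemma w_0: "unit_test h ==> w c h 0 = of_real (LINT x|M. h x)"
 unfolding w_def by simp

text \<open>A limit of characteristic functions is bounded by \<open>1\<close>.\<close>

lemma sigma2_nonneg: "\<sigma>2 >= 0"
proof -
 have t: "unit_test (%_. 1)" by (simp add: unit_test_def)
 have "(%n::nat. real n / real n) ~> 1"
  by (rule tendsto_eventually) (auto simp: eventually_sequentially intro!: exI[of _ 1])
 from charfun_limit[OF _ this t, of 1]
 have "(%n. w (1 / sqrt n) (%_. 1) n - of_real (exp (- (\<sigma>2 / 2)))) ~> 0" using w_0[OF t] prob_space by simp
 from tendsto_add[OF this tendsto_const[of "of_real (exp (- (\<sigma>2 / 2)))"]]
 have "(%n. w (1 / sqrt n) (%_. 1) n) ~> of_real (exp (- (\<sigma>2 / 2)))" by simp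
 then have "(%n. cmod (w (1 / sqrt n) (%_. 1) n)) ~> cmod (of_real (exp (- (\<sigma>2 / 2))))" by (rule tendsto_norm)
 moreover have "cmod (w (1 / sqrt n) (%_. 1) n) <= 1" for n
  unfolding w_def by (rule cmod_integral_le[OF xi_meas[OF t] xi_norm[OF t]])
 ultimately have "cmod (of_real (exp (- (\<sigma>2 / 2)))) <= 1" by (intro LIMSEQ_le_const2) auto
 then show ?thesis by (simp del: of_real_exp)
qed

text \<open>For a positive future factor, weighting by it and normalizing gives probabilities to which the continuity theorem of Levy applies.\<close>

lemma block_clt_positive:
 fixes p :: "nat => real => real" and h :: "real => real"
 assumes b: "!!n. b n <= n" "(%n. real (b n) / real n) ~> \<beta>"
  and p: "!!n. p n \<in> borel_measurable M" "!!n x. x \<in> space M ==> 1/3 <= p n x \<and> p n x <= 1"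
  and \<mu>: "real_distribution \<mu>" "!!t. char \<mu> t = of_real (exp (- (\<beta> * t^2 * \<sigma>2 / 2)))"
  and h: "!!x. isCont h x" "!!x. abs (h x) <= H"
 shows "(%n. (LINT x|M. h (S (b n) x / sqrt n) * p n ((f ^^ b n) x)) - (LINT x|\<mu>. h x) * (LINT x|M. p n x)) ~> 0"
proof -
 have abs1: "abs (p n x) <= 1" if "x \<in> space M" for n x using p(2)[OF that, of n] by auto
 have ut: "unit_test (p n)" for n unfolding unit_test_def using p(1) abs1 by blast
 define r where "r n = (LINT x|M. p n x)" for n
 have intp: "integrable M (p n)" for n by (intro bmeas_integrable bmeas_le_1 p(1) abs1)
 have r: "1/3 <= r n" "r n <= 1" for n
 proof -
  have "(LINT x|M. 1/3) <= r n" "r n <= (LINT x|M. 1)" unfolding r_def using p(2) intp by (intro integral_mono; auto)+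
  then show "1/3 <= r n" "r n <= 1" using prob_space by auto
 qed
 define g where "g n x = p n ((f ^^ b n) x) / r n" for n x
 have gm: "g n \<in> borel_measurable M" for n unfolding g_def[abs_def] by (intro borel_measurable_divide measurable_compose[OF fk_meas p(1)]) auto
 have g0: "0 <= g n x" if "x \<in> space M" for n x using p(2)[OF fk_space[OF that], of n "b n"] r[of n] by (simp add: g_def)
 define N where "N n = density M (%x. ennreal (g n x))" for n
 have spN: "space (N n) = space M" "sets (N n) = sets M" for n by (auto simp: N_def)
 define X where "X n x = S (b n) x / sqrt n" for n x
 have Xm: "X n \<in> borel_measurable M" for n unfolding X_def[abs_def] using bmeas_measurable[OF S_bmeas] by (intro borel_measurable_divide) auto
 have XN: "X n \<in> borel_measurable (N n)" for n using Xm by (simp add: N_def)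
 have dens: "(LINT x|(N n). u x) = (LINT x|M. g n x *\<^sub>R u x)" if "u \<in> borel_measurable M" for u :: "real => 'z :: {banach, second_countable_topology}" and n
  unfolding N_def by (rule integral_density) (use gm g0 that in auto)
 have gint: "integrable M (g n)" "(LINT x|M. g n x) = 1" for n
 proof -
  have i: "integrable M (%x. p n ((f ^^ b n) x))" by (intro bmeas_integrable bmeas_fk bmeas_le_1 p(1) abs1)
  then show "integrable M (g n)" unfolding g_def[abs_def] by simp
  show "(LINT x|M. g n x) = 1" unfolding g_def[abs_def] using invariant[OF p(1)[of n], of "b n"] r[of n] by (simp add: r_def[symmetric])
 qed
 have pN: "prob_space (N n)" for n
 proof
  have "emeasure (N n) (space (N n)) = (\<integral>\<^sup>+x. ennreal (g n x) \<partial>M)"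
   unfolding N_def using gm by (subst emeasure_density) (auto intro!: nn_integral_cong)
  also have "... = ennreal (LINT x|M. g n x)" using gint g0 by (intro nn_integral_eq_integral) auto
  finally show "emeasure (N n) (space (N n)) = 1" by (simp add: gint)
 qed
 define D where "D n = distr (N n) borel (X n)" for n
 have rd: "real_distribution (D n)" for n unfolding D_def by (rule prob_space.real_distribution_distr[OF pN XN])
 have Dint: "(LINT x|(D n). u x) = (LINT x|M. g n x *\<^sub>R u (X n x))" if u: "u \<in> borel_measurable borel" for u :: "real => 'z :: {banach, second_countable_topology}" and n
  unfolding D_def by (subst integral_distr[OF XN u]) (rule dens[OF measurable_compose[OF Xm u]])
 have "(%n. char (D n) t) ~> char \<mu> t" for t
 proof -
  let ?z = "%n. w (t / sqrt n) (p n) (b n) - of_real (exp (- (\<beta> * t^2 * \<sigma>2 / 2))) * w (t / sqrt n) (p n) 0"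
  have ch: "char (D n) t = w (t / sqrt n) (p n) (b n) / of_real (r n)" for n
  proof -
   have "char (D n) t = (LINT x|M. g n x *\<^sub>R iexp (t * X n x))" unfolding char_def by (rule Dint) measurable
   also have "... = (LINT x|M. xi (t / sqrt n) (p n) (b n) x / of_real (r n))"
    by (simp add: xi_eq g_def X_def scaleR_conv_of_real mult.commute)
   finally show ?thesis by (simp add: w_def)
  qed
  have "(%n. (?z n) / of_real (r n)) ~> 0"
  proof (rule Lim_null_comparison)
   show "(%n. 3 * cmod (?z n)) ~> 0" by (intro tendsto_mult_right_zero tendsto_norm_zero charfun_limit b ut)
   show "\<forall>\<^sub>F n in sequentially. norm ((?z n) / of_real (r n))
     <= 3 * cmod (?z n)"
   proof (intro always_eventually allI)
    fix n
    have "cmod (?z n) / r n <= cmod (?z n) / (1/3)" using r[of n] by (intro divide_left_mono) auto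
    then show "norm (?z n / of_real (r n)) <= 3 * cmod (?z n)" using r[of n] by (simp add: norm_divide mult.commute)
   qed
  qed
  from tendsto_add[OF this tendsto_const[of "of_real (exp (- (\<beta> * t^2 * \<sigma>2 / 2)))"]]
  have l: "(%n. (?z n) / of_real (r n) + of_real (exp (- (\<beta> * t^2 * \<sigma>2 / 2)))) ~> char \<mu> t"
   by (simp only: \<mu>(2) add_0)
  have e: "(?z n) / of_real (r n) + of_real (exp (- (\<beta> * t^2 * \<sigma>2 / 2))) = char (D n) t" for n
  proof -
   have "complex_of_real (r n) ~= 0" using r[of n] by auto
   then show ?thesis unfolding ch w_0[OF ut] r_def[symmetric] by (simp add: field_simps del: of_real_exp)
  qed
  show ?thesis using l unfolding e .
 qed
 from levy_continuity[OF rd \<mu>(1) this] have "weak_conv_m D \<mu>" .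
 from weak_conv_imp_integral_bdd_continuous_conv[OF rd \<mu>(1) this, of h H]
 have lim: "(%n. (LINT x|(D n). h x)) ~> (LINT x|\<mu>. h x)" using h by simp
 have hm: "h \<in> borel_measurable borel"
  by (intro borel_measurable_continuous_onI) (simp add: continuous_on_eq_continuous_at h)
 have eq: "(LINT x|M. h (S (b n) x / sqrt n) * p n ((f ^^ b n) x)) = r n * (LINT x|(D n). h x)" for n
 proof -
  have "r n * (LINT x|(D n). h x) = r n * (LINT x|M. g n x *\<^sub>R h (X n x))" by (simp only: Dint[OF hm])
  also have "... = (LINT x|M. r n * (g n x *\<^sub>R h (X n x)))" by simp
  also have "... = (LINT x|M. h (S (b n) x / sqrt n) * p n ((f ^^ b n) x))"
   using r[of n] by (intro LINT_cong) (auto simp: g_def X_def)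
  finally show ?thesis by simp
 qed
 have "(%n. r n * ((LINT x|(D n). h x) - (LINT x|\<mu>. h x))) ~> 0"
 proof (rule Lim_null_comparison)
  show "(%n. abs ((LINT x|(D n). h x) - (LINT x|\<mu>. h x))) ~> 0"
   using tendsto_diff[OF lim tendsto_const[of "LINT x|\<mu>. h x"]] by (intro tendsto_rabs_zero) simp
  show "\<forall>\<^sub>F n in sequentially. norm (r n * ((LINT x|(D n). h x) - (LINT x|\<mu>. h x))) <= abs ((LINT x|(D n). h x) - (LINT x|\<mu>. h x))"
  proof (intro always_eventually allI)
   fix n show "norm (r n * ((LINT x|(D n). h x) - (LINT x|\<mu>. h x))) <= abs ((LINT x|(D n). h x) - (LINT x|\<mu>. h x))"
    using r[of n] by (simp add: abs_mult mult_left_le_one_le)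
  qed
 qed
 then show ?thesis unfolding eq r_def[symmetric] by (simp add: algebra_simps)
qed

text \<open>A general factor is an affine image of one with values in \<open>[1/3, 1]\<close>.\<close>

theorem block_clt:
 fixes g :: "nat => real => real" and h :: "real => real"
 assumes b: "!!n. b n <= n" "(%n. real (b n) / real n) ~> \<beta>"
  and g: "!!n. unit_test (g n)"
  and \<mu>: "real_distribution \<mu>" "!!t. char \<mu> t = of_real (exp (- (\<beta> * t^2 * \<sigma>2 / 2)))"
  and h: "!!x. isCont h x" "!!x. abs (h x) <= H"
 shows "(%n. (LINT x|M. h (S (b n) x / sqrt n) * g n ((f ^^ b n) x)) - (LINT x|\<mu>. h x) * (LINT x|M. g n x)) ~> 0"
proof -
 have pm: "g n \<in> borel_measurable M" and p1: "x \<in> space M ==> abs (g n x) <= 1" for n x using g by (auto simp: unit_test_def)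
 have bp: "bmeas M (g n)" for n using pm p1 by (rule bmeas_le_1)
 have hm: "h \<in> borel_measurable borel"
  by (intro borel_measurable_continuous_onI) (simp add: continuous_on_eq_continuous_at h)
 have bh: "bmeas M (%x. h (S (b n) x / sqrt n))" for n
  using bmeas_measurable[OF S_bmeas] by (intro bmeasI[of _ _ H] measurable_compose[OF _ hm] borel_measurable_divide) (auto simp: h)
 let ?p1 = "%n x. (g n x + 2) / 3" and ?p2 = "%n x. 2 / 3 :: real"
 have c1: "(%n. (LINT x|M. h (S (b n) x / sqrt n) * ?p1 n ((f ^^ b n) x)) - (LINT x|\<mu>. h x) * (LINT x|M. ?p1 n x)) ~> 0"
 proof (rule block_clt_positive[OF b _ _ \<mu> h])
  show "(%x. (g n x + 2) / 3) \<in> borel_measurable M" for n using pm by simp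
  show "1 / 3 <= (g n x + 2) / 3 \<and> (g n x + 2) / 3 <= 1" if "x \<in> space M" for n x using p1[OF that, of n] by auto
 qed
 have c2: "(%n. (LINT x|M. h (S (b n) x / sqrt n) * ?p2 n ((f ^^ b n) x)) - (LINT x|\<mu>. h x) * (LINT x|M. ?p2 n x)) ~> 0"
  by (rule block_clt_positive[OF b _ _ \<mu> h]) auto
 have e1: "(LINT x|M. h (S (b n) x / sqrt n) * ?p1 n ((f ^^ b n) x)) = (LINT x|M. h (S (b n) x / sqrt n) * g n ((f ^^ b n) x)) / 3 + (LINT x|M. h (S (b n) x / sqrt n) * ?p2 n ((f ^^ b n) x))" for n
 proof -
  have "(LINT x|M. h (S (b n) x / sqrt n) * ?p1 n ((f ^^ b n) x)) = (LINT x|M. (h (S (b n) x / sqrt n) * g n ((f ^^ b n) x)) / 3 + h (S (b n) x / sqrt n) * (2 / 3))"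
   by (simp add: algebra_simps add_divide_distrib)
  also have "... = (LINT x|M. (h (S (b n) x / sqrt n) * g n ((f ^^ b n) x)) / 3) + (LINT x|M. h (S (b n) x / sqrt n) * (2 / 3))"
   by (rule LINT_add[OF bmeas_integrable[OF bmeas_divide[OF bmeas_mult[OF bh bmeas_fk[OF bp]]]] bmeas_integrable[OF bmeas_mult[OF bh bmeas_const]]])
  finally show ?thesis by simp
 qed
 have e2: "(LINT x|M. ?p1 n x) = (LINT x|M. g n x) / 3 + (LINT x|M. ?p2 n x)" for n
  using bmeas_integrable[OF bp[of n]] by (simp add: add_divide_distrib)
 have "(%n. 3 * (((LINT x|M. h (S (b n) x / sqrt n) * ?p1 n ((f ^^ b n) x)) - (LINT x|\<mu>. h x) * (LINT x|M. ?p1 n x)) -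
   ((LINT x|M. h (S (b n) x / sqrt n) * ?p2 n ((f ^^ b n) x)) - (LINT x|\<mu>. h x) * (LINT x|M. ?p2 n x)))) ~> 3 * (0 - 0)"
  by (intro tendsto_intros c1 c2)
 then show ?thesis unfolding e1 e2 by (simp add: algebra_simps)
qed

end

section \<open>Observables of bounded variation\<close>

theorem bounded_variation_mixing_observable:
 assumes \<gamma>: "0 < \<gamma>" "\<gamma> < 1/2" and f: "f \<in> Hol \<gamma> \<rho>" and \<nu>: "acip f \<nu>"
  and \<phi>: "bounded_variation_on 0 1 \<phi>" "(LINT x|\<nu>. \<phi> x) = 0"
 shows "\<exists>C s. 1 / (2 * \<gamma>) < s \<and> mixing_observable \<nu> f \<phi> C s"
proof -
 define a b where "a = 1 / (2 * \<gamma>)" and "b = 1 / \<gamma> - 1"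
 have ab: "1 < a" "a < b" using \<gamma> by (auto simp: a_def b_def field_simps)
 define s s' where "s = (2 * a + b) / 3" and "s' = (a + 2 * b) / 3"
 have s: "a < s" "s < s'" "s' < b" "1 < s" "1 < s'" using ab by (auto simp: s_def s'_def)
 interpret holland \<gamma> \<rho> f using \<gamma> f by unfold_locales auto
 obtain D C0 where "intermittent f y0 d0 D C0 s'" using intermittent_exists[OF s(5) s(3)[unfolded b_def]] by blast
 then interpret I: intermittent_acip f y0 d0 D C0 s' \<nu>
  using \<nu> by (simp add: intermittent_acip_def intermittent_acip_axioms_def)
 obtain g h where gh: "mono_on {0..1} g" "mono_on {0..1} h" "!!x. x \<in> {0..1} ==> \<phi> x = g x - h x"
  using bounded_variation_decomposition[OF \<phi>(1)] by blast
 have bg: "bmeas \<nu> g" and bh: "bmeas \<nu> h" using gh by (auto simp: I.bmeas_nu intro: I.mono_bmeas)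
 have b\<phi>: "bmeas \<nu> \<phi>"
  using bmeas_diff[OF bg bh] by (rule bmeas_cong[THEN iffD1, rotated]) (simp add: I.space_nu gh(3))
 obtain Cg where Cg: "Cg >= 0" "!!n p. n >= 1 ==> I.test p ==>
  abs ((LINT x|\<nu>. g x * p ((f ^^ n) x)) - (LINT x|\<nu>. g x) * (LINT x|\<nu>. p x)) <= Cg * n powr (- s)"
  using I.nu_decay[OF _ s(2) gh(1)] s by (metis less_imp_le)
 obtain Ch where Ch: "Ch >= 0" "!!n p. n >= 1 ==> I.test p ==>
  abs ((LINT x|\<nu>. h x * p ((f ^^ n) x)) - (LINT x|\<nu>. h x) * (LINT x|\<nu>. p x)) <= Ch * n powr (- s)"
  using I.nu_decay[OF _ s(2) gh(2)] s by (metis less_imp_le)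
 have test: "I.test p" if "p \<in> borel_measurable \<nu>" "!!x. x \<in> space \<nu> ==> abs (p x) <= 1" for p
  using that unfolding I.test_def I.meas_nu I.space_nu by blast
 have fk: "(f ^^ k) \<in> \<nu> \<rightarrow>\<^sub>M \<nu>" for k
  by (induction k) (auto simp: comp_def intro: measurable_compose[OF _ I.f_meas_nu])
 have "mixing_observable \<nu> f \<phi> (Cg + Ch) s"
 proof
  show "f \<in> \<nu> \<rightarrow>\<^sub>M \<nu>" "distr \<nu> \<nu> f = \<nu>" by (rule I.f_meas_nu, rule I.distr_nu)
  show "bmeas \<nu> \<phi>" "(LINT x|\<nu>. \<phi> x) = 0" "1 < s" "0 <= Cg + Ch" using b\<phi> \<phi> s Cg Ch by auto
 next
  fix n :: nat and p :: "real => real"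
  assume n: "n >= 1" and p: "p \<in> borel_measurable \<nu>" "!!x. x \<in> space \<nu> ==> abs (p x) <= 1"
  have bp: "bmeas \<nu> (%x. p ((f ^^ n) x))" by (rule bmeas_comp[OF bmeas_le_1[OF p] fk])
  have i: "(LINT x|\<nu>. \<phi> x * u x) = (LINT x|\<nu>. g x * u x) - (LINT x|\<nu>. h x * u x)" if u: "bmeas \<nu> u" for u
  proof -
   have "(LINT x|\<nu>. \<phi> x * u x) = (LINT x|\<nu>. g x * u x - h x * u x)"
    by (intro LINT_cong refl) (simp add: I.space_nu gh(3) left_diff_distrib)
   also have "... = (LINT x|\<nu>. g x * u x) - (LINT x|\<nu>. h x * u x)"
    by (rule LINT_diff) (intro I.nu.bmeas_integrable bmeas_mult bg bh u)+
   finally show ?thesis .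
  qed
  have gh0: "(LINT x|\<nu>. g x) = (LINT x|\<nu>. h x)" using i[of "%_. 1"] \<phi>(2) by simp
  have 1: "(LINT x|\<nu>. \<phi> x * p ((f ^^ n) x)) = (LINT x|\<nu>. g x * p ((f ^^ n) x)) - (LINT x|\<nu>. h x * p ((f ^^ n) x))"
   by (rule i[OF bp])
  show "abs (LINT x|\<nu>. \<phi> x * p ((f ^^ n) x)) <= (Cg + Ch) * n powr (- s)"
   using Cg(2)[OF n test[OF p]] Ch(2)[OF n test[OF p]] unfolding 1 gh0 distrib_right by linarith
 next
  fix u :: "real => real" and e :: real assume "bmeas \<nu> u" "e > 0"
  from I.nu_mixing[OF this] obtain N where N: "!!n p. n >= N ==> I.test p ==>
    abs ((LINT x|\<nu>. u x * p ((f ^^ n) x)) - (LINT x|\<nu>. u x) * (LINT x|\<nu>. p x)) <= e" by blast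
  show "\<exists>N. \<forall>n\<ge>N. \<forall>p\<in>borel_measurable \<nu>. (\<forall>x\<in>space \<nu>. abs (p x) <= 1) -->
    abs ((LINT x|\<nu>. u x * p ((f ^^ n) x)) - (LINT x|\<nu>. u x) * (LINT x|\<nu>. p x)) <= e"
   by (intro exI[of _ N] allI ballI impI N test) auto
 qed
 then show ?thesis using s(1) by (auto simp: a_def)
qed

section \<open>Piecewise linear paths in Hoelder spaces\<close>

text \<open>The increasing ramp from \<open>0\<close> to \<open>1\<close>. Written with ramps, linear interpolation is linear in its nodes without any case distinction.\<close>

definition ramp :: "real => real" where "ramp u = max 0 (min 1 u)"

text \<open>The polygon through the points \<open>(k / D, v k)\<close>.\<close>

definition interp :: "nat => (nat => real) => real => real" where
 "interp D v = (\<lambda>t\<in>{0..1}. v 0 + (\<Sum>k<D. (v (Suc k) - v k) * ramp (real D * t - real k)))"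

lemma ramp_mono: "u <= u' ==> ramp u <= ramp u'" by (auto simp: ramp_def)

lemma sum_ramp: "0 <= r ==> (\<Sum>k<D. ramp (r - real k)) = min r (real D)"
 by (induction D) (auto simp: ramp_def)

lemma interp_lipschitz:
 assumes v: "!!k. k < D ==> abs (v (Suc k) - v k) <= \<Lambda>" and st: "s \<in> {0..1}" "t \<in> {0..1}"
 shows "abs (interp D v s - interp D v t) <= \<Lambda> * real D * abs (s - t)"
proof -
 have *: "abs (interp D v t - interp D v s) <= \<Lambda> * real D * (t - s)" if st: "s \<in> {0..1}" "t \<in> {0..1}" "s <= t" for s t
 proof -
  let ?r = "%t k. ramp (real D * t - real k)"
  have "interp D v t - interp D v s = (\<Sum>k<D. (v (Suc k) - v k) * (?r t k - ?r s k))"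
   using st by (simp add: interp_def right_diff_distrib sum_subtractf)
  then have "abs (interp D v t - interp D v s) <= (\<Sum>k<D. abs ((v (Suc k) - v k) * (?r t k - ?r s k)))" by simp
  also have "... <= (\<Sum>k<D. \<Lambda> * (?r t k - ?r s k))"
  proof (rule sum_mono)
   fix k assume k: "k \<in> {..<D}"
   have "?r s k <= ?r t k" using st by (intro ramp_mono) (simp add: mult_left_mono)
   then show "abs ((v (Suc k) - v k) * (?r t k - ?r s k)) <= \<Lambda> * (?r t k - ?r s k)"
    using v[of k] k by (simp add: abs_mult mult_right_mono)
  qed
  also have "... = \<Lambda> * ((\<Sum>k<D. ?r t k) - (\<Sum>k<D. ?r s k))" by (simp add: sum_distrib_left[symmetric] sum_subtractf)
  also have "... = \<Lambda> * real D * (t - s)"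
  proof -
   have "(\<Sum>k<D. ?r u k) = real D * u" if "u \<in> {0..1}" for u
    using that sum_ramp[of "real D * u" D] by (simp add: mult_left_le)
   then show ?thesis using st by (simp add: algebra_simps)
  qed
  finally show ?thesis .
 qed
 show ?thesis
 proof (cases "s <= t")
  case True
  then show ?thesis using *[of s t] st by (simp add: abs_minus_commute)
 next
  case False
  then show ?thesis using *[of t s] st by simp
 qed
qed

lemma interp_grid:
 assumes "j <= D" "D >= 1" shows "interp D v (real j / real D) = v j"
proof -
 have "interp D v (real j / real D) = v 0 + (\<Sum>k<D. (v (Suc k) - v k) * ramp (real j - real k))"
  using assms by (simp add: interp_def)
 also have "(\<Sum>k<D. (v (Suc k) - v k) * ramp (real j - real k)) = (\<Sum>k<D. if k < j then v (Suc k) - v k else 0)"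
 proof (intro sum.cong refl)
  fix k
  show "(v (Suc k) - v k) * ramp (real j - real k) = (if k < j then v (Suc k) - v k else 0)"
   by (cases "k < j") (auto simp: ramp_def)
 qed
 also have "... = (\<Sum>k<j. v (Suc k) - v k)" using assms by (intro sum.mono_neutral_cong_right) auto
 also have "... = v j - v 0" by (rule sum_lessThan_telescope)
 finally show ?thesis by simp
qed

lemma interp_0: "interp D v 0 = v 0"
proof -
 have "ramp (- real k) = 0" for k by (simp add: ramp_def)
 then show ?thesis by (simp add: interp_def)
qed

lemma interp_extensional: "interp D v \<in> extensional {0..1}" by (simp add: interp_def)

lemma interp_diff: "t \<in> {0..1} ==> interp D v t - interp D v' t = interp D (%k. v k - v' k) t"
 by (simp add: interp_def sum_subtractf[symmetric] algebra_simps sum.distrib[symmetric])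

lemma holder_mod_le:
 assumes "!!s t. s \<in> {0..1} ==> t \<in> {0..1} ==> s ~= t ==> abs (s - t) < e ==> abs (x s - x t) <= c * abs (s - t) powr \<eta>"
 shows "holder_mod \<eta> x e <= ennreal c"
 unfolding holder_mod_def
proof (intro SUP_least)
 fix p assume p: "p \<in> {(s, t). s \<in> {0..1} \<and> t \<in> {0..1} \<and> 0 < abs (s - t) \<and> abs (s - t) < e}"
 obtain s t where st: "p = (s, t)" by (cases p)
 have "abs (x s - x t) / abs (s - t) powr \<eta> <= c" using assms[of s t] p st by (simp add: divide_le_eq)
 then show "(case p of (s, t) => ennreal (abs (x s - x t) / abs (s - t) powr \<eta>)) <= ennreal c"
  using st by (simp add: ennreal_leI)
qed

lemma holder_const_le:
 assumes "!!s t. s \<in> {0..1} ==> t \<in> {0..1} ==> s ~= t ==> abs (x s - x t) <= c * abs (s - t) powr \<eta>"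
 shows "holder_const \<eta> x <= ennreal c"
 unfolding holder_const_def
proof (intro SUP_least)
 fix p assume p: "p \<in> {(s, t). s \<in> {0..1} \<and> t \<in> {0..1::real} \<and> s ~= t}"
 obtain s t where st: "p = (s, t)" by (cases p)
 have "abs (x s - x t) / abs (s - t) powr \<eta> <= c" using assms[of s t] p st by (simp add: divide_le_eq)
 then show "(case p of (s, t) => ennreal (abs (x s - x t) / abs (s - t) powr \<eta>)) <= ennreal c"
  using st by (simp add: ennreal_leI)
qed

lemma holder_dist_le:
 assumes "c >= 0" "!!s t. s \<in> {0..1} ==> t \<in> {0..1} ==> abs ((x s - y s) - (x t - y t)) <= c * abs (s - t) powr \<eta>"
 shows "holder_dist \<eta> x y <= c + abs (x 0 - y 0)"
proof -
 have "holder_mod \<eta> (%t. x t - y t) 1 <= ennreal c" using assms(2) by (intro holder_mod_le) auto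
 then have "enn2real (holder_mod \<eta> (%t. x t - y t) 1) <= c" using assms(1) by (intro enn2real_leI)
 then show ?thesis by (simp add: holder_dist_def holder_norm_def)
qed

lemma powr_split: "u \<in> {0..e} ==> 0 < \<eta> ==> \<eta> < 1 ==> (u::real) <= e powr (1 - \<eta>) * u powr \<eta>"
proof (cases "u = 0")
 case False
 assume a: "u \<in> {0..e}" "0 < \<eta>" "\<eta> < 1"
 have "u = u powr (1 - \<eta>) * u powr \<eta>" using a False by (simp flip: powr_add)
 also have "... <= e powr (1 - \<eta>) * u powr \<eta>" using a by (intro mult_right_mono powr_mono2) auto
 finally show ?thesis .
qed simp

lemma lipschitz_holder0:
 assumes x: "x \<in> extensional {0..1}" and lip: "!!s t. s \<in> {0..1} ==> t \<in> {0..1} ==> abs (x s - x t) <= \<Lambda> * abs (s - t)"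
  and \<eta>: "0 < \<eta>" "\<eta> < 1"
 shows "x \<in> holder0 \<eta>"
proof -
 have "abs (x 1 - x 0) <= \<Lambda>" using lip[of 1 0] by simp
 then have \<Lambda>: "\<Lambda> >= 0" using abs_ge_zero[of "x 1 - x 0"] by linarith
 have bd: "abs (x s - x t) <= (\<Lambda> * e powr (1 - \<eta>)) * abs (s - t) powr \<eta>" if st: "s \<in> {0..1}" "t \<in> {0..1}" "abs (s - t) <= e" for s t e
 proof -
  have "abs (s - t) <= e powr (1 - \<eta>) * abs (s - t) powr \<eta>" using st(3) \<eta> by (intro powr_split) auto
  then have "\<Lambda> * abs (s - t) <= \<Lambda> * (e powr (1 - \<eta>) * abs (s - t) powr \<eta>)" using \<Lambda> by (intro mult_left_mono) auto
  then show ?thesis using lip[OF st(1,2)] by (simp add: mult.assoc)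
 qed
 have "holder_const \<eta> x <= ennreal (\<Lambda> * 1 powr (1 - \<eta>))"
 proof (rule holder_const_le)
  fix s t :: real assume "s \<in> {0..1}" "t \<in> {0..1}"
  then show "abs (x s - x t) <= \<Lambda> * 1 powr (1 - \<eta>) * abs (s - t) powr \<eta>" by (intro bd) auto
 qed
 then have fin: "holder_const \<eta> x < \<infinity>" by (rule le_less_trans) simp
 have "(holder_mod \<eta> x \<longlongrightarrow> 0) (at_right 0)"
 proof (rule tendsto_sandwich[of "%_. 0"])
  show "\<forall>\<^sub>F e in at_right 0. holder_mod \<eta> x e <= ennreal (\<Lambda> * e powr (1 - \<eta>))"
   unfolding eventually_at_right_field by (intro exI[of _ 1] conjI allI impI holder_mod_le bd) auto
  have "((%e::real. \<Lambda> * e powr (1 - \<eta>)) \<longlongrightarrow> \<Lambda> * 0) (at_right 0)"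
  proof (intro tendsto_intros)
   have "((%e::real. e powr (1 - \<eta>)) \<longlongrightarrow> 0 powr (1 - \<eta>)) (at_right 0)"
    using \<eta> by (intro tendsto_powr' tendsto_intros) (auto simp: eventually_at_right_field intro!: exI[of _ 1])
   then show "((%e::real. e powr (1 - \<eta>)) \<longlongrightarrow> 0) (at_right 0)" by simp
  qed
  then show "((%e. ennreal (\<Lambda> * e powr (1 - \<eta>))) \<longlongrightarrow> 0) (at_right 0)"
   using tendsto_ennrealI by fastforce
 qed auto
 then show ?thesis using x fin by (simp add: holder0_def holder_def)
qed

lemma holder0_local:
 assumes x: "x \<in> holder0 \<eta>" and w: "w > 0"
 shows "\<exists>e>0. \<forall>s\<in>{0..1}. \<forall>t\<in>{0..1}. abs (s - t) < e --> abs (x s - x t) <= w * abs (s - t) powr \<eta>"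
proof -
 have "(holder_mod \<eta> x \<longlongrightarrow> 0) (at_right 0)" using x by (simp add: holder0_def)
 then have "\<forall>\<^sub>F e in at_right 0. holder_mod \<eta> x e < ennreal w" using w by (intro order_tendstoD(2)) auto
 then obtain d where d: "d > 0" "!!e. 0 < e ==> e < d ==> holder_mod \<eta> x e < ennreal w" by (auto simp: eventually_at_right_field)
 have "abs (x s - x t) <= w * abs (s - t) powr \<eta>" if st: "s \<in> {0..1}" "t \<in> {0..1}" "abs (s - t) < d / 2" for s t
 proof (cases "s = t")
  case False
  have "ennreal (abs (x s - x t) / abs (s - t) powr \<eta>) <= holder_mod \<eta> x (d / 2)" using st False by (intro holder_mod_upper) auto
  also have "... < ennreal w" using d by simp
  finally have "abs (x s - x t) / abs (s - t) powr \<eta> <= w" using w by (simp add: ennreal_less_iff)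
  then show ?thesis using False by (simp add: divide_le_eq)
 qed simp
 then show ?thesis using d(1) by (intro exI[of _ "d/2"]) auto
qed

text \<open>Piecewise linear interpolation of a path on the grid of mesh \<open>1 / D\<close>.\<close>

definition proj :: "nat => (real => real) => real => real" where
 "proj D x = interp D (%k. x (real k / real D))"

lemma interp_holder0:
 assumes \<eta>: "0 < \<eta>" "\<eta> < 1" shows "interp D v \<in> holder0 \<eta>"
proof (rule lipschitz_holder0[OF interp_extensional _ \<eta>])
 fix s t :: real assume st: "s \<in> {0..1}" "t \<in> {0..1}"
 show "abs (interp D v s - interp D v t) <= (\<Sum>k<D. abs (v (Suc k) - v k)) * real D * abs (s - t)"
  by (rule interp_lipschitz[OF _ st]) (auto intro: member_le_sum)
qed

lemma interp_dist:
 assumes \<eta>: "0 < \<eta>" "\<eta> < 1"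
 shows "holder_dist \<eta> (interp D v) (interp D v') <= (2 * real D + 1) * (\<Sum>k\<le>D. abs (v k - v' k))"
proof -
 define c where "c = (\<Sum>k\<le>D. abs (v k - v' k))"
 have c: "abs (v k - v' k) <= c" if "k <= D" for k unfolding c_def using that by (intro member_le_sum) auto
 have c0: "c >= 0" by (auto simp: c_def intro: sum_nonneg)
 have "holder_dist \<eta> (interp D v) (interp D v') <= 2 * c * real D + abs (interp D v 0 - interp D v' 0)"
 proof (rule holder_dist_le)
  fix s t :: real assume st: "s \<in> {0..1}" "t \<in> {0..1}"
  have "abs ((interp D v s - interp D v' s) - (interp D v t - interp D v' t)) <= 2 * c * real D * abs (s - t)"
   unfolding interp_diff[OF st(1)] interp_diff[OF st(2)]
  proof (rule interp_lipschitz[OF _ st])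
   fix k assume "k < D"
   then show "abs (v (Suc k) - v' (Suc k) - (v k - v' k)) <= 2 * c" using c[of k] c[of "Suc k"] by linarith
  qed
  also have "... <= 2 * c * real D * abs (s - t) powr \<eta>"
   using powr_split[of "abs (s - t)" 1 \<eta>] st \<eta> c0 by (intro mult_left_mono) auto
  finally show "abs ((interp D v s - interp D v' s) - (interp D v t - interp D v' t)) <= 2 * c * real D * abs (s - t) powr \<eta>" .
 qed (use c0 in auto)
 also have "abs (interp D v 0 - interp D v' 0) <= c" using c[of 0] by (simp add: interp_0)
 finally show ?thesis by (simp add: c_def algebra_simps)
qed

text \<open>At distances below the mesh both the path and its interpolation have small increments; at larger distances compare with the grid
  points, where they agree. Thus the distance depends only on the Hoelder constant at small scales.\<close>

lemma proj_dist:
 assumes D: "D >= 1" and \<eta>: "0 < \<eta>" "\<eta> < 1" and w: "w >= 0"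
  and x: "!!s t. s \<in> {0..1} ==> t \<in> {0..1} ==> abs (s - t) <= 1 / real D ==> abs (x s - x t) <= w * abs (s - t) powr \<eta>"
 shows "holder_dist \<eta> x (proj D x) <= 4 * w"
proof -
 define y where "y t = x t - proj D x t" for t
 let ?h = "1 / real D"
 have D0: "real D > 0" using D by simp
 have near: "abs (y s - y t) <= 2 * w * abs (s - t) powr \<eta>" if st: "s \<in> {0..1}" "t \<in> {0..1}" "abs (s - t) <= ?h" for s t
 proof -
  have "abs (proj D x s - proj D x t) <= (w * ?h powr \<eta>) * real D * abs (s - t)" unfolding proj_def
  proof (rule interp_lipschitz[OF _ st(1,2)])
   fix k assume "k < D"
   then have a: "real (Suc k) / D \<in> {0..1}" "real k / D \<in> {0..1}" by auto
   have b: "real (Suc k) / D - real k / D = ?h" by (simp add: diff_divide_distrib[symmetric])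
   show "abs (x (real (Suc k) / D) - x (real k / D)) <= w * ?h powr \<eta>" using x[OF a] D0 unfolding b by simp
  qed
  also have "... <= (w * ?h powr \<eta>) * real D * (?h powr (1 - \<eta>) * abs (s - t) powr \<eta>)"
   using w st(3) \<eta> by (intro mult_left_mono powr_split) auto
  also have "... = w * (?h powr \<eta> * ?h powr (1 - \<eta>)) * real D * abs (s - t) powr \<eta>" by (simp only: mult_ac)
  also have "?h powr \<eta> * ?h powr (1 - \<eta>) = ?h" using D0 by (subst powr_add[symmetric]) simp
  finally have "abs (proj D x s - proj D x t) <= w * abs (s - t) powr \<eta>" using D0 by simp
  then show ?thesis using x[OF st] unfolding y_def by linarith
 qed
 have small: "abs (y s) <= 2 * w * ?h powr \<eta>" if s: "s \<in> {0..1}" for s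
 proof -
  define k where "k = nat \<lfloor>real D * s\<rfloor>"
  have k: "real k <= real D * s" "real D * s < real k + 1" using s by (auto simp: k_def)
  have "real D * s <= real D" using s D0 by (intro mult_left_le) auto
  then have "real k <= real D" using k(1) by linarith
  then have kD: "k <= D" by simp
  have g: "y (real k / D) = 0" unfolding y_def proj_def using interp_grid[OF kD D] by simp
  have gi: "real k / D \<in> {0..1}" using kD D0 by simp
  have d: "0 <= s - real k / D" "s - real k / D <= ?h"
  proof -
   show "0 <= s - real k / D" using k(1) D0 by (simp add: divide_le_eq mult.commute)
   have "s <= (real k + 1) / D" using k(2) D0 by (simp add: le_divide_eq mult.commute)
   then show "s - real k / D <= ?h" by (simp add: add_divide_distrib)
  qed
  have "abs (y s - y (real k / D)) <= 2 * w * abs (s - real k / D) powr \<eta>" using d by (intro near s gi) auto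
  also have "... <= 2 * w * ?h powr \<eta>" using d w \<eta> by (intro mult_left_mono powr_mono2) auto
  finally show ?thesis using g by simp
 qed
 have "holder_dist \<eta> x (proj D x) <= 4 * w + abs (x 0 - proj D x 0)"
 proof (rule holder_dist_le)
  fix s t :: real assume st: "s \<in> {0..1}" "t \<in> {0..1}"
  have "abs (y s - y t) <= 4 * w * abs (s - t) powr \<eta>"
  proof (cases "abs (s - t) <= ?h")
   case True
   have "2 * w * abs (s - t) powr \<eta> <= 4 * w * abs (s - t) powr \<eta>" using w by (intro mult_right_mono) auto
   then show ?thesis using near[OF st True] by linarith
  next
   case False
   then have "w * ?h powr \<eta> <= w * abs (s - t) powr \<eta>" using w \<eta> by (intro mult_left_mono powr_mono2) auto
   then show ?thesis using small[OF st(1)] small[OF st(2)] by linarith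
  qed
  then show "abs (x s - proj D x s - (x t - proj D x t)) <= 4 * w * abs (s - t) powr \<eta>" by (simp add: y_def)
 qed (use w in auto)
 moreover have "proj D x 0 = x 0" by (simp add: proj_def interp_0)
 ultimately show ?thesis by simp
qed

lemma proj_tendsto:
 assumes \<eta>: "0 < \<eta>" "\<eta> < 1" and x: "x \<in> holder0 \<eta>"
 shows "(%m. holder_dist \<eta> x (proj (2 ^ m) x)) ~> 0"
proof (rule LIMSEQ_I)
 fix r :: real assume r: "r > 0"
 then obtain e where e: "e > 0" "!!s t. s \<in> {0..1} ==> t \<in> {0..1} ==> abs (s - t) < e ==> abs (x s - x t) <= (r / 8) * abs (s - t) powr \<eta>"
  using holder0_local[OF x, of "r/8"] by auto
 obtain m0 where m0: "(1/2::real) ^ m0 < e" using real_arch_pow_inv[OF e(1), of "1/2"] by auto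
 have "norm (holder_dist \<eta> x (proj (2 ^ m) x) - 0) < r" if m: "m >= m0" for m
 proof -
  have "(1/2::real) ^ m <= (1/2) ^ m0" using m by (intro power_decreasing) auto
  then have h: "1 / real (2 ^ m) < e" using m0 by (simp add: power_divide)
  have "holder_dist \<eta> x (proj (2 ^ m) x) <= 4 * (r / 8)" using h r by (intro proj_dist \<eta> e(2)) auto
  moreover have "holder_dist \<eta> x (proj (2 ^ m) x) >= 0" by (simp add: holder_dist_def holder_norm_def)
  ultimately show ?thesis using r by simp
 qed
 then show "\<exists>no. \<forall>n\<ge>no. norm (holder_dist \<eta> x (proj (2 ^ n) x) - 0) < r" by blast
qed

section \<open>Dyadic chaining\<close>

text \<open>Kolmogorov's argument: a point is reached from its dyadic approximations, and the increments form a geometric series.\<close>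

lemma dyadic_chaining:
 fixes x :: "real => real" and q :: real
 assumes cont: "continuous_on {0..1} x" and q: "0 < q" "q < 1"
  and incr: "!!j k. j >= m ==> k < 2 ^ j ==> abs (x (real (Suc k) / 2 ^ j) - x (real k / 2 ^ j)) <= q ^ j"
  and j: "j >= m" and st: "s \<in> {0..1}" "t \<in> {0..1}" "abs (s - t) <= 1 / 2 ^ j"
 shows "abs (x s - x t) <= (1 + 2 / (1 - q)) * q ^ j"
proof -
 define a where "a s i = nat \<lfloor>2 ^ i * s\<rfloor>" for s :: real and i :: nat
 define g where "g s i = real (a s i) / 2 ^ i" for s i
 have a: "real (a s i) <= 2 ^ i * s" "2 ^ i * s < real (a s i) + 1" if "s \<in> {0..1}" for s i
  using that by (auto simp: a_def)
 have a_le: "a s i <= 2 ^ i" if s: "s \<in> {0..1}" for s i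
 proof -
  have "2 ^ i * s <= (2 ^ i :: real)" using s by (intro mult_left_le) auto
  then have "real (a s i) <= 2 ^ i" using a(1)[OF s, of i] by linarith
  then show ?thesis by simp
 qed
 have g_range: "g s i \<in> {0..1}" if "s \<in> {0..1}" for s i
 proof -
  have "real (a s i) <= real (2 ^ i)" using a_le[OF that] by (simp only: of_nat_le_iff)
  then show ?thesis by (auto simp: g_def)
 qed
 have neighbour: "abs (x (real k / 2 ^ i) - x (real l / 2 ^ i)) <= q ^ i" if kl: "i >= m" "k <= 2 ^ i" "l <= 2 ^ i" "k <= Suc l" "l <= Suc k" for i k l
 proof -
  consider "k = l" | "k = Suc l" | "l = Suc k" using kl(4,5) by linarith
  then show ?thesis
  proof cases
   case 1 then show ?thesis using q by simp
  next
   case 2 then show ?thesis using incr[OF kl(1), of l] kl(2) by simp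
  next
   case 3 then show ?thesis using incr[OF kl(1), of k] kl(3) by (simp add: abs_minus_commute)
  qed
 qed
 have refine: "abs (x (g s (Suc i)) - x (g s i)) <= q ^ i" if i: "i >= m" and s: "s \<in> {0..1}" for s i
 proof -
  obtain u where u: "u = 2 ^ i * s" "2 ^ Suc i * s = 2 * u" by simp
  have "real (a s (Suc i)) < real (2 * (a s i + 1))"
   using a[OF s, of i] a[OF s, of "Suc i"] unfolding u(2) u(1)[symmetric] by simp
  moreover have "real (2 * a s i) < real (a s (Suc i) + 1)"
   using a[OF s, of i] a[OF s, of "Suc i"] unfolding u(2) u(1)[symmetric] by simp
  ultimately have n: "a s (Suc i) <= Suc (2 * a s i)" "2 * a s i <= Suc (a s (Suc i))" unfolding of_nat_less_iff by simp_all
  have e: "g s i = real (2 * a s i) / 2 ^ Suc i" by (simp add: g_def)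
  have "abs (x (g s (Suc i)) - x (g s i)) <= q ^ Suc i"
   unfolding e unfolding g_def by (rule neighbour) (use i n a_le[OF s, of i] a_le[OF s, of "Suc i"] in auto)
  also have "... <= q ^ i" using q by (intro power_decreasing) auto
  finally show ?thesis .
 qed
 have tail: "abs (x s - x (g s j)) <= q ^ j / (1 - q)" if s: "s \<in> {0..1}" for s
 proof -
  have part: "abs (x (g s (j + l)) - x (g s j)) <= q ^ j * (\<Sum>i<l. q ^ i)" for l
  proof (induction l)
   case (Suc l)
   have "abs (x (g s (Suc (j + l))) - x (g s (j + l))) <= q ^ (j + l)" using j by (intro refine s) auto
   then show ?case using Suc by (simp add: distrib_left power_add)
  qed simp
  have bound: "abs (x (g s (j + l)) - x (g s j)) <= q ^ j / (1 - q)" for l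
  proof -
   have "(\<Sum>i<l. q ^ i) <= (\<Sum>i. q ^ i)" using q by (intro sum_le_suminf summable_geometric) auto
   also have "... = 1 / (1 - q)" using q by (intro suminf_geometric) auto
   finally have "q ^ j * (\<Sum>i<l. q ^ i) <= q ^ j * (1 / (1 - q))" using q by (intro mult_left_mono) auto
   then show ?thesis using part[of l] by simp
  qed
  have "(%l. g s (j + l)) ~> s"
  proof (rule tendsto_sandwich)
   show "\<forall>\<^sub>F l in sequentially. s - (1/2) ^ l <= g s (j + l)"
   proof (intro always_eventually allI)
    fix l
    have "s <= (real (a s (j + l)) + 1) / 2 ^ (j + l)" using a(2)[OF s, of "j + l"] by (simp add: le_divide_eq mult.commute)
    then have "s - 1 / 2 ^ (j + l) <= g s (j + l)" unfolding g_def add_divide_distrib by linarith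
    moreover have "(1/2::real) ^ (j + l) <= (1/2) ^ l" by (intro power_decreasing) auto
    ultimately show "s - (1/2) ^ l <= g s (j + l)" by (simp add: power_divide)
   qed
   show "\<forall>\<^sub>F l in sequentially. g s (j + l) <= s" using a(1)[OF s] by (intro always_eventually) (simp add: g_def divide_le_eq mult.commute)
   have "(%l. s - (1/2::real) ^ l) ~> s - 0" by (intro tendsto_intros LIMSEQ_power_zero) auto
   then show "(%l. s - (1/2::real) ^ l) ~> s" by simp
  qed auto
  then have "(%l. x (g s (j + l))) ~> x s"
   using cont s g_range[OF s] by (intro continuous_on_tendsto_compose[OF cont]) auto
  then have "(%l. abs (x (g s (j + l)) - x (g s j))) ~> (abs (x s - x (g s j)))" by (intro tendsto_intros)
  then show ?thesis by (rule LIMSEQ_le_const2) (use bound in auto)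
 qed
 have "abs (x (g s j) - x (g t j)) <= q ^ j"
 proof -
  have "abs (2 ^ j * s - 2 ^ j * t) <= 1" using st(3) unfolding right_diff_distrib[symmetric] abs_mult by (simp add: le_divide_eq mult.commute)
  then have "real (a s j) < real (Suc (a t j)) + 1" "real (a t j) < real (Suc (a s j)) + 1"
   using a[OF st(1), of j] a[OF st(2), of j] by auto
  then have "a s j <= Suc (a t j)" "a t j <= Suc (a s j)" by simp_all
  then show ?thesis unfolding g_def by (intro neighbour j a_le st)
 qed
 then have "abs (x s - x t) <= q ^ j / (1 - q) + q ^ j + q ^ j / (1 - q)" using tail[OF st(1)] tail[OF st(2)] by linarith
 also have "... = (1 + 2 / (1 - q)) * q ^ j" by (simp add: distrib_right)
 finally show ?thesis .
qed

lemma proj_dist_dyadic: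
 fixes x :: "real => real"
 assumes cont: "continuous_on {0..1} x" and \<eta>: "0 < \<eta>" "\<eta> < 1" "\<eta> < r"
  and incr: "!!j k. j >= m ==> k < 2 ^ j ==> abs (x (real (Suc k) / 2 ^ j) - x (real k / 2 ^ j)) <= (2 powr (- r)) ^ j"
 shows "holder_dist \<eta> x (proj (2 ^ m) x) <= 8 * (1 + 2 / (1 - 2 powr (- r))) * (2 powr (\<eta> - r)) ^ m"
proof -
 define q where "q = 2 powr (- r)"
 define A where "A = 1 + 2 / (1 - q)"
 have "2 powr (- r) < 2 powr 0" using \<eta> by (intro powr_less_mono) auto
 then have q: "0 < q" "q < 1" by (auto simp: q_def)
 have A: "A >= 0" using q by (simp add: A_def)
 have "holder_dist \<eta> x (proj (2 ^ m) x) <= 4 * (2 * A * (2 powr (\<eta> - r)) ^ m)"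
 proof (rule proj_dist)
  fix s t :: real assume st: "s \<in> {0..1}" "t \<in> {0..1}" "abs (s - t) <= 1 / real (2 ^ m)"
  show "abs (x s - x t) <= 2 * A * (2 powr (\<eta> - r)) ^ m * abs (s - t) powr \<eta>"
  proof (cases "s = t")
   case False
   define J where "J = (LEAST i. (1/2) ^ i < abs (s - t))"
   have "\<exists>i. (1/2::real) ^ i < abs (s - t)" using False by (intro real_arch_pow_inv) auto
   then have J1: "(1/2) ^ J < abs (s - t)" unfolding J_def by (rule LeastI_ex)
   have Jm: "J > m"
   proof (rule ccontr)
    assume "\<not> J > m"
    then have "(1/2::real) ^ m <= (1/2) ^ J" by (intro power_decreasing) auto
    then show False using st(3) J1 by (simp add: power_divide)
   qed
   then obtain j where j: "J = Suc j" "j >= m" by (cases J) auto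
   have "\<not> (1/2) ^ j < abs (s - t)" using not_less_Least[of j "%i. (1/2) ^ i < abs (s - t)"] j by (simp add: J_def)
   then have J2: "abs (s - t) <= 1 / 2 ^ j" by (simp add: power_divide)
   have up: "(1/2) ^ j <= 2 * abs (s - t)" using J1 j by simp
   have "abs (x s - x t) <= A * q ^ j"
    unfolding A_def by (rule dyadic_chaining[OF cont q _ j(2) st(1,2) J2]) (use incr in \<open>simp add: q_def\<close>)
   also have "q ^ j = (2 powr (\<eta> - r)) ^ j * ((1/2) ^ j) powr \<eta>"
    unfolding q_def by (simp add: powr_powr powr_realpow[symmetric] powr_add[symmetric] powr_minus_divide[symmetric] powr_divide algebra_simps)
   also have "A * ... <= A * ((2 powr (\<eta> - r)) ^ m * (2 * abs (s - t) powr \<eta>))"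
   proof (intro mult_left_mono mult_mono A)
    have "2 powr (\<eta> - r) <= 2 powr 0" using \<eta> by (intro powr_mono) auto
    then show "(2 powr (\<eta> - r)) ^ j <= (2 powr (\<eta> - r)) ^ m" using j(2) by (intro power_decreasing) auto
    have "((1/2) ^ j) powr \<eta> <= (2 * abs (s - t)) powr \<eta>" using up \<eta> by (intro powr_mono2) auto
    also have "... = 2 powr \<eta> * abs (s - t) powr \<eta>" by (simp add: powr_mult)
    also have "... <= 2 powr 1 * abs (s - t) powr \<eta>" using \<eta> by (intro mult_right_mono powr_mono) auto
    finally show "((1/2) ^ j) powr \<eta> <= 2 * abs (s - t) powr \<eta>" by simp
   qed auto
   finally show ?thesis by (simp add: mult_ac)
  qed simp
 qed (use \<eta> A in auto)
 also have "4 * (2 * A * (2 powr (\<eta> - r)) ^ m) = 8 * A * (2 powr (\<eta> - r)) ^ m" by simp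
 finally show ?thesis unfolding A_def q_def .
qed

section \<open>Lipschitz envelopes\<close>

context Metric_space begin

text \<open>The largest \<open>K\<close>-Lipschitz function below \<open>g\<close>. Envelopes reduce both measurability and convergence in distribution to Lipschitz functions.\<close>

definition envelope :: "real => ('a => real) => 'a => real" where
 "envelope K g x = (INF y\<in>M. g y + K * d x y)"

context
 fixes g :: "'a => real" and B K :: real
 assumes g: "!!y. y \<in> M ==> abs (g y) <= B" and K: "K >= 0"
begin

lemma envelope_bdd: "bdd_below ((%y. g y + K * d x y) ` M)"
proof (rule bdd_belowI2)
 fix y assume "y \<in> M"
 have "K * d x y >= 0" using K by simp
 then show "- B <= g y + K * d x y" using g[OF \<open>y \<in> M\<close>] by linarith
qed

lemma envelope_le: "y \<in> M ==> envelope K g x <= g y + K * d x y"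
 unfolding envelope_def by (rule cINF_lower[OF envelope_bdd])

lemma envelope_ge: "x \<in> M ==> (!!y. y \<in> M ==> c <= g y + K * d x y) ==> c <= envelope K g x"
 unfolding envelope_def by (rule cINF_greatest) auto

lemma envelope_le_self: "x \<in> M ==> envelope K g x <= g x"
 using envelope_le[of x x] by simp

lemma envelope_abs: assumes "x \<in> M" shows "abs (envelope K g x) <= B"
proof -
 have "- B <= envelope K g x"
 proof (rule envelope_ge[OF assms])
  fix y assume "y \<in> M"
  have "K * d x y >= 0" using K by simp
  then show "- B <= g y + K * d x y" using g[OF \<open>y \<in> M\<close>] by linarith
 qed
 then show ?thesis using envelope_le_self[OF assms] g[OF assms] by linarith
qed

lemma envelope_lipschitz: assumes "x \<in> M" "y \<in> M" shows "abs (envelope K g x - envelope K g y) <= K * d x y"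
proof -
 have *: "envelope K g x - K * d x y <= envelope K g y" if xy: "x \<in> M" "y \<in> M" for x y
 proof (rule envelope_ge[OF xy(2)])
  fix z assume z: "z \<in> M"
  have "K * d x z <= K * (d x y + d y z)" using K xy z by (intro mult_left_mono triangle) auto
  then show "envelope K g x - K * d x y <= g z + K * d y z" using envelope_le[OF z, of x] by (simp add: distrib_left)
 qed
 show ?thesis using *[OF assms] *[OF assms(2,1)] by (simp add: commute[of y x] abs_le_iff)
qed

end

lemma envelope_tendsto:
 assumes g: "!!y. y \<in> M ==> abs (g y) <= B" and cont: "continuous_map mtopology euclideanreal g" and x: "x \<in> M"
 shows "(%n. envelope (real n) g x) ~> g x"
proof (rule LIMSEQ_I)
 fix e :: real assume e: "e > 0"
 have "openin mtopology {y \<in> topspace mtopology. g y \<in> {g x - e / 2<..}}"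
  by (rule openin_continuous_map_preimage[OF cont]) auto
 then obtain r where r: "r > 0" "mball x r \<subseteq> {y \<in> M. g y \<in> {g x - e / 2<..}}"
  using x e unfolding openin_mtopology by (auto simp del: greaterThan_iff)
 obtain N where N: "real N * r > 2 * B" using reals_Archimedean3[OF r(1)] by blast
 have "norm (envelope (real n) g x - g x) < e" if n: "n >= N" for n
 proof -
  have "g x - e / 2 <= envelope (real n) g x"
  proof (rule envelope_ge[OF g])
   fix y assume y: "y \<in> M"
   show "g x - e / 2 <= g y + real n * d x y"
   proof (cases "d x y < r")
    case True
    then have "y \<in> mball x r" using x y by simp
    then have "g y > g x - e / 2" using r by auto
    moreover have "real n * d x y >= 0" by simp
    ultimately show ?thesis by linarith
   next
    case False
    have "real N * r <= real n * d x y" using n r False by (intro mult_mono) auto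
    then show ?thesis using N g[OF y] g[OF x] e by linarith
   qed
  qed (use x in auto)
  moreover have "envelope (real n) g x <= g x" by (rule envelope_le_self[OF g _ x]) auto
  ultimately show ?thesis using e by (simp add: abs_less_iff)
 qed
 then show "\<exists>no. \<forall>n\<ge>no. norm (envelope (real n) g x - g x) < e" by blast
qed

lemma envelope_indicator_pos:
 assumes U: "openin mtopology U" and x: "x \<in> M"
 shows "envelope 1 (indicator U) x > 0 \<longleftrightarrow> x \<in> U"
proof
 have g: "abs (indicator U y :: real) <= 1" for y by (simp add: indicator_def)
 show "x \<in> U" if "envelope 1 (indicator U) x > 0"
 proof (rule ccontr)
  assume "x \<notin> U"
  then show False using that envelope_le_self[of "indicator U" 1 1 x, OF g _ x] by simp
 qed
 assume "x \<in> U"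
 then obtain r where r: "r > 0" "mball x r \<subseteq> U" using U unfolding openin_mtopology by blast
 have "min 1 r <= envelope 1 (indicator U) x"
 proof (rule envelope_ge[OF g _ x])
  fix y assume y: "y \<in> M"
  show "min 1 r <= indicator U y + 1 * d x y"
  proof (cases "d x y < r")
   case True
   then have "y \<in> U" using r x y by auto
   then show ?thesis by (simp add: min.coboundedI1)
  next
   case False
   then show ?thesis by (simp add: indicator_def min.coboundedI2)
  qed
 qed auto
 then show "envelope 1 (indicator U) x > 0" using r by auto
qed

end

section \<open>Convergence in distribution in Hoelder spaces\<close>

text \<open>Functions of finitely many coordinates. Since the dimension varies, vectors are sequences of which the first \<open>D + 1\<close> entries matter.\<close>

definition coord_lipschitz :: "nat => real => ((nat => real) => real) => bool" where
 "coord_lipschitz D L H \<longleftrightarrow> (\<forall>u v. abs (H u - H v) <= L * (\<Sum>k\<le>D. abs (u k - v k)))"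

lemma coord_lipschitz_measurable:
 assumes "coord_lipschitz D L H" shows "H \<in> borel_measurable borel"
proof (intro borel_measurable_continuous_onI continuous_at_imp_continuous_on ballI)
 fix u :: "nat => real"
 have "continuous_on UNIV (%v::nat=>real. L * (\<Sum>k\<le>D. abs (v k - u k)))"
  by (intro continuous_intros continuous_on_product_coordinates)
 then have "((%v. L * (\<Sum>k\<le>D. abs (v k - u k))) \<longlongrightarrow> L * (\<Sum>k\<le>D. abs (u k - u k))) (at u)"
  unfolding continuous_on_def by blast
 then have "((%v. L * (\<Sum>k\<le>D. abs (v k - u k))) \<longlongrightarrow> 0) (at u)" by simp
 then have "((%v. H v - H u) \<longlongrightarrow> 0) (at u)"
  by (rule Lim_null_comparison[rotated]) (use assms in \<open>auto simp: coord_lipschitz_def\<close>)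
 then show "isCont H u" unfolding isCont_def by (rule LIM_zero_cancel)
qed

interpretation holder: Metric_space "holder0 \<eta>" "holder_dist \<eta>" for \<eta> by (rule Metric_space_holder0)

lemma topspace_holder0: "topspace (holder0_topology \<eta>) = holder0 \<eta>"
 by (simp add: holder0_topology_def)

lemma lipschitz_interp:
 assumes \<eta>: "0 < \<eta>" "\<eta> < 1" and K: "K >= 0" and g: "!!x y. x \<in> holder0 \<eta> ==> y \<in> holder0 \<eta> ==> abs (g x - g y) <= K * holder_dist \<eta> x y"
 shows "coord_lipschitz D (K * (2 * real D + 1)) (%v. g (interp D v))"
 unfolding coord_lipschitz_def
proof (intro allI)
 fix u v
 have "abs (g (interp D u) - g (interp D v)) <= K * holder_dist \<eta> (interp D u) (interp D v)"
  by (intro g interp_holder0 \<eta>)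
 also have "... <= K * ((2 * real D + 1) * (\<Sum>k\<le>D. abs (u k - v k)))"
  by (intro mult_left_mono interp_dist \<eta> K)
 finally show "abs (g (interp D u) - g (interp D v)) <= K * (2 * real D + 1) * (\<Sum>k\<le>D. abs (u k - v k))" by (simp add: mult.assoc)
qed

lemma dyadic_in_unit: "k <= D ==> real k / real D \<in> {0..1}" by (cases "D = 0") (auto simp: divide_le_eq)

locale holder_process =
 fixes \<eta> :: real and M :: "'a measure" and X :: "'a => real => real"
 assumes eta: "0 < \<eta>" "\<eta> < 1"
  and paths: "!!z. z \<in> space M ==> X z \<in> holder0 \<eta>"
  and coordinates: "!!t. t \<in> {0..1} ==> (%z. X z t) \<in> borel_measurable M"
begin

lemma coord_measurable:
 assumes "coord_lipschitz D L H" shows "(%z. H (%k. X z (real (min k D) / real D))) \<in> borel_measurable M"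
proof -
 have "(%z k. X z (real (min k D) / real D)) \<in> borel_measurable M"
  by (intro measurable_coordinatewise_then_product coordinates dyadic_in_unit) auto
 from measurable_compose[OF this coord_lipschitz_measurable[OF assms]] show ?thesis .
qed

text \<open>Capping the index keeps the evaluation points in \<open>[0,1]\<close>, where alone the coordinates are known to be measurable.\<close>

lemma proj_min: "proj D x = interp D (%k. x (real (min k D) / real D))"
 unfolding proj_def interp_def by (intro restrict_ext) (auto intro!: sum.cong simp: min_def)

lemma proj_measurable:
 assumes "K >= 0" "!!x y. x \<in> holder0 \<eta> ==> y \<in> holder0 \<eta> ==> abs (g x - g y) <= K * holder_dist \<eta> x y"
 shows "(%z. g (proj D (X z))) \<in> borel_measurable M"
 unfolding proj_min by (rule coord_measurable[OF lipschitz_interp[OF eta assms]])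

lemma proj_holder0: "proj D x \<in> holder0 \<eta>" unfolding proj_def by (rule interp_holder0[OF eta])

lemma lipschitz_proj_tendsto:
 assumes "K >= 0" "!!x y. x \<in> holder0 \<eta> ==> y \<in> holder0 \<eta> ==> abs (g x - g y) <= K * holder_dist \<eta> x y" "x \<in> holder0 \<eta>"
 shows "(%m. g (proj (2 ^ m) x)) ~> g x"
proof -
 have "(%m. g (proj (2 ^ m) x) - g x) ~> 0"
 proof (rule Lim_null_comparison)
  show "(%m. K * holder_dist \<eta> x (proj (2 ^ m) x)) ~> 0"
   by (intro tendsto_mult_right_zero proj_tendsto eta assms)
  show "\<forall>\<^sub>F m in sequentially. norm (g (proj (2 ^ m) x) - g x) <= K * holder_dist \<eta> x (proj (2 ^ m) x)"
   using assms(2)[OF proj_holder0 assms(3)] by (simp add: holder.commute[of \<eta> x])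
 qed
 then show ?thesis by (rule LIM_zero_cancel)
qed

lemma lipschitz_measurable:
 assumes "K >= 0" "!!x y. x \<in> holder0 \<eta> ==> y \<in> holder0 \<eta> ==> abs (g x - g y) <= K * holder_dist \<eta> x y"
 shows "(%z. g (X z)) \<in> borel_measurable M"
 by (rule borel_measurable_LIMSEQ_real[of _ "%m z. g (proj (2 ^ m) (X z))"])
   (intro lipschitz_proj_tendsto[OF assms] paths proj_measurable[OF assms]; assumption)+

text \<open>An open set is where the envelope of its indicator is positive. This replaces an appeal to separability: Lipschitz functions
  of a path are limits of functions of its dyadic interpolations.\<close>

theorem random_element: "X \<in> M \<rightarrow>\<^sub>M borel_of (holder0_topology \<eta>)"
 unfolding borel_of_def topspace_holder0
proof (rule measurable_measure_of)
 show "{U. openin (holder0_topology \<eta>) U} \<subseteq> Pow (holder0 \<eta>)" using openin_subset topspace_holder0 by blast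
 show "X \<in> space M \<rightarrow> holder0 \<eta>" using paths by auto
 fix U assume "U \<in> {U. openin (holder0_topology \<eta>) U}"
 then have U: "openin (holder.mtopology \<eta>) U" by (simp add: holder0_topology_def)
 have g: "abs (indicator U y :: real) <= 1" for y by (simp add: indicator_def)
 have m: "(%z. holder.envelope \<eta> 1 (indicator U) (X z)) \<in> borel_measurable M"
  by (rule lipschitz_measurable[of 1, OF zero_le_one holder.envelope_lipschitz[OF g zero_le_one]])
 have "X -` U \<inter> space M = {z \<in> space M. holder.envelope \<eta> 1 (indicator U) (X z) > 0}"
  using holder.envelope_indicator_pos[OF U paths] by auto
 also have "... \<in> sets M" using m by measurable
 finally show "X -` U \<inter> space M \<in> sets M" .
qed

lemma continuous_measurable:
 assumes g: "continuous_map (holder0_topology \<eta>) euclideanreal g" "!!x. x \<in> holder0 \<eta> ==> abs (g x) <= B"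
 shows "(%z. g (X z)) \<in> borel_measurable M"
proof (rule borel_measurable_LIMSEQ_real)
 show "(%n. holder.envelope \<eta> (real n) g (X z)) ~> g (X z)" if "z \<in> space M" for z
  by (rule holder.envelope_tendsto[OF g(2) g(1)[unfolded holder0_topology_def] paths[OF that]])
 show "(%z. holder.envelope \<eta> (real n) g (X z)) \<in> borel_measurable M" for n
  by (rule lipschitz_measurable[OF of_nat_0_le_iff holder.envelope_lipschitz[OF g(2) of_nat_0_le_iff]])
qed

end

lemma integrable_bdd:
 fixes u :: "'a => real"
 assumes "prob_space M" "u \<in> borel_measurable M" "!!z. z \<in> space M ==> abs (u z) <= B"
 shows "integrable M u"
proof -
 interpret prob_space M by fact
 show ?thesis using assms by (intro integrable_const_bound[of _ B]) auto
qed

text \<open>Lipschitz functionals are compared with their values on dyadic interpolations: tightness controls the error for \<open>X n\<close>, dominated convergence the one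
  for \<open>Y\<close>. For a continuous functional \<open>g\<close>, the envelopes of \<open>g\<close> and of \<open>- g\<close> give lower and upper bounds in the limit.\<close>

theorem holder_convergence:
 fixes M :: "'a measure" and N :: "'b measure"
 assumes pM: "prob_space M" and pN: "prob_space N"
  and X: "!!n. holder_process \<eta> M (X n)" and Y: "holder_process \<eta> N Y"
  and fdd: "!!m L B H. coord_lipschitz (2 ^ m) L H ==> (!!v. abs (H v) <= B) ==>
    (%n. (LINT z|M. H (%k. X n z (real (min k (2 ^ m)) / 2 ^ m)))) ~> (LINT z|N. H (%k. Y z (real (min k (2 ^ m)) / 2 ^ m)))"
  and tight: "!!\<epsilon>. \<epsilon> > 0 ==> \<exists>m0. \<forall>m\<ge>m0. \<forall>n. \<exists>A\<in>sets M. measure M A <= \<epsilon> \<and>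
    (\<forall>z\<in>space M - A. holder_dist \<eta> (X n z) (proj (2 ^ m) (X n z)) <= \<epsilon>)"
 shows "conv_in_distribution (holder0_topology \<eta>) M X N Y"
proof -
 interpret M: prob_space M by fact
 interpret N: prob_space N by fact
 interpret X: holder_process \<eta> M "X n" for n by (rule X)
 interpret Y: holder_process \<eta> N Y by (rule Y)
 have lip: "(%n. (LINT z|M. g (X n z))) ~> (LINT z|N. g (Y z))"
  if K: "K >= 0" and gK: "!!x y. x \<in> holder0 \<eta> ==> y \<in> holder0 \<eta> ==> abs (g x - g y) <= K * holder_dist \<eta> x y"
   and gB: "!!x. x \<in> holder0 \<eta> ==> abs (g x) <= B" for K B :: real and g
 proof (rule LIMSEQ_I)
  fix r :: real assume r: "r > 0"
  have "abs (g (interp 0 (%_. 0))) <= B" by (intro gB interp_holder0 X.eta)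
  then have B0: "B >= 0" by linarith
  define e where "e = r / (4 * (K + 2 * B + 1))"
  have den: "K + 2 * B + 1 > 0" using K B0 by linarith
  have e: "e > 0" using r den by (simp add: e_def)
  have ee: "(K + 2 * B) * e <= r / 4"
  proof -
   have "(K + 2 * B) * e <= (K + 2 * B + 1) * e" using e by (intro mult_right_mono) auto
   also have "... = r / 4" using den by (simp add: e_def field_simps)
   finally show ?thesis .
  qed
  obtain m0 where m0: "!!m n. m >= m0 ==> \<exists>A\<in>sets M. measure M A <= e \<and>
    (\<forall>z\<in>space M - A. holder_dist \<eta> (X n z) (proj (2 ^ m) (X n z)) <= e)" using tight[OF e] by blast
  have "(%m. (LINT z|N. g (proj (2 ^ m) (Y z)))) ~> (LINT z|N. g (Y z))"
  proof (rule integral_dominated_convergence[where w = "%_. B"])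
   show "AE z in N. (%m. g (proj (2 ^ m) (Y z))) ~> g (Y z)"
    by (rule AE_I2) (intro Y.lipschitz_proj_tendsto[OF K gK] Y.paths)
   show "AE z in N. norm (g (proj (2 ^ m) (Y z))) <= B" for m using gB[OF Y.proj_holder0] by simp
  qed (auto intro: Y.lipschitz_measurable[OF K gK] Y.proj_measurable[OF K gK])
  then have "\<forall>\<^sub>F m in sequentially. abs ((LINT z|N. g (proj (2 ^ m) (Y z))) - (LINT z|N. g (Y z))) < r / 4"
   using r by (auto dest!: tendstoD[where e = "r/4"] simp: dist_real_def)
  then obtain m1 where m1: "!!m. m >= m1 ==> abs ((LINT z|N. g (proj (2 ^ m) (Y z))) - (LINT z|N. g (Y z))) < r / 4"
   by (auto simp: eventually_sequentially)
  define m where "m = max m0 m1"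
  have close: "abs ((LINT z|M. g (X n z)) - (LINT z|M. g (proj (2 ^ m) (X n z)))) <= r / 4" for n
  proof -
   obtain A where A: "A \<in> sets M" "measure M A <= e" "!!z. z \<in> space M - A ==> holder_dist \<eta> (X n z) (proj (2 ^ m) (X n z)) <= e"
    using m0[of m n] unfolding m_def by auto
   have i1: "integrable M (%z. g (X n z))" by (rule integrable_bdd[where B = B, OF pM X.lipschitz_measurable[OF K gK]]) (use gB X.paths in auto)
   have i2: "integrable M (%z. g (proj (2 ^ m) (X n z)))" by (rule integrable_bdd[where B = B, OF pM X.proj_measurable[OF K gK]]) (use gB[OF X.proj_holder0] in auto)
   have iA: "integrable M (%z. K * e + 2 * B * indicator A z)"
    using A(1) by (intro Bochner_Integration.integrable_add integrable_mult_right integrable_real_indicator) (auto simp: M.emeasure_eq_measure)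
   have "(LINT z|M. g (X n z)) - (LINT z|M. g (proj (2 ^ m) (X n z))) = (LINT z|M. g (X n z) - g (proj (2 ^ m) (X n z)))"
    using i1 i2 by simp
   then have "abs ((LINT z|M. g (X n z)) - (LINT z|M. g (proj (2 ^ m) (X n z)))) <= (LINT z|M. abs (g (X n z) - g (proj (2 ^ m) (X n z))))"
    using integral_abs_bound by simp
   also have "... <= (LINT z|M. K * e + 2 * B * indicator A z)"
   proof (rule integral_mono)
    fix z assume w: "z \<in> space M"
    show "abs (g (X n z) - g (proj (2 ^ m) (X n z))) <= K * e + 2 * B * indicator A z"
    proof (cases "z \<in> A")
     case True
     have "0 <= K * e" using K e by simp
     then show ?thesis using True gB[OF X.paths[OF w, of n]] gB[OF X.proj_holder0[of "2 ^ m" "X n z"]] by simp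
    next
     case False
     then have "K * holder_dist \<eta> (X n z) (proj (2 ^ m) (X n z)) <= K * e" using A(3) w K by (intro mult_left_mono) auto
     then show ?thesis using gK[OF X.paths[OF w] X.proj_holder0, of n "2 ^ m" "X n z"] False by simp
    qed
   qed (use i1 i2 iA in auto)
   also have "... = K * e + 2 * B * measure M A"
    using A(1) M.prob_space by (subst LINT_add) (auto simp: M.emeasure_eq_measure)
   also have "... <= K * e + 2 * B * e" using A(2) B0 by (intro add_left_mono mult_left_mono) auto
   finally show ?thesis using ee by (simp add: distrib_right)
  qed
  have "(%n. (LINT z|M. g (interp (2 ^ m) (%k. X n z (real (min k (2 ^ m)) / 2 ^ m))))) ~> (LINT z|N. g (interp (2 ^ m) (%k. Y z (real (min k (2 ^ m)) / 2 ^ m))))"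
   by (rule fdd[OF lipschitz_interp[OF X.eta K gK], of m B]) (auto intro: gB interp_holder0 X.eta)
  then have "(%n. (LINT z|M. g (proj (2 ^ m) (X n z)))) ~> (LINT z|N. g (proj (2 ^ m) (Y z)))"
   unfolding X.proj_min by simp
  from LIMSEQ_D[OF this, of "r/4"] r obtain no where no: "!!n. n >= no ==> abs ((LINT z|M. g (proj (2 ^ m) (X n z))) - (LINT z|N. g (proj (2 ^ m) (Y z)))) < r / 4"
   by auto
  have "norm ((LINT z|M. g (X n z)) - (LINT z|N. g (Y z))) < r" if n: "n >= no" for n
   using close[of n] no[OF n] m1[of m] r unfolding m_def real_norm_def by linarith
  then show "\<exists>no. \<forall>n\<ge>no. norm ((LINT z|M. g (X n z)) - (LINT z|N. g (Y z))) < r" by blast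
 qed
 have lower: "\<exists>no. \<forall>n\<ge>no. (LINT z|N. g (Y z)) - r < (LINT z|M. g (X n z))"
  if g: "continuous_map (holder0_topology \<eta>) euclideanreal g" "!!x. x \<in> holder0 \<eta> ==> abs (g x) <= B" and r: "r > 0" for g and B r :: real
 proof -
  define E where "E j = holder.envelope \<eta> (real j) g" for j
  have El: "abs (E j x - E j y) <= real j * holder_dist \<eta> x y" if "x \<in> holder0 \<eta>" "y \<in> holder0 \<eta>" for j x y
   unfolding E_def by (rule holder.envelope_lipschitz[OF g(2) _ that]) auto
  have Eb: "abs (E j x) <= B" if "x \<in> holder0 \<eta>" for j x
   unfolding E_def by (rule holder.envelope_abs[OF g(2) _ that]) auto
  have Eg: "E j x <= g x" if "x \<in> holder0 \<eta>" for j x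
   unfolding E_def by (rule holder.envelope_le_self[OF g(2) _ that]) auto
  have "(%j. (LINT z|N. E j (Y z))) ~> (LINT z|N. g (Y z))"
  proof (rule integral_dominated_convergence[where w = "%_. B"])
   show "AE z in N. (%j. E j (Y z)) ~> g (Y z)"
    unfolding E_def by (rule AE_I2) (intro holder.envelope_tendsto[OF g(2) g(1)[unfolded holder0_topology_def]] Y.paths)
   show "AE z in N. norm (E j (Y z)) <= B" for j using Eb Y.paths by auto
   show "(%z. g (Y z)) \<in> borel_measurable N" by (rule Y.continuous_measurable[OF g])
   show "(%z. E j (Y z)) \<in> borel_measurable N" for j by (rule Y.lipschitz_measurable[OF _ El]) auto
  qed auto
  from order_tendstoD(1)[OF this, of "(LINT z|N. g (Y z)) - r / 2"] r
  obtain j where j: "(LINT z|N. g (Y z)) - r / 2 < (LINT z|N. E j (Y z))" by (auto simp: eventually_sequentially)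
  have "(%n. (LINT z|M. E j (X n z))) ~> (LINT z|N. E j (Y z))" by (rule lip[OF _ El Eb]) auto
  from LIMSEQ_D[OF this, of "r/2"] r obtain no where no: "!!n. n >= no ==> abs ((LINT z|M. E j (X n z)) - (LINT z|N. E j (Y z))) < r / 2" by auto
  have "(LINT z|M. E j (X n z)) <= (LINT z|M. g (X n z))" for n
  proof (rule integral_mono)
   show "integrable M (%z. E j (X n z))" by (rule integrable_bdd[where B = B, OF pM X.lipschitz_measurable[OF _ El]]) (use Eb X.paths in auto)
   show "integrable M (%z. g (X n z))" by (rule integrable_bdd[where B = B, OF pM X.continuous_measurable[OF g]]) (use g(2) X.paths in auto)
   show "E j (X n z) <= g (X n z)" if "z \<in> space M" for z by (rule Eg[OF X.paths[OF that]])
  qed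
  note le = this
  have "(LINT z|N. g (Y z)) - r < (LINT z|M. g (X n z))" if n: "n >= no" for n using no[OF n] j le[of n] by linarith
  then show ?thesis by blast
 qed
 have "(%n. (LINT z|M. g (X n z))) ~> (LINT z|N. g (Y z))"
  if g: "continuous_map (holder0_topology \<eta>) euclideanreal g" "bounded (g ` topspace (holder0_topology \<eta>))" for g
 proof -
  obtain B where B: "!!x. x \<in> holder0 \<eta> ==> abs (g x) <= B" using g(2) by (auto simp: bounded_iff topspace_holder0)
  have mg: "continuous_map (holder0_topology \<eta>) euclideanreal (%x. - g x)" using g(1) by (intro continuous_intros)
  show ?thesis
  proof (rule LIMSEQ_I)
   fix r :: real assume r: "r > 0"
   obtain n1 where n1: "!!n. n >= n1 ==> (LINT z|N. g (Y z)) - r < (LINT z|M. g (X n z))" using lower[OF g(1) B r] by blast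
   obtain n2 where n2: "!!n. n >= n2 ==> (LINT z|N. - g (Y z)) - r < (LINT z|M. - g (X n z))" using lower[OF mg _ r, of B] B by auto
   have "norm ((LINT z|M. g (X n z)) - (LINT z|N. g (Y z))) < r" if n: "n >= max n1 n2" for n
    using n1[of n] n2[of n] n by (simp add: abs_less_iff)
   then show "\<exists>no. \<forall>n\<ge>no. norm ((LINT z|M. g (X n z)) - (LINT z|N. g (Y z))) < r" by blast
  qed
 qed
 then show ?thesis unfolding conv_in_distribution_def using X.random_element Y.random_element by blast
qed

section \<open>Products of one-dimensional test functions\<close>

text \<open>Integer translates of the hat function form a partition of unity.\<close>

definition hat :: "real => real" where "hat u = ramp (u + 1) - ramp u"

lemma hat_bounds: "0 <= hat u" "hat u <= 1" "hat u ~= 0 ==> abs u <= 1"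
 by (auto simp: hat_def ramp_def abs_le_iff min_def max_def split: if_splits)

lemma hat_cont: "isCont (%x. hat (x / e - c)) x"
proof -
 have "continuous_on UNIV (%x. hat (x / e - c))"
  unfolding hat_def ramp_def by (cases "e = 0") (auto intro!: continuous_intros)
 then show ?thesis by (simp add: continuous_on_eq_continuous_at)
qed

lemma sum_hat: "(\<Sum>j\<in>{- int K..int K}. hat (x - of_int j)) = ramp (x + real K + 1) - ramp (x - real K)"
proof (induction K)
 case (Suc K)
 have set: "{- int (Suc K)..int (Suc K)} = insert (int (Suc K)) (insert (- int (Suc K)) {- int K..int K})" by auto
 have nin: "- int (Suc K) \<notin> {- int K..int K}" "int (Suc K) \<notin> insert (- int (Suc K)) {- int K..int K}" by auto
 have "(\<Sum>j\<in>{- int (Suc K)..int (Suc K)}. hat (x - of_int j)) = hat (x - of_int (int (Suc K))) + (hat (x - of_int (- int (Suc K))) + (\<Sum>j\<in>{- int K..int K}. hat (x - of_int j)))"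
  unfolding set by (subst sum.insert[OF _ nin(2)], simp, subst sum.insert[OF _ nin(1)], simp_all)
 then show ?case unfolding Suc by (simp add: hat_def algebra_simps)
qed (simp add: hat_def)

text \<open>A Lipschitz function is approximated by its values on a lattice of mesh \<open>e\<close>, weighted by products of hat functions. The error outside a large cube is
  controlled by the product \<open>Q K\<close> of partial sums of the partition of unity, which is itself a product function.\<close>

theorem product_tests_suffice:
 fixes M :: "'a measure" and N :: "'b measure" and \<xi> :: "nat => 'a => nat => real" and U :: "'b => nat => real"
 assumes pM: "prob_space M" and pN: "prob_space N"
  and \<xi>: "!!n i. (%z. \<xi> n z i) \<in> borel_measurable M" and U: "!!i. (%z. U z i) \<in> borel_measurable N"
  and prod: "!!h :: nat => real => real. (!!i x. isCont (h i) x) ==> (!!i x. abs (h i x) <= 1) ==>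
    (%n. (LINT z|M. (\<Prod>i<D. h i (\<xi> n z i)))) ~> (LINT z|N. (\<Prod>i<D. h i (U z i)))"
  and H: "!!u v. abs (H u - H v) <= L * (\<Sum>i<D. abs (u i - v i))" "!!v. abs (H v) <= B" and L: "L >= 0"
 shows "(%n. (LINT z|M. H (\<xi> n z))) ~> (LINT z|N. H (U z))"
proof (rule LIMSEQ_I)
 fix r :: real assume r: "r > 0"
 interpret M: prob_space M by fact
 interpret N: prob_space N by fact
 have B: "B >= 0" using H(2)[of "%_. 0"] by linarith
 define e where "e = r / (8 * (L * real D + 1))"
 have LD: "L * real D + 1 > 0" using L by (simp add: add_nonneg_pos)
 have e: "e > 0" using r LD by (simp add: e_def)
 have Le: "L * real D * e <= r / 8"
 proof -
  have "L * real D * e <= (L * real D + 1) * e" using e by (intro mult_right_mono) auto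
  also have "... = r / 8" using LD by (simp add: e_def field_simps)
  finally show ?thesis .
 qed
 define Z where "Z K = {- int K..int K}" for K
 define q where "q K x = (\<Sum>j\<in>Z K. hat (x / e - of_int j))" for K x
 define Q where "Q K v = (\<Prod>i<D. q K (v i))" for K and v :: "nat => real"
 define J where "J K = PiE {..<D} (%_. Z K)" for K
 define b where "b j v = (\<Prod>i<D. hat (v i / e - of_int (j i)))" for j :: "nat => int" and v :: "nat => real"
 define node where "node j = (%i. e * of_int (j i))" for j :: "nat => int"
 define Hd where "Hd K v = (\<Sum>j\<in>J K. H (node j) * b j v)" for K v
 have fin: "finite (J K)" for K unfolding J_def Z_def by (intro finite_PiE) auto
 have q01: "0 <= q K x" "q K x <= 1" for K x
  unfolding q_def Z_def by (simp add: sum_nonneg hat_bounds) (simp add: sum_hat ramp_def)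
 have q1: "q K x = 1" if "abs (x / e) <= real K" for K x
  using that unfolding q_def Z_def sum_hat ramp_def abs_le_iff by linarith
 have qc: "isCont (q K) x" for K x unfolding q_def using hat_cont by (intro isCont_sum) auto
 have Q01: "0 <= Q K v" "Q K v <= 1" for K v unfolding Q_def using q01 by (auto intro: prod_nonneg prod_le_1)
 have b01: "0 <= b j v" "b j v <= 1" for j v unfolding b_def using hat_bounds by (auto intro!: prod_nonneg prod_le_1)
 have Qb: "Q K v = (\<Sum>j\<in>J K. b j v)" for K v
  unfolding Q_def q_def J_def b_def by (subst prod_sum_PiE) (auto simp: Z_def)
 have node: "abs (H v - H (node j)) * b j v <= L * real D * e * b j v" for j v
 proof (cases "b j v = 0")
  case False
  have "abs (v i - node j i) <= e" if i: "i < D" for i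
  proof -
   have "hat (v i / e - of_int (j i)) ~= 0" using False i by (auto simp: b_def)
   then have "abs (v i / e - of_int (j i)) <= 1" by (rule hat_bounds(3))
   moreover have "v i / e - of_int (j i) = (v i - node j i) / e" using e by (simp add: node_def diff_divide_distrib)
   ultimately show ?thesis using e by (simp add: divide_le_eq)
  qed
  then have "(\<Sum>i<D. abs (v i - node j i)) <= (\<Sum>i<D. e)" by (intro sum_mono) auto
  then have "L * (\<Sum>i<D. abs (v i - node j i)) <= L * (real D * e)" using L by (intro mult_left_mono) auto
  then have "abs (H v - H (node j)) <= L * real D * e" using H(1)[of v "node j"] by (simp add: mult.assoc)
  then show ?thesis using b01 by (intro mult_right_mono) auto
 qed simp
 (* 1 - Q K v is the weight missing outside the cube *)
 have approx: "abs (H v - Hd K v) <= B * (1 - Q K v) + r / 8" for K v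
 proof -
  have "H v - Hd K v = H v * (1 - Q K v) + (\<Sum>j\<in>J K. (H v - H (node j)) * b j v)"
   unfolding Qb Hd_def by (simp add: left_diff_distrib sum_subtractf sum_distrib_left right_diff_distrib)
  moreover have "abs (H v * (1 - Q K v)) <= B * (1 - Q K v)"
   unfolding abs_mult using H(2)[of v] Q01[of K v] B by (intro mult_mono) auto
  moreover have "abs (\<Sum>j\<in>J K. (H v - H (node j)) * b j v) <= r / 8"
  proof -
   have "abs (\<Sum>j\<in>J K. (H v - H (node j)) * b j v) <= (\<Sum>j\<in>J K. abs (H v - H (node j)) * b j v)"
    using sum_abs[of "%j. (H v - H (node j)) * b j v" "J K"] b01 by (simp add: abs_mult)
   also have "... <= (\<Sum>j\<in>J K. L * real D * e * b j v)" by (rule sum_mono) (rule node)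
   also have "... = L * real D * e * Q K v" by (simp add: Qb sum_distrib_left)
   also have "... <= L * real D * e * 1" using Q01 L e by (intro mult_left_mono) auto
   finally show ?thesis using Le by simp
  qed
  ultimately show ?thesis by linarith
 qed
 have H_meas: "H \<in> borel_measurable borel"
 proof (rule coord_lipschitz_measurable)
  show "coord_lipschitz D L H" unfolding coord_lipschitz_def
  proof (intro allI)
   fix u v :: "nat => real"
   have "L * (\<Sum>i<D. abs (u i - v i)) <= L * (\<Sum>k\<le>D. abs (u k - v k))" using L by (intro mult_left_mono sum_mono2) auto
   then show "abs (H u - H v) <= L * (\<Sum>k\<le>D. abs (u k - v k))" using H(1)[of u v] by linarith
  qed
 qed
 have hat_meas: "(%x. hat (x / e - c)) \<in> borel_measurable borel" for c unfolding hat_def ramp_def by measurable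
 have error: "abs ((LINT z|P. H (X z)) - (LINT z|P. Hd K (X z))) <= B * (1 - (LINT z|P. Q K (X z))) + r / 8" and
  expand: "(LINT z|P. Hd K (X z)) = (\<Sum>j\<in>J K. H (node j) * (LINT z|P. b j (X z)))"
  if P: "prob_space P" and X: "!!i. (%z. X z i) \<in> borel_measurable P" for P :: "'c measure" and X K
 proof -
  interpret P: prob_space P by fact
  have bm: "(%z. b j (X z)) \<in> borel_measurable P" for j
   unfolding b_def by (intro borel_measurable_prod measurable_compose[OF X hat_meas])
  have bi: "integrable P (%z. b j (X z))" for j by (rule integrable_bdd[OF P bm, of _ 1]) (use b01 in auto)
  have Hi: "integrable P (%z. H (X z))"
   by (rule integrable_bdd[OF P measurable_compose[OF measurable_coordinatewise_then_product H_meas], of _ B]) (use X H in auto)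
  have Qi: "integrable P (%z. Q K (X z))" unfolding Qb using bi by simp
  have Hdi: "integrable P (%z. Hd K (X z))" unfolding Hd_def using bi by simp
  show "(LINT z|P. Hd K (X z)) = (\<Sum>j\<in>J K. H (node j) * (LINT z|P. b j (X z)))"
   unfolding Hd_def using bi by (subst LINT_sum) auto
  have "abs ((LINT z|P. H (X z)) - (LINT z|P. Hd K (X z))) = abs (LINT z|P. H (X z) - Hd K (X z))" using Hi Hdi by simp
  also have "... <= (LINT z|P. abs (H (X z) - Hd K (X z)))" by (rule integral_abs_bound)
  also have "... <= (LINT z|P. B * (1 - Q K (X z)) + r / 8)" using Hi Hdi Qi by (intro integral_mono approx) auto
  also have "... = B * (1 - (LINT z|P. Q K (X z))) + r / 8" using Qi P.prob_space by simp
  finally show "abs ((LINT z|P. H (X z)) - (LINT z|P. Hd K (X z))) <= B * (1 - (LINT z|P. Q K (X z))) + r / 8" .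
 qed
 have "(%K. (LINT z|N. Q K (U z))) ~> (LINT z|N. 1)"
 proof (rule integral_dominated_convergence[where w = "%_. 1"])
  show "AE z in N. (%K. Q K (U z)) ~> 1"
  proof (rule AE_I2, rule tendsto_eventually)
   fix z
   obtain K0 :: nat where K0: "(\<Sum>i<D. abs (U z i / e)) <= real K0" using real_arch_simple by blast
   have "Q K (U z) = 1" if K: "K >= K0" for K
   proof -
    have "q K (U z i) = 1" if i: "i < D" for i
    proof (rule q1)
     have "abs (U z i / e) <= (\<Sum>i<D. abs (U z i / e))" using i by (intro member_le_sum) auto
     then show "abs (U z i / e) <= real K" using K0 K by linarith
    qed
    then show ?thesis by (simp add: Q_def)
   qed
   then show "\<forall>\<^sub>F K in sequentially. Q K (U z) = 1" by (auto simp: eventually_sequentially)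
  qed
  show "(%z. Q K (U z)) \<in> borel_measurable N" for K
   unfolding Qb b_def by (intro borel_measurable_sum borel_measurable_prod measurable_compose[OF U hat_meas])
 qed (use Q01 in auto)
 then have "(%K. B * (1 - (LINT z|N. Q K (U z)))) ~> B * (1 - 1)" using N.prob_space by (intro tendsto_intros) simp
 from order_tendstoD(2)[OF this, of "r / 8"] r obtain K where K: "B * (1 - (LINT z|N. Q K (U z))) < r / 8"
  by (auto simp: eventually_sequentially)
 have Qt: "(%n. (LINT z|M. Q K (\<xi> n z))) ~> (LINT z|N. Q K (U z))"
  unfolding Q_def by (rule prod) (use qc q01 in auto)
 have "(%n. B * (1 - (LINT z|M. Q K (\<xi> n z)))) ~> B * (1 - (LINT z|N. Q K (U z)))" by (intro tendsto_intros Qt)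
 from order_tendstoD(2)[OF this K] obtain n1 where n1: "!!n. n >= n1 ==> B * (1 - (LINT z|M. Q K (\<xi> n z))) < r / 8"
  by (auto simp: eventually_sequentially)
 have "(%n. \<Sum>j\<in>J K. H (node j) * (LINT z|M. b j (\<xi> n z))) ~> (\<Sum>j\<in>J K. H (node j) * (LINT z|N. b j (U z)))"
 proof (intro tendsto_intros)
  fix j
  show "(%n. (LINT z|M. b j (\<xi> n z))) ~> (LINT z|N. b j (U z))"
   unfolding b_def by (rule prod) (use hat_cont hat_bounds in \<open>auto simp: abs_of_nonneg\<close>)
 qed
 then have "(%n. (LINT z|M. Hd K (\<xi> n z))) ~> (LINT z|N. Hd K (U z))"
  unfolding expand[OF pM \<xi>] expand[OF pN U] .
 from LIMSEQ_D[OF this, of "r / 8"] r obtain n2 where n2: "!!n. n >= n2 ==> abs ((LINT z|M. Hd K (\<xi> n z)) - (LINT z|N. Hd K (U z))) < r / 8" by auto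
 have "norm ((LINT z|M. H (\<xi> n z)) - (LINT z|N. H (U z))) < r" if n: "n >= max n1 n2" for n
 proof -
  have "n >= n1" "n >= n2" using n by auto
  note l = n1[OF this(1)] n2[OF this(2)]
  show ?thesis
  using l K error[OF pM, of "\<xi> n" K, OF \<xi>] error[OF pN, of U K, OF U] r unfolding real_norm_def by linarith
 qed
 then show "\<exists>no. \<forall>n\<ge>no. norm ((LINT z|M. H (\<xi> n z)) - (LINT z|N. H (U z))) < r" by blast
qed

section \<open>Tightness of the Birkhoff processes\<close>

lemma sum_ramp_floor:
 assumes "0 <= r" "r <= real N"
 shows "(\<Sum>k<N. a k * ramp (r - real k)) = (\<Sum>k<nat \<lfloor>r\<rfloor>. a k) + (r - of_int \<lfloor>r\<rfloor>) * (a (nat \<lfloor>r\<rfloor>) :: real)"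
 using assms
proof (induction N)
 case (Suc N)
 consider "r <= real N" | "real N < r" "r < real (Suc N)" | "r = real (Suc N)" using Suc.prems by linarith
 then show ?case
 proof cases
  case 1
  then show ?thesis using Suc by (simp add: ramp_def)
 next
  case 2
  then have fl: "\<lfloor>r\<rfloor> = int N" by (intro floor_unique) auto
  have "(\<Sum>k<N. a k * ramp (r - real k)) = (\<Sum>k<N. a k)" using 2 by (intro sum.cong refl) (simp add: ramp_def)
  then show ?thesis using 2 by (simp add: fl ramp_def mult.commute)
 next
  case 3
  have "(\<Sum>k<Suc N. a k * ramp (r - real k)) = (\<Sum>k<Suc N. a k)"
   using 3 by (intro sum.cong refl) (auto simp: ramp_def)
  then show ?thesis unfolding 3 by (simp del: of_nat_Suc)
 qed
qed simp

lemma birkhoff_process_interp: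
 assumes N: "N >= 1"
 shows "birkhoff_process f \<phi> N x = interp N (%k. birkhoff_sum f \<phi> k x / sqrt (real N))"
 unfolding birkhoff_process_def interp_def
proof (rule restrict_ext)
 fix t :: real assume t: "t \<in> {0..1}"
 have r: "0 <= real N * t" "real N * t <= real N" using t by (auto intro: mult_left_le)
 have "(\<Sum>k<N. (birkhoff_sum f \<phi> (Suc k) x / sqrt N - birkhoff_sum f \<phi> k x / sqrt N) * ramp (real N * t - real k))
   = (\<Sum>k<N. \<phi> ((f ^^ k) x) * ramp (real N * t - real k)) / sqrt N"
  unfolding sum_divide_distrib by (intro sum.cong refl) (simp add: birkhoff_sum_def diff_divide_distrib[symmetric])
 also have "... = (birkhoff_sum f \<phi> (nat \<lfloor>real N * t\<rfloor>) x + (real N * t - of_int \<lfloor>real N * t\<rfloor>) * \<phi> ((f ^^ nat \<lfloor>real N * t\<rfloor>) x)) / sqrt N"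
  unfolding sum_ramp_floor[OF r] birkhoff_sum_def ..
 finally show "(birkhoff_sum f \<phi> (nat \<lfloor>real N * t\<rfloor>) x + (real N * t - of_int \<lfloor>real N * t\<rfloor>) * \<phi> ((f ^^ nat \<lfloor>real N * t\<rfloor>) x)) / sqrt N
  = birkhoff_sum f \<phi> 0 x / sqrt N + (\<Sum>k<N. (birkhoff_sum f \<phi> (Suc k) x / sqrt N - birkhoff_sum f \<phi> k x / sqrt N) * ramp (real N * t - real k))"
  by (simp add: birkhoff_sum_def)
qed

lemma birkhoff_sum_add: "birkhoff_sum f \<phi> (j + l) x = birkhoff_sum f \<phi> j x + birkhoff_sum f \<phi> l ((f ^^ j) x)"
 by (induction l) (simp_all add: birkhoff_sum_def funpow_add add.commute[of j])

context mixing_observable begin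

abbreviation "W \<equiv> birkhoff_process f \<phi>"

lemma W_lipschitz:
 assumes N: "N >= 1" and x: "x \<in> space M" and st: "u \<in> {0..1}" "t \<in> {0..1}"
 shows "abs (W N x u - W N x t) <= Phi * sqrt N * abs (u - t)"
proof -
 have "abs (W N x u - W N x t) <= Phi / sqrt N * real N * abs (u - t)" unfolding birkhoff_process_interp[OF N]
 proof (rule interp_lipschitz[OF _ st])
  fix k
  have "S (Suc k) x / sqrt N - S k x / sqrt N = \<phi> ((f ^^ k) x) / sqrt N" by (simp add: birkhoff_sum_def diff_divide_distrib[symmetric])
  then show "abs (S (Suc k) x / sqrt N - S k x / sqrt N) <= Phi / sqrt N"
   using Phi(2)[OF fk_space[OF x]] by (simp add: divide_right_mono)
 qed
 also have "Phi / sqrt N * real N = Phi * sqrt N" using N by (simp add: field_simps)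
 finally show ?thesis .
qed

lemma W_bmeas: assumes "N >= 1" "t \<in> {0..1}" shows "bmeas M (%x. W N x t)"
proof -
 have e: "(%x. W N x t) = (%x. (S (nat \<lfloor>real N * t\<rfloor>) x + (real N * t - of_int \<lfloor>real N * t\<rfloor>) * \<phi> ((f ^^ nat \<lfloor>real N * t\<rfloor>) x)) / sqrt N)"
  using assms by (simp add: birkhoff_process_def)
 show ?thesis unfolding e by (intro bmeas_divide bmeas_add S_bmeas bmeas_cmult bmeas_fk phi_bmeas)
qed

text \<open>Increments over less than one step are bounded by the Lipschitz constant of the path; longer ones are Birkhoff sums up to a bounded error, which is
  dominated since the number of steps is at least one.\<close>

lemma increment_moment:
 assumes q: "2 < q" "q < 2 * s"
 shows "\<exists>K\<ge>0. \<forall>N t h. N >= 1 --> t \<in> {0..1} --> t + h \<in> {0..1} --> h >= 0 -->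
  (LINT x|M. abs (W N x (t + h) - W N x t) powr q) <= K * h powr (q / 2)"
proof -
 obtain K0 where K0: "K0 >= 0" "!!n. (LINT x|M. abs (S n x) powr q) <= K0 * real n powr (q / 2)"
  using moment_bound[OF q] by blast
 (* the first entry is for increments within one step, the second for longer ones *)
 define K where "K = max (Phi powr q) (2 powr q * (K0 * 2 powr (q / 2) + (2 * Phi) powr q))"
 have "(LINT x|M. abs (W N x (t + h) - W N x t) powr q) <= K * h powr (q / 2)"
  if N: "N >= 1" and th: "t \<in> {0..1}" "t + h \<in> {0..1}" "h >= 0" for N t h
 proof -
  let ?m = "LINT x|M. abs (W N x (t + h) - W N x t) powr q"
  define \<Delta> where "\<Delta> = real N * h"
  have \<Delta>0: "\<Delta> >= 0" using th by (simp add: \<Delta>_def)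
  have N0: "real N > 0" using N by simp
  have bint: "integrable M (%x. abs (W N x (t + h) - W N x t) powr q)"
   using th N q by (intro bmeas_integrable bmeas_abs_powr bmeas_diff W_bmeas) auto
  have scale: "\<Delta> powr (q / 2) = sqrt N powr q * h powr (q / 2)"
   using N0 th by (simp add: \<Delta>_def powr_mult powr_half_sqrt[symmetric] powr_powr)
  have "?m * sqrt N powr q <= K * \<Delta> powr (q / 2)"
  proof (cases "\<Delta> < 1")
   case True
   have "?m <= (LINT x|M. (Phi * sqrt N * h) powr q)"
    using W_lipschitz[OF N _ th(2,1)] th(3) q by (intro integral_mono bint) (auto intro!: powr_mono2)
   also have "... = (Phi * sqrt N * h) powr q" using prob_space by simp
   finally have "?m * sqrt N powr q <= (Phi * sqrt N * h) powr q * sqrt N powr q" by (intro mult_right_mono) auto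
   also have "... = Phi powr q * \<Delta> powr q"
   proof -
    have "(Phi * sqrt N * h) * sqrt N = Phi * \<Delta>" by (simp add: \<Delta>_def mult_ac)
    moreover have "Phi * sqrt N * h >= 0" using Phi(1) th(3) by auto
    ultimately show ?thesis using Phi(1) \<Delta>0 by (simp only: powr_mult[symmetric])
   qed
   also have "... <= Phi powr q * \<Delta> powr (q / 2)" using True \<Delta>0 q by (intro mult_left_mono powr_mono') auto
   also have "... <= K * \<Delta> powr (q / 2)" by (intro mult_right_mono) (auto simp: K_def)
   finally show ?thesis .
  next
   case False
   define j where "j = nat \<lfloor>real N * t\<rfloor>"
   define l where "l = nat \<lfloor>real N * (t + h)\<rfloor> - j"
   have nonneg: "0 <= real N * t" "real N * t <= real N * (t + h)" using th N0 by (auto intro: mult_left_mono)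
   have jl: "nat \<lfloor>real N * (t + h)\<rfloor> = j + l" using nonneg floor_mono[OF nonneg(2)] by (simp add: l_def j_def nat_mono)
   have l: "real l <= 2 * \<Delta>"
   proof -
    have "real (j + l) <= real N * (t + h)" using nonneg unfolding jl[symmetric] by simp
    moreover have "real N * t < real j + 1" using nonneg by (simp add: j_def)
    ultimately have "real l <= \<Delta> + 1" by (simp add: \<Delta>_def distrib_left)
    then show ?thesis using False by linarith
   qed
   have pw: "abs (W N x (t + h) - W N x t) * sqrt N <= abs (S l ((f ^^ j) x)) + 2 * Phi" if x: "x \<in> space M" for x
   proof -
    let ?fr = "%r. r - of_int \<lfloor>r\<rfloor> :: real"
    have small: "abs (?fr r * \<phi> ((f ^^ i) x)) <= Phi" for r i
    proof -
     have "abs (?fr r) <= 1" by linarith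
     then have "abs (?fr r) * abs (\<phi> ((f ^^ i) x)) <= 1 * Phi" by (intro mult_mono Phi fk_space x) auto
     then show ?thesis by (simp add: abs_mult)
    qed
    have e1: "W N x (t + h) * sqrt N = S (j + l) x + ?fr (real N * (t + h)) * \<phi> ((f ^^ (j + l)) x)"
     using th N0 by (simp add: birkhoff_process_def jl)
    have e2: "W N x t * sqrt N = S j x + ?fr (real N * t) * \<phi> ((f ^^ j) x)"
     using th N0 by (simp add: birkhoff_process_def j_def)
    have "abs (W N x (t + h) - W N x t) * sqrt N = abs (W N x (t + h) * sqrt N - W N x t * sqrt N)"
     by (simp add: left_diff_distrib[symmetric] abs_mult)
    then show ?thesis unfolding e1 e2 birkhoff_sum_add
     using small[of "real N * (t + h)" "j + l"] small[of "real N * t" j] by linarith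
   qed
   have bS: "integrable M (%x. abs (S l ((f ^^ j) x)) powr q)"
    using q by (intro bmeas_integrable bmeas_abs_powr bmeas_fk[OF S_bmeas]) auto
   have "?m * sqrt N powr q = (LINT x|M. (abs (W N x (t + h) - W N x t) * sqrt N) powr q)" by (simp add: powr_mult)
   also have "... <= (LINT x|M. 2 powr q * (abs (S l ((f ^^ j) x)) powr q + (2 * Phi) powr q))"
   proof (rule integral_mono)
    show "integrable M (%x. (abs (W N x (t + h) - W N x t) * sqrt N) powr q)" using bint by (simp add: powr_mult)
    show "integrable M (%x. 2 powr q * (abs (S l ((f ^^ j) x)) powr q + (2 * Phi) powr q))" using bS by simp
    fix x assume x: "x \<in> space M"
    have "(abs (W N x (t + h) - W N x t) * sqrt N) powr q <= (abs (S l ((f ^^ j) x)) + 2 * Phi) powr q"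
     using q by (intro powr_mono2 pw[OF x]) auto
    also have "... <= 2 powr q * (abs (S l ((f ^^ j) x)) powr q + (2 * Phi) powr q)" using Phi(1) q by (intro powr_add_le) auto
    finally show "(abs (W N x (t + h) - W N x t) * sqrt N) powr q <= 2 powr q * (abs (S l ((f ^^ j) x)) powr q + (2 * Phi) powr q)" .
   qed
   also have "... = 2 powr q * ((LINT x|M. abs (S l x) powr q) + (2 * Phi) powr q)"
   proof -
    have m: "(%x. abs (S l x) powr q) \<in> borel_measurable M" using bmeas_measurable[OF S_bmeas] by measurable
    show ?thesis using bS prob_space invariant[OF m, of j] by simp
   qed
   also have "... <= 2 powr q * (K0 * (2 * \<Delta>) powr (q / 2) + (2 * Phi) powr q * \<Delta> powr (q / 2))"
   proof (intro mult_left_mono add_mono)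
    have "real l powr (q / 2) <= (2 * \<Delta>) powr (q / 2)" using l q by (intro powr_mono2) auto
    then have "K0 * real l powr (q / 2) <= K0 * (2 * \<Delta>) powr (q / 2)" using K0(1) by (intro mult_left_mono)
    then show "(LINT x|M. abs (S l x) powr q) <= K0 * (2 * \<Delta>) powr (q / 2)" using K0(2)[of l] by linarith
    have "1 <= \<Delta> powr (q / 2)" using False q by (intro ge_one_powr_ge_zero) auto
    then have "(2 * Phi) powr q * 1 <= (2 * Phi) powr q * \<Delta> powr (q / 2)" by (intro mult_left_mono) auto
    then show "(2 * Phi) powr q <= (2 * Phi) powr q * \<Delta> powr (q / 2)" by simp
   qed auto
   also have "... = 2 powr q * (K0 * 2 powr (q / 2) + (2 * Phi) powr q) * \<Delta> powr (q / 2)"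
    using \<Delta>0 by (simp add: powr_mult algebra_simps)
   also have "... <= K * \<Delta> powr (q / 2)" by (intro mult_right_mono) (auto simp: K_def)
   finally show ?thesis .
  qed
  then have "?m * sqrt N powr q <= (K * h powr (q / 2)) * sqrt N powr q" unfolding scale by (simp add: mult_ac)
  then show ?thesis by (rule mult_right_le_imp_le) (use N0 in simp)
 qed
 moreover have "K >= 0" unfolding K_def by (rule max.coboundedI1) simp
 ultimately show ?thesis by blast
qed

text \<open>Markov's inequality for the \<open>q\<close>-th moments and a union bound over the \<open>2 ^ j\<close> dyadic increments of each level \<open>j \<ge> m\<close>. The choice of
  \<open>\<theta>\<close> between \<open>\<eta>\<close> and \<open>1/2 - 1/q\<close> makes the sum geometric and leaves room to apply \<open>proj_dist_dyadic\<close>.\<close>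

theorem W_tight:
 assumes q: "2 < q" "q < 2 * s" and \<eta>: "0 < \<eta>" "\<eta> < 1/2 - 1/q" and r: "r > 0"
 shows "\<exists>m0. \<forall>m\<ge>m0. \<forall>N\<ge>1. \<exists>A\<in>sets M. measure M A <= r \<and>
    (\<forall>x\<in>space M - A. holder_dist \<eta> (W N x) (proj (2 ^ m) (W N x)) <= r)"
proof -
 let ?I = "%N j k x. W N x (real (Suc k) / 2 ^ j) - W N x (real k / 2 ^ j)"
 define b where "b = (\<eta> + (1/2 - 1/q)) / 2"
 have b: "\<eta> < b" "b < 1/2 - 1/q" using \<eta> by (auto simp: b_def)
 obtain K where K: "K >= 0" "!!N t h. N >= 1 ==> t \<in> {0..1} ==> t + h \<in> {0..1} ==> h >= 0 ==>
  (LINT x|M. abs (W N x (t + h) - W N x t) powr q) <= K * h powr (q / 2)" using increment_moment[OF q] by blast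
 define \<rho> where "\<rho> = 2 powr (1 + b * q - q / 2)"
 have "b * q < (1/2 - 1/q) * q" using b q by (intro mult_strict_right_mono) auto
 also have "... = q / 2 - 1" using q by (simp add: left_diff_distrib)
 finally have neg: "1 + b * q - q / 2 < 0" by simp
 have "\<rho> < 2 powr 0" unfolding \<rho>_def using neg by (intro powr_less_mono) auto
 then have \<rho>: "0 < \<rho>" "\<rho> < 1" by (auto simp: \<rho>_def)
 have t01: "2 powr (\<eta> - b) < 1" using powr_less_mono[of "\<eta> - b" 0 2] b by simp
 define E where "E N j k = {x \<in> space M. abs (?I N j k x) powr q >= ((2 powr (- b)) ^ j) powr q}" for N j k
 have grid: "real (Suc k) / 2 ^ j \<in> {0..1}" "real k / 2 ^ j \<in> {0..1}" if "k < 2 ^ j" for j k :: nat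
 proof -
  have "real (Suc k) <= real (2 ^ j)" using that by (simp only: of_nat_le_iff Suc_le_eq)
  then have "real k + 1 <= 2 ^ j" by simp
  then show "real (Suc k) / 2 ^ j \<in> {0..1}" "real k / 2 ^ j \<in> {0..1}" using that by (simp_all add: divide_le_eq)
 qed
 have int: "integrable M (%x. abs (?I N j k x) powr q)" if k: "k < 2 ^ j" and N: "N >= 1" for N j k
  using q by (intro bmeas_integrable bmeas_abs_powr bmeas_diff W_bmeas N grid k) auto
 have Em: "E N j k \<in> sets M" if "k < 2 ^ j" "N >= 1" for N j k
  using borel_measurable_integrable[OF int[OF that]] unfolding E_def by measurable
 have Eb: "measure M (E N j k) <= K * (\<rho> / 2) ^ j" if k: "k < 2 ^ j" and N: "N >= 1" for N j k
 proof -
  have c: "((2 powr (- b)) ^ j) powr q > 0" by simp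
  have "measure M (E N j k) <= (LINT x|M. abs (?I N j k x) powr q) / ((2 powr (- b)) ^ j) powr q"
   unfolding E_def by (rule integral_Markov_inequality_measure[OF int[OF k N] sets.top]) (use c in auto)
  also have "... <= (K * (1 / 2 ^ j) powr (q / 2)) / ((2 powr (- b)) ^ j) powr q"
  proof (intro divide_right_mono)
   have e: "real (Suc k) / 2 ^ j = real k / 2 ^ j + 1 / 2 ^ j" by (simp add: add_divide_distrib)
   show "(LINT x|M. abs (?I N j k x) powr q) <= K * (1 / 2 ^ j) powr (q / 2)"
    unfolding e by (rule K(2)[OF N grid(2)[OF k] grid(1)[OF k, unfolded e]]) simp
  qed auto
  also have "... = K * (\<rho> / 2) ^ j"
  proof -
   have "(1 / 2 ^ j :: real) = 2 powr (- real j)" by (simp add: powr_minus powr_realpow divide_inverse)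
   then have "(1 / 2 ^ j) powr (q / 2) = 2 powr (- real j * (q / 2))" by (simp only: powr_powr)
   moreover have "((2 powr (- b)) ^ j) powr q = (2 powr (- b * real j * q) :: real)"
   proof -
    have "(2 powr (- b)) ^ j = (2 powr (- b * real j) :: real)" by (subst powr_realpow[symmetric]) (simp_all add: powr_powr)
    then show ?thesis by (simp only: powr_powr)
   qed
   moreover have "(\<rho> / 2) ^ j = 2 powr ((b * q - q / 2) * real j)"
   proof -
    have "\<rho> / 2 = 2 powr (b * q - q / 2)" by (simp add: \<rho>_def powr_add powr_diff)
    then show ?thesis by (simp only:) (subst powr_realpow[symmetric], simp_all add: powr_powr)
   qed
   moreover have "- real j * (q / 2) - - b * real j * q = (b * q - q / 2) * real j" by (simp add: algebra_simps)
   ultimately show ?thesis by (simp only: times_divide_eq_right[symmetric] powr_diff[symmetric])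
  qed
  finally show ?thesis .
 qed
 define G where "G N j = (\<Union>k\<in>{..<2 ^ j}. E N j k)" for N j
 have Gm: "G N j \<in> sets M" if "N >= 1" for N j unfolding G_def using Em that by auto
 have Gb: "measure M (G N j) <= K * \<rho> ^ j" if N: "N >= 1" for N j
 proof -
  have "measure M (G N j) <= (\<Sum>k<2 ^ j. measure M (E N j k))"
   unfolding G_def using Em N by (intro finite_measure_subadditive_finite) auto
  also have "... <= (\<Sum>k<(2::nat) ^ j. K * (\<rho> / 2) ^ j)" by (intro sum_mono Eb N) auto
  also have "... = K * \<rho> ^ j" by (simp add: power_divide)
  finally show ?thesis .
 qed
 define Bad where "Bad N m = (\<Union>i. G N (m + i))" for N m
 have Badm: "Bad N m \<in> sets M" if "N >= 1" for N m unfolding Bad_def using Gm[OF that] by auto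
 have Badb: "measure M (Bad N m) <= K * \<rho> ^ m / (1 - \<rho>)" if N: "N >= 1" for N m
 proof -
  have geo: "(%i. K * \<rho> ^ m * \<rho> ^ i) sums (K * \<rho> ^ m * (1 / (1 - \<rho>)))" using \<rho> by (intro sums_mult geometric_sums) auto
  have le: "measure M (G N (m + i)) <= K * \<rho> ^ m * \<rho> ^ i" for i using Gb[OF N, of "m + i"] by (simp add: power_add mult.assoc)
  have sm: "summable (%i. measure M (G N (m + i)))"
   by (rule summable_comparison_test'[OF sums_summable[OF geo], of 0]) (use le in auto)
  have "measure M (Bad N m) <= (\<Sum>i. measure M (G N (m + i)))"
   unfolding Bad_def using Gm[OF N] by (intro finite_measure_subadditive_countably sm) auto
  also have "... <= (\<Sum>i. K * \<rho> ^ m * \<rho> ^ i)" by (intro suminf_le le sm sums_summable[OF geo])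
  also have "... = K * \<rho> ^ m / (1 - \<rho>)" using sums_unique[OF geo] by simp
  finally show ?thesis .
 qed
 define A where "A = 8 * (1 + 2 / (1 - 2 powr (- b)))"
 have good: "holder_dist \<eta> (W N x) (proj (2 ^ m) (W N x)) <= A * (2 powr (\<eta> - b)) ^ m"
  if N: "N >= 1" and x: "x \<in> space M - Bad N m" for N m x unfolding A_def
 proof (rule proj_dist_dyadic)
  have xs: "x \<in> space M" using x by simp
  show "continuous_on {0..1} (W N x)" by (rule lipschitz_on_continuous_on[of "Phi * sqrt N"], rule lipschitz_onI)
     (use W_lipschitz[OF N xs] Phi(1) in \<open>auto simp: dist_real_def\<close>)
  have "1 / q > 0" using q by simp
  then show "0 < \<eta>" "\<eta> < 1" "\<eta> < b" using \<eta> b by linarith+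
  fix j k :: nat assume j: "m <= j" and k: "k < 2 ^ j"
  then obtain i where "j = m + i" using le_Suc_ex by blast
  then have "x \<notin> E N j k" using x k by (auto simp: Bad_def G_def)
  then have "abs (?I N j k x) powr q < ((2 powr (- b)) ^ j) powr q" using xs by (simp add: E_def not_le)
  then show "abs (?I N j k x) <= (2 powr (- b)) ^ j"
   using q powr_mono2[of q "(2 powr (- b)) ^ j" "abs (?I N j k x)"] by fastforce
 qed
 have "(%m. K * \<rho> ^ m / (1 - \<rho>)) ~> K * 0 / (1 - \<rho>)" using \<rho> by (intro tendsto_intros LIMSEQ_power_zero) auto
 then have "\<forall>\<^sub>F m in sequentially. K * \<rho> ^ m / (1 - \<rho>) < r" using r by (intro order_tendstoD(2)) auto
 moreover have "(%m. A * (2 powr (\<eta> - b)) ^ m) ~> A * 0" using t01 by (intro tendsto_intros LIMSEQ_power_zero) auto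
 then have "\<forall>\<^sub>F m in sequentially. A * (2 powr (\<eta> - b)) ^ m < r" using r by (intro order_tendstoD(2)) auto
 ultimately have "\<forall>\<^sub>F m in sequentially. K * \<rho> ^ m / (1 - \<rho>) < r \<and> A * (2 powr (\<eta> - b)) ^ m < r" by (rule eventually_conj)
 then obtain m0 where m0: "!!m. m >= m0 ==> K * \<rho> ^ m / (1 - \<rho>) < r" "!!m. m >= m0 ==> A * (2 powr (\<eta> - b)) ^ m < r"
  by (auto simp: eventually_sequentially)
 show ?thesis
 proof (intro exI[of _ m0] allI impI)
  fix m N :: nat assume m: "m >= m0" and N: "N >= 1"
  show "\<exists>A\<in>sets M. measure M A <= r \<and> (\<forall>x\<in>space M - A. holder_dist \<eta> (W N x) (proj (2 ^ m) (W N x)) <= r)"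
  proof (intro bexI[of _ "Bad N m"] conjI ballI Badm N)
   show "measure M (Bad N m) <= r" using Badb[OF N, of m] m0(1)[OF m] by linarith
   show "holder_dist \<eta> (W N x) (proj (2 ^ m) (W N x)) <= r" if "x \<in> space M - Bad N m" for x
    using good[OF N that] m0(2)[OF m] by linarith
  qed
 qed
qed

end

section \<open>Finite-dimensional distributions\<close>

lemma div_asymptotics: assumes "D >= 1" shows "(%n. real (n div D) / real n) ~> 1 / real D"
proof -
 have "(%n. real (n div D) / real n - 1 / real D) ~> 0"
 proof (rule Lim_null_comparison[OF _ lim_1_over_n])
  show "\<forall>\<^sub>F n in sequentially. norm (real (n div D) / real n - 1 / real D) <= 1 / real n"
  proof (rule eventually_sequentiallyI[of 1])
   fix n :: nat assume n: "1 <= n"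
   have D: "real D > 0" using assms by simp
   have "n = D * (n div D) + n mod D" by simp
   then have "real n = real D * real (n div D) + real (n mod D)" by (metis of_nat_add of_nat_mult)
   moreover have "real (n mod D) <= real D" using assms by simp
   ultimately have d: "abs (real D * real (n div D) - real n) <= real D" by simp
   have "real (n div D) / real n - 1 / real D = (real D * real (n div D) - real n) / (real D * real n)"
    using D n by (simp add: field_simps)
   also have "abs (...) = abs (real D * real (n div D) - real n) / (real D * real n)" by (simp add: abs_divide)
   also have "... <= real D / (real D * real n)" using d by (intro divide_right_mono) auto
   also have "... = 1 / real n" using D by simp
   finally show "norm (real (n div D) / real n - 1 / real D) <= 1 / real n" by simp
  qed
 qed
 then show ?thesis by (rule LIM_zero_cancel)
qed

context mixing_observable begin

lemma birkhoff_sum_blocks: "S (k * b) x = (\<Sum>i<k. S b ((f ^^ (i * b)) x))"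
proof (induction k)
 case (Suc k)
 have "S (Suc k * b) x = S (k * b + b) x" by (simp add: add.commute)
 then show ?case using Suc by (simp add: birkhoff_sum_add)
qed (simp add: birkhoff_sum_def)

text \<open>Induction over the blocks: the product over the later blocks is the future factor in \<open>block_clt\<close> for the first one.\<close>

lemma block_products:
 fixes h :: "nat => real => real"
 assumes D: "D >= 1" and \<mu>: "real_distribution \<mu>" "!!t. char \<mu> t = of_real (exp (- (1 / real D * t^2 * \<sigma>2 / 2)))"
  and h: "!!i x. isCont (h i) x" "!!i x. abs (h i x) <= 1"
 shows "(%n. (LINT x|M. (\<Prod>i<k. h i (S (n div D) ((f ^^ (i * (n div D))) x) / sqrt n)))) ~> (\<Prod>i<k. (LINT x|\<mu>. h i x))"
 using h
proof (induction k arbitrary: h)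
 case 0
 then show ?case using prob_space by simp
next
 case (Suc k)
 define g where "g n x = (\<Prod>i<k. h (Suc i) (S (n div D) ((f ^^ (i * (n div D))) x) / sqrt (real n)))" for n x
 have hm: "h i \<in> borel_measurable borel" for i
  by (intro borel_measurable_continuous_onI) (simp add: continuous_on_eq_continuous_at Suc.prems(1))
 have gm: "g n \<in> borel_measurable M" for n unfolding g_def using bmeas_measurable[OF bmeas_fk[OF S_bmeas]]
  by (intro borel_measurable_prod measurable_compose[OF _ hm] borel_measurable_divide) auto
 have ut: "unit_test (g n)" for n
  unfolding unit_test_def using gm Suc.prems(2) by (auto simp: g_def abs_prod intro!: prod_le_1)
 have IH: "(%n. (LINT x|M. g n x)) ~> (\<Prod>i<k. (LINT x|\<mu>. h (Suc i) x))"
  unfolding g_def by (rule Suc.IH) (use Suc.prems in auto)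
 have "(%n. (LINT x|M. h 0 (S (n div D) x / sqrt n) * g n ((f ^^ (n div D)) x)) - (LINT x|\<mu>. h 0 x) * (LINT x|M. g n x)) ~> 0"
  by (rule block_clt[OF _ div_asymptotics[OF D] ut \<mu> Suc.prems(1) Suc.prems(2)]) simp
 from tendsto_add[OF this tendsto_mult_left[OF IH, of "LINT x|\<mu>. h 0 x"]]
 have "(%n. (LINT x|M. h 0 (S (n div D) x / sqrt n) * g n ((f ^^ (n div D)) x))) ~> (LINT x|\<mu>. h 0 x) * (\<Prod>i<k. (LINT x|\<mu>. h (Suc i) x))"
  by simp
 moreover have "h 0 (S (n div D) x / sqrt n) * g n ((f ^^ (n div D)) x) = (\<Prod>i<Suc k. h i (S (n div D) ((f ^^ (i * (n div D))) x) / sqrt n))" for n x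
  unfolding prod.lessThan_Suc_shift g_def by (simp add: funpow_add[symmetric, THEN fun_cong, unfolded o_def] add.commute)
 ultimately show ?case unfolding prod.lessThan_Suc_shift by simp
qed

text \<open>Blocks have the integral length \<open>N div D\<close>, so that their end points miss the grid times by at most \<open>D / N\<close>.\<close>

lemma process_block_sums:
 assumes N: "N >= 1" and D: "D >= 1" and k: "k <= D" and x: "x \<in> space M"
 shows "abs (W N x (real k / real D) - (\<Sum>i<k. S (N div D) ((f ^^ (i * (N div D))) x) / sqrt N)) <= Phi * real D / sqrt N"
proof -
 define b where "b = N div D"
 have NR: "real N > 0" and DR: "real D > 0" using N D by auto
 have "k * b <= D * b" using k by simp
 also have "D * b <= N" by (simp add: b_def)
 finally have kb: "k * b <= N" .
 have "(\<Sum>i<k. S b ((f ^^ (i * b)) x) / sqrt N) = S (k * b) x / sqrt N"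
  by (simp add: birkhoff_sum_blocks sum_divide_distrib)
 also have "... = W N x (real (k * b) / real N)"
  unfolding birkhoff_process_interp[OF N] by (rule interp_grid[OF kb N, symmetric])
 finally have e: "(\<Sum>i<k. S b ((f ^^ (i * b)) x) / sqrt N) = W N x (real (k * b) / real N)" .
 have "N = D * b + N mod D" by (simp add: b_def)
 then have NDb: "real N = real D * real b + real (N mod D)" by (metis of_nat_add of_nat_mult)
 have md: "real (N mod D) <= real D" using D by simp
 have close: "abs (real k / real D - real (k * b) / real N) <= real D / real N"
 proof -
  have "real k / real D - real (k * b) / real N = real k * (real N - real D * real b) / (real D * real N)"
   using NR DR by (simp add: field_simps)
  also have "abs (...) = real k * real (N mod D) / (real D * real N)" using NDb by (simp add: abs_mult)
  also have "... <= real D * real D / (real D * real N)" using k md by (intro divide_right_mono mult_mono) auto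
  also have "... = real D / real N" using DR by simp
  finally show ?thesis .
 qed
 have "real (k * b) / real N \<in> {0..1}" using kb NR by (simp add: of_nat_le_iff[symmetric, where 'a = real] del: of_nat_mult of_nat_le_iff)
 from W_lipschitz[OF N x dyadic_in_unit[OF k] this]
 have "abs (W N x (real k / real D) - W N x (real (k * b) / real N)) <= Phi * sqrt N * abs (real k / real D - real (k * b) / real N)" .
 also have "... <= Phi * sqrt N * (real D / real N)" using close Phi(1) by (intro mult_left_mono) auto
 also have "... = Phi * real D / sqrt N"
 proof -
  have "real N = sqrt N * sqrt N" by simp
  then show ?thesis using NR by (simp add: field_simps)
 qed
 finally show ?thesis unfolding e[symmetric, unfolded b_def] b_def .
qed

text \<open>The limit is described by variables \<open>\<zeta> \<omega> i\<close> that play the role of independent increments with law \<open>\<mu>\<close>; grid values of the process are their partial sums.\<close>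

theorem W_fdd:
 fixes P :: "'c measure" and Z :: "'c => nat => real"
 assumes D: "D >= 1" and \<mu>: "real_distribution \<mu>" "!!t. char \<mu> t = of_real (exp (- (1 / real D * t^2 * \<sigma>2 / 2)))"
  and P: "prob_space P" and Z: "!!i. (%z. Z z i) \<in> borel_measurable P"
  and indep: "!!h :: nat => real => real. (!!i x. isCont (h i) x) ==> (!!i x. abs (h i x) <= 1) ==>
    (LINT z|P. (\<Prod>i<D. h i (Z z i))) = (\<Prod>i<D. (LINT x|\<mu>. h i x))"
  and H: "coord_lipschitz D L H" "!!v. abs (H v) <= B"
 shows "(%n. (LINT x|M. H (%k. W (Suc n) x (real (min k D) / real D)))) ~> (LINT z|P. H (%k. \<Sum>i<min k D. Z z i))"
proof -
 let ?H = "%n x. H (%k. W (Suc n) x (real (min k D) / real D))"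
 define b where "b n = Suc n div D" for n
 define \<xi> where "\<xi> n x i = S (b n) ((f ^^ (i * b n)) x) / sqrt (real (Suc n))" for n x i
 define G where "G v = H (%k. \<Sum>i<min k D. v i)" for v :: "nat => real"
 define L' where "L' = abs L"
 have HL: "abs (H u - H v) <= L' * (\<Sum>k\<le>D. abs (u k - v k))" for u v
 proof -
  have "abs (H u - H v) <= L * (\<Sum>k\<le>D. abs (u k - v k))" using H(1) by (simp add: coord_lipschitz_def)
  also have "... <= L' * (\<Sum>k\<le>D. abs (u k - v k))" by (intro mult_right_mono sum_nonneg) (auto simp: L'_def)
  finally show ?thesis .
 qed
 have L': "L' >= 0" by (simp add: L'_def)
 have \<xi>m: "(%x. \<xi> n x i) \<in> borel_measurable M" for n i
  unfolding \<xi>_def using bmeas_measurable[OF bmeas_fk[OF S_bmeas]] by (intro borel_measurable_divide) auto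
 have G_lim: "(%n. (LINT x|M. G (\<xi> n x))) ~> (LINT z|P. G (Z z))"
 proof (rule product_tests_suffice[OF prob_space_axioms P \<xi>m Z])
  fix h :: "nat => real => real" assume h: "!!i x. isCont (h i) x" "!!i x. abs (h i x) <= 1"
  have "(%n. (LINT x|M. (\<Prod>i<D. h i (\<xi> n x i)))) ~> (\<Prod>i<D. (LINT x|\<mu>. h i x))"
   using LIMSEQ_Suc[OF block_products[where k = D, OF D \<mu> h]] by (simp add: \<xi>_def b_def)
  then show "(%n. (LINT x|M. (\<Prod>i<D. h i (\<xi> n x i)))) ~> (LINT z|P. (\<Prod>i<D. h i (Z z i)))" by (simp add: indep[OF h])
 next
  fix u v :: "nat => real"
  have "abs (G u - G v) <= L' * (\<Sum>k\<le>D. abs ((\<Sum>i<min k D. u i) - (\<Sum>i<min k D. v i)))" unfolding G_def by (rule HL)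
  also have "... <= L' * (\<Sum>k\<le>D. \<Sum>i<D. abs (u i - v i))"
  proof (intro mult_left_mono L' sum_mono)
   fix k
   have "abs ((\<Sum>i<min k D. u i) - (\<Sum>i<min k D. v i)) <= (\<Sum>i<min k D. abs (u i - v i))"
    unfolding sum_subtractf[symmetric] by (rule sum_abs)
   also have "... <= (\<Sum>i<D. abs (u i - v i))" by (intro sum_mono2) auto
   finally show "abs ((\<Sum>i<min k D. u i) - (\<Sum>i<min k D. v i)) <= (\<Sum>i<D. abs (u i - v i))" .
  qed
  finally show "abs (G u - G v) <= (L' * (real D + 1)) * (\<Sum>i<D. abs (u i - v i))" by (simp add: add.commute mult.assoc)
 next
  show "abs (G v) <= B" for v unfolding G_def by (rule H(2))
  show "0 <= L' * (real D + 1)" using L' by simp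
 qed
 have Hm: "H \<in> borel_measurable borel" by (rule coord_lipschitz_measurable[OF H(1)])
 have iW: "integrable M (%x. ?H n x)" for n
  by (rule integrable_bdd[OF prob_space_axioms measurable_compose[OF measurable_coordinatewise_then_product Hm], of _ B])
    (use H(2) bmeas_measurable[OF W_bmeas[OF _ dyadic_in_unit]] in auto)
 have iG: "integrable M (%x. G (\<xi> n x))" for n unfolding G_def
  by (rule integrable_bdd[OF prob_space_axioms measurable_compose[OF measurable_coordinatewise_then_product Hm], of _ B])
    (use H(2) \<xi>m in auto)
 have "(%n. (LINT x|M. ?H n x) - (LINT x|M. G (\<xi> n x))) ~> 0"
 proof (rule Lim_null_comparison)
  let ?c = "%n. L' * ((real D + 1) * (Phi * real D / sqrt (real (Suc n))))"
  have "(%n. 1 / sqrt (real n)) ~> 0"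
   by (intro tendsto_divide_0[OF tendsto_const] filterlim_at_top_imp_at_infinity filterlim_compose[OF sqrt_at_top filterlim_real_sequentially])
  from tendsto_mult_right_zero[OF LIMSEQ_Suc[OF this], of "L' * ((real D + 1) * (Phi * real D))"]
  show "?c ~> 0" by (simp add: mult.assoc)
  show "\<forall>\<^sub>F n in sequentially. norm ((LINT x|M. ?H n x) - (LINT x|M. G (\<xi> n x))) <= ?c n"
  proof (intro always_eventually allI)
   fix n
   have "norm ((LINT x|M. ?H n x) - (LINT x|M. G (\<xi> n x)))
    = abs (LINT x|M. ?H n x - G (\<xi> n x))" using iW[of n] iG[of n] by simp
   also have "... <= (LINT x|M. abs (?H n x - G (\<xi> n x)))" by (rule integral_abs_bound)
   also have "... <= (LINT x|M. ?c n)"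
   proof (rule integral_mono)
    show "integrable M (%x. abs (?H n x - G (\<xi> n x)))" using iW[of n] iG[of n] by simp
    fix x assume x: "x \<in> space M"
    have "abs (?H n x - G (\<xi> n x)) <= L' * (\<Sum>k\<le>D. abs (W (Suc n) x (real (min k D) / real D) - (\<Sum>i<min k D. \<xi> n x i)))"
     unfolding G_def by (rule HL)
    also have "... <= L' * (\<Sum>k\<le>D. Phi * real D / sqrt (real (Suc n)))"
     unfolding \<xi>_def b_def by (intro mult_left_mono L' sum_mono process_block_sums D x) auto
    finally show "abs (?H n x - G (\<xi> n x)) <= ?c n" by (simp add: add.commute)
   qed simp
   also have "... = ?c n" using prob_space by simp
   finally show "norm ((LINT x|M. ?H n x) - (LINT x|M. G (\<xi> n x))) <= ?c n" .
  qed
 qed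
 from tendsto_add[OF this G_lim] show ?thesis by (simp add: G_def)
qed

end

section \<open>Brownian motion and the limit theorem\<close>

lemma holder0I:
 assumes x: "x \<in> extensional {0..1}" and K: "!!s t. s \<in> {0..1} ==> t \<in> {0..1} ==> abs (x s - x t) <= K * abs (s - t) powr \<eta>"
  and small: "!!w. w > 0 ==> \<exists>e>0. \<forall>s\<in>{0..1}. \<forall>t\<in>{0..1}. abs (s - t) < e --> abs (x s - x t) <= w * abs (s - t) powr \<eta>"
 shows "x \<in> holder0 \<eta>"
proof -
 have "holder_const \<eta> x <= ennreal K" by (intro holder_const_le K)
 then have fin: "holder_const \<eta> x < \<infinity>" by (rule le_less_trans) simp
 have "(holder_mod \<eta> x \<longlongrightarrow> 0) (at_right 0)"
 proof (rule order_tendstoI)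
  fix a :: ennreal assume a: "0 < a"
  from dense[OF this] obtain b where b: "0 < b" "b < a" by blast
  then obtain w :: real where "b = ennreal w" "0 <= w" by (cases b) auto
  then have w: "0 < w" "ennreal w < a" using b by auto
  from small[OF w(1)] obtain e where e: "e > 0" "!!s t. s \<in> {0..1} ==> t \<in> {0..1} ==> abs (s - t) < e ==> abs (x s - x t) <= w * abs (s - t) powr \<eta>" by blast
  have "holder_mod \<eta> x d < a" if "0 < d" "d < e" for d
  proof -
   have "holder_mod \<eta> x d <= ennreal w" using that by (intro holder_mod_le e(2)) auto
   then show ?thesis using w(2) by (rule le_less_trans)
  qed
  then show "\<forall>\<^sub>F d in at_right 0. holder_mod \<eta> x d < a" using e(1) by (auto simp: eventually_at_right_field)
 qed simp
 then show ?thesis using x fin by (simp add: holder0_def holder_def)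
qed

lemma holder0_scale:
 assumes x: "x \<in> holder0 \<eta>" and c: "c >= 0" shows "(\<lambda>t\<in>{0..1}. c * x t) \<in> holder0 \<eta>"
proof -
 have "holder_const \<eta> x < \<infinity>" using x by (simp add: holder0_def holder_def)
 then obtain K where K: "holder_const \<eta> x = ennreal K" "K >= 0" by (cases "holder_const \<eta> x") auto
 have xK: "abs (x s - x t) <= K * abs (s - t) powr \<eta>" if st: "s \<in> {0..1}" "t \<in> {0..1}" for s t
 proof (cases "s = t")
  case False
  have "(case (s, t) of (s, t) => ennreal (abs (x s - x t) / abs (s - t) powr \<eta>)) <= holder_const \<eta> x"
   unfolding holder_const_def by (rule SUP_upper) (use st False in auto)
  then have "abs (x s - x t) / abs (s - t) powr \<eta> <= K" using K by (simp add: ennreal_le_iff)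
  then show ?thesis using False by (simp add: divide_le_eq)
 qed simp
 have scaled: "abs ((\<lambda>t\<in>{0..1}. c * x t) s - (\<lambda>t\<in>{0..1}. c * x t) t) = c * abs (x s - x t)" if "s \<in> {0..1}" "t \<in> {0..1}" for s t
  using that c by (simp add: right_diff_distrib[symmetric] abs_mult)
 have bd: "abs ((\<lambda>t\<in>{0..1}. c * x t) s - (\<lambda>t\<in>{0..1}. c * x t) t) <= (c * K) * abs (s - t) powr \<eta>" if st: "s \<in> {0..1}" "t \<in> {0..1}" for s t
  unfolding scaled[OF st] mult.assoc by (intro mult_left_mono xK st c)
 have sm: "\<exists>e>0. \<forall>s\<in>{0..1}. \<forall>t\<in>{0..1}. abs (s - t) < e --> abs ((\<lambda>t\<in>{0..1}. c * x t) s - (\<lambda>t\<in>{0..1}. c * x t) t) <= w * abs (s - t) powr \<eta>" if w: "w > 0" for w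
 proof -
  have "w / (c + 1) > 0" using w c by simp
  from holder0_local[OF x this] obtain e where e: "e > 0" "!!s t. s \<in> {0..1} ==> t \<in> {0..1} ==> abs (s - t) < e ==> abs (x s - x t) <= w / (c + 1) * abs (s - t) powr \<eta>" by blast
  have "abs ((\<lambda>t\<in>{0..1}. c * x t) s - (\<lambda>t\<in>{0..1}. c * x t) t) <= w * abs (s - t) powr \<eta>" if st: "s \<in> {0..1}" "t \<in> {0..1}" "abs (s - t) < e" for s t
  proof -
   have "c * abs (x s - x t) <= c * (w / (c + 1) * abs (s - t) powr \<eta>)" by (intro mult_left_mono e(2) st c)
   also have "... = (c * (w / (c + 1))) * abs (s - t) powr \<eta>" by simp
   also have "... <= w * abs (s - t) powr \<eta>"
   proof (intro mult_right_mono)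
    show "c * (w / (c + 1)) <= w" using w c by (simp add: divide_le_eq field_simps)
   qed auto
   finally show ?thesis unfolding scaled[OF st(1,2)] .
  qed
  then show ?thesis using e(1) by blast
 qed
 show ?thesis by (rule holder0I[OF restrict_extensional bd sm])
qed

text \<open>Written as an image of the standard normal distribution in order to include the degenerate case \<open>\<kappa> = 0\<close>.\<close>

lemma scaled_std_normal:
 fixes \<kappa> :: real
 defines "\<mu> \<equiv> distr std_normal_distribution borel (%z. \<kappa> * z)"
 shows "real_distribution \<mu>" "char \<mu> t = of_real (exp (- (\<kappa>^2 * t^2 / 2)))"
proof -
 have m: "(%z. \<kappa> * z) \<in> borel_measurable std_normal_distribution" by simp
 show "real_distribution \<mu>" unfolding \<mu>_def
  by (rule prob_space.real_distribution_distr[OF _ m]) (rule prob_space_normal_density, simp)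
 have "char \<mu> t = (LINT x|(distr std_normal_distribution borel (%z. \<kappa> * z)). iexp (t * x))" by (simp add: char_def \<mu>_def)
 also have "... = (LINT z|std_normal_distribution. iexp (t * (\<kappa> * z)))" by (rule integral_distr[OF m]) measurable
 also have "... = char std_normal_distribution (t * \<kappa>)" by (simp add: char_def mult.assoc)
 also have "... = of_real (exp (- ((t * \<kappa>)^2 / 2)))" by (simp add: char_std_normal_distribution)
 finally show "char \<mu> t = of_real (exp (- (\<kappa>^2 * t^2 / 2)))" by (simp add: power_mult_distrib mult.commute)
qed

lemma brownian_increment_products:
 fixes W :: "real => 'b => real" and h :: "nat => real => real"
 assumes W: "standard_brownian_motion P W" and D: "D >= 1" and h: "!!i x. isCont (h i) x" "!!i x. abs (h i x) <= 1"
 shows "(LINT \<omega>|P. (\<Prod>i<D. h i (c * (W (real (Suc i) / D) \<omega> - W (real i / D) \<omega>))))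
  = (\<Prod>i<D. (LINT x|(distr std_normal_distribution borel (%z. (c / sqrt D) * z)). h i x))"
proof -
 let ?\<mu> = "distr std_normal_distribution borel (%z. (c / sqrt D) * z)"
 interpret prob_space P using W by (simp add: standard_brownian_motion_def)
 define X where "X i \<omega> = W (real (Suc i) / D) \<omega> - W (real i / D) \<omega>" for i \<omega>
 have DR: "real D > 0" using D by simp
 have hm: "h i \<in> borel_measurable borel" for i
  by (intro borel_measurable_continuous_onI) (simp add: continuous_on_eq_continuous_at h)
 have grid: "(%i. real i / D) ` {..D} \<subseteq> {0..1}" "mono_on {..D} (%i. real i / D)"
  using DR by (auto simp: divide_le_eq intro!: mono_onI divide_right_mono)
 have "indep_vars (%_. borel) X {..<D}" using W grid unfolding standard_brownian_motion_def X_def by blast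
 from indep_vars_compose2[OF this, of "%i x. h i (c * x)" "%_. borel"]
 have ind: "indep_vars (%_. borel) (%i \<omega>. h i (c * X i \<omega>)) {..<D}"
  using hm by (auto intro: measurable_compose[OF _ hm])
 have Xd: "distributed P lborel (X i) (normal_density 0 (sqrt (1 / D)))" if i: "i < D" for i
 proof -
  have "real (Suc i) / D - real i / D = 1 / D" by (simp add: diff_divide_distrib[symmetric])
  moreover have "0 <= real i / D" "real i / D < real (Suc i) / D" "real (Suc i) / D <= 1"
   using DR i by (auto simp: divide_strict_right_mono)
  ultimately show ?thesis using W unfolding standard_brownian_motion_def X_def by metis
 qed
 have Xm: "X i \<in> borel_measurable P" if "i < D" for i using distributed_measurable[OF Xd[OF that]] by simp
 have int: "integrable P (%\<omega>. h i (c * X i \<omega>))" if "i < D" for i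
  by (rule integrable_const_bound[of _ 1]) (use h(2) Xm[OF that] in \<open>auto intro!: measurable_compose[OF _ hm]\<close>)
 have one: "(LINT \<omega>|P. h i (c * X i \<omega>)) = (LINT x|?\<mu>. h i x)" if i: "i < D" for i
 proof -
  define Z where "Z \<omega> = (X i \<omega> - 0) / sqrt (1 / D)" for \<omega>
  have "distributed P lborel Z std_normal_density"
   unfolding Z_def using Xd[OF i] DR by (subst normal_standard_normal_convert[symmetric]) auto
  then have Zd: "distr P lborel Z = std_normal_distribution" and Zm: "Z \<in> P \<rightarrow>\<^sub>M lborel" by (auto simp: distributed_def)
  have XZ: "c * X i \<omega> = (c / sqrt D) * Z \<omega>" for \<omega> using DR by (simp add: Z_def real_sqrt_divide)
  have hm': "(%z. h i ((c / sqrt D) * z)) \<in> borel_measurable lborel" by (intro measurable_compose[OF _ hm]) simp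
  have "(LINT \<omega>|P. h i (c * X i \<omega>)) = (LINT \<omega>|P. h i ((c / sqrt D) * Z \<omega>))" by (simp only: XZ)
  also have "... = (LINT z|(distr P lborel Z). h i ((c / sqrt D) * z))" by (rule integral_distr[OF Zm hm', symmetric])
  also have "... = (LINT x|?\<mu>. h i x)" unfolding Zd by (rule integral_distr[symmetric]) (use hm in auto)
  finally show ?thesis .
 qed
 have "(LINT \<omega>|P. (\<Prod>i<D. h i (c * X i \<omega>))) = (\<Prod>i<D. (LINT \<omega>|P. h i (c * X i \<omega>)))"
  by (rule indep_vars_lebesgue_integral[OF _ ind int]) auto
 also have "... = (\<Prod>i<D. (LINT x|?\<mu>. h i x))" by (intro prod.cong refl one) auto
 finally show ?thesis by (simp only: X_def)
qed

theorem theorem1p3: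
  fixes \<gamma> p :: real and \<rho> f \<phi> :: "real \<Rightarrow> real" and \<nu> :: "real measure"
    and P :: "'b measure" and W :: "real \<Rightarrow> 'b \<Rightarrow> real"
  assumes "0 < \<gamma>" and "\<gamma> < 1/2" and "p = 1 / \<gamma>"
    and "f \<in> Hol \<gamma> \<rho>"
    and "acip f \<nu>"
    and "bounded_variation_on 0 1 \<phi>"
    and "(\<integral>x. \<phi> x \<partial>\<nu>) = 0"
    and "standard_brownian_motion P W"
    and "\<And>\<omega>. \<omega> \<in> space P \<Longrightarrow> (\<lambda>t\<in>{0..1}. W t \<omega>) \<in> holder0 (1/2 - 1/p)"
  shows "summable (\<lambda>k. \<bar>covariance \<nu> \<phi> (\<phi> \<circ> f ^^ Suc k)\<bar>) \<and>
    (\<exists>\<sigma>\<ge>0.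
       \<sigma>\<^sup>2 = prob_space.variance \<nu> \<phi> + 2 * (\<Sum>k. covariance \<nu> \<phi> (\<phi> \<circ> f ^^ Suc k)) \<and>
       conv_in_distribution (holder0_topology (1/2 - 1/p))
         \<nu> (\<lambda>n. birkhoff_process f \<phi> (Suc n))
         P (\<lambda>\<omega>. \<lambda>t\<in>{0..1}. \<sigma> * W t \<omega>))"
proof -
 obtain C s where s: "1 / (2 * \<gamma>) < s" and obs: "mixing_observable \<nu> f \<phi> C s"
  using bounded_variation_mixing_observable[OF assms(1,2,4-7)] by blast
 interpret O: mixing_observable \<nu> f \<phi> C s by (rule obs)
 define \<eta> where "\<eta> = 1/2 - 1/p"
 have \<eta>\<gamma>: "\<eta> = 1/2 - \<gamma>" using assms by (simp add: \<eta>_def)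
 have \<eta>: "0 < \<eta>" "\<eta> < 1" using assms(1,2) by (auto simp: \<eta>\<gamma>)
 have p: "p > 2" unfolding assms(3) using assms(1,2) by (simp add: less_divide_eq)
 have p2s: "p < 2 * s" unfolding assms(3) using s by simp
 (* above p for tightness, below 2 s for the moment bound *)
 define q where "q = (p + 2 * s) / 2"
 have q: "p < q" "2 < q" "q < 2 * s" using p p2s by (auto simp: q_def)
 have \<eta>q: "\<eta> < 1/2 - 1/q" using q p unfolding \<eta>_def by (simp add: frac_less2)
 define \<sigma> where "\<sigma> = sqrt O.\<sigma>2"
 have \<sigma>: "\<sigma> >= 0" "\<sigma>^2 = O.\<sigma>2" using O.sigma2_nonneg by (auto simp: \<sigma>_def)
 have cov: "covariance \<nu> \<phi> (\<phi> \<circ> f ^^ k) = O.cov k" for k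
  using O.invariant[OF bmeas_measurable[OF O.phi_bmeas], of k] assms(7) by (simp add: covariance_def O.cov_def)
 have var: "O.variance \<phi> = O.cov 0" using assms(7) by (simp add: O.cov_def power2_eq_square)
 interpret P: prob_space P using assms(8) by (simp add: standard_brownian_motion_def)
 define Y where "Y \<omega> = (\<lambda>t\<in>{0..1}. \<sigma> * W t \<omega>)" for \<omega>
 have Wm: "W t \<in> borel_measurable P" if "t \<in> {0..1}" for t using assms(8) that by (simp add: standard_brownian_motion_def)
 have conv: "conv_in_distribution (holder0_topology \<eta>) \<nu> (%n. birkhoff_process f \<phi> (Suc n)) P Y"
 proof (rule holder_convergence[OF O.prob_space_axioms P.prob_space_axioms])
  show "holder_process \<eta> \<nu> (birkhoff_process f \<phi> (Suc n))" for n
  proof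
   show "birkhoff_process f \<phi> (Suc n) \<omega> \<in> holder0 \<eta>" for \<omega>
    by (subst birkhoff_process_interp) (auto intro: interp_holder0[OF \<eta>])
   show "(%\<omega>. birkhoff_process f \<phi> (Suc n) \<omega> t) \<in> borel_measurable \<nu>" if "t \<in> {0..1}" for t
    by (rule bmeas_measurable[OF O.W_bmeas[OF _ that]]) simp
  qed (use \<eta> in auto)
  show "holder_process \<eta> P Y"
  proof
   show "Y \<omega> \<in> holder0 \<eta>" if "\<omega> \<in> space P" for \<omega>
   proof -
    have "(\<lambda>t\<in>{0..1}. \<sigma> * (\<lambda>t\<in>{0..1}. W t \<omega>) t) \<in> holder0 \<eta>"
     using assms(9)[OF that] \<sigma>(1) unfolding \<eta>_def by (rule holder0_scale)
    then show ?thesis unfolding Y_def by (simp cong: restrict_cong)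
   qed
   show "(%\<omega>. Y \<omega> t) \<in> borel_measurable P" if "t \<in> {0..1}" for t
    using Wm[OF that] that by (simp add: Y_def)
  qed (use \<eta> in auto)
 next
  fix \<epsilon> :: real assume "\<epsilon> > 0"
  from O.W_tight[OF q(2,3) \<eta>(1) \<eta>q this] obtain m0 where "\<forall>m\<ge>m0. \<forall>N\<ge>1. \<exists>A\<in>sets \<nu>. measure \<nu> A <= \<epsilon> \<and>
    (\<forall>x\<in>space \<nu> - A. holder_dist \<eta> (birkhoff_process f \<phi> N x) (proj (2 ^ m) (birkhoff_process f \<phi> N x)) <= \<epsilon>)" by blast
  then show "\<exists>m0. \<forall>m\<ge>m0. \<forall>n. \<exists>A\<in>sets \<nu>. measure \<nu> A <= \<epsilon> \<and>
    (\<forall>x\<in>space \<nu> - A. holder_dist \<eta> (birkhoff_process f \<phi> (Suc n) x) (proj (2 ^ m) (birkhoff_process f \<phi> (Suc n) x)) <= \<epsilon>)"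
   by (intro exI[of _ m0] allI impI) simp
 next
  fix m :: nat and L B :: real and H :: "(nat => real) => real"
  assume H: "coord_lipschitz (2 ^ m) L H" "!!v. abs (H v) <= B"
  define D where "D = (2::nat) ^ m"
  have D: "D >= 1" "real D = 2 ^ m" by (auto simp: D_def)
  define \<kappa> where "\<kappa> = \<sigma> / sqrt D"
  have \<kappa>: "\<kappa>^2 = O.\<sigma>2 / real D" using \<sigma>(2) by (simp add: \<kappa>_def power_divide)
  define \<mu> where "\<mu> = distr std_normal_distribution borel (%z. \<kappa> * z)"
  have \<mu>: "real_distribution \<mu>" unfolding \<mu>_def by (rule scaled_std_normal)
  have ch: "char \<mu> t = of_real (exp (- (1 / real D * t^2 * O.\<sigma>2 / 2)))" for t
   unfolding \<mu>_def scaled_std_normal(2) \<kappa> by (simp add: mult_ac)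
  define \<zeta> where "\<zeta> \<omega> i = (if i < D then \<sigma> * (W (real (Suc i) / D) \<omega> - W (real i / D) \<omega>) else 0)" for \<omega> i
  have \<zeta>m: "(%\<omega>. \<zeta> \<omega> i) \<in> borel_measurable P" for i
  proof (cases "i < D")
   case True
   then have "real (Suc i) / D \<in> {0..1}" "real i / D \<in> {0..1}" by (intro dyadic_in_unit; simp)+
   then show ?thesis using True Wm by (simp add: \<zeta>_def)
  qed (simp add: \<zeta>_def)
  have indep: "(LINT \<omega>|P. (\<Prod>i<D. h i (\<zeta> \<omega> i))) = (\<Prod>i<D. (LINT x|\<mu>. h i x))"
   if h: "!!i x. isCont (h i) x" "!!i x. abs (h i x) <= 1" for h :: "nat => real => real"
  proof -
   have "(\<Prod>i<D. h i (\<zeta> \<omega> i)) = (\<Prod>i<D. h i (\<sigma> * (W (real (Suc i) / D) \<omega> - W (real i / D) \<omega>)))" for \<omega>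
    by (intro prod.cong refl) (simp add: \<zeta>_def)
   then show ?thesis using brownian_increment_products[where c = \<sigma>, OF assms(8) D(1) h] by (simp add: \<mu>_def \<kappa>_def)
  qed
  have lim: "(%n. (LINT x|\<nu>. H (%k. birkhoff_process f \<phi> (Suc n) x (real (min k D) / real D)))) ~> (LINT \<omega>|P. H (%k. \<Sum>i<min k D. \<zeta> \<omega> i))"
   by (rule O.W_fdd[OF D(1) \<mu> ch P.prob_space_axioms \<zeta>m indep H[folded D_def]])
  have Hm: "H \<in> borel_measurable borel" by (rule coord_lipschitz_measurable[OF H(1)])
  have "(LINT \<omega>|P. H (%k. \<Sum>i<min k D. \<zeta> \<omega> i)) = (LINT \<omega>|P. H (%k. Y \<omega> (real (min k D) / real D)))"
  proof (rule integral_cong_AE)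
   show "(%\<omega>. H (%k. \<Sum>i<min k D. \<zeta> \<omega> i)) \<in> borel_measurable P"
    by (intro measurable_compose[OF measurable_coordinatewise_then_product Hm] borel_measurable_sum \<zeta>m)
   have "(%\<omega>. Y \<omega> (real (min k D) / real D)) \<in> borel_measurable P" for k
    using dyadic_in_unit[of "min k D" D] Wm by (simp add: Y_def)
   then show "(%\<omega>. H (%k. Y \<omega> (real (min k D) / real D))) \<in> borel_measurable P"
    by (intro measurable_compose[OF measurable_coordinatewise_then_product Hm])
   have "AE \<omega> in P. W 0 \<omega> = 0" using assms(8) by (simp add: standard_brownian_motion_def)
   then show "AE \<omega> in P. H (%k. \<Sum>i<min k D. \<zeta> \<omega> i) = H (%k. Y \<omega> (real (min k D) / real D))"
   proof eventually_elim
    case (elim \<omega>)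
    have "(\<Sum>i<min k D. \<zeta> \<omega> i) = Y \<omega> (real (min k D) / real D)" for k
    proof -
     have "(\<Sum>i<min k D. \<zeta> \<omega> i) = (\<Sum>i<min k D. \<sigma> * (W (real (Suc i) / D) \<omega>) - \<sigma> * W (real i / D) \<omega>)"
      by (intro sum.cong refl) (simp add: \<zeta>_def right_diff_distrib)
     also have "... = \<sigma> * W (real (min k D) / D) \<omega> - \<sigma> * W (real 0 / D) \<omega>"
      by (rule sum_lessThan_telescope)
     finally show ?thesis using elim dyadic_in_unit[of "min k D" D] by (simp add: Y_def)
    qed
    then show ?case by simp
   qed
  qed
  then show "(%n. (LINT \<omega>|\<nu>. H (%k. birkhoff_process f \<phi> (Suc n) \<omega> (real (min k (2 ^ m)) / 2 ^ m))))
   ~> (LINT \<omega>|P. H (%k. Y \<omega> (real (min k (2 ^ m)) / 2 ^ m)))"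
   using lim unfolding D(2) unfolding D_def by simp
 qed
 show ?thesis
 proof (intro conjI exI[of _ \<sigma>])
  show "summable (%k. abs (covariance \<nu> \<phi> (\<phi> \<circ> f ^^ Suc k)))" unfolding cov by (rule O.summable_cov)
  show "\<sigma>^2 = O.variance \<phi> + 2 * (\<Sum>k. covariance \<nu> \<phi> (\<phi> \<circ> f ^^ Suc k))" unfolding cov var \<sigma>(2) by (rule O.\<sigma>2_def)
  show "conv_in_distribution (holder0_topology (1/2 - 1/p)) \<nu> (%n. birkhoff_process f \<phi> (Suc n)) P (%\<omega>. \<lambda>t\<in>{0..1}. \<sigma> * W t \<omega>)"
   using conv unfolding \<eta>_def Y_def .
 qed (rule \<sigma>(1))
qed

end
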